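(* Let $n\ge 2$. Regard $\mathrm{Pol}_{n,\mathbb{Q}}^-$ as a right ${}^{D}\Lambda_{n,\mathbb{Q}}^-$-module. There are algebra isomorphisms $${}^{D}\mathrm{NH}_{n,\mathbb{Q}}^-\xrightarrow{\ \cong\ }\mathrm{End}_{{}^{D}\Lambda_{n,\mathbb{Q}}^-}(\mathrm{Pol}_{n,\mathbb{Q}}^-)\cong\mathrm{Mat}_{q^{n(n-1)}[n][2n-2]!!}({}^{D}\Lambda_{n,\mathbb{Q}}^-),$$ where the first map is given by the action of ${}^{D}\mathrm{NH}_{n,\mathbb{Q}}^-$ on its polynomial representation $\mathrm{Pol}_{n,\mathbb{Q}}^-$.
   Context: $\mathrm{Pol}_n^-$ is the unital $\mathbb{Z}$-algebra generated by $x_1,\dots,x_n$ subject to $x_ix_j+x_jx_i=0$ for all $i\ne j$. A subscript $\mathbb{Q}$ denotes $\mathbb{Q}\otimes_{\mathbb{Z}}-$. The spin type D nilHecke algebra ${}^{D}\mathrm{NH}_n^-$ is the unital $\mathbb{Z}$-algebra generated by $x_1,\dots,x_n$, $\partial_1^-,\dots,\partial_{n-1}^-$, $\partial_n^D$ subject to $x_ix_j+x_jx_i=0$ ($i\neq j$) and, for $1\le i\le n-1$ (whenever the indices make sense): $(\partial_i^-)^2=0$; $\partial_i^-\partial_{i+1}^-\partial_i^-=\partial_{i+1}^-\partial_i^-\partial_{i+1}^-$; $\partial_i^-\partial_j^-+\partial_j^-\partial_i^-=0$ for $|i-j|>1$; $x_i\partial_i^-+\partial_i^-x_{i+1}=1$;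 $\partial_i^-x_i+x_{i+1}\partial_i^-=1$; $\partial_i^-x_j+x_j\partial_i^-=0$ for $j\ne i,i+1$; and $(\partial_n^D)^2=0$; $\partial_n^D\partial_{n-2}^-\partial_n^D=\partial_{n-2}^-\partial_n^D\partial_{n-2}^-$; $\partial_n^D\partial_i^-+\partial_i^-\partial_n^D=0$ for $1\le i\le n-3$; $\partial_n^D\partial_{n-1}^--\partial_{n-1}^-\partial_n^D=0$; $x_{n-1}\partial_n^D-\partial_n^Dx_n=1$; $\partial_n^Dx_{n-1}-x_n\partial_n^D=1$; $\partial_n^Dx_i+x_i\partial_n^D=0$ for $1\le i\le n-2$. It is $\mathbb{Z}$-graded by $|x_i|=2$, $|\partial_i^-|=|\partial_n^D|=-2$. It acts on $\mathrm{Pol}_n^-$ as follows. The $x_i$ act by left multiplication. For $1\le i\le n-1$ let $s_i$ be the algebra endomorphism of $\mathrm{Pol}_n^-$ with $s_i(x_i)=-x_{i+1}$, $s_i(x_{i+1})=-x_i$, $s_i(x_j)=-x_j$ for $j\ne i,i+1$, and let $s_n^D$ be the algebra endomorphism with $s_n^D(x_n)=x_{n-1}$, $s_n^D(x_{n-1})=x_n$, $s_n^D(x_j)=-x_j$ for $j\le n-2$. Then $\partial_i^-$ and $\partial_n^D$ act as the $\mathbb{Z}$-linear (odd Demazure) operators that kill $1$ and satisfy: $\partial_i^-(x_j)=1$ if $j\in\{i,i+1\}$ and $0$ otherwise; $\partial_n^D(x_n)=-1$, $\partial_n^D(x_{n-1})=1$, $\partial_n^D(x_j)=0$ for $j\le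 n-2$; $\partial_i^-(fg)=\partial_i^-(f)g+s_i(f)\partial_i^-(g)$, $\partial_n^D(fg)=\partial_n^D(f)g+s_n^D(f)\partial_n^D(g)$. The ring of spin type D symmetric polynomials is ${}^{D}\Lambda_n^-=\bigcap_{i=1}^{n-1}\ker(\partial_i^-)\cap\ker(\partial_n^D)\subset\mathrm{Pol}_n^-$. The left action of ${}^{D}\mathrm{NH}_n^-$ commutes with right multiplication by ${}^{D}\Lambda_n^-$. Notation: $[m]=\frac{q^m-q^{-m}}{q-q^{-1}}$, $[2n-2]!!=[2n-2][2n-4]\cdots[2]$. For $f(q)=\sum_{i=1}^N q^{d_i}$, $\mathrm{Mat}_{f(q)}(R)$ denotes the algebra $\mathrm{Mat}_N(R)$ of $N\times N$ matrices over the graded ring $R$, graded as the endomorphism algebra of a free graded $R$-module with basis in degrees $d_1,\dots,d_N$. Here $N=2^{n-1}n!$. *)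

theory Defs
  imports
    "HOL-Library.FuncSet"
    "HOL-Library.Poly_Mapping"
    "HOL-Computational_Algebra.Formal_Laurent_Series"
    "HOL-Algebra.QuotRing"
begin

section \<open>Algebras given by generators and relations\<close>

text \<open>
  Lists under concatenation form the free monoid, so the convolution product of
  \<^theory>\<open>HOL-Library.Poly_Mapping\<close> makes the type \<open>'g list \<Rightarrow>\<^sub>0 'k\<close> the free associative
  unital \<open>'k\<close>-algebra on the set of all elements of \<open>'g\<close>.
\<close>

instantiation list :: (type) monoid_add
begin

definition zero_list_def: "(0 :: 'a list) = []"

definition plus_list_def: "(xs :: 'a list) + ys = xs @ ys"

instance
  by standard (simp_all add: zero_list_def plus_list_def)

end

definition free_algebra :: "'g set \<Rightarrow> ('g list \<Rightarrow>\<^sub>0 'k::comm_ring_1) ring" where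
  "free_algebra A =
    \<lparr>carrier = {p. Poly_Mapping.keys p \<subseteq> lists A}, mult = (*), one = 1, zero = 0, add = (+)\<rparr>"

definition letter :: "'g \<Rightarrow> ('g list \<Rightarrow>\<^sub>0 'k::comm_ring_1)" where
  "letter g = Poly_Mapping.single [g] 1"

text \<open>
  The constants lie in \<^const>\<open>free_algebra\<close>, so the two-sided ideal generated by \<open>rels\<close> is
  \<open>'k\<close>-linear. With \<open>'k = int\<close> the quotient is the \<open>\<int>\<close>-algebra presented by \<open>A\<close> and \<open>rels\<close>;
  when the relations have integer coefficients, \<open>'k = rat\<close> is its base change to the rationals.
\<close>

definition presented_algebra ::
    "'g set \<Rightarrow> ('g list \<Rightarrow>\<^sub>0 'k::comm_ring_1) set \<Rightarrow> ('g list \<Rightarrow>\<^sub>0 'k) set ring" where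
  "presented_algebra A rels = free_algebra A Quot (Idl\<^bsub>free_algebra A\<^esub> rels)"

definition presented_class ::
    "'g set \<Rightarrow> ('g list \<Rightarrow>\<^sub>0 'k::comm_ring_1) set \<Rightarrow> ('g list \<Rightarrow>\<^sub>0 'k) \<Rightarrow> ('g list \<Rightarrow>\<^sub>0 'k) set" where
  "presented_class A rels p = (Idl\<^bsub>free_algebra A\<^esub> rels) +>\<^bsub>free_algebra A\<^esub> p"

definition presented_degree ::
    "('g \<Rightarrow> int) \<Rightarrow> 'g set \<Rightarrow> ('g list \<Rightarrow>\<^sub>0 'k::comm_ring_1) set \<Rightarrow> int \<Rightarrow> ('g list \<Rightarrow>\<^sub>0 'k) set set" where
  "presented_degree wt A rels d =
    presented_class A rels `
      {p \<in> carrier (free_algebra A). \<forall>w \<in> Poly_Mapping.keys p. sum_list (map wt w) = d}"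


section \<open>The skew polynomial ring and the odd Demazure operators\<close>

definition odd_pol_rels :: "nat \<Rightarrow> (nat list \<Rightarrow>\<^sub>0 'k::comm_ring_1) set" where
  "odd_pol_rels n =
    {letter i * letter j + letter j * letter i | i j. i \<in> {1..n} \<and> j \<in> {1..n} \<and> i \<noteq> j}"

definition odd_pol :: "nat \<Rightarrow> (nat list \<Rightarrow>\<^sub>0 'k::comm_ring_1) set ring" where
  "odd_pol n = presented_algebra {1..n} (odd_pol_rels n)"

definition pol_var :: "nat \<Rightarrow> nat \<Rightarrow> (nat list \<Rightarrow>\<^sub>0 'k::comm_ring_1) set" where
  "pol_var n i = presented_class {1..n} (odd_pol_rels n) (letter i)"

definition pol_const :: "nat \<Rightarrow> 'k \<Rightarrow> (nat list \<Rightarrow>\<^sub>0 'k::comm_ring_1) set" where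
  "pol_const n c = presented_class {1..n} (odd_pol_rels n) (Poly_Mapping.single [] c)"

definition pol_degree :: "nat \<Rightarrow> int \<Rightarrow> (nat list \<Rightarrow>\<^sub>0 'k::comm_ring_1) set set" where
  "pol_degree n = presented_degree (\<lambda>_. 2) {1..n} (odd_pol_rels n)"

text \<open>The algebra endomorphism of \<^const>\<open>odd_pol\<close> sending the \<open>j\<close>-th variable to \<open>img j\<close>.\<close>

definition pol_endo ::
    "nat \<Rightarrow> (nat \<Rightarrow> (nat list \<Rightarrow>\<^sub>0 'k::comm_ring_1) set) \<Rightarrow>
      (nat list \<Rightarrow>\<^sub>0 'k) set \<Rightarrow> (nat list \<Rightarrow>\<^sub>0 'k) set" where
  "pol_endo n img = (THE s.
     s \<in> extensional (carrier (odd_pol n)) \<and> s \<in> ring_hom (odd_pol n) (odd_pol n) \<and>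
     (\<forall>c. s (pol_const n c) = pol_const n c) \<and>
     (\<forall>j\<in>{1..n}. s (pol_var n j) = img j))"

text \<open>
  The linear operator that kills \<open>1\<close>, takes the value \<open>val j\<close> on the \<open>j\<close>-th variable and
  satisfies the Leibniz rule twisted by \<open>s\<close>.
\<close>

definition pol_skew_derivation ::
    "nat \<Rightarrow> ((nat list \<Rightarrow>\<^sub>0 'k) set \<Rightarrow> (nat list \<Rightarrow>\<^sub>0 'k) set) \<Rightarrow>
      (nat \<Rightarrow> (nat list \<Rightarrow>\<^sub>0 'k::comm_ring_1) set) \<Rightarrow>
      (nat list \<Rightarrow>\<^sub>0 'k) set \<Rightarrow> (nat list \<Rightarrow>\<^sub>0 'k) set" where
  "pol_skew_derivation n s val = (let P = odd_pol n in THE D.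
     D \<in> carrier P \<rightarrow>\<^sub>E carrier P \<and>
     (\<forall>f\<in>carrier P. \<forall>g\<in>carrier P. D (f \<oplus>\<^bsub>P\<^esub> g) = D f \<oplus>\<^bsub>P\<^esub> D g) \<and>
     (\<forall>c. \<forall>f\<in>carrier P. D (pol_const n c \<otimes>\<^bsub>P\<^esub> f) = pol_const n c \<otimes>\<^bsub>P\<^esub> D f) \<and>
     D \<one>\<^bsub>P\<^esub> = \<zero>\<^bsub>P\<^esub> \<and>
     (\<forall>j\<in>{1..n}. D (pol_var n j) = val j) \<and>
     (\<forall>f\<in>carrier P. \<forall>g\<in>carrier P.
        D (f \<otimes>\<^bsub>P\<^esub> g) = D f \<otimes>\<^bsub>P\<^esub> g \<oplus>\<^bsub>P\<^esub> s f \<otimes>\<^bsub>P\<^esub> D g))"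

definition odd_refl ::
    "nat \<Rightarrow> nat \<Rightarrow> (nat list \<Rightarrow>\<^sub>0 'k::comm_ring_1) set \<Rightarrow> (nat list \<Rightarrow>\<^sub>0 'k) set" where
  "odd_refl n i = pol_endo n (\<lambda>j.
     if j = i then \<ominus>\<^bsub>odd_pol n\<^esub> pol_var n (i + 1)
     else if j = i + 1 then \<ominus>\<^bsub>odd_pol n\<^esub> pol_var n i
     else \<ominus>\<^bsub>odd_pol n\<^esub> pol_var n j)"

definition odd_refl_D ::
    "nat \<Rightarrow> (nat list \<Rightarrow>\<^sub>0 'k::comm_ring_1) set \<Rightarrow> (nat list \<Rightarrow>\<^sub>0 'k) set" where
  "odd_refl_D n = pol_endo n (\<lambda>j.
     if j = n then pol_var n (n - 1)
     else if j = n - 1 then pol_var n n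
     else \<ominus>\<^bsub>odd_pol n\<^esub> pol_var n j)"

definition odd_demazure ::
    "nat \<Rightarrow> nat \<Rightarrow> (nat list \<Rightarrow>\<^sub>0 'k::comm_ring_1) set \<Rightarrow> (nat list \<Rightarrow>\<^sub>0 'k) set" where
  "odd_demazure n i = pol_skew_derivation n (odd_refl n i) (\<lambda>j.
     if j = i \<or> j = i + 1 then \<one>\<^bsub>odd_pol n\<^esub> else \<zero>\<^bsub>odd_pol n\<^esub>)"

definition odd_demazure_D ::
    "nat \<Rightarrow> (nat list \<Rightarrow>\<^sub>0 'k::comm_ring_1) set \<Rightarrow> (nat list \<Rightarrow>\<^sub>0 'k) set" where
  "odd_demazure_D n = pol_skew_derivation n (odd_refl_D n) (\<lambda>j.
     if j = n then \<ominus>\<^bsub>odd_pol n\<^esub> \<one>\<^bsub>odd_pol n\<^esub>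
     else if j = n - 1 then \<one>\<^bsub>odd_pol n\<^esub>
     else \<zero>\<^bsub>odd_pol n\<^esub>)"

text \<open>
  The spin type D symmetric polynomials. As \<open>\<rat>\<close> is flat over \<open>\<int>\<close>, the instance \<open>'k = rat\<close> is
  the base change of the instance \<open>'k = int\<close>.
\<close>

definition spinD_sym :: "nat \<Rightarrow> (nat list \<Rightarrow>\<^sub>0 'k::comm_ring_1) set set" where
  "spinD_sym n = {f \<in> carrier (odd_pol n).
     (\<forall>i\<in>{1..n-1}. odd_demazure n i f = \<zero>\<^bsub>odd_pol n\<^esub>) \<and>
     odd_demazure_D n f = \<zero>\<^bsub>odd_pol n\<^esub>}"

definition spinD_sym_ring :: "nat \<Rightarrow> (nat list \<Rightarrow>\<^sub>0 'k::comm_ring_1) set ring" where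
  "spinD_sym_ring n = (odd_pol n)\<lparr>carrier := spinD_sym n\<rparr>"


section \<open>The spin type D nilHecke algebra\<close>

datatype nh_gen = X nat | Del nat | DelD

definition spinD_gens :: "nat \<Rightarrow> nh_gen set" where
  "spinD_gens n = X ` {1..n} \<union> Del ` {1..n-1} \<union> {DelD}"

text \<open>
  Each \<open>a\<close> in this set imposes the relation \<open>a = 0\<close>. For \<open>n = 2\<close> the relation between
  \<^const>\<open>DelD\<close> and \<open>Del (n - 2)\<close> is absent.
\<close>

definition spinD_rels :: "nat \<Rightarrow> (nh_gen list \<Rightarrow>\<^sub>0 'k::comm_ring_1) set" where
  "spinD_rels n = (let x = (\<lambda>i. letter (X i)); d = (\<lambda>i. letter (Del i)); dD = letter DelD in
     {x i * x j + x j * x i | i j. 1 \<le> i \<and> i \<le> n \<and> 1 \<le> j \<and> j \<le> n \<and> i \<noteq> j} \<union>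
     {d i * d i | i. 1 \<le> i \<and> i < n} \<union>
     {d i * d (i+1) * d i - d (i+1) * d i * d (i+1) | i. 1 \<le> i \<and> i + 1 < n} \<union>
     {d i * d j + d j * d i | i j.
        1 \<le> i \<and> i < n \<and> 1 \<le> j \<and> j < n \<and> \<bar>int i - int j\<bar> > 1} \<union>
     {x i * d i + d i * x (i+1) - 1 | i. 1 \<le> i \<and> i < n} \<union>
     {d i * x i + x (i+1) * d i - 1 | i. 1 \<le> i \<and> i < n} \<union>
     {d i * x j + x j * d i | i j.
        1 \<le> i \<and> i < n \<and> 1 \<le> j \<and> j \<le> n \<and> j \<noteq> i \<and> j \<noteq> i + 1} \<union>
     {dD * dD} \<union>
     {dD * d i * dD - d i * dD * d i | i. 1 \<le> i \<and> i + 2 = n} \<union>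
     {dD * d i + d i * dD | i. 1 \<le> i \<and> i + 3 \<le> n} \<union>
     {dD * d i - d i * dD | i. 1 \<le> i \<and> i + 1 = n} \<union>
     {x i * dD - dD * x n - 1 | i. 1 \<le> i \<and> i + 1 = n} \<union>
     {dD * x i - x n * dD - 1 | i. 1 \<le> i \<and> i + 1 = n} \<union>
     {dD * x i + x i * dD | i. 1 \<le> i \<and> i + 2 \<le> n})"

definition spinD_nilHecke :: "nat \<Rightarrow> (nh_gen list \<Rightarrow>\<^sub>0 'k::comm_ring_1) set ring" where
  "spinD_nilHecke n = presented_algebra (spinD_gens n) (spinD_rels n)"

definition nilHecke_gen :: "nat \<Rightarrow> nh_gen \<Rightarrow> (nh_gen list \<Rightarrow>\<^sub>0 'k::comm_ring_1) set" where
  "nilHecke_gen n g = presented_class (spinD_gens n) (spinD_rels n) (letter g)"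

fun nh_weight :: "nh_gen \<Rightarrow> int" where
  "nh_weight (X i) = 2"
| "nh_weight (Del i) = -2"
| "nh_weight DelD = -2"

definition nilHecke_degree :: "nat \<Rightarrow> int \<Rightarrow> (nh_gen list \<Rightarrow>\<^sub>0 'k::comm_ring_1) set set" where
  "nilHecke_degree n = presented_degree nh_weight (spinD_gens n) (spinD_rels n)"

fun gen_action ::
    "nat \<Rightarrow> nh_gen \<Rightarrow> (nat list \<Rightarrow>\<^sub>0 'k::comm_ring_1) set \<Rightarrow> (nat list \<Rightarrow>\<^sub>0 'k) set" where
  "gen_action n (X i) = (\<lambda>f\<in>carrier (odd_pol n). pol_var n i \<otimes>\<^bsub>odd_pol n\<^esub> f)"
| "gen_action n (Del i) = odd_demazure n i"
| "gen_action n DelD = odd_demazure_D n"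


section \<open>Endomorphism rings and graded matrix rings\<close>

text \<open>Endomorphisms of the ring \<open>R\<close> as a right module over its subring with carrier \<open>S\<close>.\<close>

definition right_End :: "('a, 'm) ring_scheme \<Rightarrow> 'a set \<Rightarrow> ('a \<Rightarrow> 'a) ring" where
  "right_End R S =
    \<lparr>carrier = {\<phi> \<in> carrier R \<rightarrow>\<^sub>E carrier R.
        (\<forall>f\<in>carrier R. \<forall>g\<in>carrier R. \<phi> (f \<oplus>\<^bsub>R\<^esub> g) = \<phi> f \<oplus>\<^bsub>R\<^esub> \<phi> g) \<and>
        (\<forall>f\<in>carrier R. \<forall>a\<in>S. \<phi> (f \<otimes>\<^bsub>R\<^esub> a) = \<phi> f \<otimes>\<^bsub>R\<^esub> a)},
     mult = compose (carrier R),
     one = (\<lambda>f\<in>carrier R. f),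
     zero = (\<lambda>f\<in>carrier R. \<zero>\<^bsub>R\<^esub>),
     add = (\<lambda>\<phi> \<psi>. \<lambda>f\<in>carrier R. \<phi> f \<oplus>\<^bsub>R\<^esub> \<psi> f)\<rparr>"

definition right_End_degree ::
    "('a, 'm) ring_scheme \<Rightarrow> 'a set \<Rightarrow> (int \<Rightarrow> 'a set) \<Rightarrow> int \<Rightarrow> ('a \<Rightarrow> 'a) set" where
  "right_End_degree R S gr d =
    {\<phi> \<in> carrier (right_End R S). \<forall>k. \<phi> ` gr k \<subseteq> gr (k + d)}"

definition matrix_ring :: "nat \<Rightarrow> ('a, 'm) ring_scheme \<Rightarrow> (nat \<Rightarrow> nat \<Rightarrow> 'a) ring" where
  "matrix_ring N R =
    \<lparr>carrier = {..<N} \<rightarrow>\<^sub>E ({..<N} \<rightarrow>\<^sub>E carrier R),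
     mult = (\<lambda>A B. \<lambda>i\<in>{..<N}. \<lambda>j\<in>{..<N}. \<Oplus>\<^bsub>R\<^esub>k\<in>{..<N}. A i k \<otimes>\<^bsub>R\<^esub> B k j),
     one = (\<lambda>i\<in>{..<N}. \<lambda>j\<in>{..<N}. if i = j then \<one>\<^bsub>R\<^esub> else \<zero>\<^bsub>R\<^esub>),
     zero = (\<lambda>i\<in>{..<N}. \<lambda>j\<in>{..<N}. \<zero>\<^bsub>R\<^esub>),
     add = (\<lambda>A B. \<lambda>i\<in>{..<N}. \<lambda>j\<in>{..<N}. A i j \<oplus>\<^bsub>R\<^esub> B i j)\<rparr>"

text \<open>
  The matrix \<open>A\<close> represents the endomorphism sending the \<open>j\<close>-th basis vector \<open>b\<^sub>j\<close>, of degree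
  \<open>deg j\<close>, to the sum of the \<open>b\<^sub>i \<cdot> A i j\<close>. It has degree \<open>d\<close> iff each such summand is homogeneous
  of degree \<open>deg j + d\<close>.
\<close>

definition matrix_degree ::
    "nat \<Rightarrow> (nat \<Rightarrow> int) \<Rightarrow> ('a, 'm) ring_scheme \<Rightarrow> (int \<Rightarrow> 'a set) \<Rightarrow> int \<Rightarrow> (nat \<Rightarrow> nat \<Rightarrow> 'a) set" where
  "matrix_degree N deg R gr d =
    {A \<in> carrier (matrix_ring N R).
       \<forall>i<N. \<forall>j<N. A i j \<in> carrier R \<inter> gr (deg j + d - deg i)}"

text \<open>
  Between algebras over the rationals every unital ring homomorphism is linear over the
  rationals, so that ring isomorphisms are the same as algebra isomorphisms.
\<close>

definition graded_iso ::
    "('a, 'm) ring_scheme \<Rightarrow> (int \<Rightarrow> 'a set) \<Rightarrow> ('b, 'l) ring_scheme \<Rightarrow> (int \<Rightarrow> 'b set) \<Rightarrow> ('a \<Rightarrow> 'b) set" where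
  "graded_iso R Rgr S Sgr = {h \<in> ring_iso R S. \<forall>d. h ` Rgr d = Sgr d}"


section \<open>The rational algebras\<close>

abbreviation PolQ :: "nat \<Rightarrow> (nat list \<Rightarrow>\<^sub>0 rat) set ring" where
  "PolQ \<equiv> odd_pol"

abbreviation LamQ :: "nat \<Rightarrow> (nat list \<Rightarrow>\<^sub>0 rat) set ring" where
  "LamQ \<equiv> spinD_sym_ring"

abbreviation NHQ :: "nat \<Rightarrow> (nh_gen list \<Rightarrow>\<^sub>0 rat) set ring" where
  "NHQ \<equiv> spinD_nilHecke"

abbreviation EndQ :: "nat \<Rightarrow> ((nat list \<Rightarrow>\<^sub>0 rat) set \<Rightarrow> (nat list \<Rightarrow>\<^sub>0 rat) set) ring" where
  "EndQ n \<equiv> right_End (PolQ n) (carrier (LamQ n))"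

abbreviation EndQ_degree ::
    "nat \<Rightarrow> int \<Rightarrow> ((nat list \<Rightarrow>\<^sub>0 rat) set \<Rightarrow> (nat list \<Rightarrow>\<^sub>0 rat) set) set" where
  "EndQ_degree n \<equiv> right_End_degree (PolQ n) (carrier (LamQ n)) (pol_degree n)"


section \<open>Quantum integers\<close>

text \<open>Identities between Laurent polynomials in \<open>q\<close> are stated in the field of Laurent series.\<close>

abbreviation q_pow :: "int \<Rightarrow> rat fls" where
  "q_pow m \<equiv> fls_X_intpow m"

definition q_int :: "nat \<Rightarrow> rat fls" where
  "q_int m = (q_pow (int m) - q_pow (- int m)) / (q_pow 1 - q_pow (-1))"

definition q_even_dfact :: "nat \<Rightarrow> rat fls" where
  "q_even_dfact k = (\<Prod>i=1..k. q_int (2 * i))"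

end

theory Submission
  imports Defs
begin

text \<open>
  Number the generators backwards: \<open>y k\<close> is the variable with index \<open>n - k\<close>, \<open>d j\<close> the Demazure
  generator with index \<open>n - j\<close>, and \<open>t\<close> the generator of the fork of the Dynkin diagram, which
  involves \<open>y 0\<close> and \<open>y 1\<close>. Then \<open>y 0, \<dots>, y r\<close>, \<open>d 1, \<dots>, d r\<close> and \<open>t\<close> generate an algebra of
  rank \<open>r + 1\<close> inside the one of rank \<open>r + 2\<close>, which allows induction on \<open>r\<close>.

  The operators on polynomials satisfy the defining relations: an operator that kills \<open>1\<close> and that
  can be moved past each variable, up to a sign and a permutation of the variables, is zero
  (\<open>imE_eq_zeroI\<close>), and the difference of the two sides of a relation between Demazure operators is
  of this kind. So the algebra acts. Let \<open>E\<close> be the product of the Demazure generators along a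
  reduced word of the longest element of the Weyl group. Every Demazure generator kills \<open>E\<close> on both
  sides, whence \<open>h f E = (h \<cdot> f) E\<close> for every \<open>h\<close> in the algebra and every polynomial \<open>f\<close>
  (\<open>Phi_long\<close>), where the dot denotes the action.

  The heart of the proof is a resolution of the unit (\<open>unit_resolution\<close>): there are polynomials
  \<open>b k\<close> and \<open>c k\<close>, with \<open>k\<close> ranging over a set of \<open>2 ^ (n - 1) * fact n\<close> indices, such that
  \<open>1 = (\<Sum>k. b k * E * c k)\<close>. It follows from the relations alone, and therefore holds both in the
  algebra and for the operators. Here \<open>b k\<close> is a product with one factor for each \<open>r\<close> from \<open>1\<close> to
  \<open>n - 1\<close>, which is one of the powers of \<open>y r\<close> with exponent at most \<open>2 * r\<close>, or the product
  \<open>omega r\<close> of \<open>y (r - 1), \<dots>, y 0\<close>. Everything else is a consequence: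

  \<^item> \<open>h = (\<Sum>k. h * b k * E * c k) = (\<Sum>k. (h \<cdot> b k) * E * c k)\<close> depends only on the action of \<open>h\<close>,
    so the representation is faithful (\<open>Phi_inj\<close>);

  \<^item> \<open>\<phi> k = E * c k\<close> acts as a map with symmetric values that is linear over the symmetric
    polynomials, and \<open>f = (\<Sum>k. b k * \<phi> k f)\<close>. Thus a right linear \<open>\<psi>\<close> equals \<open>\<Sum>k. \<psi> (b k) * \<phi> k\<close>,
    which belongs to the image of the algebra (\<open>Phi_surj\<close>);

  \<^item> the \<open>b k\<close> are independent over the symmetric polynomials (\<open>basis_independent\<close>), so that they
    and the \<open>\<phi> k\<close> are dual bases (\<open>dual_basis\<close>), and sending \<open>\<psi>\<close> to the matrix with entries
    \<open>\<phi> i (\<psi> (b j))\<close> is an isomorphism. The factors for a fixed \<open>r\<close> have the degrees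
    \<open>0, 2, \<dots>, 4 * r\<close> and \<open>2 * r\<close>, and the product of the corresponding sums of powers of \<open>q\<close> is the
    graded rank (\<open>basis_degree_sum\<close>).

  Rational coefficients are used at two places. The resolution of the unit requires a division by
  \<open>2\<close>, because at the fork of the Dynkin diagram only the sum and the difference of two words are
  obtained (\<open>fall_in_pieces\<close>). The independence requires the inverse of a nonzero constant
  (\<open>cox_top_const\<close>).
\<close>

section \<open>The product of all rings over a type\<close>

text \<open>
  The relations between words in the generators are derived in the setting of type classes. To apply
  them to rings that are records with carriers, all these rings are collected in one type: their
  product is again a ring, and each of them embeds into it. The embedding \<open>embed R\<close> below maps the
  unit of \<open>R\<close> to an idempotent different from \<open>1\<close>. This is why the relations carry an explicit
  unit \<open>u\<close>, where one would expect \<open>1\<close>.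
\<close>

typedef 'a all_rings = "{f :: 'a ring \<Rightarrow> 'a. \<forall>R. if ring R then f R \<in> carrier R else f R = undefined}"
  morphisms component all_rings
proof
  show "(\<lambda>R. if ring R then \<zero>\<^bsub>R\<^esub> else undefined) \<in>
      {f. \<forall>R. if ring R then f R \<in> carrier R else f R = undefined}"
    using ring.ring_simprules(2) by auto
qed

setup_lifting type_definition_all_rings

lemma component_closed: "ring R \<Longrightarrow> component a R \<in> carrier R"
  using component[of a] by (metis (mono_tags, lifting) mem_Collect_eq)

lemma component_undefined: "\<not> ring R \<Longrightarrow> component a R = undefined"
  using component[of a] by (metis (mono_tags, lifting) mem_Collect_eq)

lemma all_rings_eqI:
  assumes "\<And>R. ring R \<Longrightarrow> component a R = component b R"
  shows "a = b"
  using assms component_undefined by (metis component_inject ext)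

instantiation all_rings :: (type) "{ring, monoid_mult}"
begin

lift_definition zero_all_rings :: "'a all_rings" is
  "\<lambda>R. if ring R then \<zero>\<^bsub>R\<^esub> else undefined"
  by (auto intro: ring.ring_simprules)

lift_definition one_all_rings :: "'a all_rings" is
  "\<lambda>R. if ring R then \<one>\<^bsub>R\<^esub> else undefined"
  by (auto intro: ring.ring_simprules)

lift_definition plus_all_rings :: "'a all_rings \<Rightarrow> 'a all_rings \<Rightarrow> 'a all_rings" is
  "\<lambda>f g R. if ring R then f R \<oplus>\<^bsub>R\<^esub> g R else undefined"
  by (auto intro: ring.ring_simprules)

lift_definition minus_all_rings :: "'a all_rings \<Rightarrow> 'a all_rings \<Rightarrow> 'a all_rings" is
  "\<lambda>f g R. if ring R then f R \<ominus>\<^bsub>R\<^esub> g R else undefined"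
  by (auto intro: ring.ring_simprules)

lift_definition uminus_all_rings :: "'a all_rings \<Rightarrow> 'a all_rings" is
  "\<lambda>f R. if ring R then \<ominus>\<^bsub>R\<^esub> f R else undefined"
  by (auto intro: ring.ring_simprules)

lift_definition times_all_rings :: "'a all_rings \<Rightarrow> 'a all_rings \<Rightarrow> 'a all_rings" is
  "\<lambda>f g R. if ring R then f R \<otimes>\<^bsub>R\<^esub> g R else undefined"
  by (auto intro: ring.ring_simprules)

instance
proof
  fix a b c :: "'a all_rings"
  note defs = zero_all_rings.rep_eq one_all_rings.rep_eq plus_all_rings.rep_eq
    minus_all_rings.rep_eq uminus_all_rings.rep_eq times_all_rings.rep_eq
  show "a + b + c = a + (b + c)"
    by (rule all_rings_eqI) (simp add: defs component_closed ring.ring_simprules)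
  show "a + b = b + a"
    by (rule all_rings_eqI) (simp add: defs component_closed ring.ring_simprules)
  show "0 + a = a"
    by (rule all_rings_eqI) (simp add: defs component_closed ring.ring_simprules)
  show "- a + a = 0"
    by (rule all_rings_eqI) (simp add: defs component_closed ring.ring_simprules)
  show "a - b = a + - b"
    by (rule all_rings_eqI) (simp add: defs component_closed ring.ring_simprules)
  show "a * b * c = a * (b * c)"
    by (rule all_rings_eqI) (simp add: defs component_closed ring.ring_simprules)
  show "(a + b) * c = a * c + b * c"
    by (rule all_rings_eqI) (simp add: defs component_closed ring.ring_simprules)
  show "a * (b + c) = a * b + a * c"
    by (rule all_rings_eqI) (simp add: defs component_closed ring.ring_simprules)
  show "1 * a = a"
    by (rule all_rings_eqI) (simp add: defs component_closed ring.ring_simprules)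
  show "a * 1 = a"
    by (rule all_rings_eqI) (simp add: defs component_closed ring.ring_simprules monoid.r_one[OF ring.is_monoid])
qed

end

lift_definition embed :: "'a ring \<Rightarrow> 'a \<Rightarrow> 'a all_rings" is
  "\<lambda>R a R'. if ring R' then (if R' = R \<and> a \<in> carrier R then a else \<zero>\<^bsub>R'\<^esub>) else undefined"
  by (auto intro: ring.ring_simprules)

lemma component_embed: "ring R \<Longrightarrow> a \<in> carrier R \<Longrightarrow> component (embed R a) R = a"
  by (simp add: embed.rep_eq)

context
  fixes R :: "'a ring"
  assumes R: "ring R"
begin

lemma embed_inject: "a \<in> carrier R \<Longrightarrow> b \<in> carrier R \<Longrightarrow> embed R a = embed R b \<longleftrightarrow> a = b"
  using component_embed[OF R] by metis

lemma embed_zero [simp]: "embed R \<zero>\<^bsub>R\<^esub> = 0"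
  by (rule all_rings_eqI) (auto simp: zero_all_rings.rep_eq embed.rep_eq)

lemma embed_add: "a \<in> carrier R \<Longrightarrow> b \<in> carrier R \<Longrightarrow> embed R (a \<oplus>\<^bsub>R\<^esub> b) = embed R a + embed R b"
  by (rule all_rings_eqI) (auto simp: plus_all_rings.rep_eq embed.rep_eq ring.ring_simprules)

lemma embed_mult: "a \<in> carrier R \<Longrightarrow> b \<in> carrier R \<Longrightarrow> embed R (a \<otimes>\<^bsub>R\<^esub> b) = embed R a * embed R b"
  by (rule all_rings_eqI) (auto simp: times_all_rings.rep_eq embed.rep_eq ring.ring_simprules)

lemma embed_uminus: "a \<in> carrier R \<Longrightarrow> embed R (\<ominus>\<^bsub>R\<^esub> a) = - embed R a"
  by (rule all_rings_eqI) (auto simp: uminus_all_rings.rep_eq embed.rep_eq ring.ring_simprules)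

lemma embed_minus: "a \<in> carrier R \<Longrightarrow> b \<in> carrier R \<Longrightarrow> embed R (a \<ominus>\<^bsub>R\<^esub> b) = embed R a - embed R b"
  using R by (simp add: a_minus_def embed_add embed_uminus ring.ring_simprules)

lemma embed_finsum:
  assumes "finite A" "\<And>i. i \<in> A \<Longrightarrow> f i \<in> carrier R"
  shows "embed R (finsum R f A) = (\<Sum>i\<in>A. embed R (f i))"
  using assms
proof (induction A rule: finite_induct)
  case empty
  then show ?case using R abelian_monoid.finsum_empty[of R f] by (simp add: ring_def abelian_group_def)
next
  case (insert a A)
  have am: "abelian_monoid R" using R by (simp add: ring_def abelian_group_def)
  have "finsum R f (insert a A) = f a \<oplus>\<^bsub>R\<^esub> finsum R f A"
    using insert by (intro abelian_monoid.finsum_insert[OF am]) auto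
  moreover have "finsum R f A \<in> carrier R"
    using insert by (intro abelian_monoid.finsum_closed[OF am]) auto
  ultimately show ?case using insert by (simp add: embed_add)
qed

end

section \<open>Algebras given by generators and relations\<close>

text \<open>
  The monomials are restricted to keys of \<open>p\<close>, so that an induction stays inside carriers that are
  defined by a condition on keys.
\<close>

lemma poly_mapping_additive_induct [case_names zero single add]:
  fixes p :: "'a \<Rightarrow>\<^sub>0 'k::comm_monoid_add"
  assumes "P 0" "\<And>w c. w \<in> Poly_Mapping.keys p \<Longrightarrow> P (Poly_Mapping.single w c)"
    and "\<And>q r. P q \<Longrightarrow> P r \<Longrightarrow> P (q + r)"
  shows "P p"
proof -
  have fin: "finite K \<Longrightarrow> K \<subseteq> Poly_Mapping.keys p \<Longrightarrow>
      P (\<Sum>w\<in>K. Poly_Mapping.single w (Poly_Mapping.lookup p w))" for K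
    by (induction K rule: finite_induct) (use assms in auto)
  have "(\<Sum>w\<in>Poly_Mapping.keys p. Poly_Mapping.single w (Poly_Mapping.lookup p w)) = p"
  proof (rule poly_mapping_eqI)
    fix v
    show "Poly_Mapping.lookup (\<Sum>w\<in>Poly_Mapping.keys p. Poly_Mapping.single w (Poly_Mapping.lookup p w)) v
        = Poly_Mapping.lookup p v"
      by (simp add: lookup_sum lookup_single when_def not_in_keys_iff_lookup_eq_zero)
  qed
  then show ?thesis using fin[of "Poly_Mapping.keys p"] by simp
qed

lemma keys_uminus: "Poly_Mapping.keys (- p) = Poly_Mapping.keys (p :: 'a \<Rightarrow>\<^sub>0 'k::ab_group_add)"
  by (auto simp: in_keys_iff)

lemma free_algebra_simps [simp]:
  "mult (free_algebra A) = (*)" "one (free_algebra A) = 1"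
  "zero (free_algebra A) = 0" "add (free_algebra A) = (+)"
  by (simp_all add: free_algebra_def)

lemma carrier_free_algebra: "p \<in> carrier (free_algebra A) \<longleftrightarrow> Poly_Mapping.keys p \<subseteq> lists A"
  by (simp add: free_algebra_def)

lemma free_algebra_closed [simp]:
  "0 \<in> carrier (free_algebra A)" "1 \<in> carrier (free_algebra A)"
  "p \<in> carrier (free_algebra A) \<Longrightarrow> q \<in> carrier (free_algebra A) \<Longrightarrow> p + q \<in> carrier (free_algebra A)"
  "p \<in> carrier (free_algebra A) \<Longrightarrow> - p \<in> carrier (free_algebra A)"
  "p \<in> carrier (free_algebra A) \<Longrightarrow> q \<in> carrier (free_algebra A) \<Longrightarrow> p * q \<in> carrier (free_algebra A)"
  "Poly_Mapping.single [] c \<in> carrier (free_algebra A)"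
  "a \<in> A \<Longrightarrow> letter a \<in> carrier (free_algebra A)"
proof -
  show "p \<in> carrier (free_algebra A) \<Longrightarrow> q \<in> carrier (free_algebra A) \<Longrightarrow> p + q \<in> carrier (free_algebra A)"
    using Poly_Mapping.keys_add[of p q] by (auto simp: carrier_free_algebra)
  show "p \<in> carrier (free_algebra A) \<Longrightarrow> q \<in> carrier (free_algebra A) \<Longrightarrow> p * q \<in> carrier (free_algebra A)"
    using keys_mult[of p q] by (force simp: carrier_free_algebra plus_list_def)
qed (auto simp: carrier_free_algebra keys_uminus letter_def zero_list_def)

lemma free_algebra_closed_minus [simp]:
  "p \<in> carrier (free_algebra A) \<Longrightarrow> q \<in> carrier (free_algebra A) \<Longrightarrow> p - q \<in> carrier (free_algebra A)"
  using free_algebra_closed(3)[of p A "- q"] by simp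

lemma ring_free_algebra: "ring (free_algebra A :: ('g list \<Rightarrow>\<^sub>0 'k::comm_ring_1) ring)"
proof (rule ringI)
  show "abelian_group (free_algebra A :: ('g list \<Rightarrow>\<^sub>0 'k) ring)"
  proof (rule abelian_groupI)
    fix x :: "'g list \<Rightarrow>\<^sub>0 'k" assume "x \<in> carrier (free_algebra A)"
    then show "\<exists>y\<in>carrier (free_algebra A). y \<oplus>\<^bsub>free_algebra A\<^esub> x = \<zero>\<^bsub>free_algebra A\<^esub>"
      by (intro bexI[of _ "- x"]) auto
  qed (auto simp: add_ac)
  show "Group.monoid (free_algebra A :: ('g list \<Rightarrow>\<^sub>0 'k) ring)"
    by (rule monoidI) (auto simp: mult.assoc)
qed (auto simp: algebra_simps)

lemma a_inv_free_algebra: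
  "p \<in> carrier (free_algebra A) \<Longrightarrow> a_inv (free_algebra A) p = (- p :: 'g list \<Rightarrow>\<^sub>0 'k::comm_ring_1)"
proof -
  assume p: "p \<in> carrier (free_algebra A)"
  interpret ring "free_algebra A :: ('g list \<Rightarrow>\<^sub>0 'k) ring" by (rule ring_free_algebra)
  show ?thesis using minus_equality[of "- p" p] p by simp
qed

lemma single_Cons: "Poly_Mapping.single (a # w) c = letter a * Poly_Mapping.single w (c::'k::comm_ring_1)"
  by (simp add: letter_def mult_single plus_list_def)

lemma single_Nil_one: "Poly_Mapping.single [] 1 = (1 :: 'g list \<Rightarrow>\<^sub>0 'k::comm_ring_1)"
  by (metis single_one zero_list_def)

lemma free_algebra_induct [consumes 1, case_names const letter add]:
  fixes p :: "'g list \<Rightarrow>\<^sub>0 'k::comm_ring_1"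
  assumes "p \<in> carrier (free_algebra A)"
    and "\<And>c. P (Poly_Mapping.single [] c)"
    and "\<And>a q. a \<in> A \<Longrightarrow> q \<in> carrier (free_algebra A) \<Longrightarrow> P q \<Longrightarrow> P (letter a * q)"
    and "\<And>q r. q \<in> carrier (free_algebra A) \<Longrightarrow> r \<in> carrier (free_algebra A) \<Longrightarrow> P q \<Longrightarrow> P r \<Longrightarrow> P (q + r)"
  shows "P p"
proof -
  have word: "P (Poly_Mapping.single w c) \<and> Poly_Mapping.single w c \<in> carrier (free_algebra A)"
    if "w \<in> lists A" for w c
    using that
    by (induction w) (use assms(2,3) in \<open>auto simp: single_Cons\<close>)
  have "P p \<and> p \<in> carrier (free_algebra A)"
  proof (induction p rule: poly_mapping_additive_induct)
    case zero show ?case using assms(2)[of 0] by simp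
  next
    case (single w c) then show ?case using word assms(1) carrier_free_algebra by blast
  qed (use assms(4) in auto)
  then show ?thesis ..
qed

subsection \<open>The quotient by the ideal of relations\<close>

locale presentation =
  fixes A :: "'g set" and rels :: "('g list \<Rightarrow>\<^sub>0 'k::comm_ring_1) set"
  assumes rels: "rels \<subseteq> carrier (free_algebra A)"
begin

abbreviation "F \<equiv> free_algebra A :: ('g list \<Rightarrow>\<^sub>0 'k) ring"
abbreviation "PR \<equiv> presented_algebra A rels"
abbreviation "cls \<equiv> presented_class A rels"

lemma ideal_rels: "ideal (Idl\<^bsub>F\<^esub> rels) F"
  by (rule ring.genideal_ideal[OF ring_free_algebra rels])

lemma ring_presented: "ring PR"
  unfolding presented_algebra_def by (rule ideal.quotient_is_ring[OF ideal_rels])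

lemma presented_class_hom: "cls \<in> ring_hom F PR"
  unfolding presented_algebra_def presented_class_def[abs_def]
  by (rule ideal.rcos_ring_hom[OF ideal_rels])

lemma presented_class_closed [simp]: "p \<in> carrier F \<Longrightarrow> cls p \<in> carrier PR"
  using ring_hom_closed[OF presented_class_hom] .

lemma presented_class_add: "p \<in> carrier F \<Longrightarrow> q \<in> carrier F \<Longrightarrow> cls (p + q) = cls p \<oplus>\<^bsub>PR\<^esub> cls q"
  using ring_hom_add[OF presented_class_hom] by simp

lemma presented_class_mult: "p \<in> carrier F \<Longrightarrow> q \<in> carrier F \<Longrightarrow> cls (p * q) = cls p \<otimes>\<^bsub>PR\<^esub> cls q"
  using ring_hom_mult[OF presented_class_hom] by simp

lemma presented_class_one: "cls 1 = \<one>\<^bsub>PR\<^esub>"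
  using ring_hom_one[OF presented_class_hom] by simp

lemma presented_class_zero: "cls 0 = \<zero>\<^bsub>PR\<^esub>"
  using ring_hom_zero[OF presented_class_hom ring_free_algebra ring_presented] by simp

lemma presented_class_uminus: "p \<in> carrier F \<Longrightarrow> cls (- p) = \<ominus>\<^bsub>PR\<^esub> cls p"
proof -
  assume p: "p \<in> carrier F"
  interpret ring PR by (rule ring_presented)
  have "cls (- p) \<oplus>\<^bsub>PR\<^esub> cls p = \<zero>\<^bsub>PR\<^esub>"
    using p presented_class_add[of "- p" p] by (simp add: presented_class_zero)
  then show ?thesis using minus_equality[of "cls (- p)" "cls p"] p by simp
qed

lemma presented_carrierE:
  assumes "f \<in> carrier PR" obtains p where "p \<in> carrier F" "f = cls p"
  using assms unfolding presented_algebra_def presented_class_def FactRing_def A_RCOSETS_def'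
  by auto

lemma presented_class_eq_iff:
  "p \<in> carrier F \<Longrightarrow> q \<in> carrier F \<Longrightarrow> cls p = cls q \<longleftrightarrow> p - q \<in> Idl\<^bsub>F\<^esub> rels"
  using ring.quotient_eq_iff_same_a_r_cos[OF ring_free_algebra ideal_rels, of p q]
  by (simp add: presented_class_def a_minus_def a_inv_free_algebra)

lemma presented_class_eq_zero_iff:
  "p \<in> carrier F \<Longrightarrow> cls p = \<zero>\<^bsub>PR\<^esub> \<longleftrightarrow> p \<in> Idl\<^bsub>F\<^esub> rels"
  using presented_class_eq_iff[of p 0] by (simp add: presented_class_zero)

lemma presented_class_rel: "r \<in> rels \<Longrightarrow> cls r = \<zero>\<^bsub>PR\<^esub>"
  using presented_class_eq_zero_iff ring.genideal_self[OF ring_free_algebra rels] rels by blast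

lemma presented_induct [consumes 1, case_names const letter add]:
  assumes "f \<in> carrier PR"
    and "\<And>c. P (cls (Poly_Mapping.single [] c))"
    and "\<And>a g. a \<in> A \<Longrightarrow> g \<in> carrier PR \<Longrightarrow> P g \<Longrightarrow> P (cls (letter a) \<otimes>\<^bsub>PR\<^esub> g)"
    and "\<And>g h. g \<in> carrier PR \<Longrightarrow> h \<in> carrier PR \<Longrightarrow> P g \<Longrightarrow> P h \<Longrightarrow> P (g \<oplus>\<^bsub>PR\<^esub> h)"
  shows "P f"
proof -
  obtain p where p: "p \<in> carrier F" "f = cls p" using presented_carrierE[OF assms(1)] .
  from p(1) have "P (cls p)"
    by (induction p rule: free_algebra_induct)
      (use assms(2-) in \<open>auto simp: presented_class_add presented_class_mult\<close>)
  then show ?thesis using p by simp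
qed

text \<open>
  The only way in which the generated ideal is used: any set of polynomials that contains the relations
  and is closed under the ideal operations contains it.
\<close>

lemma presented_ideal_subset:
  assumes "rels \<subseteq> J" "J \<subseteq> carrier F" "0 \<in> J" "\<And>p q. p \<in> J \<Longrightarrow> q \<in> J \<Longrightarrow> p + q \<in> J"
    and neg: "\<And>p. p \<in> J \<Longrightarrow> - p \<in> J"
    and "\<And>p a. p \<in> J \<Longrightarrow> a \<in> carrier F \<Longrightarrow> a * p \<in> J" "\<And>p a. p \<in> J \<Longrightarrow> a \<in> carrier F \<Longrightarrow> p * a \<in> J"
  shows "Idl\<^bsub>F\<^esub> rels \<subseteq> J"
proof (rule ring.genideal_minimal[OF ring_free_algebra _ assms(1)])
  show "ideal J F"
  proof (rule idealI)
    show "subgroup J (add_monoid F)"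
    proof (rule subgroup.intro)
      fix x assume x: "x \<in> J"
      then have "inv\<^bsub>add_monoid F\<^esub> x = - x"
        using a_inv_free_algebra[of x A] assms(2) by (auto simp: a_inv_def)
      then show "inv\<^bsub>add_monoid F\<^esub> x \<in> J" using neg x by simp
    qed (use assms in auto)
  qed (use assms ring_free_algebra in auto)
qed

end

subsection \<open>The universal property\<close>

fun word_eval :: "'b ring \<Rightarrow> ('g \<Rightarrow> 'b) \<Rightarrow> 'g list \<Rightarrow> 'b all_rings" where
  "word_eval S g [] = embed S \<one>\<^bsub>S\<^esub>"
| "word_eval S g (a # w) = embed S (g a) * word_eval S g w"

text \<open>
  The value of a noncommutative polynomial at the elements \<open>g a\<close> of a ring \<open>S\<close>, with coefficients
  mapped by \<open>\<eta>\<close>. It lives in the product of all rings, where sums over keys are ordinary sums.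
\<close>

definition free_eval :: "'b ring \<Rightarrow> ('k \<Rightarrow> 'b) \<Rightarrow> ('g \<Rightarrow> 'b) \<Rightarrow> ('g list \<Rightarrow>\<^sub>0 'k::comm_ring_1) \<Rightarrow> 'b all_rings" where
  "free_eval S \<eta> g p = (\<Sum>w\<in>Poly_Mapping.keys p. embed S (\<eta> (Poly_Mapping.lookup p w)) * word_eval S g w)"

locale algebra_target =
  fixes S :: "'b ring" and \<eta> :: "'k::comm_ring_1 \<Rightarrow> 'b" and A :: "'g set" and g :: "'g \<Rightarrow> 'b"
  assumes S: "ring S"
    and eta_closed [simp]: "\<eta> c \<in> carrier S"
    and eta_add: "\<eta> (c + c') = \<eta> c \<oplus>\<^bsub>S\<^esub> \<eta> c'"
    and eta_mult: "\<eta> (c * c') = \<eta> c \<otimes>\<^bsub>S\<^esub> \<eta> c'"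
    and eta_one: "\<eta> 1 = \<one>\<^bsub>S\<^esub>"
    and g_closed [simp]: "a \<in> A \<Longrightarrow> g a \<in> carrier S"
    and eta_central: "a \<in> A \<Longrightarrow> \<eta> c \<otimes>\<^bsub>S\<^esub> g a = g a \<otimes>\<^bsub>S\<^esub> \<eta> c"
begin

lemma eta_zero: "\<eta> 0 = \<zero>\<^bsub>S\<^esub>"
proof -
  have "embed S (\<eta> 0) = 0" using eta_add[of 0 0] embed_add[OF S, of "\<eta> 0" "\<eta> 0"] by simp
  moreover have "\<zero>\<^bsub>S\<^esub> \<in> carrier S" using S by (rule ring.ring_simprules)
  ultimately show ?thesis using embed_inject[OF S, of "\<eta> 0" "\<zero>\<^bsub>S\<^esub>"] embed_zero[OF S] by simp
qed

lemma embed_eta_add: "embed S (\<eta> (c + c')) = embed S (\<eta> c) + embed S (\<eta> c')"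
  by (simp add: eta_add embed_add[OF S])

lemma one_closed [simp]: "\<one>\<^bsub>S\<^esub> \<in> carrier S"
  using S ring.ring_simprules(6) by blast

lemma embed_one_mult: "a \<in> carrier S \<Longrightarrow> embed S \<one>\<^bsub>S\<^esub> * embed S a = embed S a"
  "a \<in> carrier S \<Longrightarrow> embed S a * embed S \<one>\<^bsub>S\<^esub> = embed S a"
  using monoid.l_one[OF ring.is_monoid[OF S]] monoid.r_one[OF ring.is_monoid[OF S]]
  by (simp_all flip: embed_mult[OF S])

abbreviation "ev \<equiv> free_eval S \<eta> g"

lemma free_eval_zero [simp]: "ev 0 = 0"
  by (simp add: free_eval_def)

lemma free_eval_single: "ev (Poly_Mapping.single w c) = embed S (\<eta> c) * word_eval S g w"
  by (cases "c = 0") (auto simp: free_eval_def eta_zero embed_zero[OF S])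

lemma free_eval_add: "ev (p + q) = ev p + ev q"
proof -
  let ?K = "Poly_Mapping.keys p \<union> Poly_Mapping.keys q"
  have *: "ev r = (\<Sum>w\<in>?K. embed S (\<eta> (Poly_Mapping.lookup r w)) * word_eval S g w)"
    if "Poly_Mapping.keys r \<subseteq> ?K" for r
    unfolding free_eval_def
    by (rule sum.mono_neutral_left)
      (use that in \<open>auto simp: eta_zero embed_zero[OF S] not_in_keys_iff_lookup_eq_zero\<close>)
  have "ev (p + q) = (\<Sum>w\<in>?K. embed S (\<eta> (Poly_Mapping.lookup (p + q) w)) * word_eval S g w)"
    by (rule *) (rule Poly_Mapping.keys_add)
  also have "\<dots> = ev p + ev q"
    by (simp add: * lookup_add embed_eta_add distrib_right sum.distrib)
  finally show ?thesis .
qed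

lemma free_eval_uminus: "ev (- p) = - ev p"
  using free_eval_add[of p "- p"] by (simp add: eq_neg_iff_add_eq_0 add.commute)

lemma free_eval_diff: "ev (p - q) = ev p - ev q"
  using free_eval_add[of p "- q"] by (simp add: free_eval_uminus)

lemma free_eval_one: "ev 1 = embed S \<one>\<^bsub>S\<^esub>"
  using free_eval_single[of "[]" 1] by (simp add: eta_one embed_one_mult single_Nil_one)

lemma free_eval_letter: "a \<in> A \<Longrightarrow> ev (letter a) = embed S (g a)"
  unfolding letter_def free_eval_single by (simp add: eta_one embed_one_mult)

lemma free_eval_const: "ev (Poly_Mapping.single [] c) = embed S (\<eta> c)"
  unfolding free_eval_single by (simp add: embed_one_mult)

lemma word_eval_append:
  "v \<in> lists A \<Longrightarrow> w \<in> lists A \<Longrightarrow> word_eval S g (v @ w) = word_eval S g v * word_eval S g w"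
proof (induction v)
  case Nil
  then show ?case by (cases w) (auto simp: embed_one_mult simp flip: mult.assoc)
qed (auto simp: mult.assoc)

lemma word_eval_eta: "w \<in> lists A \<Longrightarrow> word_eval S g w * embed S (\<eta> c) = embed S (\<eta> c) * word_eval S g w"
proof (induction w)
  case (Cons a w)
  have "embed S (g a) * embed S (\<eta> c) = embed S (\<eta> c) * embed S (g a)"
    using Cons by (simp add: eta_central flip: embed_mult[OF S])
  then show ?case using Cons by simp (metis mult.assoc)
qed (auto simp: embed_one_mult)

lemma free_eval_mult:
  assumes "p \<in> carrier (free_algebra A)" "q \<in> carrier (free_algebra A)"
  shows "ev (p * q) = ev p * ev q"
proof (induction p rule: poly_mapping_additive_induct)
  case (single v c)
  then have v: "v \<in> lists A" using assms(1) by (auto simp: carrier_free_algebra)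
  show ?case
  proof (induction q rule: poly_mapping_additive_induct)
    case (single w c')
    then have w: "w \<in> lists A" using assms(2) by (auto simp: carrier_free_algebra)
    have "embed S (\<eta> (c * c')) * word_eval S g (v @ w) =
        embed S (\<eta> c) * (embed S (\<eta> c') * word_eval S g v) * word_eval S g w"
      using v w by (simp add: eta_mult embed_mult[OF S] word_eval_append mult.assoc)
    also have "\<dots> = embed S (\<eta> c) * word_eval S g v * (embed S (\<eta> c') * word_eval S g w)"
      using word_eval_eta[OF v, of c'] by (metis mult.assoc)
    finally show ?case by (simp add: mult_single free_eval_single plus_list_def)
  qed (auto simp: distrib_left free_eval_add)
qed (auto simp: distrib_right free_eval_add)

lemma free_eval_in_image: "p \<in> carrier (free_algebra A) \<Longrightarrow> \<exists>s\<in>carrier S. ev p = embed S s"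
proof (induction p rule: free_algebra_induct)
  case (const c) then show ?case using free_eval_const eta_closed by blast
next
  case (letter a q)
  then obtain s where "s \<in> carrier S" "ev q = embed S s" by blast
  then show ?case using letter
    by (intro bexI[of _ "g a \<otimes>\<^bsub>S\<^esub> s"]) (auto simp: free_eval_mult free_eval_letter embed_mult[OF S] ring.ring_simprules[OF S])
next
  case (add q r)
  then obtain s s' where "s \<in> carrier S" "ev q = embed S s" "s' \<in> carrier S" "ev r = embed S s'" by blast
  then show ?case
    by (intro bexI[of _ "s \<oplus>\<^bsub>S\<^esub> s'"]) (auto simp: free_eval_add embed_add[OF S] ring.ring_simprules[OF S])
qed

text \<open>
  Evaluation is additive and multiplicative, so the polynomials of value zero contain the ideal as soon as
  they contain the relations. Hence the value depends on the class only.
\<close>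

theorem presented_universal:
  fixes rels :: "('g list \<Rightarrow>\<^sub>0 'k) set"
  assumes rels: "rels \<subseteq> carrier (free_algebra A)" and vanish: "\<And>r. r \<in> rels \<Longrightarrow> ev r = 0"
  shows "\<exists>h\<in>ring_hom (presented_algebra A rels) S.
    (\<forall>p\<in>carrier (free_algebra A). embed S (h (presented_class A rels p)) = ev p) \<and>
    (\<forall>a\<in>A. h (presented_class A rels (letter a)) = g a) \<and>
    (\<forall>c. h (presented_class A rels (Poly_Mapping.single [] c)) = \<eta> c)"
proof -
  interpret presentation A rels by unfold_locales (rule rels)
  let ?F = "free_algebra A :: ('g list \<Rightarrow>\<^sub>0 'k) ring" and ?c = "presented_class A rels"
  let ?P = "presented_algebra A rels"
  have "Idl\<^bsub>?F\<^esub> rels \<subseteq> {p \<in> carrier ?F. ev p = 0}"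
    by (rule presented_ideal_subset)
      (use rels vanish in \<open>auto simp: free_eval_add free_eval_uminus free_eval_mult\<close>)
  then have ker: "ev p = ev q" if "p \<in> carrier ?F" "q \<in> carrier ?F" "?c p = ?c q" for p q
    using that presented_class_eq_iff[of p q] by (auto simp: free_eval_diff)
  define h where "h f = component (ev (SOME p. p \<in> carrier ?F \<and> ?c p = f)) S" for f
  have h: "embed S (h (?c p)) = ev p \<and> h (?c p) \<in> carrier S" if p: "p \<in> carrier ?F" for p
  proof -
    let ?q = "SOME q. q \<in> carrier ?F \<and> ?c q = ?c p"
    have "?q \<in> carrier ?F \<and> ?c ?q = ?c p" by (rule someI[of _ p]) (use p in simp)
    then have "ev ?q = ev p" using ker p by blast
    moreover obtain s where "s \<in> carrier S" "ev p = embed S s" using free_eval_in_image[OF p] by blast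
    ultimately show ?thesis by (simp add: h_def component_embed[OF S])
  qed
  have eqI: "a = b" if "a \<in> carrier S" "b \<in> carrier S" "embed S a = embed S b" for a b
    using embed_inject[OF S] that by blast
  have hom: "h \<in> ring_hom ?P S"
  proof (rule ring_hom_memI)
    fix x assume "x \<in> carrier ?P"
    then show "h x \<in> carrier S" using presented_carrierE h by metis
  next
    fix x y assume "x \<in> carrier ?P" "y \<in> carrier ?P"
    then obtain p q where pq: "p \<in> carrier ?F" "x = ?c p" "q \<in> carrier ?F" "y = ?c q"
      using presented_carrierE by metis
    then have "h (x \<otimes>\<^bsub>?P\<^esub> y) = h (?c (p * q))" "h (x \<oplus>\<^bsub>?P\<^esub> y) = h (?c (p + q))"
      by (simp_all add: presented_class_mult presented_class_add)
    then show "h (x \<otimes>\<^bsub>?P\<^esub> y) = h x \<otimes>\<^bsub>S\<^esub> h y" "h (x \<oplus>\<^bsub>?P\<^esub> y) = h x \<oplus>\<^bsub>S\<^esub> h y"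
      using pq h by (auto intro!: eqI simp: free_eval_mult free_eval_add embed_mult[OF S] embed_add[OF S]
          ring.ring_simprules[OF S])
  next
    show "h \<one>\<^bsub>?P\<^esub> = \<one>\<^bsub>S\<^esub>"
      using h[of 1] by (auto intro!: eqI simp: free_eval_one presented_class_one)
  qed
  have "h (?c (letter a)) = g a" if "a \<in> A" for a
    using h[of "letter a"] that by (auto intro!: eqI simp: free_eval_letter)
  moreover have "h (?c (Poly_Mapping.single [] c)) = \<eta> c" for c
    using h[of "Poly_Mapping.single [] c"] by (auto intro!: eqI simp: free_eval_const)
  ultimately show ?thesis using hom h by blast
qed

end

subsection \<open>Homogeneous components\<close>

abbreviation word_weight :: "('g \<Rightarrow> int) \<Rightarrow> 'g list \<Rightarrow> int" where
  "word_weight wt w \<equiv> sum_list (map wt w)"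

definition free_component :: "('g \<Rightarrow> int) \<Rightarrow> int \<Rightarrow> ('g list \<Rightarrow>\<^sub>0 'k::comm_ring_1) \<Rightarrow> ('g list \<Rightarrow>\<^sub>0 'k)" where
  "free_component wt d p =
    (\<Sum>w\<in>Poly_Mapping.keys p. Poly_Mapping.single w (if word_weight wt w = d then Poly_Mapping.lookup p w else 0))"

lemma lookup_free_component:
  "Poly_Mapping.lookup (free_component wt d p) w =
    (if word_weight wt w = d then Poly_Mapping.lookup p w else 0)"
  by (simp add: free_component_def lookup_sum lookup_single when_def not_in_keys_iff_lookup_eq_zero)

lemma free_component_add: "free_component wt d (p + q) = free_component wt d p + free_component wt d q"
  by (rule poly_mapping_eqI) (simp add: lookup_free_component lookup_add)

lemma free_component_uminus: "free_component wt d (- p) = - free_component wt d p"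
  by (rule poly_mapping_eqI) (simp add: lookup_free_component)

lemma free_component_zero [simp]: "free_component wt d 0 = 0"
  by (rule poly_mapping_eqI) (simp add: lookup_free_component)

lemma keys_free_component:
  "Poly_Mapping.keys (free_component wt d p) = {w \<in> Poly_Mapping.keys p. word_weight wt w = d}"
  by (auto simp: in_keys_iff lookup_free_component split: if_splits)

lemma free_component_homogeneous:
  assumes "\<forall>w\<in>Poly_Mapping.keys p. word_weight wt w = e"
  shows "free_component wt d p = (if d = e then p else 0)"
  by (rule poly_mapping_eqI) (use assms in \<open>auto simp: lookup_free_component not_in_keys_iff_lookup_eq_zero\<close>)

lemma free_component_single:
  "free_component wt d (Poly_Mapping.single w c) = (if word_weight wt w = d then Poly_Mapping.single w c else 0)"
  by (rule poly_mapping_eqI) (simp add: lookup_free_component lookup_single when_def)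

lemma free_component_single_mult:
  "free_component wt d (Poly_Mapping.single v c * p) = Poly_Mapping.single v c * free_component wt (d - word_weight wt v) p"
  "free_component wt d (p * Poly_Mapping.single v c) = free_component wt (d - word_weight wt v) p * Poly_Mapping.single v c"
  by (induction p rule: poly_mapping_additive_induct)
    (auto simp: free_component_single mult_single plus_list_def distrib_left distrib_right free_component_add)

lemma free_component_letter_mult:
  "free_component wt d (letter a * p) = letter a * free_component wt (d - wt a) p"
  "free_component wt d (p * letter a) = free_component wt (d - wt a) p * letter a"
  by (simp_all add: letter_def free_component_single_mult)

lemma sum_free_components:
  assumes "finite D" "word_weight wt ` Poly_Mapping.keys p \<subseteq> D"
  shows "(\<Sum>d\<in>D. free_component wt d p) = p"
proof (rule poly_mapping_eqI)
  fix w
  show "Poly_Mapping.lookup (\<Sum>d\<in>D. free_component wt d p) w = Poly_Mapping.lookup p w"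
    using assms by (cases "w \<in> Poly_Mapping.keys p")
      (auto simp: lookup_sum lookup_free_component not_in_keys_iff_lookup_eq_zero)
qed

locale graded_presentation = presentation A rels
  for A :: "'g set" and rels :: "('g list \<Rightarrow>\<^sub>0 'k::comm_ring_1) set" +
  fixes wt :: "'g \<Rightarrow> int"
  assumes homogeneous: "r \<in> rels \<Longrightarrow> \<exists>e. \<forall>w\<in>Poly_Mapping.keys r. word_weight wt w = e"
begin

abbreviation "gr \<equiv> presented_degree wt A rels"

lemma free_component_closed [simp]: "p \<in> carrier F \<Longrightarrow> free_component wt d p \<in> carrier F"
  by (auto simp: carrier_free_algebra keys_free_component)

text \<open>
  An ideal generated by homogeneous elements is homogeneous. It suffices to see that the polynomials all
  of whose components lie in the ideal are stable under multiplication; by induction on the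
  multiplier this reduces to letters, and multiplication by a letter shifts the components.
\<close>

lemma free_component_ideal: "p \<in> Idl\<^bsub>F\<^esub> rels \<Longrightarrow> free_component wt d p \<in> Idl\<^bsub>F\<^esub> rels"
proof -
  let ?I = "Idl\<^bsub>F\<^esub> rels" and ?J = "{p \<in> carrier F. \<forall>d. free_component wt d p \<in> Idl\<^bsub>F\<^esub> rels}"
  interpret ideal ?I F by (rule ideal_rels)
  have I0: "0 \<in> ?I" and Iadd: "\<And>p q. p \<in> ?I \<Longrightarrow> q \<in> ?I \<Longrightarrow> p + q \<in> ?I"
    and Imult: "\<And>a p. a \<in> carrier F \<Longrightarrow> p \<in> ?I \<Longrightarrow> a * p \<in> ?I" "\<And>a p. a \<in> carrier F \<Longrightarrow> p \<in> ?I \<Longrightarrow> p * a \<in> ?I"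
    using additive_subgroup.zero_closed[OF additive_subgroup_axioms]
      additive_subgroup.a_closed[OF additive_subgroup_axioms] I_l_closed I_r_closed by auto
  have Iu: "- p \<in> ?I" if "p \<in> ?I" for p
  proof -
    have "- 1 * p \<in> ?I" by (rule Imult(1)) (use that in auto)
    then show ?thesis by simp
  qed
  have "?I \<subseteq> ?J"
  proof (rule presented_ideal_subset)
    show "rels \<subseteq> ?J"
    proof
      fix r assume r: "r \<in> rels"
      then obtain e where "\<forall>w\<in>Poly_Mapping.keys r. word_weight wt w = e" using homogeneous by blast
      then have "free_component wt d r \<in> ?I" for d
        using r I0 ring.genideal_self[OF ring_free_algebra rels] free_component_homogeneous[of r wt e d] by auto
      then show "r \<in> ?J" using r rels by auto
    qed
  next
    fix p a :: "'g list \<Rightarrow>\<^sub>0 'k"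
    assume "p \<in> ?J" "a \<in> carrier F"
    from this(2,1) show "a * p \<in> ?J"
    proof (induction a arbitrary: p rule: free_algebra_induct)
      case (letter x q)
      have "q * p \<in> ?J" using letter by blast
      then have "free_component wt d (letter x * (q * p)) \<in> ?I" for d
        using letter.hyps Imult(1)[of "letter x"] by (simp add: free_component_letter_mult)
      then show ?case using letter by (auto simp: mult.assoc)
    qed (auto simp: free_component_single_mult distrib_right free_component_add Iadd Imult)
  next
    fix p a :: "'g list \<Rightarrow>\<^sub>0 'k"
    assume "p \<in> ?J" "a \<in> carrier F"
    from this(2,1) show "p * a \<in> ?J"
    proof (induction a arbitrary: p rule: free_algebra_induct)
      case (letter x q)
      have "free_component wt d (p * letter x) \<in> ?I" for d
        using letter.hyps letter.prems Imult(2)[of "letter x"] by (simp add: free_component_letter_mult)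
      then have "p * letter x \<in> ?J" using letter by auto
      then have "p * letter x * q \<in> ?J" using letter.IH by blast
      then show ?case by (simp add: mult.assoc)
    qed (auto simp: free_component_single_mult distrib_left free_component_add Iadd Imult)
  qed (auto simp: I0 free_component_add Iadd free_component_uminus Iu)
  then show "p \<in> ?I \<Longrightarrow> free_component wt d p \<in> ?I" by blast
qed

definition comp :: "int \<Rightarrow> ('g list \<Rightarrow>\<^sub>0 'k) set \<Rightarrow> ('g list \<Rightarrow>\<^sub>0 'k) set" where
  "comp d f = cls (free_component wt d (SOME p. p \<in> carrier F \<and> cls p = f))"

lemma comp_class: "p \<in> carrier F \<Longrightarrow> comp d (cls p) = cls (free_component wt d p)"
proof -
  assume p: "p \<in> carrier F"
  let ?q = "SOME q. q \<in> carrier F \<and> cls q = cls p"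
  have q: "?q \<in> carrier F \<and> cls ?q = cls p" by (rule someI[of _ p]) (use p in simp)
  then have "?q - p \<in> Idl\<^bsub>F\<^esub> rels" using presented_class_eq_iff[of ?q p] p by blast
  then have "free_component wt d (?q - p) \<in> Idl\<^bsub>F\<^esub> rels" by (rule free_component_ideal)
  moreover have "free_component wt d (?q - p) = free_component wt d ?q - free_component wt d p"
    using free_component_add[of wt d ?q "- p"] by (simp add: free_component_uminus)
  ultimately show ?thesis unfolding comp_def
    using presented_class_eq_iff[of "free_component wt d ?q" "free_component wt d p"] p q by simp
qed

lemma gr_carrier: "f \<in> gr d \<Longrightarrow> f \<in> carrier PR"
  unfolding presented_degree_def using presented_class_closed by auto

lemma grI: "p \<in> carrier F \<Longrightarrow> \<forall>w\<in>Poly_Mapping.keys p. word_weight wt w = d \<Longrightarrow> cls p \<in> gr d"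
  unfolding presented_degree_def by blast

lemma comp_closed [simp]: "f \<in> carrier PR \<Longrightarrow> comp d f \<in> carrier PR"
  using presented_carrierE comp_class free_component_closed presented_class_closed by metis

lemma comp_in_gr: "f \<in> carrier PR \<Longrightarrow> comp d f \<in> gr d"
proof -
  assume "f \<in> carrier PR"
  then obtain p where p: "p \<in> carrier F" "f = cls p" using presented_carrierE by blast
  then show ?thesis by (auto simp: comp_class keys_free_component intro!: grI)
qed

lemma comp_gr: "f \<in> gr e \<Longrightarrow> comp d f = (if d = e then f else \<zero>\<^bsub>PR\<^esub>)"
proof -
  assume "f \<in> gr e"
  then obtain p where p: "p \<in> carrier F" "f = cls p" "\<forall>w\<in>Poly_Mapping.keys p. word_weight wt w = e"
    unfolding presented_degree_def by blast
  then show ?thesis using free_component_homogeneous[OF p(3), of d] by (simp add: comp_class presented_class_zero)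
qed

lemma comp_add: "f \<in> carrier PR \<Longrightarrow> g \<in> carrier PR \<Longrightarrow> comp d (f \<oplus>\<^bsub>PR\<^esub> g) = comp d f \<oplus>\<^bsub>PR\<^esub> comp d g"
proof -
  assume "f \<in> carrier PR" "g \<in> carrier PR"
  then obtain p q where p: "p \<in> carrier F" "f = cls p" "q \<in> carrier F" "g = cls q"
    using presented_carrierE by metis
  then show ?thesis
    using comp_class[of "p + q" d] presented_class_add[of p q]
    by (simp add: comp_class free_component_add presented_class_add)
qed

lemma zero_gr: "\<zero>\<^bsub>PR\<^esub> \<in> gr d"
  using grI[of 0 d] by (simp add: presented_class_zero)

lemma gr_add: "f \<in> gr d \<Longrightarrow> g \<in> gr d \<Longrightarrow> f \<oplus>\<^bsub>PR\<^esub> g \<in> gr d"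
proof -
  assume f: "f \<in> gr d" "g \<in> gr d"
  then have "comp d (f \<oplus>\<^bsub>PR\<^esub> g) = f \<oplus>\<^bsub>PR\<^esub> g" using comp_add[of f g d] gr_carrier comp_gr by simp
  moreover have "f \<oplus>\<^bsub>PR\<^esub> g \<in> carrier PR"
    using ring.ring_simprules(1)[OF ring_presented] f gr_carrier by blast
  ultimately show ?thesis using comp_in_gr by metis
qed

lemma gr_mult: "f \<in> gr d \<Longrightarrow> g \<in> gr e \<Longrightarrow> f \<otimes>\<^bsub>PR\<^esub> g \<in> gr (d + e)"
proof -
  assume "f \<in> gr d" "g \<in> gr e"
  then obtain p q where p: "p \<in> carrier F" "f = cls p" "\<forall>w\<in>Poly_Mapping.keys p. word_weight wt w = d"
    and q: "q \<in> carrier F" "g = cls q" "\<forall>w\<in>Poly_Mapping.keys q. word_weight wt w = e"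
    unfolding presented_degree_def by blast
  have "\<forall>w\<in>Poly_Mapping.keys (p * q). word_weight wt w = d + e"
    using keys_mult[of p q] p q by (force simp: plus_list_def)
  then show ?thesis using p q grI[of "p * q" "d + e"] by (simp add: presented_class_mult)
qed

lemma const_gr: "cls (Poly_Mapping.single [] c) \<in> gr 0"
  by (rule grI) auto

lemma letter_gr: "a \<in> A \<Longrightarrow> cls (letter a) \<in> gr (wt a)"
  using grI[of "letter a" "wt a"] by (simp add: letter_def[of a] free_algebra_closed(7)[unfolded letter_def])

lemma components:
  assumes "f \<in> carrier PR"
  shows "\<exists>D. finite D \<and> f = finsum PR (\<lambda>d. comp d f) D"
proof -
  obtain p where p: "p \<in> carrier F" "f = cls p" using presented_carrierE[OF assms] .
  let ?D = "word_weight wt ` Poly_Mapping.keys p"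
  have R: "ring PR" by (rule ring_presented)
  interpret ring PR by (rule R)
  have "cls (\<Sum>d\<in>E. free_component wt d p) = finsum PR (\<lambda>d. comp d f) E" if "finite E" for E
    using that
  proof (induction E rule: finite_induct)
    case empty then show ?case by (simp add: presented_class_zero)
  next
    case (insert d E)
    have "(\<Sum>d\<in>E. free_component wt d p) \<in> carrier F"
      using insert(1) by (induction E rule: finite_induct) (use p in auto)
    then show ?case using insert p assms
      by (simp add: presented_class_add comp_class)
  qed
  from this[of ?D] have "f = finsum PR (\<lambda>d. comp d f) ?D" using sum_free_components[of ?D wt p] p by simp
  then show ?thesis by (intro exI[of _ ?D]) simp
qed

lemma graded_induct [consumes 1, case_names homogeneous add]:
  assumes "f \<in> carrier PR" "\<And>d g. g \<in> gr d \<Longrightarrow> P g"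
    and add: "\<And>g h. g \<in> carrier PR \<Longrightarrow> h \<in> carrier PR \<Longrightarrow> P g \<Longrightarrow> P h \<Longrightarrow> P (g \<oplus>\<^bsub>PR\<^esub> h)"
  shows "P f"
proof -
  obtain D where D: "finite D" "f = finsum PR (\<lambda>d. comp d f) D"
    using components[OF assms(1)] by blast
  interpret ring PR by (rule ring_presented)
  have "P (finsum PR (\<lambda>d. comp d f) E)" if "finite E" for E
    using that
  proof (induction E rule: finite_induct)
    case empty then show ?case using assms(2)[OF zero_gr] by simp
  next
    case (insert d E)
    then show ?case using assms(1) assms(2)[OF comp_in_gr, of f d] by (simp add: add)
  qed
  then show ?thesis using D by metis
qed

text \<open>
  An additive map that raises degrees by \<open>e\<close> commutes with taking components up to this shift. The
  statement is applied to the Demazure operators and to multiplication by a homogeneous element.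
\<close>

lemma comp_shift:
  assumes "D \<in> carrier PR \<rightarrow> carrier PR"
    and "\<And>f g. f \<in> carrier PR \<Longrightarrow> g \<in> carrier PR \<Longrightarrow> D (f \<oplus>\<^bsub>PR\<^esub> g) = D f \<oplus>\<^bsub>PR\<^esub> D g"
    and "\<And>k f. f \<in> gr k \<Longrightarrow> D f \<in> gr (k + e)" and "f \<in> carrier PR"
  shows "comp (d + e) (D f) = D (comp d f)"
proof -
  interpret ring PR by (rule ring_presented)
  have D0: "D \<zero>\<^bsub>PR\<^esub> = \<zero>\<^bsub>PR\<^esub>"
    using assms(2)[of "\<zero>\<^bsub>PR\<^esub>" "\<zero>\<^bsub>PR\<^esub>"] assms(1) by (metis PiE add.r_cancel_one' r_zero zero_closed)
  show ?thesis using assms(4)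
  proof (induction f rule: graded_induct)
    case (homogeneous k g)
    then show ?case using comp_gr[OF assms(3)[OF homogeneous], of "d + e"] comp_gr[OF homogeneous, of d] D0 by simp
  next
    case (add g h)
    then show ?case using assms(1,2) comp_add[of "D g" "D h"] comp_add[of g h] by (simp add: Pi_iff)
  qed
qed

lemma comp_mult:
  assumes "b \<in> gr e" "f \<in> carrier PR"
  shows "comp (d + e) (b \<otimes>\<^bsub>PR\<^esub> f) = b \<otimes>\<^bsub>PR\<^esub> comp d f"
proof (rule comp_shift[of "\<lambda>f. b \<otimes>\<^bsub>PR\<^esub> f"])
  interpret ring PR by (rule ring_presented)
  have b: "b \<in> carrier PR" using assms gr_carrier by blast
  show "(\<lambda>f. b \<otimes>\<^bsub>PR\<^esub> f) \<in> carrier PR \<rightarrow> carrier PR" using b by auto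
  show "b \<otimes>\<^bsub>PR\<^esub> (f \<oplus>\<^bsub>PR\<^esub> g) = b \<otimes>\<^bsub>PR\<^esub> f \<oplus>\<^bsub>PR\<^esub> b \<otimes>\<^bsub>PR\<^esub> g"
    if "f \<in> carrier PR" "g \<in> carrier PR" for f g using that b by (simp add: r_distr)
  show "b \<otimes>\<^bsub>PR\<^esub> f \<in> gr (k + e)" if "f \<in> gr k" for k f
    using gr_mult[OF assms(1) that] by (simp add: add.commute)
qed fact

end

section \<open>Words in the type D relations\<close>

lemma commute_mult:
  fixes a b c :: "'a::semigroup_mult"
  shows "a * b = b * a \<Longrightarrow> a * c = c * a \<Longrightarrow> a * (b * c) = b * c * a"
  by (metis mult.assoc)

lemma anticommute_mult:
  fixes a b c :: "'a::ring"
  assumes "a * b = - (b * a)" "a * c = - (c * a)"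
  shows "a * (b * c) = b * c * a"
proof -
  have "a * (b * c) = - (b * (a * c))" using assms(1) by (simp flip: mult.assoc)
  then show ?thesis using assms(2) by (simp add: mult.assoc)
qed

lemma anticommute_conj:
  fixes a b c :: "'a::ring"
  assumes "a * b = - (b * a)" "a * c = c * a"
  shows "a * (b * c * b) = b * c * b * a"
proof -
  have "a * (c * b) = - (c * b * a)" using assms by (metis mult.assoc mult_minus_right)
  then show ?thesis using anticommute_mult[OF assms(1), of "c * b"] by (simp add: mult.assoc)
qed

text \<open>
  The relations of the nilHecke algebra in the reversed numbering. They hold for the
  generators of the algebra and also for the operators on polynomials, and the locale is instantiated
  with both.
\<close>

locale type_D_relations =
  fixes n :: nat
    and y d :: "nat \<Rightarrow> 'a::{ring,monoid_mult}"
    and t u :: 'a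
  assumes two_le_n: "2 \<le> n"
    and u_u [simp]: "u * u = u"
    and u_y [simp]: "k < n \<Longrightarrow> u * y k = y k" "k < n \<Longrightarrow> y k * u = y k"
    and u_d [simp]: "1 \<le> j \<Longrightarrow> j < n \<Longrightarrow> u * d j = d j" "1 \<le> j \<Longrightarrow> j < n \<Longrightarrow> d j * u = d j"
    and u_t [simp]: "u * t = t" "t * u = t"
    and y_y: "i < n \<Longrightarrow> j < n \<Longrightarrow> i \<noteq> j \<Longrightarrow> y i * y j = - (y j * y i)"
    and d_d: "1 \<le> j \<Longrightarrow> j < n \<Longrightarrow> d j * d j = 0"
    and d_braid: "1 \<le> j \<Longrightarrow> Suc j < n \<Longrightarrow> d j * d (Suc j) * d j = d (Suc j) * d j * d (Suc j)"
    and d_far: "1 \<le> i \<Longrightarrow> Suc i < j \<Longrightarrow> j < n \<Longrightarrow> d i * d j = - (d j * d i)"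
    and d_y: "1 \<le> j \<Longrightarrow> j < n \<Longrightarrow> d j * y j = u - y (j - 1) * d j"
    and d_y_pred: "1 \<le> j \<Longrightarrow> j < n \<Longrightarrow> d j * y (j - 1) = u - y j * d j"
    and d_y_far: "1 \<le> j \<Longrightarrow> j < n \<Longrightarrow> k < n \<Longrightarrow> k \<noteq> j \<Longrightarrow> k \<noteq> j - 1 \<Longrightarrow> d j * y k = - (y k * d j)"
    and t_t: "t * t = 0"
    and t_d1: "t * d 1 = d 1 * t"
    and t_braid: "2 < n \<Longrightarrow> t * d 2 * t = d 2 * t * d 2"
    and t_far: "3 \<le> j \<Longrightarrow> j < n \<Longrightarrow> t * d j = - (d j * t)"
    and t_y1: "t * y 1 = u + y 0 * t"
    and t_y0: "t * y 0 = y 1 * t - u"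
    and t_y_far: "2 \<le> k \<Longrightarrow> k < n \<Longrightarrow> t * y k = - (y k * t)"
begin

lemma d_far': "1 \<le> i \<Longrightarrow> Suc i < j \<Longrightarrow> j < n \<Longrightarrow> d j * d i = - (d i * d j)"
  using d_far[of i j] by simp

text \<open>
  The word \<open>d r \<dots> d 2 * d 1 * t * d 2 \<dots> d r\<close> of length \<open>2 * r\<close>. It belongs to the longest of the
  minimal coset representatives of the Weyl group of type \<open>D\<close> and rank \<open>r\<close> in the one of rank
  \<open>r + 1\<close>. Consequently \<open>longest_word r\<close> belongs to the longest element of the latter group.
\<close>

fun coset_word :: "nat \<Rightarrow> 'a" where
  "coset_word 0 = u"
| "coset_word (Suc 0) = d 1 * t"
| "coset_word (Suc (Suc r)) = d (Suc (Suc r)) * coset_word (Suc r) * d (Suc (Suc r))"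

lemma cox_step: "1 \<le> r \<Longrightarrow> coset_word (Suc r) = d (Suc r) * coset_word r * d (Suc r)"
  by (cases r) auto

fun longest_word :: "nat \<Rightarrow> 'a" where
  "longest_word 0 = u"
| "longest_word (Suc r) = longest_word r * coset_word (Suc r)"

lemma u_cox [simp]: "r < n \<Longrightarrow> u * coset_word r = coset_word r" "r < n \<Longrightarrow> coset_word r * u = coset_word r"
proof -
  have "u * coset_word r = coset_word r \<and> coset_word r * u = coset_word r" if "r < n"
    using that
  proof (induction r rule: coset_word.induct)
    case 2 then show ?case using u_d(1)[of 1] by (metis One_nat_def coset_word.simps(2) le_refl mult.assoc u_t(2))
  next
    case (3 r)
    then have "u * d (Suc (Suc r)) = d (Suc (Suc r))" "d (Suc (Suc r)) * u = d (Suc (Suc r))" by auto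
    then show ?case unfolding coset_word.simps(3) by (metis mult.assoc)
  qed simp
  then show "r < n \<Longrightarrow> u * coset_word r = coset_word r" "r < n \<Longrightarrow> coset_word r * u = coset_word r" by auto
qed

lemma u_long [simp]: "r < n \<Longrightarrow> u * longest_word r = longest_word r" "r < n \<Longrightarrow> longest_word r * u = longest_word r"
proof -
  have "u * longest_word r = longest_word r \<and> longest_word r * u = longest_word r" if "r < n"
    using that
  proof (induction r)
    case (Suc r)
    then show ?case using u_cox[of "Suc r"] unfolding longest_word.simps by (metis Suc_lessD mult.assoc)
  qed simp
  then show "r < n \<Longrightarrow> u * longest_word r = longest_word r" "r < n \<Longrightarrow> longest_word r * u = longest_word r" by auto
qed

lemma cox_d_above: "r + 2 \<le> j \<Longrightarrow> j < n \<Longrightarrow> d j * coset_word r = coset_word r * d j"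
proof (induction r rule: coset_word.induct)
  case 2
  then show ?case using anticommute_mult[of "d j" "d 1" t] d_far'[of 1 j] t_far[of j] by simp
next
  case (3 r)
  then show ?case using anticommute_conj[of "d j" "d (Suc (Suc r))" "coset_word (Suc r)"]
      d_far'[of "Suc (Suc r)" j] by simp
qed (use u_d in simp)

lemma cox_y_above: "r < k \<Longrightarrow> k < n \<Longrightarrow> y k * coset_word r = coset_word r * y k"
proof (induction r rule: coset_word.induct)
  case 2
  then show ?case using anticommute_mult[of "y k" "d 1" t] d_y_far[of 1 k] t_y_far[of k] by simp
next
  case (3 r)
  then show ?case using anticommute_conj[of "y k" "d (Suc (Suc r))" "coset_word (Suc r)"]
      d_y_far[of "Suc (Suc r)" k] by simp
qed (use u_y in simp)

lemma long_y_above: "r < k \<Longrightarrow> k < n \<Longrightarrow> y k * longest_word r = longest_word r * y k"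
  by (induction r) (use cox_y_above commute_mult in force)+

lemma long_d_above: "r + 2 \<le> j \<Longrightarrow> j < n \<Longrightarrow> d j * longest_word r = longest_word r * d j"
  by (induction r) (use cox_d_above commute_mult in force)+

text \<open>
  The coset representative normalizes the smaller Weyl group: it fixes the generators other than those of
  the fork, and exchanges the latter (\<open>cox_fork\<close>). No signs occur, because the letters of the coset
  word that anticommute with a given letter come in pairs.
\<close>

lemma cox_d_below: "2 \<le> j \<Longrightarrow> j < r \<Longrightarrow> r < n \<Longrightarrow> d j * coset_word r = coset_word r * d j"
proof (induction r)
  case (Suc r)
  show ?case
  proof (cases "j = r")
    case True
    obtain i where i: "j = Suc i" "1 \<le> i" using Suc.prems by (cases j) auto
    let ?a = "d j" and ?b = "d (Suc j)" and ?c = "coset_word i"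
    have C: "coset_word (Suc r) = ?b * (?a * ?c * ?a) * ?b"
      using True i cox_step[of i] cox_step[of j] by simp
    have br: "?a * ?b * ?a = ?b * ?a * ?b" using d_braid[of j] Suc.prems True by simp
    have bc: "?b * ?c = ?c * ?b" using cox_d_above[of i "Suc j"] i Suc.prems True by simp
    \<comment> \<open>The letter passes by two braid moves, at the beginning and at the end of the word.\<close>
    have "?a * coset_word (Suc r) = (?a * ?b * ?a) * ?c * ?a * ?b" by (simp add: C mult.assoc)
    also have "\<dots> = ?b * ?a * (?b * ?c) * ?a * ?b" by (simp only: br) (simp only: mult.assoc)
    also have "\<dots> = ?b * ?a * ?c * (?b * ?a * ?b)" by (simp only: bc) (simp only: mult.assoc)
    also have "\<dots> = coset_word (Suc r) * ?a" by (simp only: C flip: br) (simp only: mult.assoc)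
    finally show ?thesis .
  next
    case False
    then have *: "d j * coset_word r = coset_word r * d j" "d j * d (Suc r) = - (d (Suc r) * d j)"
      using Suc d_far[of j "Suc r"] by auto
    have "coset_word (Suc r) = d (Suc r) * coset_word r * d (Suc r)" using Suc.prems by (simp add: cox_step)
    then show ?thesis using anticommute_conj[OF *(2,1)] by simp
  qed
qed simp

lemma cox_fork: "2 \<le> r \<Longrightarrow> r < n \<Longrightarrow> d 1 * coset_word r = coset_word r * t \<and> t * coset_word r = coset_word r * d 1"
proof (induction r rule: nat_induct_at_least)
  case base
  let ?a = "d 1" and ?b = "d 2"
  have C: "coset_word 2 = ?b * ?a * t * ?b" by (simp add: numeral_2_eq_2 mult.assoc)
  have br: "?a * ?b * ?a = ?b * ?a * ?b" "t * ?b * t = ?b * t * ?b"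
    using d_braid[of 1] t_braid base by (auto simp: numeral_2_eq_2)
  have "?a * coset_word 2 = (?a * ?b * ?a) * t * ?b" by (simp add: C mult.assoc)
  also have "\<dots> = ?b * ?a * (?b * t * ?b)" unfolding br(1) by (simp add: mult.assoc)
  also have "\<dots> = coset_word 2 * t" by (simp only: C flip: br(2)) (simp only: mult.assoc)
  finally have 1: "?a * coset_word 2 = coset_word 2 * t" .
  have "t * coset_word 2 = t * ?b * (t * ?a) * ?b" using t_d1 by (simp add: C mult.assoc)
  also have "\<dots> = (t * ?b * t) * ?a * ?b" by (simp add: mult.assoc)
  also have "\<dots> = ?b * t * (?b * ?a * ?b)" unfolding br(2) by (simp add: mult.assoc)
  also have "\<dots> = ?b * (t * ?a) * ?b * ?a" by (simp only: flip: br(1)) (simp only: mult.assoc)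
  also have "\<dots> = coset_word 2 * ?a" by (simp add: C t_d1 mult.assoc del: One_nat_def)
  finally show ?case using 1 by simp
next
  case (Suc r)
  have *: "d 1 * d (Suc r) = - (d (Suc r) * d 1)" "t * d (Suc r) = - (d (Suc r) * t)"
    using Suc d_far[of 1 "Suc r"] t_far[of "Suc r"] by auto
  have C: "coset_word (Suc r) = d (Suc r) * coset_word r * d (Suc r)" using Suc by (simp add: cox_step)
  have IH: "d 1 * coset_word r = coset_word r * t" "t * coset_word r = coset_word r * d 1" using Suc by auto
  have "d 1 * coset_word (Suc r) = - (d (Suc r) * (d 1 * coset_word r) * d (Suc r))"
    by (simp add: C * flip: mult.assoc del: One_nat_def)
  also have "\<dots> = coset_word (Suc r) * t" unfolding IH by (simp add: C * mult.assoc)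
  finally have 1: "d 1 * coset_word (Suc r) = coset_word (Suc r) * t" .
  have "t * coset_word (Suc r) = - (d (Suc r) * (t * coset_word r) * d (Suc r))"
    by (simp add: C * flip: mult.assoc)
  also have "\<dots> = coset_word (Suc r) * d 1" unfolding IH by (simp add: C * mult.assoc del: One_nat_def)
  finally show ?case using 1 by simp
qed

lemma cox_commute: "k < r \<Longrightarrow> r < n \<Longrightarrow> coset_word k * coset_word r = coset_word r * coset_word k"
proof (induction k rule: coset_word.induct)
  case 2
  then have r: "2 \<le> r" by simp
  have "d 1 * t * coset_word r = d 1 * (coset_word r * d 1)" using cox_fork[OF r] 2 by (simp add: mult.assoc)
  also have "\<dots> = coset_word r * (t * d 1)" using cox_fork[OF r] 2 by (simp flip: mult.assoc)
  finally show ?case by (simp add: t_d1 del: One_nat_def)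
next
  case (3 k)
  have "d (Suc (Suc k)) * coset_word r = coset_word r * d (Suc (Suc k))" using cox_d_below 3 by simp
  moreover have "coset_word (Suc k) * coset_word r = coset_word r * coset_word (Suc k)" using 3 by simp
  ultimately show ?case unfolding coset_word.simps(3)
    by (metis commute_mult)
qed simp

lemma long_cox_commute: "k < r \<Longrightarrow> r < n \<Longrightarrow> longest_word k * coset_word r = coset_word r * longest_word k"
proof (induction k)
  case (Suc k)
  have "longest_word (Suc k) * coset_word r = longest_word k * (coset_word (Suc k) * coset_word r)" by (simp add: mult.assoc)
  also have "\<dots> = (longest_word k * coset_word r) * coset_word (Suc k)" using cox_commute[of "Suc k" r] Suc.prems by (simp add: mult.assoc)
  also have "\<dots> = coset_word r * longest_word (Suc k)" using Suc by (simp add: mult.assoc)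
  finally show ?case .
qed simp

lemma cox_d_self: "1 \<le> r \<Longrightarrow> r < n \<Longrightarrow> coset_word r * d r = 0 \<and> d r * coset_word r = 0"
proof -
  assume r: "1 \<le> r" "r < n"
  show ?thesis
  proof (cases "r = 1")
    case True
    then show ?thesis using d_d[of 1] r t_d1
      by (simp add: mult.assoc) (metis mult.assoc mult_zero_left)
  next
    case False
    then have "coset_word r = d r * coset_word (r - 1) * d r" using r cox_step[of "r - 1"] by simp
    then show ?thesis using d_d[of r] r by (simp add: mult.assoc) (metis mult.assoc mult_zero_left)
  qed
qed

text \<open>
  By induction on the rank. On the right, a letter is moved through the last coset word, where it becomes a
  letter of smaller rank and meets the previous longest word; the new letter is the last one of the coset
  word and squares to zero. On the left, only the new letter
  \<open>d (r + 1)\<close> needs an argument, since the other letters already kill the left factor.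
\<close>

lemma long_kill:
  "r < n \<Longrightarrow> (\<forall>j. 1 \<le> j \<longrightarrow> j \<le> r \<longrightarrow> longest_word r * d j = 0 \<and> d j * longest_word r = 0) \<and>
    (1 \<le> r \<longrightarrow> longest_word r * t = 0 \<and> t * longest_word r = 0)"
proof (induction r)
  case (Suc r)
  then have IH: "\<And>j. 1 \<le> j \<Longrightarrow> j \<le> r \<Longrightarrow> longest_word r * d j = 0 \<and> d j * longest_word r = 0"
      "1 \<le> r \<Longrightarrow> longest_word r * t = 0 \<and> t * longest_word r = 0" and n: "Suc r < n" by auto
  show ?case
  proof (cases r)
    case 0
    have "d 1 * t * d 1 = 0" "d 1 * (d 1 * t) = 0" "d 1 * t * t = 0" "t * (d 1 * t) = 0"
      using d_d[of 1] t_t t_d1 two_le_n by (auto simp: mult.assoc simp del: One_nat_def)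
        (simp_all flip: mult.assoc del: One_nat_def add: t_d1, simp_all add: mult.assoc t_t del: One_nat_def)
    moreover have "u * (d 1 * t) = d 1 * t" using u_d[of 1] two_le_n by (simp flip: mult.assoc)
    ultimately show ?thesis using 0 by (auto simp: le_Suc_eq)
  next
    case (Suc s)
    have s: "1 \<le> r" using Suc by simp
    have L: "longest_word (Suc r) = longest_word r * coset_word (Suc r)" by simp
    have right: "longest_word (Suc r) * d j = 0" if "1 \<le> j" "j \<le> Suc r" for j
    proof -
      consider "j = Suc r" | "j = 1" "j \<le> r" | "2 \<le> j" "j \<le> r" using \<open>1 \<le> j\<close> \<open>j \<le> Suc r\<close> by linarith
      then show ?thesis
      proof cases
        case 1 then show ?thesis using cox_d_self[of "Suc r"] n by (simp add: mult.assoc)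
      next
        case 2
        have "coset_word (Suc r) * d 1 = t * coset_word (Suc r)" using cox_fork[of "Suc r"] s n by simp
        then have "longest_word (Suc r) * d 1 = longest_word r * t * coset_word (Suc r)" unfolding L by (simp only: mult.assoc)
        then show ?thesis using IH(2) s 2 by simp
      next
        case 3
        have "coset_word (Suc r) * d j = d j * coset_word (Suc r)" using cox_d_below[of j "Suc r"] 3 n by simp
        then have "longest_word (Suc r) * d j = longest_word r * d j * coset_word (Suc r)" unfolding L by (simp only: mult.assoc)
        then show ?thesis using IH(1) 3 by simp
      qed
    qed
    have "coset_word (Suc r) * t = d 1 * coset_word (Suc r)" using cox_fork[of "Suc r"] s n by simp
    then have "longest_word (Suc r) * t = longest_word r * d 1 * coset_word (Suc r)" unfolding L by (simp only: mult.assoc)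
    then have rt: "longest_word (Suc r) * t = 0" using IH(1)[of 1] s by simp
    have lt: "t * longest_word (Suc r) = 0" unfolding L using IH(2) s by (simp flip: mult.assoc)
    have left: "d j * longest_word (Suc r) = 0" if "1 \<le> j" "j \<le> Suc r" for j
    proof (cases "j = Suc r")
      case False
      then have "d j * longest_word r = 0" using IH(1) that by simp
      then show ?thesis unfolding L by (simp flip: mult.assoc)
    next
      case True
      have "d j * longest_word (Suc r) = d j * longest_word s * coset_word r * coset_word (Suc r)" using Suc by (simp add: mult.assoc)
      also have "\<dots> = longest_word s * d j * (coset_word r * coset_word (Suc r))"
        using long_d_above[of s j] True Suc n by (simp add: mult.assoc)
      \<comment> \<open>The coset words commute, and the larger one begins with the letter in question.\<close>
      also have "\<dots> = longest_word s * (d j * coset_word (Suc r)) * coset_word r"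
        using cox_commute[of r "Suc r"] n by (simp add: mult.assoc)
      also have "\<dots> = 0" using cox_d_self[of "Suc r"] True n by simp
      finally show ?thesis .
    qed
    show ?thesis using right left rt lt by blast
  qed
qed simp

lemma long_d: "1 \<le> j \<Longrightarrow> j \<le> r \<Longrightarrow> r < n \<Longrightarrow> longest_word r * d j = 0"
  and d_long: "1 \<le> j \<Longrightarrow> j \<le> r \<Longrightarrow> r < n \<Longrightarrow> d j * longest_word r = 0"
  and long_t: "1 \<le> r \<Longrightarrow> r < n \<Longrightarrow> longest_word r * t = 0"
  and t_long: "1 \<le> r \<Longrightarrow> r < n \<Longrightarrow> t * longest_word r = 0"
  using long_kill by blast+

end

section \<open>The resolution of the unit\<close>

text \<open>
  Moving odd elements past each other produces signs that do not matter for membership in additive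
  subgroups, nor for vanishing. Working up to a sign avoids keeping track of them.
\<close>

definition eq_upto_sign :: "'a::ab_group_add \<Rightarrow> 'a \<Rightarrow> bool" (infix "\<approx>" 50) where
  "a \<approx> b \<longleftrightarrow> a = b \<or> a = - b"

lemma eq_upto_sign_refl [simp]: "a \<approx> a"
  and eq_upto_sign_uminus [simp]: "- a \<approx> b \<longleftrightarrow> a \<approx> b" "a \<approx> - b \<longleftrightarrow> a \<approx> b"
  by (auto simp: eq_upto_sign_def)

lemma eq_upto_sign_sym: "a \<approx> b \<Longrightarrow> b \<approx> a"
  by (auto simp: eq_upto_sign_def)

lemma eq_upto_sign_trans [trans]: "a \<approx> b \<Longrightarrow> b \<approx> c \<Longrightarrow> a \<approx> c"
  by (auto simp: eq_upto_sign_def)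

lemma eq_upto_sign_mult:
  fixes a b c :: "'a::ring"
  shows "a \<approx> b \<Longrightarrow> c * a \<approx> c * b" "a \<approx> b \<Longrightarrow> a * c \<approx> b * c"
  by (auto simp: eq_upto_sign_def)

lemma supercommute_mult:
  fixes a b c :: "'a::ring"
  assumes "a * b \<approx> b * a" "a * c \<approx> c * a"
  shows "a * (b * c) \<approx> b * c * a"
proof -
  have "a * (b * c) \<approx> b * (a * c)" using eq_upto_sign_mult(2)[OF assms(1), of c] by (simp add: mult.assoc)
  also have "\<dots> \<approx> b * c * a" using eq_upto_sign_mult(1)[OF assms(2), of b] by (simp add: mult.assoc)
  finally show ?thesis .
qed

lemma supercommute_mult':
  fixes a b c :: "'a::ring"
  assumes "b * a \<approx> a * b" "c * a \<approx> a * c"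
  shows "b * c * a \<approx> a * (b * c)"
  by (rule eq_upto_sign_sym, rule supercommute_mult) (use assms eq_upto_sign_sym in blast)+

text \<open>
  The set \<open>H\<close> plays the role of the ring of polynomials inside the algebra. The last assumption allows
  moving polynomials to the right of a Demazure generator, at the expense of terms without it.
\<close>

locale type_D_nilHecke = type_D_relations +
  fixes H :: "'a set" and half :: 'a
  assumes half: "half \<in> H" "half + half = u"
    and H_u: "u \<in> H" and H_y: "k < n \<Longrightarrow> y k \<in> H"
    and H_add: "g \<in> H \<Longrightarrow> h \<in> H \<Longrightarrow> g + h \<in> H"
    and H_uminus: "g \<in> H \<Longrightarrow> - g \<in> H"
    and H_mult: "g \<in> H \<Longrightarrow> h \<in> H \<Longrightarrow> g * h \<in> H"
    and u_H: "g \<in> H \<Longrightarrow> u * g = g" "g \<in> H \<Longrightarrow> g * u = g"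
    and H_d: "g \<in> H \<Longrightarrow> 1 \<le> j \<Longrightarrow> j < n \<Longrightarrow> \<exists>g'\<in>H. \<exists>g''\<in>H. g * d j = d j * g' + g''"
begin

lemma H_zero: "0 \<in> H"
  using H_add[OF H_u H_uminus[OF H_u]] by simp

lemma y_d_far: "1 \<le> j \<Longrightarrow> j < n \<Longrightarrow> k < n \<Longrightarrow> k \<noteq> j \<Longrightarrow> k \<noteq> j - 1 \<Longrightarrow> y k * d j \<approx> d j * y k"
  using d_y_far[of j k] by simp

lemma y_t_far: "2 \<le> k \<Longrightarrow> k < n \<Longrightarrow> y k * t \<approx> t * y k"
  using t_y_far[of k] by simp

fun omega :: "nat \<Rightarrow> 'a" where
  "omega 0 = u"
| "omega (Suc r) = y r * omega r"

text \<open>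
  Prefixes of \<open>coset_word r\<close>: \<open>fall r k = d r * d (r - 1) * \<dots>\<close> consists of the first \<open>k\<close> letters, up
  to \<open>d 1\<close>, and \<open>turn r k = d r * \<dots> * d 1 * t * d 2 * \<dots> * d (k + 1)\<close> of the prefixes that have passed
  the fork. The remaining factors are \<open>rise k = d 2 * \<dots> * d (k + 1)\<close>.
\<close>

fun fall :: "nat \<Rightarrow> nat \<Rightarrow> 'a" where
  "fall r 0 = u"
| "fall r (Suc k) = fall r k * d (r - k)"

fun turn :: "nat \<Rightarrow> nat \<Rightarrow> 'a" where
  "turn r 0 = fall r r * t"
| "turn r (Suc k) = turn r k * d (Suc (Suc k))"

fun rise :: "nat \<Rightarrow> 'a" where
  "rise 0 = u"
| "rise (Suc k) = rise k * d (Suc (Suc k))"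

fun top_vars :: "nat \<Rightarrow> nat \<Rightarrow> 'a" where
  "top_vars r 0 = u"
| "top_vars r (Suc k) = top_vars r k * y (r - k)"

text \<open>
  What remains of \<open>turn r k\<close> when its last letter is removed. Since \<open>d 1\<close> and \<open>t\<close> commute, both of them
  can be the last letter of \<open>turn r 0\<close>, and both removals occur at the same time.
\<close>

fun below :: "nat \<Rightarrow> nat \<Rightarrow> 'a" where
  "below r 0 = fall r r + fall r (r - 1) * t"
| "below r (Suc k) = turn r k"

lemma omega_H: "r \<le> n \<Longrightarrow> omega r \<in> H"
  by (induction r) (auto simp: H_u H_y H_mult)

lemma top_vars_H: "r < n \<Longrightarrow> top_vars r k \<in> H"
  by (induction k) (auto simp: H_u H_y H_mult)

lemma u_fall [simp]: "r < n \<Longrightarrow> k \<le> r \<Longrightarrow> u * fall r k = fall r k" "r < n \<Longrightarrow> k \<le> r \<Longrightarrow> fall r k * u = fall r k"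
proof -
  have "u * fall r k = fall r k \<and> fall r k * u = fall r k" if "r < n" "k \<le> r" using that
    by (induction k) (auto simp: mult.assoc, auto simp flip: mult.assoc)
  then show "r < n \<Longrightarrow> k \<le> r \<Longrightarrow> u * fall r k = fall r k" "r < n \<Longrightarrow> k \<le> r \<Longrightarrow> fall r k * u = fall r k"
    by auto
qed

lemma fall_front: "k \<le> r \<Longrightarrow> Suc r < n \<Longrightarrow> fall (Suc r) (Suc k) = d (Suc r) * fall r k"
proof (induction k)
  case (Suc k)
  then have "fall (Suc r) (Suc (Suc k)) = d (Suc r) * fall r k * d (r - k)" by simp
  then show ?case by (simp add: mult.assoc)
qed simp

lemma turn_rise: "r < n \<Longrightarrow> 1 \<le> r \<Longrightarrow> k < r \<Longrightarrow> turn r k = turn r 0 * rise k"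
  by (induction k) (auto simp: mult.assoc)

lemma fall_cox: "1 \<le> i \<Longrightarrow> i \<le> r \<Longrightarrow> r < n \<Longrightarrow> fall r (r - i) * coset_word i = turn r (i - 1)"
proof (induction i rule: nat_induct_at_least)
  case base
  then have "fall r r = fall r (r - 1) * d 1" by (cases r) auto
  then show ?case by (simp add: mult.assoc)
next
  case (Suc i)
  have "fall r (r - i) = fall r (r - Suc i) * d (Suc i)" 
    using Suc.prems by (metis Suc_diff_Suc Suc_le_lessD diff_diff_cancel Suc_leD fall.simps(2) Suc_diff_le)
  moreover have "turn r i = turn r (i - 1) * d (Suc i)" using Suc.hyps by (cases i) auto
  ultimately show ?case using Suc cox_step[of i] by (simp flip: mult.assoc)
qed

lemma turn_cox: "1 \<le> r \<Longrightarrow> r < n \<Longrightarrow> turn r (r - 1) = coset_word r"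
  using fall_cox[of r r] by simp

text \<open>
  The odd product \<open>omega\<close> of an initial segment of the variables behaves like a symmetric
  polynomial: it supercommutes with the Demazure generators that involve variables of this segment only.
  The computation with the last two variables covers the generator that exchanges them.
\<close>

lemma d_omega: "1 \<le> j \<Longrightarrow> j \<le> r \<Longrightarrow> r < n \<Longrightarrow> omega (Suc r) * d j \<approx> d j * omega (Suc r)"
proof (induction r)
  case (Suc r)
  show ?case
  proof (cases "j = Suc r")
    case False
    then have "y (Suc r) * d j \<approx> d j * y (Suc r)" using y_d_far[of j "Suc r"] Suc.prems by simp
    moreover have "omega (Suc r) * d j \<approx> d j * omega (Suc r)" using Suc False by simp
    ultimately show ?thesis using supercommute_mult'[of "y (Suc r)" "d j" "omega (Suc r)"] by simp
  next
    case True
    have o: "omega k * d j \<approx> d j * omega k" if "k \<le> r" for k using that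
    proof (induction k)
      case 0 then show ?case using True Suc.prems by simp
    next
      case (Suc k)
      then show ?case using supercommute_mult'[of "y k" "d j" "omega k"] y_d_far[of j k] True Suc.prems \<open>Suc r < n\<close> by simp
    qed
    have "d j * y (Suc r) * y r = (u - y r * d j) * y r" using True d_y[of j] Suc.prems by simp
    also have "\<dots> = y r - y r * (d j * y r)" using Suc.prems by (simp add: algebra_simps)
    also have "d j * y r = u - y (Suc r) * d j" using True d_y_pred[of j] Suc.prems by simp
    also have "y r - y r * (u - y (Suc r) * d j) = y r * y (Suc r) * d j" using Suc.prems by (simp add: algebra_simps)
    also have "\<dots> = - (y (Suc r) * y r * d j)" using y_y[of r "Suc r"] Suc.prems by simp
    finally have "y (Suc r) * y r * d j \<approx> d j * (y (Suc r) * y r)" by (simp add: mult.assoc)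
    from supercommute_mult'[OF this o[of r]] show ?thesis by (simp add: mult.assoc)
  qed
qed simp

lemma t_omega: "1 \<le> r \<Longrightarrow> r < n \<Longrightarrow> omega (Suc r) * t \<approx> t * omega (Suc r)"
proof (induction r rule: nat_induct_at_least)
  case base
  have "t * y 1 * y 0 = y 0 + y 0 * (t * y 0)" using t_y1 base by (simp add: algebra_simps)
  also have "\<dots> = y 0 * y 1 * t" unfolding t_y0 using base by (simp add: algebra_simps)
  also have "\<dots> = - (y 1 * y 0 * t)" using y_y[of 0 1] base by simp
  finally show ?case using base by (simp add: mult.assoc)
next
  case (Suc r)
  then show ?case using supercommute_mult'[of "y (Suc r)" t "omega (Suc r)"] y_t_far[of "Suc r"] by simp
qed

lemma long_omega: "r < n \<Longrightarrow> omega (Suc r) * longest_word r \<approx> longest_word r * omega (Suc r)"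
proof -
  assume r: "r < n"
  have c: "omega (Suc r) * coset_word k \<approx> coset_word k * omega (Suc r)" if "k \<le> r" for k using that
  proof (induction k rule: coset_word.induct)
    case 1 then show ?case using u_H[OF omega_H[of "Suc r"]] r by (simp del: omega.simps)
  next
    case 2 then show ?case using supercommute_mult[OF d_omega[of 1 r] t_omega[of r]] r by simp
  next
    case (3 k)
    let ?d = "d (Suc (Suc k))"
    have "omega (Suc r) * ?d \<approx> ?d * omega (Suc r)" using d_omega[of "Suc (Suc k)" r] 3 r by simp
    with supercommute_mult[OF supercommute_mult[OF this, of "coset_word (Suc k)"] this] show ?case using 3
      by simp
  qed
  have "omega (Suc r) * longest_word k \<approx> longest_word k * omega (Suc r)" if "k \<le> r" for k using that
  proof (induction k)
    case 0 then show ?case using u_H[OF omega_H[of "Suc r"]] r by (simp del: omega.simps)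
  next
    case (Suc k)
    then show ?case using supercommute_mult[of "omega (Suc r)" "longest_word k" "coset_word (Suc k)"] c[of "Suc k"] by simp
  qed
  then show ?thesis by simp
qed

text \<open>
  The right module over the polynomials that is generated by the first \<open>a + 1\<close> powers of \<open>y r\<close> and by
  \<open>omega r\<close>, each followed by the longest word. The aim is \<open>long_pred_in_pieces\<close>: the longest word
  of one rank less belongs to it when \<open>a = 2 * r\<close>.
\<close>

definition pieces :: "nat \<Rightarrow> nat \<Rightarrow> 'a set" where
  "pieces r a = {(\<Sum>b\<le>a. y r ^ b * longest_word r * g b) + omega r * longest_word r * g' | g g'. (\<forall>b. g b \<in> H) \<and> g' \<in> H}"

lemma piecesI:
  "(\<And>b. g b \<in> H) \<Longrightarrow> g' \<in> H \<Longrightarrow>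
    p = (\<Sum>b\<le>a. y r ^ b * longest_word r * g b) + omega r * longest_word r * g' \<Longrightarrow> p \<in> pieces r a"
  unfolding pieces_def by blast

lemma piecesE:
  "p \<in> pieces r a \<Longrightarrow> \<exists>g g'. (\<forall>b. g b \<in> H) \<and> g' \<in> H \<and>
    p = (\<Sum>b\<le>a. y r ^ b * longest_word r * g b) + omega r * longest_word r * g'"
  unfolding pieces_def by blast

lemma pieces_add: "p \<in> pieces r a \<Longrightarrow> q \<in> pieces r a \<Longrightarrow> p + q \<in> pieces r a"
proof -
  assume p: "p \<in> pieces r a" and q: "q \<in> pieces r a"
  from p obtain g g' where *: "\<forall>b. g b \<in> H" "g' \<in> H"
    and p: "p = (\<Sum>b\<le>a. y r ^ b * longest_word r * g b) + omega r * longest_word r * g'"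
    using piecesE by blast
  from q obtain h h' where **: "\<forall>b. h b \<in> H" "h' \<in> H"
    and q: "q = (\<Sum>b\<le>a. y r ^ b * longest_word r * h b) + omega r * longest_word r * h'"
    using piecesE by blast
  have "p + q = (\<Sum>b\<le>a. y r ^ b * longest_word r * (g b + h b)) + omega r * longest_word r * (g' + h')"
    by (simp add: p q distrib_left sum.distrib add_ac)
  then show ?thesis by (rule piecesI[rotated 2]) (use * ** H_add in blast)+
qed

lemma pieces_uminus: "p \<in> pieces r a \<Longrightarrow> - p \<in> pieces r a"
proof -
  assume "p \<in> pieces r a"
  then obtain g g' where *: "\<forall>b. g b \<in> H" "g' \<in> H"
    and p: "p = (\<Sum>b\<le>a. y r ^ b * longest_word r * g b) + omega r * longest_word r * g'"
    using piecesE by blast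
  have "- p = (\<Sum>b\<le>a. y r ^ b * longest_word r * (- g b)) + omega r * longest_word r * (- g')"
    by (simp add: p sum_negf)
  then show ?thesis by (rule piecesI[rotated 2]) (use * H_uminus in blast)+
qed

lemma pieces_diff: "p \<in> pieces r a \<Longrightarrow> q \<in> pieces r a \<Longrightarrow> p - q \<in> pieces r a"
  using pieces_add[OF _ pieces_uminus] by fastforce

lemma pieces_eq_upto_sign: "p \<in> pieces r a \<Longrightarrow> q \<approx> p \<Longrightarrow> q \<in> pieces r a"
  using pieces_uminus by (auto simp: eq_upto_sign_def)

lemma pieces_mult: "p \<in> pieces r a \<Longrightarrow> h \<in> H \<Longrightarrow> p * h \<in> pieces r a"
proof -
  assume "p \<in> pieces r a" and h: "h \<in> H"
  then obtain g g' where *: "\<forall>b. g b \<in> H" "g' \<in> H"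
    and p: "p = (\<Sum>b\<le>a. y r ^ b * longest_word r * g b) + omega r * longest_word r * g'"
    using piecesE by blast
  have "p * h = (\<Sum>b\<le>a. y r ^ b * longest_word r * (g b * h)) + omega r * longest_word r * (g' * h)"
    by (simp add: p sum_distrib_right distrib_right mult.assoc)
  then show ?thesis by (rule piecesI[rotated 2]) (use * H_mult[OF _ h] in blast)+
qed

lemma pieces_mono: "p \<in> pieces r a \<Longrightarrow> a \<le> a' \<Longrightarrow> p \<in> pieces r a'"
proof -
  assume "p \<in> pieces r a" and le: "a \<le> a'"
  then obtain g g' where *: "\<forall>b. g b \<in> H" "g' \<in> H"
    and p: "p = (\<Sum>b\<le>a. y r ^ b * longest_word r * g b) + omega r * longest_word r * g'"
    using piecesE by blast
  let ?h = "\<lambda>b. if b \<le> a then g b else 0"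
  have "(\<Sum>b\<le>a'. y r ^ b * longest_word r * ?h b) = (\<Sum>b\<le>a. y r ^ b * longest_word r * ?h b)"
    using le by (intro sum.mono_neutral_right) auto
  also have "\<dots> = (\<Sum>b\<le>a. y r ^ b * longest_word r * g b)" by (intro sum.cong) auto
  finally have "p = (\<Sum>b\<le>a'. y r ^ b * longest_word r * ?h b) + omega r * longest_word r * g'" using p by simp
  moreover have "?h b \<in> H" for b using * H_zero by simp
  ultimately show ?thesis by (intro piecesI[of ?h g']) (use *(2) in blast)+
qed

text \<open>
  Multiplication by \<open>y r\<close> raises the exponents by one. It turns \<open>omega r\<close> into \<open>omega (r + 1)\<close>, which
  passes through the longest word and is absorbed by the polynomials on the right.
\<close>

lemma pieces_step:
  assumes r: "r < n" and "p \<in> pieces r a"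
  shows "y r * p \<in> pieces r (Suc a)"
proof -
  from assms(2) obtain g g' where *: "\<forall>b. g b \<in> H" "g' \<in> H"
    and p: "p = (\<Sum>b\<le>a. y r ^ b * longest_word r * g b) + omega r * longest_word r * g'"
    using piecesE by blast
  have "y r * omega r * longest_word r \<approx> longest_word r * omega (Suc r)"
    using long_omega[OF r] by simp
  then obtain w where w: "w \<in> H" "y r * omega r * longest_word r = longest_word r * w"
    unfolding eq_upto_sign_def using omega_H[of "Suc r"] H_uminus r
    by (metis Suc_leI mult_minus_right)
  let ?h = "\<lambda>b. if b = 0 then w * g' else g (b - 1)"
  have "(\<Sum>b\<le>Suc a. y r ^ b * longest_word r * ?h b) = longest_word r * (w * g') + (\<Sum>b\<le>a. y r ^ Suc b * longest_word r * g b)"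
    by (subst sum.atMost_Suc_shift) simp
  also have "\<dots> = y r * p"
    using w(2) by (simp add: p distrib_left sum_distrib_left flip: mult.assoc)
  finally have "y r * p = (\<Sum>b\<le>Suc a. y r ^ b * longest_word r * ?h b) + omega r * longest_word r * 0" by simp
  moreover have "?h b \<in> H" for b using * w H_mult by simp
  ultimately show ?thesis using H_zero by (intro piecesI[of ?h 0]) blast+
qed

lemma long_in_pieces: "r < n \<Longrightarrow> longest_word r \<in> pieces r 0"
  unfolding pieces_def
  by (intro CollectI exI[of _ "\<lambda>_. u"] exI[of _ 0]) (auto simp: H_u H_zero)

lemma omega_long_in_pieces: "r < n \<Longrightarrow> omega r * longest_word r \<in> pieces r a"
  unfolding pieces_def
  by (intro CollectI exI[of _ "\<lambda>_. 0"] exI[of _ u]) (auto simp: H_u H_zero mult.assoc)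

context
  fixes r :: nat and e :: 'a
  assumes r: "1 \<le> r" "r < n"
  defines e_def: "e \<equiv> longest_word (r - 1)"
begin

text \<open>
  From here on \<open>e\<close> is the longest word of the next smaller rank, multiplied by prefixes of the coset word on
  the right. The full coset word gives the longest word (\<open>e_cox\<close>), the empty prefix gives \<open>e\<close>
  itself. Letters of index below \<open>r\<close> that can be moved to the left end are absorbed by \<open>e\<close>; the
  lemmas up to \<open>turn_d_below\<close> list the letters for which this happens.
\<close>

lemma e_u: "e * u = e" and e_d: "1 \<le> j \<Longrightarrow> j < r \<Longrightarrow> e * d j = 0" and e_t: "2 \<le> r \<Longrightarrow> e * t = 0"
  and e_y: "y r * e = e * y r"
  using long_d[of j "r - 1"] long_t[of "r - 1"] long_y_above[of "r - 1" r] r by (auto simp: e_def)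

lemma e_cox: "e * coset_word r = longest_word r"
  using r by (cases r) (auto simp: e_def)

lemma fall_d_below: "1 \<le> j \<Longrightarrow> j + k < r \<Longrightarrow> e * fall r k * d j = 0"
proof (induction k)
  case (Suc k)
  then have "d (r - k) * d j = - (d j * d (r - k))" using d_far'[of j "r - k"] r by simp
  then have "e * fall r (Suc k) * d j = - (e * fall r k * d j * d (r - k))" by (simp add: mult.assoc)
  then show ?case using Suc by simp
qed (use e_d e_u in simp)

lemma fall_t: "k + 2 \<le> r \<Longrightarrow> e * fall r k * t = 0"
proof (induction k)
  case (Suc k)
  then have "d (r - k) * t = - (t * d (r - k))" using t_far[of "r - k"] r by simp
  then have "e * fall r (Suc k) * t = - (e * fall r k * t * d (r - k))" by (simp add: mult.assoc)
  then show ?case using Suc by simp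
qed (use e_t e_u in simp)

lemma fall_d_above: "k \<le> r \<Longrightarrow> r - k + 1 < i \<Longrightarrow> i \<le> r \<Longrightarrow> e * fall r k * d i = 0"
proof (induction k)
  case (Suc k)
  show ?case
  proof (cases "i = Suc (r - k)")
    case False
    then have "d (r - k) * d i = - (d i * d (r - k))" using d_far[of "r - k" i] Suc r by simp
    then have "e * fall r (Suc k) * d i = - (e * fall r k * d i * d (r - k))" by (simp add: mult.assoc)
    then show ?thesis using Suc False by simp
  next
    case True
    then obtain m where k: "k = Suc m" using Suc.prems by (cases k) auto
    let ?j = "r - k"
    have j: "r - m = Suc ?j" "1 \<le> ?j" "i = Suc ?j" "Suc ?j < n" using k Suc.prems True r by auto
    have "e * fall r (Suc k) * d i = e * fall r m * (d (Suc ?j) * d ?j * d (Suc ?j))"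
      using k j by (simp add: mult.assoc)
    also have "\<dots> = e * fall r m * d ?j * d (Suc ?j) * d ?j"
      by (simp only: flip: d_braid[OF j(2) j(4)]) (simp only: mult.assoc)
    also have "e * fall r m * d ?j = 0" using fall_d_below[of ?j m] j k Suc.prems by simp
    finally show ?thesis by simp
  qed
qed simp

lemma fall_t_d: "2 \<le> i \<Longrightarrow> i \<le> r \<Longrightarrow> e * fall r (r - 1) * t * d i = 0"
proof (cases "i = 2")
  case True
  assume i: "2 \<le> i" "i \<le> r"
  then have "r - 1 = Suc (r - 2)" by simp
  then have "fall r (r - 1) = fall r (r - 2) * d 2" using i True by simp
  then have "e * fall r (r - 1) * t * d i = e * fall r (r - 2) * (d 2 * t * d 2)" using True by (simp add: mult.assoc)
  also have "d 2 * t * d 2 = t * d 2 * t" using t_braid i r True by simp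
  also have "e * fall r (r - 2) * (t * d 2 * t) = e * fall r (r - 2) * t * d 2 * t" by (simp only: mult.assoc)
  also have "\<dots> = 0" using fall_t[of "r - 2"] i True by simp
  finally show ?thesis .
next
  case False
  assume i: "2 \<le> i" "i \<le> r"
  then have "t * d i = - (d i * t)" using False t_far[of i] r by simp
  then have "e * fall r (r - 1) * t * d i = - (e * fall r (r - 1) * d i * t)" by (simp add: mult.assoc)
  then show ?thesis using fall_d_above[of "r - 1" i] i False by simp
qed

lemma turn_d_above: "k + 2 < i \<Longrightarrow> i \<le> r \<Longrightarrow> e * turn r k * d i = 0"
proof (induction k)
  case 0
  then have "t * d i = - (d i * t)" using t_far[of i] r by simp
  then have "e * turn r 0 * d i = - (e * fall r r * d i * t)" by (simp add: mult.assoc)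
  then show ?case using fall_d_above[of r i] 0 by simp
next
  case (Suc k)
  then have "d (Suc (Suc k)) * d i = - (d i * d (Suc (Suc k)))" using d_far[of "Suc (Suc k)" i] r by simp
  then have "e * turn r (Suc k) * d i = - (e * turn r k * d i * d (Suc (Suc k)))" by (simp add: mult.assoc)
  then show ?case using Suc by simp
qed

lemma turn_d_below: "2 \<le> i \<Longrightarrow> i \<le> k \<Longrightarrow> k < r \<Longrightarrow> e * turn r k * d i = 0"
proof (induction k)
  case (Suc k)
  show ?case
  proof (cases "i = Suc k")
    case False
    then have "d (Suc (Suc k)) * d i = - (d i * d (Suc (Suc k)))" using d_far'[of i "Suc (Suc k)"] Suc r by simp
    then have "e * turn r (Suc k) * d i = - (e * turn r k * d i * d (Suc (Suc k)))" by (simp add: mult.assoc)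
    then show ?thesis using Suc False by simp
  next
    case True
    then obtain m where k: "k = Suc m" using Suc.prems by (cases k) auto
    have i: "i = Suc (Suc m)" using True k by simp
    have "e * turn r (Suc k) * d i = e * turn r m * (d i * d (Suc i) * d i)"
      using k i by (simp add: mult.assoc)
    also have "d i * d (Suc i) * d i = d (Suc i) * d i * d (Suc i)" using d_braid[of i] Suc.prems k i r by simp
    also have "e * turn r m * (d (Suc i) * d i * d (Suc i)) = e * turn r m * d (Suc i) * d i * d (Suc i)"
      by (simp add: mult.assoc)
    also have "e * turn r m * d (Suc i) = 0" using turn_d_above[of m "Suc i"] Suc.prems k i by simp
    finally show ?thesis by simp
  qed
qed simp

lemma fall_y_d: "k < r \<Longrightarrow> e * fall r k * y (r - k) * d (r - k) \<approx> y r * e * fall r (Suc k)"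
proof (induction k)
  case 0
  then show ?case using e_y r by (simp add: mult.assoc e_u)
next
  case (Suc k)
  let ?j = "r - Suc k"
  have j: "r - k = Suc ?j" "1 \<le> ?j" using Suc.prems by auto
  have dy: "d (r - k) * y ?j = u - y (r - k) * d (r - k)" using d_y_pred[of "r - k"] j r by simp
  have "e * fall r (Suc k) * y ?j * d ?j = e * fall r k * (d (r - k) * y ?j) * d ?j"
    by (simp add: mult.assoc)
  also have "\<dots> = e * fall r k * d ?j - e * fall r k * y (r - k) * d (r - k) * d ?j"
    unfolding dy using j r by (simp add: algebra_simps)
  also have "e * fall r k * d ?j = 0" using fall_d_below[of ?j k] j Suc.prems by simp
  finally have "e * fall r (Suc k) * y ?j * d ?j \<approx> e * fall r k * y (r - k) * d (r - k) * d ?j" by simp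
  also have "\<dots> \<approx> y r * e * fall r (Suc k) * d ?j" using eq_upto_sign_mult(2)[OF Suc.IH] Suc.prems by simp
  also have "\<dots> = y r * e * fall r (Suc (Suc k))" by (simp add: mult.assoc)
  finally show ?case .
qed

text \<open>
  Multiplying \<open>e\<close> times a prefix by the variable that its last letter involves removes this letter, up to a
  term with \<open>y r\<close> on the far left. That term arises because the variable travels to the left through
  all the letters; the terms in which another letter is removed vanish, as the letters after the
  gap can then be moved to \<open>e\<close>. Read backwards, this expresses a prefix by the next longer one.
\<close>

lemma fall_y: "k < r \<Longrightarrow> e * fall r k - e * fall r (Suc k) * y (r - Suc k) \<approx> y r * e * fall r (Suc k)"
proof -
  assume k: "k < r"
  have dy: "d (r - k) * y (r - Suc k) = u - y (r - k) * d (r - k)" using d_y_pred[of "r - k"] k r by simp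
  have "e * fall r (Suc k) * y (r - Suc k) = e * fall r k * (d (r - k) * y (r - Suc k))" by (simp add: mult.assoc)
  also have "\<dots> = e * fall r k - e * fall r k * y (r - k) * d (r - k)"
    unfolding dy using k r by (simp add: right_diff_distrib mult.assoc)
  finally show ?thesis using fall_y_d[OF k] by simp
qed

lemma below_d: "k + 2 \<le> r \<Longrightarrow> e * below r k * d (k + 2) = 0"
proof (cases k)
  case 0
  assume "k + 2 \<le> r"
  then have "2 \<le> r" using 0 by simp
  then have "e * fall r r * d 2 = 0" "e * fall r (r - 1) * t * d 2 = 0" using fall_d_above[of r 2] fall_t_d[of 2] by auto
  then show ?thesis using 0 by (simp add: algebra_simps numeral_2_eq_2)
next
  case (Suc j)
  assume "k + 2 \<le> r"
  then show ?thesis using turn_d_above[of j "k + 2"] Suc by simp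
qed

text \<open>
  The same principle beyond the fork. At the fork itself the variable removes \<open>d 1\<close> or \<open>t\<close>, and only
  the sum of the two outcomes is obtained.
\<close>

lemma turn_y: "k < r \<Longrightarrow> e * below r k - e * turn r k * y (Suc k) \<approx> y r * e * turn r k"
proof (induction k)
  case 0
  have f: "fall r r = fall r (r - 1) * d 1" using r by (cases r) auto
  have d1: "d 1 * y 0 = u - y 1 * d 1" using d_y_pred[of 1] r by simp
  have "e * turn r 0 * y 1 = e * fall r r * (t * y 1)" by (simp add: mult.assoc)
  also have "\<dots> = e * fall r r + e * fall r (r - 1) * (d 1 * y 0) * t"
    unfolding t_y1 using f r by (simp add: distrib_left mult.assoc)
  also have "\<dots> = e * fall r r + e * fall r (r - 1) * t - e * fall r (r - 1) * y 1 * d 1 * t"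
    unfolding d1 by (simp add: algebra_simps)
  finally have "e * below r 0 - e * turn r 0 * y (Suc 0) = e * fall r (r - 1) * y 1 * d 1 * t"
    by (simp add: distrib_left mult.assoc)
  moreover have "e * fall r (r - 1) * y 1 * d 1 \<approx> y r * e * fall r r" using fall_y_d[of "r - 1"] r by simp
  from eq_upto_sign_mult(2)[OF this, of t] have "e * fall r (r - 1) * y 1 * d 1 * t \<approx> y r * e * turn r 0"
    by (simp add: mult.assoc)
  ultimately show ?case by simp
next
  case (Suc k)
  let ?i = "Suc (Suc k)"
  have dy: "d ?i * y ?i = u - y (Suc k) * d ?i" using d_y[of ?i] Suc.prems r by simp
  have ku: "turn r k * u = turn r k" using r Suc.prems by (cases k) (auto simp: mult.assoc)
  have "e * turn r (Suc k) * y ?i = e * turn r k * (d ?i * y ?i)" by (simp add: mult.assoc)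
  also have "\<dots> = e * turn r k - e * turn r k * y (Suc k) * d ?i"
    unfolding dy using ku by (simp add: right_diff_distrib mult.assoc)
  finally have "e * below r (Suc k) - e * turn r (Suc k) * y ?i = e * turn r k * y (Suc k) * d ?i" by simp
  also have "\<dots> = - ((e * below r k - e * turn r k * y (Suc k)) * d ?i)"
    using below_d[of k] Suc.prems by (simp add: algebra_simps)
  also have "\<dots> \<approx> y r * e * turn r k * d ?i"
    using eq_upto_sign_mult(2)[OF Suc.IH, of "d ?i"] Suc.prems by simp
  finally show ?case by (simp add: mult.assoc)
qed

lemma descend_in_pieces:
  assumes "p - q * y k \<approx> y r * q" "q \<in> pieces r a" "k < n"
  shows "p \<in> pieces r (Suc a)"
proof -
  have "p - q * y k \<in> pieces r (Suc a)" using pieces_step[OF r(2) assms(2)] assms(1) pieces_eq_upto_sign by blast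
  moreover have "q * y k \<in> pieces r (Suc a)" using pieces_mult[OF assms(2) H_y[OF assms(3)]] pieces_mono by simp
  ultimately show ?thesis using pieces_add by fastforce
qed

text \<open>
  Starting from the full word, the letters after the fork are removed one by one. This reaches only the
  sum of the two words at the fork.
\<close>

lemma below_in_pieces: "i \<le> r \<Longrightarrow> e * below r (r - i) \<in> pieces r i"
proof (induction i)
  case 0
  have "below r r = coset_word r" using turn_cox[OF r] r by (cases r) auto
  then show ?case using e_cox long_in_pieces[OF r(2)] by simp
next
  case (Suc i)
  have "below r (r - i) = turn r (r - Suc i)" using Suc.prems by (cases "r - i") (auto dest: arg_cong[of _ _ "\<lambda>k. k - 1"])
  then have "e * turn r (r - Suc i) \<in> pieces r i" using Suc by simp
  moreover have "e * below r (r - Suc i) - e * turn r (r - Suc i) * y (Suc (r - Suc i)) \<approx> y r * (e * turn r (r - Suc i))"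
    using turn_y[of "r - Suc i"] Suc.prems r by (simp add: mult.assoc)
  moreover have "Suc (r - Suc i) < n" using r Suc.prems by simp
  ultimately show ?case using descend_in_pieces by blast
qed

text \<open>
  The right module over the polynomials generated by \<open>e\<close> times the prefixes beyond the fork. It collects
  error terms; by \<open>below_in_pieces\<close> these belong to the pieces.
\<close>

inductive_set turn_span :: "'a set" where
  base: "k < r \<Longrightarrow> g \<in> H \<Longrightarrow> e * turn r k * g \<in> turn_span"
| add: "p \<in> turn_span \<Longrightarrow> q \<in> turn_span \<Longrightarrow> p + q \<in> turn_span"

lemma turn_span_pieces: "p \<in> turn_span \<Longrightarrow> p \<in> pieces r r"
proof (induction rule: turn_span.induct)
  case (base k g)
  then have "e * turn r k \<in> pieces r (r - Suc k)"
    using below_in_pieces[of "r - Suc k"] by (simp add: Suc_diff_Suc)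
  then show ?case using pieces_mult[OF _ base(2)] pieces_mono[of _ r "r - Suc k" r] by simp
qed (rule pieces_add)

lemma turn_span_d:
  assumes "p \<in> turn_span" "2 \<le> i" "i \<le> r"
  shows "p * d i \<in> turn_span"
  using assms(1)
proof (induction rule: turn_span.induct)
  case (base k g)
  obtain g' g'' where g: "g' \<in> H" "g'' \<in> H" "g * d i = d i * g' + g''"
    using H_d[OF base(2), of i] assms r by auto
  have "e * turn r k * g * d i = e * turn r k * d i * g' + e * turn r k * g''"
    by (simp add: mult.assoc g(3) distrib_left)
  moreover have "e * turn r k * d i * g' \<in> turn_span"
  proof -
    consider "i = k + 2" | "k + 2 < i" | "i = k + 1" | "i \<le> k" by linarith
    then show ?thesis
    proof cases
      case 1
      then have "e * turn r k * d i = e * turn r (Suc k)" by (simp add: mult.assoc numeral_2_eq_2)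
      then show ?thesis using turn_span.base[of "Suc k" g'] 1 assms g by simp
    next
      case 2
      then show ?thesis using turn_d_above[of k i] assms turn_span.base[OF base(1) H_zero] by simp
    next
      case 3
      then obtain m where "k = Suc m" "i = Suc (Suc m)" using assms by (cases k) auto
      then have "turn r k * d i = 0" using d_d[of i] assms r by (simp add: mult.assoc)
      then have "e * turn r k * d i = 0" by (simp add: mult.assoc)
      then show ?thesis using turn_span.base[OF base(1) H_zero] by simp
    next
      case 4
      then show ?thesis using turn_d_below[of i k] assms base turn_span.base[OF base(1) H_zero] by simp
    qed
  qed
  ultimately show ?case using turn_span.add turn_span.base[OF base(1) g(2)] by simp
qed (auto simp: distrib_right intro: turn_span.add)

lemma turn_span_uminus: "p \<in> turn_span \<Longrightarrow> - p \<in> turn_span"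
proof (induction rule: turn_span.induct)
  case (base k g)
  then show ?case using turn_span.base[OF base(1) H_uminus[OF base(2)]] by simp
next
  case (add p q)
  have "- (p + q) = - p + - q" by simp
  then show ?case using add turn_span.add by metis
qed

lemma turn_span_rise: "p \<in> turn_span \<Longrightarrow> k < r \<Longrightarrow> p * u = p \<Longrightarrow> p * rise k \<in> turn_span"
proof (induction k)
  case (Suc k)
  have "p * rise (Suc k) = p * rise k * d (Suc (Suc k))" by (simp add: mult.assoc)
  then show ?case using turn_span_d[of "p * rise k" "Suc (Suc k)"] Suc by simp
qed simp

lemma y_fall: "k \<le> s \<Longrightarrow> s < n \<Longrightarrow> j < n \<Longrightarrow> s < j \<or> j + k < s \<Longrightarrow> y j * fall s k \<approx> fall s k * y j"
proof (induction k)
  case (Suc k)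
  have "y j * d (s - k) \<approx> d (s - k) * y j" using y_d_far[of "s - k" j] Suc.prems by auto
  then show ?case using supercommute_mult[of "y j" "fall s k" "d (s - k)"] Suc by auto
qed simp

lemma fall_fall: "k \<le> r \<Longrightarrow> m \<le> s \<Longrightarrow> s + k < r \<Longrightarrow> fall s m * fall r k \<approx> fall r k * fall s m"
proof (induction m)
  case 0 then show ?case using r by simp
next
  case (Suc m)
  have "d (s - m) * fall r k' \<approx> fall r k' * d (s - m)" if "k' \<le> k" for k'
    using that
  proof (induction k')
    case 0 then show ?case using r Suc.prems by simp
  next
    case (Suc l)
    have "d (s - m) * d (r - l) \<approx> d (r - l) * d (s - m)"
      using d_far[of "s - m" "r - l"] Suc.prems \<open>Suc m \<le> s\<close> \<open>s + k < r\<close> r by simp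
    then show ?case using supercommute_mult[of "d (s - m)" "fall r l" "d (r - l)"] Suc by simp
  qed
  then show ?case using supercommute_mult'[of "fall s m" "fall r k" "d (s - m)"] Suc by simp
qed

lemma t_fall: "k + 2 \<le> r \<Longrightarrow> t * fall r k \<approx> fall r k * t"
proof (induction k)
  case 0 then show ?case using r by simp
next
  case (Suc k)
  then show ?case using supercommute_mult[of t "fall r k" "d (r - k)"] t_far[of "r - k"] r by simp
qed

lemma omega_fall: "k + s < r \<Longrightarrow> omega s * fall r k \<approx> fall r k * omega s"
proof (induction s)
  case 0 then show ?case using r by simp
next
  case (Suc s)
  then show ?case using supercommute_mult'[of "y s" "fall r k" "omega s"] y_fall[of k r s] r by simp
qed

lemma top_vars_supercommute:
  assumes "\<And>j. r - k < j \<Longrightarrow> j \<le> r \<Longrightarrow> y j * a \<approx> a * y j" "u * a = a" "a * u = a" "k \<le> r"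
  shows "top_vars r k * a \<approx> a * top_vars r k"
  using assms(1,4)
proof (induction k)
  case 0 then show ?case using assms by simp
next
  case (Suc k)
  have "top_vars r k * a \<approx> a * top_vars r k" by (rule Suc.IH) (use Suc.prems in auto)
  moreover have "y (r - k) * a \<approx> a * y (r - k)" using Suc.prems by simp
  ultimately show ?case using supercommute_mult'[of "top_vars r k" a "y (r - k)"] by simp
qed

lemma y_omega: "s \<le> j \<Longrightarrow> j < n \<Longrightarrow> y j * omega s \<approx> omega s * y j"
proof (induction s)
  case (Suc s)
  then show ?case using supercommute_mult[of "y j" "y s" "omega s"] y_y[of j s] by simp
qed simp

lemma y_tail: "s + 1 < j \<Longrightarrow> j < n \<Longrightarrow>
    y j * (omega s * fall s s * t) \<approx> omega s * fall s s * t * y j"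
  using y_fall[of s s j] y_omega[of s j] y_t_far[of j]
  by (intro supercommute_mult) auto

text \<open>
  Replace \<open>y s * d (s + 1)\<close> by \<open>u - d (s + 1) * y (s + 1)\<close>. The second term is killed, since its letter
  meets \<open>e\<close>, and the first has a smaller \<open>s\<close>; in the end \<open>t\<close> meets \<open>e\<close>.
\<close>

lemma omega_fall_t: "s < r \<Longrightarrow> 2 \<le> r \<Longrightarrow> e * omega s * fall s s * t = 0"
proof (induction s)
  case 0 then show ?case using e_t r by (simp add: e_u)
next
  case (Suc s)
  let ?j = "Suc s"
  have f: "fall ?j ?j = d ?j * fall s s" using fall_front[of s s] Suc.prems r by simp
  have o: "omega m * d ?j \<approx> d ?j * omega m" if "m \<le> s" for m using that
  proof (induction m)
    case 0 then show ?case using Suc.prems r by simp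
  next
    case (Suc m)
    then show ?case using supercommute_mult'[of "y m" "d ?j" "omega m"] y_d_far[of ?j m] \<open>Suc s < r\<close> r by simp
  qed
  have yd: "y s * d ?j = u - d ?j * y ?j" using d_y[of ?j] Suc.prems r by simp
  have "omega s * d ?j * (fall s s * t) \<approx> d ?j * omega s * (fall s s * t)"
    using eq_upto_sign_mult(2)[OF o[of s]] by simp
  from eq_upto_sign_mult(1)[OF this, of "e * y s"]
  have "e * omega ?j * fall ?j ?j * t \<approx> e * (y s * d ?j) * omega s * fall s s * t"
    unfolding f by (simp add: mult.assoc)
  also have "\<dots> = e * omega s * fall s s * t - e * d ?j * (y ?j * omega s * fall s s * t)"
    unfolding yd using e_u by (simp add: left_diff_distrib right_diff_distrib flip: mult.assoc)
  also have "\<dots> = 0" using Suc e_d[of ?j] by simp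
  finally show ?case by (simp add: eq_upto_sign_def)
qed

lemma tail_vanish:
  assumes "k + s + 1 = r" "1 \<le> s"
  shows "e * fall r k * top_vars r k * (omega s * fall s s * t) = 0"
proof -
  let ?T = "omega s * fall s s * t"
  have u: "u * ?T = ?T" "?T * u = ?T" using assms r u_H(1)[OF omega_H[of s]]
    by (auto simp: mult.assoc) (simp flip: mult.assoc)
  have "top_vars r k * ?T \<approx> ?T * top_vars r k"
    by (rule top_vars_supercommute) (use u assms r y_tail in auto)
  from eq_upto_sign_mult(1)[OF this, of "e * fall r k"]
  have "e * fall r k * top_vars r k * ?T \<approx> e * (fall r k * ?T) * top_vars r k"
    by (simp add: mult.assoc)
  also have "fall r k * ?T \<approx> ?T * fall r k"
    using omega_fall[of k s] fall_fall[of k s s] t_fall[of k] assms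
    by (intro supercommute_mult) (auto intro: eq_upto_sign_sym)
  then have "e * (fall r k * ?T) * top_vars r k \<approx> e * (?T * fall r k) * top_vars r k"
    by (intro eq_upto_sign_mult)
  also have "\<dots> = e * omega s * fall s s * t * fall r k * top_vars r k" by (simp only: mult.assoc)
  also have "\<dots> = 0" using omega_fall_t[of s] assms by simp
  finally show ?thesis by (simp add: eq_upto_sign_def)
qed

text \<open>
  The product \<open>omega r\<close> is moved from the left into the falling word, one variable per letter, by
  \<open>y s * d (s + 1) = u - d (s + 1) * y (s + 1)\<close>. The terms with \<open>u\<close> vanish by \<open>tail_vanish\<close>, so each
  variable ends up to the right of its letter.
\<close>

lemma omega_fall_expand:
  "k < r \<Longrightarrow> e * omega r * fall r r * t \<approx>
    e * fall r k * top_vars r k * (omega (r - k) * fall (r - k) (r - k) * t)"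
proof (induction k)
  case 0 then show ?case by (simp add: e_u mult.assoc)
next
  case (Suc k)
  define s where "s = r - Suc k"
  have s: "r - k = Suc s" "1 \<le> s" "k + s + 1 = r" using Suc.prems by (auto simp: s_def)
  let ?G = "e * fall r k * top_vars r k" and ?T = "omega s * fall s s * t" and ?j = "Suc s"
  have f: "fall ?j ?j = d ?j * fall s s" using fall_front[of s s] s r by simp
  have o: "omega m * d ?j \<approx> d ?j * omega m" if "m \<le> s" for m using that
  proof (induction m)
    case 0 then show ?case using s r by simp
  next
    case (Suc m)
    then show ?case using supercommute_mult'[of "y m" "d ?j" "omega m"] y_d_far[of ?j m] s r by simp
  qed
  have yd: "y s * d ?j = u - d ?j * y ?j" using d_y[of ?j] s r by simp
  have uT: "u * ?T = ?T" using s r u_H(1)[OF omega_H[of s]] by (simp flip: mult.assoc)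
  have "omega s * d ?j * (fall s s * t) \<approx> d ?j * omega s * (fall s s * t)"
    using eq_upto_sign_mult(2)[OF o[of s]] by simp
  from eq_upto_sign_mult(1)[OF this, of "?G * y s"]
  have "?G * (omega ?j * fall ?j ?j * t) \<approx> ?G * ((y s * d ?j) * ?T)"
    unfolding f by (simp add: mult.assoc)
  also have "\<dots> = ?G * ?T - ?G * d ?j * y ?j * ?T"
    unfolding yd using uT by (simp add: left_diff_distrib right_diff_distrib mult.assoc)
  also have "?G * ?T = 0" using tail_vanish[of k s] s by simp
  finally have "?G * (omega ?j * fall ?j ?j * t) \<approx> ?G * d ?j * y ?j * ?T" by simp
  also have "top_vars r k * d ?j \<approx> d ?j * top_vars r k"
    by (rule top_vars_supercommute) (use s r y_d_far[of ?j] in auto)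
  from eq_upto_sign_mult(2)[OF eq_upto_sign_mult(1)[OF this, of "e * fall r k"], of "y ?j * ?T"]
  have "?G * d ?j * y ?j * ?T \<approx> e * fall r (Suc k) * top_vars r (Suc k) * ?T"
    using s by (simp add: mult.assoc)
  finally show ?case using Suc s eq_upto_sign_trans by (simp add: s_def)
qed

text \<open>
  The last step of the expansion differs from the others: near the fork the terms with \<open>u\<close> do not vanish
  and give the difference of the two words at the fork.
\<close>

lemma omega_fall_t_split:
  defines "z \<equiv> e * fall r (r - 1) * t - e * fall r r"
  shows "\<exists>c\<in>turn_span. e * omega r * fall r r * t \<approx> z * top_vars r (r - 1) + c"
proof -
  let ?v = "top_vars r (r - 1)" and ?A = "e * fall r (r - 1)"
  have f: "fall r r = fall r (r - 1) * d 1" using r by (cases r) auto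
  have y1t: "y 1 * t = t * y 0 + u" using t_y0 by simp
  have yd: "y 0 * d 1 = u - d 1 * y 1" using d_y[of 1] r by simp
  have "omega 1 * fall 1 1 * t = y 0 * d 1 * t" using r u_d[of 1] by (simp add: mult.assoc)
  also have "\<dots> = t - d 1 * (y 1 * t)" unfolding yd by (simp add: left_diff_distrib mult.assoc)
  also have "\<dots> = (t - d 1) - d 1 * t * y 0" unfolding y1t using r
    by (simp add: distrib_left mult.assoc)
  finally have w: "omega 1 * fall 1 1 * t = (t - d 1) - d 1 * t * y 0" .
  have ud: "u * d 1 = d 1" "d 1 * u = d 1" using r by auto
  have "y j * (t - d 1) \<approx> (t - d 1) * y j" if "1 < j" "j \<le> r" for j
    using t_y_far[of j] d_y_far[of 1 j] that r by (simp add: algebra_simps eq_upto_sign_def)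
  then have c1: "?v * (t - d 1) \<approx> (t - d 1) * ?v"
    by (intro top_vars_supercommute) (use r ud in \<open>auto simp: algebra_simps\<close>)
  have "y j * (d 1 * t) \<approx> d 1 * t * y j" if "1 < j" "j \<le> r" for j
    by (rule supercommute_mult) (use that r y_d_far[of 1 j] y_t_far[of j] in auto)
  then have c2: "?v * (d 1 * t) \<approx> d 1 * t * ?v"
    by (intro top_vars_supercommute) (use r ud in \<open>auto simp: mult.assoc simp flip: mult.assoc[of u]\<close>)
  have e1: "e * omega r * fall r r * t \<approx> ?A * (?v * (t - d 1)) - ?A * (?v * (d 1 * t)) * y 0"
  proof -
    have 1: "r - (r - 1) = 1" "r - 1 < r" using r by auto
    show ?thesis using omega_fall_expand[OF 1(2)] unfolding 1(1) w
      by (simp add: right_diff_distrib mult.assoc)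
  qed
  have z: "?A * ((t - d 1) * ?v) = z * ?v" unfolding z_def f by (simp add: algebra_simps)
  have t: "?A * (d 1 * t * ?v) * y 0 = e * turn r 0 * (?v * y 0)" unfolding turn.simps f by (simp add: mult.assoc)
  have S: "e * turn r 0 * (?v * y 0) \<in> turn_span"
    by (rule turn_span.base) (use r top_vars_H H_y H_mult in auto)
  have "?A * (?v * (t - d 1)) \<approx> z * ?v" using eq_upto_sign_mult(1)[OF c1, of ?A] z by simp
  moreover have "?A * (?v * (d 1 * t)) * y 0 \<approx> e * turn r 0 * (?v * y 0)"
    using eq_upto_sign_mult(2)[OF eq_upto_sign_mult(1)[OF c2, of ?A], of "y 0"] t by simp
  ultimately show ?thesis
  proof -
    assume a: "?A * (?v * (t - d 1)) \<approx> z * ?v"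
    assume "?A * (?v * (d 1 * t)) * y 0 \<approx> e * turn r 0 * (?v * y 0)"
    then have b: "?A * (?v * (d 1 * t)) * y 0 \<in> turn_span"
      using S turn_span_uminus by (auto simp: eq_upto_sign_def)
    let ?b = "?A * (?v * (d 1 * t)) * y 0"
    have "?A * (?v * (t - d 1)) - ?b \<approx> z * ?v + ?b \<or> ?A * (?v * (t - d 1)) - ?b \<approx> z * ?v + - ?b"
      using a by (auto simp: eq_upto_sign_def)
    then show ?thesis using e1 b turn_span_uminus[OF b] eq_upto_sign_trans by blast
  qed
qed

text \<open>
  The letters \<open>d 2, d 3, \<dots>\<close> remove the variables \<open>y 2, y 3, \<dots>\<close> one by one, because all of these letters
  kill \<open>z\<close>.
\<close>

lemma top_vars_rise:
  assumes z: "z * u = z" "\<And>i. 2 \<le> i \<Longrightarrow> i \<le> r \<Longrightarrow> z * d i = 0"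
  shows "k < r \<Longrightarrow> z * top_vars r (r - 1) * rise k = z * top_vars r (r - 1 - k)"
proof (induction k)
  case 0
  then show ?case using u_H(2)[OF top_vars_H[of r "r - 1"]] r by (simp add: mult.assoc)
next
  case (Suc k)
  define m where "m = r - 2 - k"
  have m: "r - 1 - k = Suc m" "r - m = k + 2" "r - 1 - Suc k = m" using Suc.prems by (auto simp: m_def)
  let ?d = "d (k + 2)"
  have yd: "y (k + 2) * ?d = u - ?d * y (k + 1)" using d_y_pred[of "k + 2"] Suc.prems r by simp
  have "top_vars r m * ?d \<approx> ?d * top_vars r m"
    by (rule top_vars_supercommute) (use m Suc.prems r y_d_far[of "k + 2"] in auto)
  from eq_upto_sign_mult(1)[OF this, of z] have 0: "z * top_vars r m * ?d = 0"
    using z(2)[of "k + 2"] Suc.prems by (simp add: eq_upto_sign_def flip: mult.assoc)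
  have "z * top_vars r (r - 1) * rise (Suc k) = z * top_vars r (r - 1) * rise k * ?d"
    by (simp add: mult.assoc)
  also have "\<dots> = z * top_vars r m * (y (k + 2) * ?d)"
    using Suc m by (simp add: mult.assoc)
  also have "\<dots> = z * top_vars r m - z * top_vars r m * ?d * y (k + 1)"
    unfolding yd using u_H(2)[OF top_vars_H[of r m]] r by (simp add: right_diff_distrib mult.assoc)
  finally show ?case using 0 m by simp
qed

text \<open>
  The difference comes from the generator \<open>omega r * longest_word r\<close>, which equals
  \<open>e * omega r * coset_word r\<close> up to a sign. In the first part of the coset word, \<open>omega r\<close> produces the
  difference times \<open>y r * \<dots> * y 2\<close>, and the rest of the coset word removes these variables.
\<close>

lemma fork_difference_in_pieces: "e * fall r (r - 1) * t - e * fall r r \<in> pieces r r"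
proof -
  let ?z = "e * fall r (r - 1) * t - e * fall r r" and ?R = "rise (r - 1)"
  obtain c where c: "c \<in> turn_span" "e * omega r * fall r r * t \<approx> ?z * top_vars r (r - 1) + c"
    using omega_fall_t_split by blast
  have cu: "c * u = c" using c(1)
  proof (induction rule: turn_span.induct)
    case (base k g) then show ?case using u_H(2) by (simp add: mult.assoc)
  qed (simp add: distrib_right)
  have zR: "?z * top_vars r (r - 1) * ?R = ?z"
  proof -
    have "?z * u = ?z" using r by (simp add: left_diff_distrib mult.assoc)
    moreover have "?z * d i = 0" if "2 \<le> i" "i \<le> r" for i
      using fall_t_d[of i] fall_d_above[of r i] that by (simp add: left_diff_distrib)
    ultimately show ?thesis using top_vars_rise[of ?z "r - 1"] r by simp
  qed
  have "omega r * e \<approx> e * omega r" using long_omega[of "r - 1"] r by (simp add: e_def del: omega.simps)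
  from eq_upto_sign_mult(2)[OF this, of "coset_word r"]
  have "e * omega r * coset_word r \<approx> omega r * longest_word r"
    using e_cox eq_upto_sign_sym by (simp add: mult.assoc)
  then have "e * omega r * coset_word r \<in> pieces r r"
    using omega_long_in_pieces[OF r(2)] pieces_eq_upto_sign by blast
  moreover have "e * omega r * fall r r * t * ?R = e * omega r * coset_word r"
    using turn_rise[of r "r - 1"] turn_cox r by (simp add: mult.assoc)
  moreover have "e * omega r * fall r r * t * ?R \<approx> (?z * top_vars r (r - 1) + c) * ?R"
    by (rule eq_upto_sign_mult(2)[OF c(2)])
  ultimately have "(?z * top_vars r (r - 1) + c) * ?R \<in> pieces r r"
    using pieces_eq_upto_sign eq_upto_sign_sym by metis
  then have "?z + c * ?R \<in> pieces r r" by (simp only: distrib_right zR)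
  moreover have "c * ?R \<in> pieces r r" using turn_span_pieces turn_span_rise[OF c(1)] cu r by simp
  ultimately show ?thesis using pieces_diff by fastforce
qed

text \<open>
  Having both the sum and the difference of the two words at the fork, and the division by two, one gets
  the falling word itself, and the removal of letters continues down to the empty word.
\<close>

lemma fall_in_pieces: "k \<le> r \<Longrightarrow> e * fall r (r - k) \<in> pieces r (r + k)"
proof (induction k)
  case 0
  let ?p = "e * fall r r"
  have "e * below r 0 \<in> pieces r r" using below_in_pieces[of r] by simp
  then have "?p + e * fall r (r - 1) * t \<in> pieces r r" by (simp add: distrib_left mult.assoc)
  from pieces_diff[OF this fork_difference_in_pieces] have "?p + ?p \<in> pieces r r" by simp
  from pieces_mult[OF this half(1)] have "?p * (half + half) \<in> pieces r r"
    by (simp only: distrib_left distrib_right)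
  then show ?case using half r by (simp add: mult.assoc)
next
  case (Suc k)
  have "Suc (r - Suc k) = r - k" "r - Suc (r - Suc k) = k" using Suc.prems by auto
  then have "e * fall r (r - Suc k) - e * fall r (r - k) * y k \<approx> y r * (e * fall r (r - k))"
    using fall_y[of "r - Suc k"] Suc.prems by (simp add: mult.assoc del: fall.simps)
  then show ?case using descend_in_pieces[of _ _ k] Suc r by simp
qed

lemma long_pred_in_pieces: "longest_word (r - 1) \<in> pieces r (2 * r)"
proof -
  have "e \<in> pieces r (2 * r)" using fall_in_pieces[of r] e_u by (simp add: mult_2)
  then show ?thesis by (simp only: e_def)
qed

end

text \<open>
  The first entry of an index refers to the largest \<open>r\<close>. An entry \<open>j\<close> at most \<open>2 * r\<close> stands for a power of
  \<open>y r\<close>, and \<open>2 * r + 1\<close> for \<open>omega r\<close>; with \<open>r + 1\<close> in place of \<open>r\<close> the bound is \<open>2 * r + 3\<close>.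
\<close>

fun multi_indices :: "nat \<Rightarrow> nat list set" where
  "multi_indices 0 = {[]}"
| "multi_indices (Suc r) = (\<lambda>(j, k). j # k) ` ({..2 * r + 3} \<times> multi_indices r)"

fun layer :: "nat \<Rightarrow> nat \<Rightarrow> 'a" where
  "layer r j = (if j \<le> 2 * r then y r ^ j else omega r)"

fun basis :: "nat list \<Rightarrow> 'a" where
  "basis [] = u"
| "basis (j # k) = basis k * layer (Suc (length k)) j"

lemma multi_indices_length: "k \<in> multi_indices r \<Longrightarrow> length k = r"
  by (induction r arbitrary: k) auto

lemma sum_multi_indices_Suc:
  "(\<Sum>k\<in>multi_indices (Suc r). f k) = (\<Sum>k\<in>multi_indices r. \<Sum>j\<le>2 * r + 3. f (j # k))"
proof -
  have "inj_on (\<lambda>(j, k). j # k) ({..2 * r + 3} \<times> multi_indices r)" by (auto simp: inj_on_def)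
  then have "(\<Sum>k\<in>multi_indices (Suc r). f k) = (\<Sum>(j, k)\<in>{..2 * r + 3} \<times> multi_indices r. f (j # k))"
    by (simp add: sum.reindex case_prod_unfold comp_def)
  also have "\<dots> = (\<Sum>j\<le>2 * r + 3. \<Sum>k\<in>multi_indices r. f (j # k))" by (simp add: sum.cartesian_product)
  finally show ?thesis by (simp only: sum.swap[of _ "multi_indices r"])
qed

lemma finite_multi_indices [simp]: "finite (multi_indices r)"
  by (induction r) auto

lemma long_layers:
  assumes "Suc r < n"
  shows "\<exists>h. (\<forall>j. h j \<in> H) \<and> longest_word r = (\<Sum>j\<le>2 * r + 3. layer (Suc r) j * longest_word (Suc r) * h j)"
proof -
  let ?r = "Suc r"
  have "longest_word r \<in> pieces ?r (2 * ?r)" using long_pred_in_pieces[of ?r] assms by simp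
  then obtain g g' where g: "\<forall>b. g b \<in> H" "g' \<in> H"
    and lr: "longest_word r = (\<Sum>b\<le>2 * ?r. y ?r ^ b * longest_word ?r * g b) + omega ?r * longest_word ?r * g'"
    using piecesE by blast
  define h where "h j = (if j \<le> 2 * ?r then g j else g')" for j
  have h: "h j \<in> H" for j using g by (simp add: h_def)
  have "2 * r + 3 = Suc (2 * ?r)" by simp
  then have "(\<Sum>j\<le>2 * r + 3. layer ?r j * longest_word ?r * h j) = (\<Sum>j\<le>2 * ?r. layer ?r j * longest_word ?r * h j) + omega ?r * longest_word ?r * g'"
    by (simp only: sum.atMost_Suc) (simp add: h_def del: omega.simps longest_word.simps)
  also have "\<dots> = longest_word r" unfolding lr by (intro arg_cong2[of _ _ _ _ "(+)"] sum.cong) (auto simp: h_def)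
  finally show ?thesis using h by (intro exI[of _ h]) simp
qed

text \<open>
  Insert the expressions of \<open>long_layers\<close> for the longest words into each other, starting from the unit, which
  is the longest word of rank zero.
\<close>

lemma unit_resolution:
  "r < n \<Longrightarrow> \<exists>c. (\<forall>k. c k \<in> H) \<and> u = (\<Sum>k\<in>multi_indices r. basis k * longest_word r * c k)"
proof (induction r)
  case 0
  then show ?case by (intro exI[of _ "\<lambda>_. u"]) (simp add: H_u)
next
  case (Suc r)
  then obtain c where c: "\<forall>k. c k \<in> H" "u = (\<Sum>k\<in>multi_indices r. basis k * longest_word r * c k)" by auto
  let ?r = "Suc r"
  obtain h where h: "\<And>j. h j \<in> H" and l: "longest_word r = (\<Sum>j\<le>2 * r + 3. layer ?r j * longest_word ?r * h j)"
    using long_layers[OF Suc.prems] by blast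
  let ?c = "\<lambda>l. case l of [] \<Rightarrow> u | j # k \<Rightarrow> h j * c k"
  have "(\<Sum>l\<in>multi_indices ?r. basis l * longest_word ?r * ?c l) =
      (\<Sum>k\<in>multi_indices r. \<Sum>j\<le>2 * r + 3. basis k * layer ?r j * longest_word ?r * (h j * c k))"
    unfolding sum_multi_indices_Suc by (intro sum.cong) (auto simp: multi_indices_length simp del: layer.simps longest_word.simps)
  also have "\<dots> = (\<Sum>k\<in>multi_indices r. basis k * longest_word r * c k)"
    unfolding l by (intro sum.cong)
      (simp_all add: sum_distrib_left sum_distrib_right mult.assoc del: layer.simps longest_word.simps)
  finally have "u = (\<Sum>l\<in>multi_indices ?r. basis l * longest_word ?r * ?c l)" using c by simp
  moreover have "?c l \<in> H" for l using c h H_u H_mult by (cases l) auto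
  ultimately show ?case by (intro exI[of _ ?c]) blast
qed

end

section \<open>Rings of triangular matrices and of endomorphisms\<close>

text \<open>
  Upper triangular matrices of size two, as triples of entry \<open>(1,1)\<close>, entry \<open>(1,2)\<close> and entry
  \<open>(2,2)\<close>. A ring homomorphism of the form \<open>f \<mapsto> (s f, D f, f)\<close> is the same as an
  endomorphism \<open>s\<close> together with a derivation \<open>D\<close> twisted by \<open>s\<close>.
\<close>

definition triangular :: "'a ring \<Rightarrow> ('a \<times> 'a \<times> 'a) ring" where
  "triangular R = \<lparr>carrier = carrier R \<times> carrier R \<times> carrier R,
     mult = (\<lambda>(a, b, c) (a', b', c'). (a \<otimes>\<^bsub>R\<^esub> a', a \<otimes>\<^bsub>R\<^esub> b' \<oplus>\<^bsub>R\<^esub> b \<otimes>\<^bsub>R\<^esub> c', c \<otimes>\<^bsub>R\<^esub> c')),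
     one = (\<one>\<^bsub>R\<^esub>, \<zero>\<^bsub>R\<^esub>, \<one>\<^bsub>R\<^esub>), zero = (\<zero>\<^bsub>R\<^esub>, \<zero>\<^bsub>R\<^esub>, \<zero>\<^bsub>R\<^esub>),
     add = (\<lambda>(a, b, c) (a', b', c'). (a \<oplus>\<^bsub>R\<^esub> a', b \<oplus>\<^bsub>R\<^esub> b', c \<oplus>\<^bsub>R\<^esub> c'))\<rparr>"

lemma triangular_simps:
  "carrier (triangular R) = carrier R \<times> carrier R \<times> carrier R"
  "(a, b, c) \<otimes>\<^bsub>triangular R\<^esub> (a', b', c') = (a \<otimes>\<^bsub>R\<^esub> a', a \<otimes>\<^bsub>R\<^esub> b' \<oplus>\<^bsub>R\<^esub> b \<otimes>\<^bsub>R\<^esub> c', c \<otimes>\<^bsub>R\<^esub> c')"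
  "(a, b, c) \<oplus>\<^bsub>triangular R\<^esub> (a', b', c') = (a \<oplus>\<^bsub>R\<^esub> a', b \<oplus>\<^bsub>R\<^esub> b', c \<oplus>\<^bsub>R\<^esub> c')"
  "\<one>\<^bsub>triangular R\<^esub> = (\<one>\<^bsub>R\<^esub>, \<zero>\<^bsub>R\<^esub>, \<one>\<^bsub>R\<^esub>)" "\<zero>\<^bsub>triangular R\<^esub> = (\<zero>\<^bsub>R\<^esub>, \<zero>\<^bsub>R\<^esub>, \<zero>\<^bsub>R\<^esub>)"
  by (simp_all add: triangular_def)

lemma ring_triangular:
  fixes R (structure)
  assumes "ring R" shows "ring (triangular R)"
proof -
  interpret ring R by fact
  show ?thesis
  proof (rule ringI)
    show "abelian_group (triangular R)"
    proof (rule abelian_groupI)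
      fix x assume "x \<in> carrier (triangular R)"
      then obtain a b c where "x = (a, b, c)" "a \<in> carrier R" "b \<in> carrier R" "c \<in> carrier R"
        by (auto simp: triangular_simps)
      then show "\<exists>y\<in>carrier (triangular R). y \<oplus>\<^bsub>triangular R\<^esub> x = \<zero>\<^bsub>triangular R\<^esub>"
        by (intro bexI[of _ "(\<ominus> a, \<ominus> b, \<ominus> c)"]) (auto simp: triangular_simps l_neg)
    qed (auto simp: triangular_simps a_ac)
    show "Group.monoid (triangular R)"
      by (rule monoidI) (auto simp: triangular_simps m_assoc l_distr r_distr a_assoc)
  qed (auto simp: triangular_simps l_distr r_distr a_ac)
qed

lemma right_End_mem:
  "\<phi> \<in> carrier (right_End R S) \<longleftrightarrow> \<phi> \<in> carrier R \<rightarrow>\<^sub>E carrier R \<and>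
    (\<forall>f\<in>carrier R. \<forall>g\<in>carrier R. \<phi> (f \<oplus>\<^bsub>R\<^esub> g) = \<phi> f \<oplus>\<^bsub>R\<^esub> \<phi> g) \<and>
    (\<forall>f\<in>carrier R. \<forall>a\<in>S. \<phi> (f \<otimes>\<^bsub>R\<^esub> a) = \<phi> f \<otimes>\<^bsub>R\<^esub> a)"
  by (simp add: right_End_def)

lemma right_End_simps:
  "\<phi> \<otimes>\<^bsub>right_End R S\<^esub> \<psi> = compose (carrier R) \<phi> \<psi>"
  "\<phi> \<oplus>\<^bsub>right_End R S\<^esub> \<psi> = (\<lambda>f\<in>carrier R. \<phi> f \<oplus>\<^bsub>R\<^esub> \<psi> f)"
  "\<one>\<^bsub>right_End R S\<^esub> = (\<lambda>f\<in>carrier R. f)" "\<zero>\<^bsub>right_End R S\<^esub> = (\<lambda>f\<in>carrier R. \<zero>\<^bsub>R\<^esub>)"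
  by (simp_all add: right_End_def)

lemma right_End_eqI:
  assumes "\<phi> \<in> carrier (right_End R S)" "\<psi> \<in> carrier (right_End R S)"
    and "\<And>f. f \<in> carrier R \<Longrightarrow> \<phi> f = \<psi> f"
  shows "\<phi> = \<psi>"
  using assms by (intro extensionalityI[of _ "carrier R"]) (auto simp: right_End_mem PiE_iff)

lemma ring_right_End:
  fixes R (structure)
  assumes "ring R" "S \<subseteq> carrier R" shows "ring (right_End R S)"
proof -
  interpret ring R by fact
  let ?E = "right_End R S"
  have S: "\<And>a. a \<in> S \<Longrightarrow> a \<in> carrier R" using assms by blast
  have cl: "\<And>\<phi> f. \<phi> \<in> carrier ?E \<Longrightarrow> f \<in> carrier R \<Longrightarrow> \<phi> f \<in> carrier R"
    by (auto simp: right_End_mem)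
  have ad: "\<And>\<phi> f g. \<phi> \<in> carrier ?E \<Longrightarrow> f \<in> carrier R \<Longrightarrow> g \<in> carrier R \<Longrightarrow> \<phi> (f \<oplus> g) = \<phi> f \<oplus> \<phi> g"
    by (auto simp: right_End_mem)
  have li: "\<And>\<phi> f a. \<phi> \<in> carrier ?E \<Longrightarrow> f \<in> carrier R \<Longrightarrow> a \<in> S \<Longrightarrow> \<phi> (f \<otimes> a) = \<phi> f \<otimes> a"
    by (auto simp: right_End_mem)
  have addc: "\<phi> \<oplus>\<^bsub>?E\<^esub> \<psi> \<in> carrier ?E" if "\<phi> \<in> carrier ?E" "\<psi> \<in> carrier ?E" for \<phi> \<psi>
    using cl[OF that(1)] cl[OF that(2)] ad[OF that(1)] ad[OF that(2)] li[OF that(1)] li[OF that(2)] S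
    unfolding right_End_mem right_End_simps by (auto simp: a_ac l_distr)
  have mulc: "\<phi> \<otimes>\<^bsub>?E\<^esub> \<psi> \<in> carrier ?E" if "\<phi> \<in> carrier ?E" "\<psi> \<in> carrier ?E" for \<phi> \<psi>
    using cl[OF that(1)] cl[OF that(2)] ad[OF that(1)] ad[OF that(2)] li[OF that(1)] li[OF that(2)] S
    unfolding right_End_mem right_End_simps by (auto simp: compose_def)
  have onec: "\<one>\<^bsub>?E\<^esub> \<in> carrier ?E" using S unfolding right_End_mem right_End_simps by auto
  have zeroc: "\<zero>\<^bsub>?E\<^esub> \<in> carrier ?E" using S unfolding right_End_mem right_End_simps by auto
  have invc: "(\<lambda>f\<in>carrier R. \<ominus> \<phi> f) \<in> carrier ?E" if "\<phi> \<in> carrier ?E" for \<phi>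
    using cl[OF that] ad[OF that] li[OF that] S
    unfolding right_End_mem right_End_simps by (auto simp: minus_add l_minus)
  show ?thesis
  proof (rule ringI)
    show "abelian_group ?E"
    proof (rule abelian_groupI)
      fix \<phi> assume \<phi>: "\<phi> \<in> carrier ?E"
      have "(\<lambda>f\<in>carrier R. \<ominus> \<phi> f) \<oplus>\<^bsub>?E\<^esub> \<phi> = \<zero>\<^bsub>?E\<^esub>"
        by (rule right_End_eqI[OF addc[OF invc[OF \<phi>] \<phi>] zeroc])
          (use cl[OF \<phi>] in \<open>auto simp: right_End_simps l_neg\<close>)
      then show "\<exists>\<psi>\<in>carrier ?E. \<psi> \<oplus>\<^bsub>?E\<^esub> \<phi> = \<zero>\<^bsub>?E\<^esub>" using invc[OF \<phi>] by blast
    next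
      fix \<phi> \<psi> \<chi> assume "\<phi> \<in> carrier ?E" "\<psi> \<in> carrier ?E" "\<chi> \<in> carrier ?E"
      then show "\<phi> \<oplus>\<^bsub>?E\<^esub> \<psi> \<oplus>\<^bsub>?E\<^esub> \<chi> = \<phi> \<oplus>\<^bsub>?E\<^esub> (\<psi> \<oplus>\<^bsub>?E\<^esub> \<chi>)"
        by (intro right_End_eqI[of _ R S] addc) (auto simp: right_End_simps a_assoc cl)
    next
      fix \<phi> \<psi> assume "\<phi> \<in> carrier ?E" "\<psi> \<in> carrier ?E"
      then show "\<phi> \<oplus>\<^bsub>?E\<^esub> \<psi> = \<psi> \<oplus>\<^bsub>?E\<^esub> \<phi>"
        by (intro right_End_eqI[of _ R S] addc) (auto simp: right_End_simps a_comm cl)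
    next
      fix \<phi> assume "\<phi> \<in> carrier ?E"
      then show "\<zero>\<^bsub>?E\<^esub> \<oplus>\<^bsub>?E\<^esub> \<phi> = \<phi>"
        by (intro right_End_eqI[of _ R S] addc zeroc) (auto simp: right_End_simps cl)
    qed (use addc zeroc in auto)
    show "Group.monoid ?E"
    proof (rule monoidI)
      fix \<phi> \<psi> \<chi> assume "\<phi> \<in> carrier ?E" "\<psi> \<in> carrier ?E" "\<chi> \<in> carrier ?E"
      then show "\<phi> \<otimes>\<^bsub>?E\<^esub> \<psi> \<otimes>\<^bsub>?E\<^esub> \<chi> = \<phi> \<otimes>\<^bsub>?E\<^esub> (\<psi> \<otimes>\<^bsub>?E\<^esub> \<chi>)"
        by (intro right_End_eqI[of _ R S] mulc) (auto simp: right_End_simps compose_eq cl)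
    next
      fix \<phi> assume \<phi>: "\<phi> \<in> carrier ?E"
      then show "\<one>\<^bsub>?E\<^esub> \<otimes>\<^bsub>?E\<^esub> \<phi> = \<phi>"
        by (intro right_End_eqI[of _ R S] mulc onec) (auto simp: right_End_simps compose_eq cl)
      show "\<phi> \<otimes>\<^bsub>?E\<^esub> \<one>\<^bsub>?E\<^esub> = \<phi>"
        using \<phi> by (intro right_End_eqI[of _ R S] mulc onec) (auto simp: right_End_simps compose_eq cl)
    qed (use mulc onec in auto)
  next
    fix \<phi> \<psi> \<chi> assume *: "\<phi> \<in> carrier ?E" "\<psi> \<in> carrier ?E" "\<chi> \<in> carrier ?E"
    then show "(\<phi> \<oplus>\<^bsub>?E\<^esub> \<psi>) \<otimes>\<^bsub>?E\<^esub> \<chi> = \<phi> \<otimes>\<^bsub>?E\<^esub> \<chi> \<oplus>\<^bsub>?E\<^esub> \<psi> \<otimes>\<^bsub>?E\<^esub> \<chi>"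
      by (intro right_End_eqI[of _ R S] mulc addc) (auto simp: right_End_simps compose_eq cl)
    show "\<chi> \<otimes>\<^bsub>?E\<^esub> (\<phi> \<oplus>\<^bsub>?E\<^esub> \<psi>) = \<chi> \<otimes>\<^bsub>?E\<^esub> \<phi> \<oplus>\<^bsub>?E\<^esub> \<chi> \<otimes>\<^bsub>?E\<^esub> \<psi>"
      using * by (intro right_End_eqI[of _ R S] mulc addc) (auto simp: right_End_simps compose_eq cl ad)
  qed
qed

section \<open>Exchange relations between an operator and variables\<close>

text \<open>
  A Demazure generator and the two variables that it involves. For the generator of the fork the second
  variable is \<open>- y 0\<close>, so that it has the same shape as the others.
\<close>

locale exchange =
  fixes u a x y :: "'a::ring"
  assumes x: "a * x = u - y * a" and y: "a * y = u - x * a" and u: "u * a = a" "a * u = a"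
begin

lemma mults: "a * (x * w) = u * w - y * (a * w)" "a * (y * w) = u * w - x * (a * w)"
  "u * (a * w) = a * w" "a * (u * w) = a * w"
  using x y u by (metis left_diff_distrib mult.assoc)+

lemmas rules = x y u mults

lemma swap: "exchange u a y x"
  by unfold_locales (fact x y u)+

lemma square: "a * a * x = x * (a * a)"
  by (simp add: rules algebra_simps)

lemma far:
  assumes "b * x = - (x * b)" "b * y = - (y * b)" "u * b = b" "b * u = b"
  shows "(a * b + b * a) * x = y * (a * b + b * a)"
proof -
  have "b * (y * w) = - (y * (b * w))" for w using assms(2) by (simp flip: mult.assoc)
  then show ?thesis using assms by (simp add: rules algebra_simps)
qed

end

text \<open>
  Two generators adjacent in the Dynkin diagram; they share the variable \<open>y\<close>. The difference of the two
  sides of the braid relation moves past the three variables, exchanging the outer ones, with signs.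
\<close>

locale exchange_pair = a: exchange u a x y + b: exchange u b y z for u a b x y z :: "'a::ring" +
  assumes far: "a * z = - (z * a)" "b * x = - (x * b)" and nil: "a * a = 0" "b * b = 0"
begin

lemma far_mults: "a * (z * w) = - (z * (a * w))" "b * (x * w) = - (x * (b * w))"
  "a * (a * w) = 0" "b * (b * w) = 0"
  using far nil by (simp_all flip: mult.assoc)

lemma braid_x: "(a * b * a - b * a * b) * x = - (z * (a * b * a - b * a * b))"
  and braid_y: "(a * b * a - b * a * b) * y = - (y * (a * b * a - b * a * b))"
  and braid_z: "(a * b * a - b * a * b) * z = - (x * (a * b * a - b * a * b))"
  by (simp_all add: a.rules b.rules far nil far_mults algebra_simps)

end

text \<open>
  The two generators of the fork, which involve the same two variables.
\<close>

lemma exchange_commute: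
  fixes u a b x y :: "'a::ring"
  assumes "exchange u a x y" "exchange u b x (- y)"
  shows "(b * a - a * b) * x = - (x * (b * a - a * b))"
proof -
  interpret a: exchange u a x y by fact
  interpret b: exchange u b x "- y" by fact
  have y: "b * y = x * b - u" "b * (y * w) = x * (b * w) - u * w" for w
    using b.y b.mults(2)[of w] by (auto simp: algebra_simps)
  show ?thesis by (simp add: a.rules b.x b.u b.mults(1,3,4) y algebra_simps)
qed

section \<open>The odd Demazure operators\<close>

lemma const_commute: "Poly_Mapping.single [] c * p = p * Poly_Mapping.single [] (c :: 'k::comm_ring_1)"
  by (induction p rule: poly_mapping_additive_induct)
    (auto simp: mult_single plus_list_def distrib_left distrib_right mult.commute)

lemma odd_pol_rels_closed: "odd_pol_rels n \<subseteq> carrier (free_algebra {1..n})"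
  by (auto simp: odd_pol_rels_def intro!: free_algebra_closed)

lemma keys_letter_mult: "Poly_Mapping.keys (letter a * letter b :: 'g list \<Rightarrow>\<^sub>0 'k::comm_ring_1) = {[a, b]}"
  by (simp add: letter_def mult_single plus_list_def)

locale odd_polynomials =
  fixes n :: nat
  assumes two_le_n: "2 \<le> n"
begin

declare One_nat_def [simp del]

abbreviation P :: "(nat list \<Rightarrow>\<^sub>0 rat) set ring" where "P \<equiv> odd_pol n"
abbreviation var :: "nat \<Rightarrow> (nat list \<Rightarrow>\<^sub>0 rat) set" where "var \<equiv> pol_var n"
abbreviation const :: "rat \<Rightarrow> (nat list \<Rightarrow>\<^sub>0 rat) set" where "const \<equiv> pol_const n"

sublocale pol: graded_presentation "{1..n}" "odd_pol_rels n :: (nat list \<Rightarrow>\<^sub>0 rat) set" "\<lambda>_. 2"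
  rewrites "presented_algebra {1..n} (odd_pol_rels n) = P"
    and "presented_degree (\<lambda>_. 2) {1..n} (odd_pol_rels n) = (pol_degree n :: int \<Rightarrow> (nat list \<Rightarrow>\<^sub>0 rat) set set)"
proof -
  show "graded_presentation {1..n} (odd_pol_rels n :: (nat list \<Rightarrow>\<^sub>0 rat) set) (\<lambda>_. 2)"
  proof
    fix r :: "nat list \<Rightarrow>\<^sub>0 rat" assume "r \<in> odd_pol_rels n"
    then obtain i j where "r = letter i * letter j + letter j * letter i" by (auto simp: odd_pol_rels_def)
    then have "Poly_Mapping.keys r \<subseteq> {[i, j], [j, i]}"
      using Poly_Mapping.keys_add[of "letter i * letter j" "letter j * letter i"] by (auto simp: keys_letter_mult)
    then show "\<exists>e. \<forall>w\<in>Poly_Mapping.keys r. word_weight (\<lambda>_. 2) w = e" by (intro exI[of _ 4]) auto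
  qed (rule odd_pol_rels_closed)
qed (simp_all add: odd_pol_def pol_degree_def)

sublocale P: ring P by (rule pol.ring_presented)

lemma var_closed [simp]: "i \<in> {1..n} \<Longrightarrow> var i \<in> carrier P"
  unfolding pol_var_def by simp

lemma const_closed [simp]: "const c \<in> carrier P"
  unfolding pol_const_def by simp

lemma const_add: "const (c + c') = const c \<oplus>\<^bsub>P\<^esub> const c'"
  unfolding pol_const_def by (simp add: single_add pol.presented_class_add)

lemma const_mult: "const (c * c') = const c \<otimes>\<^bsub>P\<^esub> const c'"
  unfolding pol_const_def using pol.presented_class_mult[of "Poly_Mapping.single [] c" "Poly_Mapping.single [] c'"]
  by (simp add: mult_single plus_list_def)

lemma const_one: "const 1 = \<one>\<^bsub>P\<^esub>"
  unfolding pol_const_def by (simp add: single_Nil_one pol.presented_class_one)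

lemma const_zero: "const 0 = \<zero>\<^bsub>P\<^esub>"
  unfolding pol_const_def by (simp add: pol.presented_class_zero)

lemma const_central: "f \<in> carrier P \<Longrightarrow> const c \<otimes>\<^bsub>P\<^esub> f = f \<otimes>\<^bsub>P\<^esub> const c"
proof -
  assume "f \<in> carrier P"
  then obtain p where "p \<in> carrier pol.F" "f = pol.cls p" using pol.presented_carrierE by blast
  then show ?thesis unfolding pol_const_def
    by (simp add: const_commute flip: pol.presented_class_mult)
qed

lemma var_anticommute:
  assumes "i \<in> {1..n}" "j \<in> {1..n}" "i \<noteq> j"
  shows "var i \<otimes>\<^bsub>P\<^esub> var j \<oplus>\<^bsub>P\<^esub> var j \<otimes>\<^bsub>P\<^esub> var i = \<zero>\<^bsub>P\<^esub>"
proof -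
  have "letter i * letter j + letter j * letter i \<in> (odd_pol_rels n :: (nat list \<Rightarrow>\<^sub>0 rat) set)"
    using assms by (auto simp: odd_pol_rels_def)
  then have "pol.cls (letter i * letter j + letter j * letter i) = \<zero>\<^bsub>P\<^esub>" by (rule pol.presented_class_rel)
  then show ?thesis using assms unfolding pol_var_def
    by (simp add: pol.presented_class_add pol.presented_class_mult)
qed

lemma pol_induct [consumes 1, case_names const var add]:
  assumes "f \<in> carrier P" "\<And>c. Q (const c)"
    and "\<And>i g. i \<in> {1..n} \<Longrightarrow> g \<in> carrier P \<Longrightarrow> Q g \<Longrightarrow> Q (var i \<otimes>\<^bsub>P\<^esub> g)"
    and "\<And>g h. g \<in> carrier P \<Longrightarrow> h \<in> carrier P \<Longrightarrow> Q g \<Longrightarrow> Q h \<Longrightarrow> Q (g \<oplus>\<^bsub>P\<^esub> h)"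
  shows "Q f"
  using assms(1)
  by (induction f rule: pol.presented_induct) (use assms(2-) in \<open>auto simp: pol_const_def pol_var_def\<close>)

subsection \<open>Existence and uniqueness\<close>

text \<open>
  The properties in the definite descriptions by which endomorphisms and skew derivations of the
  polynomials are introduced.
\<close>

definition is_endo :: "(nat \<Rightarrow> (nat list \<Rightarrow>\<^sub>0 rat) set) \<Rightarrow> ((nat list \<Rightarrow>\<^sub>0 rat) set \<Rightarrow> (nat list \<Rightarrow>\<^sub>0 rat) set) \<Rightarrow> bool" where
  "is_endo img s \<longleftrightarrow> s \<in> extensional (carrier P) \<and> s \<in> ring_hom P P \<and> (\<forall>c. s (const c) = const c) \<and>
    (\<forall>j\<in>{1..n}. s (var j) = img j)"

definition is_derivation where
  "is_derivation s val D \<longleftrightarrow> D \<in> carrier P \<rightarrow>\<^sub>E carrier P \<and>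
     (\<forall>f\<in>carrier P. \<forall>g\<in>carrier P. D (f \<oplus>\<^bsub>P\<^esub> g) = D f \<oplus>\<^bsub>P\<^esub> D g) \<and>
     (\<forall>c. \<forall>f\<in>carrier P. D (const c \<otimes>\<^bsub>P\<^esub> f) = const c \<otimes>\<^bsub>P\<^esub> D f) \<and>
     D \<one>\<^bsub>P\<^esub> = \<zero>\<^bsub>P\<^esub> \<and> (\<forall>j\<in>{1..n}. D (var j) = val j) \<and>
     (\<forall>f\<in>carrier P. \<forall>g\<in>carrier P. D (f \<otimes>\<^bsub>P\<^esub> g) = D f \<otimes>\<^bsub>P\<^esub> g \<oplus>\<^bsub>P\<^esub> s f \<otimes>\<^bsub>P\<^esub> D g)"

lemma endo_unique:
  assumes "is_endo img s" "is_endo img s'" shows "s = s'"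
proof (rule extensionalityI[of _ "carrier P"])
  fix f assume "f \<in> carrier P"
  then show "s f = s' f"
  proof (induction f rule: pol_induct)
    case (var i g)
    then show ?case using assms ring_hom_mult[of s P P "var i" g] ring_hom_mult[of s' P P "var i" g]
      by (simp add: is_endo_def)
  next
    case (add g h)
    then show ?case using assms ring_hom_add[of s P P g h] ring_hom_add[of s' P P g h]
      by (simp add: is_endo_def)
  qed (use assms in \<open>simp add: is_endo_def\<close>)
qed (use assms in \<open>auto simp: is_endo_def\<close>)

lemma derivation_const:
  assumes "is_derivation s val D" shows "D (const c) = \<zero>\<^bsub>P\<^esub>"
proof -
  have "D (const c \<otimes>\<^bsub>P\<^esub> \<one>\<^bsub>P\<^esub>) = const c \<otimes>\<^bsub>P\<^esub> D \<one>\<^bsub>P\<^esub>" "D \<one>\<^bsub>P\<^esub> = \<zero>\<^bsub>P\<^esub>"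
    using assms P.one_closed unfolding is_derivation_def by blast+
  then show ?thesis by simp
qed

lemma derivation_unique:
  assumes "is_derivation s val D" "is_derivation s val D'" shows "D = D'"
proof (rule extensionalityI[of _ "carrier P"])
  fix f assume "f \<in> carrier P"
  then show "D f = D' f"
  proof (induction f rule: pol_induct)
    case (const c)
    show ?case using derivation_const[OF assms(1)] derivation_const[OF assms(2)] by simp
  qed (use assms in \<open>auto simp: is_derivation_def\<close>)
qed (use assms in \<open>auto simp: is_derivation_def PiE_iff\<close>)

text \<open>
  The universal property is applied to the ring of triangular matrices. The assumptions say that the
  matrices \<open>(img j, val j, var j)\<close> anticommute.
\<close>

lemma endo_derivation_exist:
  assumes img: "\<And>i. i \<in> {1..n} \<Longrightarrow> img i \<in> carrier P" and val: "\<And>i. i \<in> {1..n} \<Longrightarrow> val i \<in> carrier P"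
    and anti: "\<And>i j. i \<in> {1..n} \<Longrightarrow> j \<in> {1..n} \<Longrightarrow> i \<noteq> j \<Longrightarrow>
      img i \<otimes>\<^bsub>P\<^esub> img j \<oplus>\<^bsub>P\<^esub> img j \<otimes>\<^bsub>P\<^esub> img i = \<zero>\<^bsub>P\<^esub>"
    and compat: "\<And>i j. i \<in> {1..n} \<Longrightarrow> j \<in> {1..n} \<Longrightarrow> i \<noteq> j \<Longrightarrow>
      (img i \<otimes>\<^bsub>P\<^esub> val j \<oplus>\<^bsub>P\<^esub> val i \<otimes>\<^bsub>P\<^esub> var j) \<oplus>\<^bsub>P\<^esub>
      (img j \<otimes>\<^bsub>P\<^esub> val i \<oplus>\<^bsub>P\<^esub> val j \<otimes>\<^bsub>P\<^esub> var i) = \<zero>\<^bsub>P\<^esub>"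
  shows "\<exists>s D. is_endo img s \<and> is_derivation s val D"
proof -
  let ?T = "triangular P" and ?g = "\<lambda>j. (img j, val j, var j)"
  let ?\<eta> = "\<lambda>c. (const c, \<zero>\<^bsub>P\<^esub>, const c)"
  have T: "ring ?T" by (rule ring_triangular) (rule P.ring_axioms)
  interpret t: algebra_target ?T ?\<eta> "{1..n}" ?g
  proof (rule algebra_target.intro, rule T)
    fix c a assume "a \<in> {1..n}"
    then show "?\<eta> c \<otimes>\<^bsub>?T\<^esub> ?g a = ?g a \<otimes>\<^bsub>?T\<^esub> ?\<eta> c"
      using img val const_central[of "img a" c] const_central[of "val a" c] const_central[of "var a" c]
      by (simp add: triangular_simps)
  qed (use img val in \<open>auto simp: triangular_simps const_add const_mult const_one\<close>)
  have "t.ev r = 0" if r: "r \<in> odd_pol_rels n" for r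
  proof -
    obtain i j where ij: "r = letter i * letter j + letter j * letter i" "i \<in> {1..n}" "j \<in> {1..n}" "i \<noteq> j"
      using r by (auto simp: odd_pol_rels_def)
    have "t.ev r = embed ?T (?g i \<otimes>\<^bsub>?T\<^esub> ?g j \<oplus>\<^bsub>?T\<^esub> ?g j \<otimes>\<^bsub>?T\<^esub> ?g i)"
      using ij img val by (simp add: t.free_eval_add t.free_eval_mult t.free_eval_letter embed_add[OF T] embed_mult[OF T] triangular_simps
          flip: embed_mult[OF T] embed_add[OF T])
    also have "?g i \<otimes>\<^bsub>?T\<^esub> ?g j \<oplus>\<^bsub>?T\<^esub> ?g j \<otimes>\<^bsub>?T\<^esub> ?g i = \<zero>\<^bsub>?T\<^esub>"
      using ij anti compat var_anticommute by (simp add: triangular_simps)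
    finally show ?thesis by (simp add: embed_zero[OF T])
  qed
  then obtain h where h: "h \<in> ring_hom P ?T" "\<And>j. j \<in> {1..n} \<Longrightarrow> h (var j) = ?g j" "\<And>c. h (const c) = ?\<eta> c"
    using t.presented_universal[OF odd_pol_rels_closed] unfolding odd_pol_def[symmetric] pol_var_def[symmetric] pol_const_def[symmetric]
    by blast
  have hc: "h f \<in> carrier ?T" if "f \<in> carrier P" for f using ring_hom_closed[OF h(1) that] .
  have ha: "h (f \<oplus>\<^bsub>P\<^esub> g) = h f \<oplus>\<^bsub>?T\<^esub> h g" "h (f \<otimes>\<^bsub>P\<^esub> g) = h f \<otimes>\<^bsub>?T\<^esub> h g"
    if "f \<in> carrier P" "g \<in> carrier P" for f g
    using ring_hom_add[OF h(1) that] ring_hom_mult[OF h(1) that] by auto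
  \<comment> \<open>The last entry is the identity, since it fixes the variables.\<close>
  have third: "snd (snd (h f)) = f" if "f \<in> carrier P" for f
    using that
  proof (induction f rule: pol_induct)
    case (var i g)
    obtain a b c where "h g = (a, b, c)" by (cases "h g")
    then show ?case using var ha[of "var i" g] h(2)[of i] by (simp add: triangular_simps)
  next
    case (add f g)
    obtain a b c a' b' c' where "h f = (a, b, c)" "h g = (a', b', c')" by (cases "h f", cases "h g")
    then show ?case using add ha[of f g] by (simp add: triangular_simps)
  qed (simp add: h)
  let ?s = "\<lambda>f\<in>carrier P. fst (h f)" and ?D = "\<lambda>f\<in>carrier P. fst (snd (h f))"
  have hf: "h f = (?s f, ?D f, f)" if "f \<in> carrier P" for f
    using third[OF that] that by (simp add: prod_eq_iff)
  have sc: "?s f \<in> carrier P" "?D f \<in> carrier P" if "f \<in> carrier P" for f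
    using hc[OF that] hf[OF that] by (auto simp: triangular_simps)
  have sa: "?s (f \<oplus>\<^bsub>P\<^esub> g) = ?s f \<oplus>\<^bsub>P\<^esub> ?s g" "?D (f \<oplus>\<^bsub>P\<^esub> g) = ?D f \<oplus>\<^bsub>P\<^esub> ?D g"
    "?s (f \<otimes>\<^bsub>P\<^esub> g) = ?s f \<otimes>\<^bsub>P\<^esub> ?s g" "?D (f \<otimes>\<^bsub>P\<^esub> g) = ?D f \<otimes>\<^bsub>P\<^esub> g \<oplus>\<^bsub>P\<^esub> ?s f \<otimes>\<^bsub>P\<^esub> ?D g"
    if f: "f \<in> carrier P" and g: "g \<in> carrier P" for f g
  proof -
    have "(?s (f \<oplus>\<^bsub>P\<^esub> g), ?D (f \<oplus>\<^bsub>P\<^esub> g), f \<oplus>\<^bsub>P\<^esub> g) =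
        (?s f \<oplus>\<^bsub>P\<^esub> ?s g, ?D f \<oplus>\<^bsub>P\<^esub> ?D g, f \<oplus>\<^bsub>P\<^esub> g)"
      unfolding hf[OF P.a_closed[OF f g], symmetric] ha(1)[OF f g] unfolding hf[OF f] hf[OF g] triangular_simps ..
    then show "?s (f \<oplus>\<^bsub>P\<^esub> g) = ?s f \<oplus>\<^bsub>P\<^esub> ?s g" "?D (f \<oplus>\<^bsub>P\<^esub> g) = ?D f \<oplus>\<^bsub>P\<^esub> ?D g"
      by (simp_all only: prod.inject)
    have "(?s (f \<otimes>\<^bsub>P\<^esub> g), ?D (f \<otimes>\<^bsub>P\<^esub> g), f \<otimes>\<^bsub>P\<^esub> g) =
        (?s f \<otimes>\<^bsub>P\<^esub> ?s g, ?s f \<otimes>\<^bsub>P\<^esub> ?D g \<oplus>\<^bsub>P\<^esub> ?D f \<otimes>\<^bsub>P\<^esub> g, f \<otimes>\<^bsub>P\<^esub> g)"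
      unfolding hf[OF P.m_closed[OF f g], symmetric] ha(2)[OF f g] unfolding hf[OF f] hf[OF g] triangular_simps ..
    moreover have "?s f \<otimes>\<^bsub>P\<^esub> ?D g \<oplus>\<^bsub>P\<^esub> ?D f \<otimes>\<^bsub>P\<^esub> g = ?D f \<otimes>\<^bsub>P\<^esub> g \<oplus>\<^bsub>P\<^esub> ?s f \<otimes>\<^bsub>P\<^esub> ?D g"
      by (rule P.a_comm) (rule P.m_closed; (rule sc f g)+)+
    ultimately show "?s (f \<otimes>\<^bsub>P\<^esub> g) = ?s f \<otimes>\<^bsub>P\<^esub> ?s g"
      "?D (f \<otimes>\<^bsub>P\<^esub> g) = ?D f \<otimes>\<^bsub>P\<^esub> g \<oplus>\<^bsub>P\<^esub> ?s f \<otimes>\<^bsub>P\<^esub> ?D g"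
      by (simp_all only: prod.inject)
  qed
  have k: "?s (const c) = const c" "?D (const c) = \<zero>\<^bsub>P\<^esub>" for c by (simp_all add: h)
  have one: "?s \<one>\<^bsub>P\<^esub> = \<one>\<^bsub>P\<^esub>" "?D \<one>\<^bsub>P\<^esub> = \<zero>\<^bsub>P\<^esub>" using k[of 1] by (simp_all add: const_one)
  have "is_endo img ?s" unfolding is_endo_def
    using sc(1) sa(1,3) k(1) one(1) h(2) by (intro conjI ring_hom_memI ballI allI) (auto simp del: restrict_apply, auto)
  moreover have "is_derivation ?s val ?D" unfolding is_derivation_def
  proof (intro conjI ballI allI)
    show "?D \<in> carrier P \<rightarrow>\<^sub>E carrier P" using sc(2) by auto
    show "?D (const c \<otimes>\<^bsub>P\<^esub> f) = const c \<otimes>\<^bsub>P\<^esub> ?D f" if "f \<in> carrier P" for c f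
      unfolding sa(4)[OF const_closed that] k using sc(2)[OF that] that by simp
    show "?D (var j) = val j" if "j \<in> {1..n}" for j using h(2)[OF that] that by simp
  qed (rule sa one; assumption)+
  ultimately show ?thesis by blast
qed

lemma pol_endo_derivation:
  assumes "\<exists>s D. is_endo img s \<and> is_derivation s val D"
  shows "is_endo img (pol_endo n img)" "is_derivation (pol_endo n img) val (pol_skew_derivation n (pol_endo n img) val)"
proof -
  obtain s D where sD: "is_endo img s" "is_derivation s val D" using assms by blast
  have "pol_endo n img = s"
    unfolding pol_endo_def is_endo_def[symmetric] using sD endo_unique by (intro the_equality) auto
  moreover have "pol_skew_derivation n s val = D"
    unfolding pol_skew_derivation_def Let_def is_derivation_def[symmetric]
    using sD derivation_unique by (intro the_equality) auto
  ultimately show "is_endo img (pol_endo n img)"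
    "is_derivation (pol_endo n img) val (pol_skew_derivation n (pol_endo n img) val)"
    using sD by auto
qed

definition refl_img :: "nat \<Rightarrow> nat \<Rightarrow> (nat list \<Rightarrow>\<^sub>0 rat) set" where
  "refl_img i j = (if j = i then \<ominus>\<^bsub>P\<^esub> var (i + 1) else if j = i + 1 then \<ominus>\<^bsub>P\<^esub> var i else \<ominus>\<^bsub>P\<^esub> var j)"

definition dem_val :: "nat \<Rightarrow> nat \<Rightarrow> (nat list \<Rightarrow>\<^sub>0 rat) set" where
  "dem_val i j = (if j = i \<or> j = i + 1 then \<one>\<^bsub>P\<^esub> else \<zero>\<^bsub>P\<^esub>)"

definition refl_img_D :: "nat \<Rightarrow> (nat list \<Rightarrow>\<^sub>0 rat) set" where
  "refl_img_D j = (if j = n then var (n - 1) else if j = n - 1 then var n else \<ominus>\<^bsub>P\<^esub> var j)"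

definition dem_val_D :: "nat \<Rightarrow> (nat list \<Rightarrow>\<^sub>0 rat) set" where
  "dem_val_D j = (if j = n then \<ominus>\<^bsub>P\<^esub> \<one>\<^bsub>P\<^esub> else if j = n - 1 then \<one>\<^bsub>P\<^esub> else \<zero>\<^bsub>P\<^esub>)"

lemma odd_refl_demazure:
  assumes i: "1 \<le> i" "i < n"
  shows "is_endo (refl_img i) (odd_refl n i)" "is_derivation (odd_refl n i) (dem_val i) (odd_demazure n i)"
proof -
  have "\<exists>s D. is_endo (refl_img i) s \<and> is_derivation s (dem_val i) D"
  proof (rule endo_derivation_exist)
    fix a b assume ab: "a \<in> {1..n}" "b \<in> {1..n}" "a \<noteq> b"
    define \<pi> where "\<pi> j = (if j = i then i + 1 else if j = i + 1 then i else j)" for j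
    have im: "refl_img i j = \<ominus>\<^bsub>P\<^esub> var (\<pi> j)" for j by (simp add: refl_img_def \<pi>_def)
    have "\<pi> a \<in> {1..n}" "\<pi> b \<in> {1..n}" "\<pi> a \<noteq> \<pi> b" using ab i by (auto simp: \<pi>_def)
    then show "refl_img i a \<otimes>\<^bsub>P\<^esub> refl_img i b \<oplus>\<^bsub>P\<^esub> refl_img i b \<otimes>\<^bsub>P\<^esub> refl_img i a = \<zero>\<^bsub>P\<^esub>"
      using var_anticommute[of "\<pi> a" "\<pi> b"] by (simp add: im P.l_minus P.r_minus)
    show "(refl_img i a \<otimes>\<^bsub>P\<^esub> dem_val i b \<oplus>\<^bsub>P\<^esub> dem_val i a \<otimes>\<^bsub>P\<^esub> var b) \<oplus>\<^bsub>P\<^esub>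
      (refl_img i b \<otimes>\<^bsub>P\<^esub> dem_val i a \<oplus>\<^bsub>P\<^esub> dem_val i b \<otimes>\<^bsub>P\<^esub> var a) = \<zero>\<^bsub>P\<^esub>"
      using ab i by (auto simp: refl_img_def dem_val_def P.l_neg P.r_neg)
  qed (use i in \<open>auto simp: refl_img_def dem_val_def\<close>)
  from pol_endo_derivation[OF this] show "is_endo (refl_img i) (odd_refl n i)"
    "is_derivation (odd_refl n i) (dem_val i) (odd_demazure n i)"
    by (simp_all add: odd_refl_def odd_demazure_def refl_img_def[abs_def] dem_val_def[abs_def])
qed

lemma odd_refl_demazure_D:
  shows "is_endo refl_img_D (odd_refl_D n)" "is_derivation (odd_refl_D n) dem_val_D (odd_demazure_D n)"
proof -
  have "\<exists>s D. is_endo refl_img_D s \<and> is_derivation s dem_val_D D"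
  proof (rule endo_derivation_exist)
    fix a b assume ab: "a \<in> {1..n}" "b \<in> {1..n}" "a \<noteq> b"
    define \<pi> where "\<pi> j = (if j = n then n - 1 else if j = n - 1 then n else j)" for j
    have im: "refl_img_D j = var (\<pi> j) \<or> refl_img_D j = \<ominus>\<^bsub>P\<^esub> var (\<pi> j)" for j
      by (simp add: refl_img_D_def \<pi>_def)
    have \<pi>: "\<pi> a \<in> {1..n}" "\<pi> b \<in> {1..n}" "\<pi> a \<noteq> \<pi> b" using ab two_le_n by (auto simp: \<pi>_def)
    have "\<ominus>\<^bsub>P\<^esub> (var (\<pi> a) \<otimes>\<^bsub>P\<^esub> var (\<pi> b)) \<oplus>\<^bsub>P\<^esub> \<ominus>\<^bsub>P\<^esub> (var (\<pi> b) \<otimes>\<^bsub>P\<^esub> var (\<pi> a)) = \<zero>\<^bsub>P\<^esub>"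
      using \<pi> var_anticommute[OF \<pi>] by (simp flip: P.minus_add)
    then show "refl_img_D a \<otimes>\<^bsub>P\<^esub> refl_img_D b \<oplus>\<^bsub>P\<^esub> refl_img_D b \<otimes>\<^bsub>P\<^esub> refl_img_D a = \<zero>\<^bsub>P\<^esub>"
      using var_anticommute[OF \<pi>] im[of a] im[of b] \<pi> by (auto simp: P.l_minus P.r_minus)
    show "(refl_img_D a \<otimes>\<^bsub>P\<^esub> dem_val_D b \<oplus>\<^bsub>P\<^esub> dem_val_D a \<otimes>\<^bsub>P\<^esub> var b) \<oplus>\<^bsub>P\<^esub>
      (refl_img_D b \<otimes>\<^bsub>P\<^esub> dem_val_D a \<oplus>\<^bsub>P\<^esub> dem_val_D b \<otimes>\<^bsub>P\<^esub> var a) = \<zero>\<^bsub>P\<^esub>"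
      using ab two_le_n by (auto simp: refl_img_D_def dem_val_D_def P.l_neg P.r_neg P.l_minus P.r_minus)
  qed (use two_le_n in \<open>auto simp: refl_img_D_def dem_val_D_def\<close>)
  from pol_endo_derivation[OF this] show "is_endo refl_img_D (odd_refl_D n)"
    "is_derivation (odd_refl_D n) dem_val_D (odd_demazure_D n)"
    by (simp_all add: odd_refl_D_def odd_demazure_D_def refl_img_D_def[abs_def] dem_val_D_def[abs_def])
qed

abbreviation "Lam \<equiv> spinD_sym n :: (nat list \<Rightarrow>\<^sub>0 rat) set set"
abbreviation "E \<equiv> right_End P Lam"

lemma Lam_subset: "Lam \<subseteq> carrier P"
  by (auto simp: spinD_sym_def)

lemma derivationD:
  assumes "is_derivation s val D"
  shows "D \<in> carrier P \<rightarrow>\<^sub>E carrier P" "f \<in> carrier P \<Longrightarrow> D f \<in> carrier P"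
    "f \<in> carrier P \<Longrightarrow> g \<in> carrier P \<Longrightarrow> D (f \<oplus>\<^bsub>P\<^esub> g) = D f \<oplus>\<^bsub>P\<^esub> D g" "D \<one>\<^bsub>P\<^esub> = \<zero>\<^bsub>P\<^esub>"
    "j \<in> {1..n} \<Longrightarrow> D (var j) = val j"
    "f \<in> carrier P \<Longrightarrow> g \<in> carrier P \<Longrightarrow> D (f \<otimes>\<^bsub>P\<^esub> g) = D f \<otimes>\<^bsub>P\<^esub> g \<oplus>\<^bsub>P\<^esub> s f \<otimes>\<^bsub>P\<^esub> D g"
  using assms unfolding is_derivation_def by blast+

lemma endoD:
  assumes "is_endo img s"
  shows "f \<in> carrier P \<Longrightarrow> s f \<in> carrier P" "j \<in> {1..n} \<Longrightarrow> s (var j) = img j"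
  using assms ring_hom_closed[of s P P f] unfolding is_endo_def by blast+

lemma Lam_iff: "f \<in> Lam \<longleftrightarrow> f \<in> carrier P \<and> (\<forall>i. 1 \<le> i \<and> i < n \<longrightarrow> odd_demazure n i f = \<zero>\<^bsub>P\<^esub>) \<and>
    odd_demazure_D n f = \<zero>\<^bsub>P\<^esub>"
  using two_le_n by (auto simp: spinD_sym_def)

lemma const_Lam [simp]: "const c \<in> Lam"
  unfolding Lam_iff using derivation_const[OF odd_refl_demazure(2)] derivation_const[OF odd_refl_demazure_D(2)]
  by simp

lemma derivation_right_linear:
  assumes "is_endo img s" "is_derivation s val D" "D l = \<zero>\<^bsub>P\<^esub>" "f \<in> carrier P" "l \<in> carrier P"
  shows "D (f \<otimes>\<^bsub>P\<^esub> l) = D f \<otimes>\<^bsub>P\<^esub> l"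
  using derivationD(2,6)[OF assms(2)] endoD(1)[OF assms(1)] assms(3-) by simp

lemma demazure_E: "1 \<le> i \<Longrightarrow> i < n \<Longrightarrow> odd_demazure n i \<in> carrier E"
  unfolding right_End_mem Ball_def Lam_iff
  using derivationD(1,3)[OF odd_refl_demazure(2)[of i]]
    derivation_right_linear[OF odd_refl_demazure[of i]] by simp

lemma demazure_D_E: "odd_demazure_D n \<in> carrier E"
  unfolding right_End_mem Ball_def Lam_iff
  using derivationD(1,3)[OF odd_refl_demazure_D(2)] derivation_right_linear[OF odd_refl_demazure_D] by simp

lemma mult_E: "f \<in> carrier P \<Longrightarrow> (\<lambda>g\<in>carrier P. f \<otimes>\<^bsub>P\<^esub> g) \<in> carrier E"
  unfolding right_End_mem using Lam_subset by (auto simp: P.r_distr P.m_assoc subset_iff)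

lemma ring_E: "ring E"
  by (rule ring_right_End[OF P.ring_axioms Lam_subset])

lemma gen_action_E: "g \<in> spinD_gens n \<Longrightarrow> gen_action n g \<in> carrier E"
  using demazure_E demazure_D_E mult_E by (cases g) (auto simp: spinD_gens_def)

subsection \<open>The operators satisfy the nilHecke relations\<close>

text \<open>
  Operators are handled as elements of the product of all rings, in order to use the algebra of a type class.
  Only their component in the endomorphism ring acts.
\<close>

definition act :: "((nat list \<Rightarrow>\<^sub>0 rat) set \<Rightarrow> (nat list \<Rightarrow>\<^sub>0 rat) set) all_rings \<Rightarrow> (nat list \<Rightarrow>\<^sub>0 rat) set \<Rightarrow> (nat list \<Rightarrow>\<^sub>0 rat) set" where
  "act a f = component a E f"

lemma component_E: "component a E \<in> carrier E"
  by (rule component_closed[OF ring_E])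

lemma act_closed [simp]: "f \<in> carrier P \<Longrightarrow> act a f \<in> carrier P"
  using component_E[of a] by (auto simp: act_def right_End_mem)

lemma act_plus: "f \<in> carrier P \<Longrightarrow> g \<in> carrier P \<Longrightarrow> act a (f \<oplus>\<^bsub>P\<^esub> g) = act a f \<oplus>\<^bsub>P\<^esub> act a g"
  using component_E[of a] by (auto simp: act_def right_End_mem)

lemma act_Lam: "f \<in> carrier P \<Longrightarrow> l \<in> Lam \<Longrightarrow> act a (f \<otimes>\<^bsub>P\<^esub> l) = act a f \<otimes>\<^bsub>P\<^esub> l"
  using component_E[of a] by (auto simp: act_def right_End_mem)

lemma act_zero [simp]: "act a \<zero>\<^bsub>P\<^esub> = \<zero>\<^bsub>P\<^esub>"
  using act_plus[of "\<zero>\<^bsub>P\<^esub>" "\<zero>\<^bsub>P\<^esub>" a] P.add.l_cancel_one'[of "act a \<zero>\<^bsub>P\<^esub>" "act a \<zero>\<^bsub>P\<^esub>"] by simp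

lemma act_uminus: "f \<in> carrier P \<Longrightarrow> act a (\<ominus>\<^bsub>P\<^esub> f) = \<ominus>\<^bsub>P\<^esub> act a f"
  using act_plus[of "\<ominus>\<^bsub>P\<^esub> f" f a] P.minus_equality[of "act a (\<ominus>\<^bsub>P\<^esub> f)" "act a f"] by (simp add: P.l_neg)

lemma add_act: "f \<in> carrier P \<Longrightarrow> act (a + b) f = act a f \<oplus>\<^bsub>P\<^esub> act b f"
  by (simp add: act_def plus_all_rings.rep_eq ring_E right_End_simps)

lemma mult_act: "f \<in> carrier P \<Longrightarrow> act (a * b) f = act a (act b f)"
  by (simp add: act_def times_all_rings.rep_eq ring_E right_End_simps compose_eq)

lemma zero_act [simp]: "f \<in> carrier P \<Longrightarrow> act 0 f = \<zero>\<^bsub>P\<^esub>"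
  by (simp add: act_def zero_all_rings.rep_eq ring_E right_End_simps)

lemma uminus_act: "f \<in> carrier P \<Longrightarrow> act (- a) f = \<ominus>\<^bsub>P\<^esub> act a f"
  using add_act[of f "- a" a] P.minus_equality[of "act (- a) f" "act a f"] by simp

lemma minus_act: "f \<in> carrier P \<Longrightarrow> act (a - b) f = act a f \<ominus>\<^bsub>P\<^esub> act b f"
  using add_act[of f a "- b"] by (simp add: uminus_act a_minus_def)

lemma embed_act: "\<phi> \<in> carrier E \<Longrightarrow> act (embed E \<phi>) f = \<phi> f"
  by (simp add: act_def component_embed ring_E)

abbreviation "imE \<equiv> embed E ` carrier E"

lemma imE_closed [simp]:
  "a \<in> imE \<Longrightarrow> b \<in> imE \<Longrightarrow> a + b \<in> imE" "a \<in> imE \<Longrightarrow> b \<in> imE \<Longrightarrow> a * b \<in> imE"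
  "a \<in> imE \<Longrightarrow> - a \<in> imE" "a \<in> imE \<Longrightarrow> b \<in> imE \<Longrightarrow> a - b \<in> imE" "0 \<in> imE"
  using ring.ring_simprules[OF ring_E] embed_zero[OF ring_E, symmetric]
  by (auto simp flip: embed_add[OF ring_E] embed_mult[OF ring_E] embed_uminus[OF ring_E] embed_minus[OF ring_E])

lemma imE_eqI: "a \<in> imE \<Longrightarrow> b \<in> imE \<Longrightarrow> (\<And>f. f \<in> carrier P \<Longrightarrow> act a f = act b f) \<Longrightarrow> a = b"
  by (auto simp: embed_act intro!: arg_cong[of _ _ "embed E"] right_End_eqI)

text \<open>
  The generators in the reversed numbering: here as operators, with the prefix \<open>e\<close>, and below as elements of the
  nilHecke algebra, with the prefix \<open>g\<close>.
\<close>

abbreviation "yv k \<equiv> var (n - k)"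
definition "eu = embed E \<one>\<^bsub>E\<^esub>"
definition "ey k = embed E (gen_action n (X (n - k)))"
definition "ed j = embed E (gen_action n (Del (n - j)))"
definition "et = embed E (gen_action n DelD)"

lemma e_gens [simp]: "eu \<in> imE" "k < n \<Longrightarrow> ey k \<in> imE" "1 \<le> j \<Longrightarrow> j < n \<Longrightarrow> ed j \<in> imE" "et \<in> imE"
proof -
  have "X (n - k) \<in> spinD_gens n" if "k < n" for k using that by (auto simp: spinD_gens_def)
  moreover have "Del (n - j) \<in> spinD_gens n" if "1 \<le> j" "j < n" for j
    using that unfolding spinD_gens_def by (intro UnI1 UnI2 imageI) auto
  moreover have "DelD \<in> spinD_gens n" by (simp add: spinD_gens_def)
  ultimately show "eu \<in> imE" "k < n \<Longrightarrow> ey k \<in> imE" "1 \<le> j \<Longrightarrow> j < n \<Longrightarrow> ed j \<in> imE" "et \<in> imE"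
    using ring.ring_simprules(6)[OF ring_E] unfolding eu_def ey_def ed_def et_def
    by (blast intro: gen_action_E)+
qed

lemma act_eu [simp]: "f \<in> carrier P \<Longrightarrow> act eu f = f"
  using ring.ring_simprules(6)[OF ring_E] by (simp add: eu_def embed_act right_End_simps)

lemma act_ey [simp]: "k < n \<Longrightarrow> f \<in> carrier P \<Longrightarrow> act (ey k) f = yv k \<otimes>\<^bsub>P\<^esub> f"
  using gen_action_E[of "X (n - k)"] by (simp add: ey_def embed_act spinD_gens_def)

lemma act_ed: "1 \<le> j \<Longrightarrow> j < n \<Longrightarrow> act (ed j) f = odd_demazure n (n - j) f"
  using demazure_E[of "n - j"] by (simp add: ed_def embed_act)

lemma act_et: "act et f = odd_demazure_D n f"
  using demazure_D_E by (simp add: et_def embed_act)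

lemma yv_closed [simp]: "k < n \<Longrightarrow> yv k \<in> carrier P"
  by simp

lemma eu_mult: "a \<in> imE \<Longrightarrow> eu * a = a" "a \<in> imE \<Longrightarrow> a * eu = a"
  by (rule imE_eqI; simp add: mult_act)+

lemma ey_ey: "i < n \<Longrightarrow> j < n \<Longrightarrow> i \<noteq> j \<Longrightarrow> ey i * ey j = - (ey j * ey i)"
proof (rule imE_eqI)
  fix f assume ij: "i < n" "j < n" "i \<noteq> j" and f: "f \<in> carrier P"
  have "yv i \<otimes>\<^bsub>P\<^esub> yv j \<oplus>\<^bsub>P\<^esub> yv j \<otimes>\<^bsub>P\<^esub> yv i = \<zero>\<^bsub>P\<^esub>" using ij var_anticommute[of "n - i" "n - j"] by simp
  then have "yv i \<otimes>\<^bsub>P\<^esub> yv j = \<ominus>\<^bsub>P\<^esub> (yv j \<otimes>\<^bsub>P\<^esub> yv i)" using ij P.minus_equality[of "yv i \<otimes>\<^bsub>P\<^esub> yv j"] by simp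
  then have "yv i \<otimes>\<^bsub>P\<^esub> yv j \<otimes>\<^bsub>P\<^esub> f = \<ominus>\<^bsub>P\<^esub> (yv j \<otimes>\<^bsub>P\<^esub> yv i) \<otimes>\<^bsub>P\<^esub> f" by simp
  then show "act (ey i * ey j) f = act (- (ey j * ey i)) f"
    using ij f by (simp add: mult_act uminus_act P.m_assoc P.l_minus)
qed (simp_all)

lemma ed_ey:
  assumes j: "1 \<le> j" "j < n"
  shows "ed j * ey j = eu - ey (j - 1) * ed j" "ed j * ey (j - 1) = eu - ey j * ed j"
    "k < n \<Longrightarrow> k \<noteq> j \<Longrightarrow> k \<noteq> j - 1 \<Longrightarrow> ed j * ey k = - (ey k * ed j)"
proof -
  note * = derivationD[OF odd_refl_demazure(2), of "n - j"] endoD[OF odd_refl_demazure(1), of "n - j"]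
  have L: "act (ed j * ey k) f = dem_val (n - j) (n - k) \<otimes>\<^bsub>P\<^esub> f \<oplus>\<^bsub>P\<^esub> refl_img (n - j) (n - k) \<otimes>\<^bsub>P\<^esub> act (ed j) f"
    if "k < n" "f \<in> carrier P" for k f
    using j that * by (simp add: mult_act act_ed)
  have c: "act (ed j) f \<in> carrier P" if "f \<in> carrier P" for f using that by simp
  have i: "n - (j - 1) = n - j + 1" "n - j \<noteq> n - (j - 1)" using j by auto
  have v: "var (n + 1 - j) \<in> carrier P" by (rule var_closed) (use j in auto)
  show "ed j * ey j = eu - ey (j - 1) * ed j"
    using j c i v by (intro imE_eqI) (simp_all add: L minus_act dem_val_def refl_img_def P.l_minus a_minus_def,
       simp_all add: mult_act)
  show "ed j * ey (j - 1) = eu - ey j * ed j"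
    using j c i v by (intro imE_eqI) (simp_all add: L minus_act dem_val_def refl_img_def P.l_minus a_minus_def,
       simp_all add: mult_act)
  assume k: "k < n" "k \<noteq> j" "k \<noteq> j - 1"
  then have "n - k \<noteq> n - j" "n - k \<noteq> n - j + 1" using j by auto
  then show "ed j * ey k = - (ey k * ed j)"
    using j c k by (intro imE_eqI) (simp_all add: L uminus_act dem_val_def refl_img_def P.l_minus a_minus_def,
       simp_all add: mult_act)
qed

lemma et_ey:
  shows "et * ey 1 = eu + ey 0 * et" "et * ey 0 = ey 1 * et - eu"
    "2 \<le> k \<Longrightarrow> k < n \<Longrightarrow> et * ey k = - (ey k * et)"
proof -
  note * = derivationD[OF odd_refl_demazure_D(2)] endoD[OF odd_refl_demazure_D(1)]
  have L: "act (et * ey k) f = dem_val_D (n - k) \<otimes>\<^bsub>P\<^esub> f \<oplus>\<^bsub>P\<^esub> refl_img_D (n - k) \<otimes>\<^bsub>P\<^esub> act et f"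
    if "k < n" "f \<in> carrier P" for k f
    using that * by (simp add: mult_act act_et)
  have c: "act et f \<in> carrier P" if "f \<in> carrier P" for f using that by simp
  have n: "n - 1 \<noteq> n" "0 < n" "1 < n" using two_le_n by auto
  show "et * ey 1 = eu + ey 0 * et"
    using c n by (intro imE_eqI) (simp_all add: L add_act dem_val_D_def refl_img_D_def P.l_minus,
       simp_all add: mult_act)
  show "et * ey 0 = ey 1 * et - eu"
    using c n by (intro imE_eqI) (simp_all add: L minus_act dem_val_D_def refl_img_D_def P.l_minus a_minus_def,
       simp_all add: mult_act P.a_comm)
  assume k: "2 \<le> k" "k < n"
  then have "n - k \<noteq> n" "n - k \<noteq> n - 1" by auto
  then show "et * ey k = - (ey k * et)"
    using c k by (intro imE_eqI) (simp_all add: L uminus_act dem_val_D_def refl_img_D_def P.l_minus a_minus_def,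
       simp_all add: mult_act)
qed

definition annihilates_one :: "_ \<Rightarrow> bool" where
  "annihilates_one a \<longleftrightarrow> a \<in> imE \<and> act a \<one>\<^bsub>P\<^esub> = \<zero>\<^bsub>P\<^esub>"

lemma annihilates_one [simp]:
  "1 \<le> j \<Longrightarrow> j < n \<Longrightarrow> annihilates_one (ed j)" "annihilates_one et"
  "a \<in> imE \<Longrightarrow> annihilates_one b \<Longrightarrow> annihilates_one (a * b)"
  "annihilates_one a \<Longrightarrow> annihilates_one b \<Longrightarrow> annihilates_one (a + b)"
  "annihilates_one a \<Longrightarrow> annihilates_one b \<Longrightarrow> annihilates_one (a - b)"
  using derivationD(4)[OF odd_refl_demazure(2), of "n - j"] derivationD(4)[OF odd_refl_demazure_D(2)]
  by (auto simp: annihilates_one_def act_ed act_et mult_act add_act minus_act a_minus_def)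

text \<open>
  Polynomials are obtained from constants by left multiplication with variables and addition. Moving the
  operator past the variables leaves its value at \<open>1\<close>.
\<close>

lemma imE_eq_zeroI:
  assumes a: "annihilates_one a"
    and "\<And>k. k < n \<Longrightarrow> \<exists>k'<n. a * ey k = ey k' * a \<or> a * ey k = - (ey k' * a)"
  shows "a = 0"
proof (rule imE_eqI)
  show "a \<in> imE" using a by (simp add: annihilates_one_def)
  fix f assume "f \<in> carrier P"
  then have "act a f = \<zero>\<^bsub>P\<^esub>"
  proof (induction f rule: pol_induct)
    case (const c)
    have "act a (const c) = act a (\<one>\<^bsub>P\<^esub> \<otimes>\<^bsub>P\<^esub> const c)" by simp
    also have "\<dots> = \<zero>\<^bsub>P\<^esub>" using a by (subst act_Lam) (auto simp: annihilates_one_def)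
    finally show ?case .
  next
    case (var i g)
    define k where "k = n - i"
    have k: "k < n" "n - k = i" using var by (auto simp: k_def)
    obtain k' where k': "k' < n" "a * ey k = ey k' * a \<or> a * ey k = - (ey k' * a)" using assms(2)[OF k(1)] by blast
    have "act a (var i \<otimes>\<^bsub>P\<^esub> g) = act (a * ey k) g" using k var by (simp add: mult_act)
    also have "\<dots> = \<zero>\<^bsub>P\<^esub>"
    proof -
      have "act (ey k' * a) g = \<zero>\<^bsub>P\<^esub>" "act (- (ey k' * a)) g = \<zero>\<^bsub>P\<^esub>"
        using k'(1) var by (simp_all add: mult_act uminus_act)
      then show ?thesis using k'(2) by metis
    qed
    finally show ?case .
  next
    case (add g h)
    then show ?case by (simp add: act_plus)
  qed
  then show "act a f = act 0 f" using \<open>f \<in> carrier P\<close> by simp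
qed simp

lemma annihilates_one_imE [simp]: "annihilates_one a \<Longrightarrow> a \<in> imE"
  by (simp add: annihilates_one_def)

lemma exchange_ed: "1 \<le> j \<Longrightarrow> j < n \<Longrightarrow> exchange eu (ed j) (ey j) (ey (j - 1))"
  using ed_ey[of j] by unfold_locales (simp_all add: eu_mult)

lemma exchange_et: "exchange eu et (ey 1) (- ey 0)"
  using et_ey by unfold_locales (simp_all add: eu_mult)

lemma ed_ed: "1 \<le> j \<Longrightarrow> j < n \<Longrightarrow> ed j * ed j = 0"
proof (rule imE_eq_zeroI)
  assume j: "1 \<le> j" "j < n"
  show "annihilates_one (ed j * ed j)" using j by simp
  fix k assume k: "k < n"
  have "ed j * ed j * ey k = ey k * (ed j * ed j)"
  proof -
    consider "k = j" | "k = j - 1" | "k \<noteq> j" "k \<noteq> j - 1" by blast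
    then show ?thesis
    proof cases
      case 1 then show ?thesis using exchange.square[OF exchange_ed[OF j]] by simp
    next
      case 2 then show ?thesis using exchange.square[OF exchange.swap[OF exchange_ed[OF j]]] by simp
    next
      case 3
      then have "ey k * ed j = - (ed j * ey k)" using ed_ey(3)[OF j k] by simp
      then show ?thesis by (metis anticommute_mult)
    qed
  qed
  then show "\<exists>k'<n. ed j * ed j * ey k = ey k' * (ed j * ed j) \<or> ed j * ed j * ey k = - (ey k' * (ed j * ed j))"
    using k by blast
qed

lemma et_et: "et * et = 0"
proof (rule imE_eq_zeroI)
  show "annihilates_one (et * et)" by simp
  fix k assume k: "k < n"
  have "et * et * ey k = ey k * (et * et)"
  proof -
    consider "k = 1" | "k = 0" | "2 \<le> k" by linarith
    then show ?thesis
    proof cases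
      case 1 then show ?thesis using exchange.square[OF exchange_et] by simp
    next
      case 2 then show ?thesis using exchange.square[OF exchange.swap[OF exchange_et]] by simp
    next
      case 3
      then have "ey k * et = - (et * ey k)" using et_ey(3)[of k] k by simp
      then show ?thesis by (metis anticommute_mult)
    qed
  qed
  then show "\<exists>k'<n. et * et * ey k = ey k' * (et * et) \<or> et * et * ey k = - (ey k' * (et * et))"
    using k by blast
qed

lemma triple_anticommute:
  fixes a b z :: "'b::ring"
  assumes "a * z = - (z * a)" "b * z = - (z * b)"
  shows "(a * b * a - b * a * b) * z = - (z * (a * b * a - b * a * b))"
proof -
  have "a * (z * w) = - (z * (a * w))" "b * (z * w) = - (z * (b * w))" for w
    using assms by (simp_all flip: mult.assoc)
  then show ?thesis using assms by (simp add: algebra_simps)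
qed

lemma ed_braid:
  assumes j: "1 \<le> j" "Suc j < n"
  shows "ed j * ed (Suc j) * ed j = ed (Suc j) * ed j * ed (Suc j)"
proof -
  let ?T = "ed j * ed (Suc j) * ed j - ed (Suc j) * ed j * ed (Suc j)"
  interpret exchange_pair eu "ed j" "ed (Suc j)" "ey (j - 1)" "ey j" "ey (Suc j)"
    using j ed_ed[of j] ed_ed[of "Suc j"] ed_ey(3)[of j "Suc j"] ed_ey(3)[of "Suc j" "j - 1"]
      exchange.swap[OF exchange_ed[of j]] exchange.swap[OF exchange_ed[of "Suc j"]]
    by (intro exchange_pair.intro exchange_pair_axioms.intro) simp_all
  have "?T = 0"
  proof (rule imE_eq_zeroI)
    show "annihilates_one ?T" using j by simp
    fix k assume k: "k < n"
    consider "k = j - 1" | "k = j" | "k = Suc j" | "k \<noteq> j - 1" "k \<noteq> j" "k \<noteq> Suc j" by blast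
    then show "\<exists>k'<n. ?T * ey k = ey k' * ?T \<or> ?T * ey k = - (ey k' * ?T)"
    proof cases
      case 1 then show ?thesis using braid_x j by blast
    next
      case 2 then show ?thesis using braid_y k by blast
    next
      case 3 then show ?thesis using braid_z j by (intro exI[of _ "j - 1"]) simp
    next
      case 4
      then have "?T * ey k = - (ey k * ?T)" using triple_anticommute[of "ed j" "ey k" "ed (Suc j)"]
          ed_ey(3)[of j k] ed_ey(3)[of "Suc j" k] j k by simp
      then show ?thesis using k by blast
    qed
  qed
  then show ?thesis by simp
qed

lemma et_braid:
  assumes "2 < n"
  shows "et * ed 2 * et = ed 2 * et * ed 2"
proof -
  let ?T = "et * ed 2 * et - ed 2 * et * ed 2"
  have two: "2 - 1 = (1::nat)" by simp
  interpret exchange_pair eu et "ed 2" "- ey 0" "ey 1" "ey 2"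
    using assms ed_ed[of 2] et_et et_ey(3)[of 2] ed_ey(3)[of 2 0]
      exchange.swap[OF exchange_et] exchange.swap[OF exchange_ed[of 2, unfolded two]]
    by (intro exchange_pair.intro exchange_pair_axioms.intro) simp_all
  have "?T = 0"
  proof (rule imE_eq_zeroI)
    show "annihilates_one ?T" using assms by simp
    fix k assume k: "k < n"
    consider "k = 0" | "k = 1" | "k = 2" | "k \<ge> 3" by linarith
    then show "\<exists>k'<n. ?T * ey k = ey k' * ?T \<or> ?T * ey k = - (ey k' * ?T)"
    proof cases
      case 1
      have "?T * ey 0 = ey 2 * ?T" using braid_x by simp
      then show ?thesis using 1 assms by blast
    next
      case 2 then show ?thesis using braid_y k by blast
    next
      case 3
      have "?T * ey 2 = ey 0 * ?T" using braid_z by simp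
      then show ?thesis using 3 assms by (intro exI[of _ 0]) simp
    next
      case 4
      then have "?T * ey k = - (ey k * ?T)" using triple_anticommute[of et "ey k" "ed 2"]
          et_ey(3)[of k] ed_ey(3)[of 2 k] k assms by simp
      then show ?thesis using k by blast
    qed
  qed
  then show ?thesis by simp
qed

lemma pair_commute:
  fixes a b z :: "'b::ring"
  assumes "a * z = - (z * a)" "b * z = - (z * b)"
  shows "(a * b + b * a) * z = z * (a * b + b * a)" "(a * b - b * a) * z = z * (a * b - b * a)"
proof -
  have "a * (z * w) = - (z * (a * w))" "b * (z * w) = - (z * (b * w))" for w
    using assms by (simp_all flip: mult.assoc)
  then show "(a * b + b * a) * z = z * (a * b + b * a)" "(a * b - b * a) * z = z * (a * b - b * a)"
    using assms by (simp_all add: algebra_simps)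
qed

lemma ed_far:
  assumes ij: "1 \<le> i" "Suc i < j" "j < n"
  shows "ed i * ed j = - (ed j * ed i)"
proof -
  let ?T = "ed i * ed j + ed j * ed i"
  have i: "exchange eu (ed i) (ey i) (ey (i - 1))" and j: "exchange eu (ed j) (ey j) (ey (j - 1))"
    using exchange_ed ij by auto
  have "?T = 0"
  proof (rule imE_eq_zeroI)
    show "annihilates_one ?T" using ij by simp
    fix k assume k: "k < n"
    have e: "eu * ed i = ed i" "ed i * eu = ed i" "eu * ed j = ed j" "ed j * eu = ed j"
      using ij by (simp_all add: eu_mult)
    have fi: "ed i * ey j = - (ey j * ed i)" "ed i * ey (j - 1) = - (ey (j - 1) * ed i)"
      "ed j * ey i = - (ey i * ed j)" "ed j * ey (i - 1) = - (ey (i - 1) * ed j)"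
      using ij ed_ey(3)[of i] ed_ey(3)[of j] by auto
    consider "k = i" | "k = i - 1" | "k = j" | "k = j - 1" | "k \<noteq> i" "k \<noteq> i - 1" "k \<noteq> j" "k \<noteq> j - 1" by blast
    then show "\<exists>k'<n. ?T * ey k = ey k' * ?T \<or> ?T * ey k = - (ey k' * ?T)"
    proof cases
      case 1
      have "?T * ey k = ey (i - 1) * ?T" using exchange.far[OF i, of "ed j"] fi e 1 by simp
      then show ?thesis using ij by (intro exI[of _ "i - 1"]) simp
    next
      case 2
      have "?T * ey k = ey i * ?T" using exchange.far[OF exchange.swap[OF i], of "ed j"] fi e 2 by simp
      then show ?thesis using ij by (intro exI[of _ i]) simp
    next
      case 3
      have "?T * ey k = ey (j - 1) * ?T" using exchange.far[OF j, of "ed i"] fi e 3 by (simp add: add.commute)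
      then show ?thesis using ij by (intro exI[of _ "j - 1"]) simp
    next
      case 4
      have "?T * ey k = ey j * ?T" using exchange.far[OF exchange.swap[OF j], of "ed i"] fi e 4 by (simp add: add.commute)
      then show ?thesis using ij by (intro exI[of _ j]) simp
    next
      case 5
      have "?T * ey k = ey k * ?T" using pair_commute(1)[of "ed i" "ey k" "ed j"] ed_ey(3)[of i k] ed_ey(3)[of j k] 5 ij k by simp
      then show ?thesis using k by blast
    qed
  qed
  then show ?thesis by (simp add: eq_neg_iff_add_eq_0)
qed

lemma et_far:
  assumes ij: "3 \<le> j" "j < n"
  shows "et * ed j = - (ed j * et)"
proof -
  let ?T = "et * ed j + ed j * et"
  have j: "exchange eu (ed j) (ey j) (ey (j - 1))" using exchange_ed ij by auto
  have "?T = 0"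
  proof (rule imE_eq_zeroI)
    show "annihilates_one ?T" using ij by simp
    fix k assume k: "k < n"
    have e: "eu * et = et" "et * eu = et" "eu * ed j = ed j" "ed j * eu = ed j"
      using ij by (simp_all add: eu_mult)
    have fi: "et * ey j = - (ey j * et)" "et * ey (j - 1) = - (ey (j - 1) * et)"
      "ed j * ey 1 = - (ey 1 * ed j)" "ed j * ey 0 = - (ey 0 * ed j)"
      using ij et_ey(3)[of j] et_ey(3)[of "j - 1"] ed_ey(3)[of j] by auto
    consider "k = 1" | "k = 0" | "k = j" | "k = j - 1" | "2 \<le> k" "k \<noteq> j" "k \<noteq> j - 1" by linarith
    then show "\<exists>k'<n. ?T * ey k = ey k' * ?T \<or> ?T * ey k = - (ey k' * ?T)"
    proof cases
      case 1
      have "?T * ey k = - (ey 0 * ?T)" using exchange.far[OF exchange_et, of "ed j"] fi e 1 by simp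
      then show ?thesis using ij by (intro exI[of _ 0]) simp
    next
      case 2
      have "?T * ey k = - (ey 1 * ?T)" using exchange.far[OF exchange.swap[OF exchange_et], of "ed j"] fi e 2
        by (simp add: eq_neg_iff_add_eq_0 neg_eq_iff_add_eq_0)
      then show ?thesis using ij by (intro exI[of _ 1]) simp
    next
      case 3
      have "?T * ey k = ey (j - 1) * ?T" using exchange.far[OF j, of et] fi e 3 by (simp add: add.commute)
      then show ?thesis using ij by (intro exI[of _ "j - 1"]) simp
    next
      case 4
      have "?T * ey k = ey j * ?T" using exchange.far[OF exchange.swap[OF j], of et] fi e 4 by (simp add: add.commute)
      then show ?thesis using ij by (intro exI[of _ j]) simp
    next
      case 5
      have "?T * ey k = ey k * ?T" using pair_commute(1)[of et "ey k" "ed j"] et_ey(3)[of k] ed_ey(3)[of j k] 5 ij k by simp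
      then show ?thesis using k by blast
    qed
  qed
  then show ?thesis by (simp add: eq_neg_iff_add_eq_0)
qed

lemma et_ed1: "et * ed 1 = ed 1 * et"
proof -
  let ?T = "et * ed 1 - ed 1 * et"
  have n: "1 < n" "0 < n" using two_le_n by auto
  have d: "exchange eu (ed 1) (ey 1) (ey 0)" using exchange_ed[of 1] n by simp
  have "?T = 0"
  proof (rule imE_eq_zeroI)
    show "annihilates_one ?T" using n by simp
    fix k assume k: "k < n"
    consider "k = 1" | "k = 0" | "2 \<le> k" by linarith
    then show "\<exists>k'<n. ?T * ey k = ey k' * ?T \<or> ?T * ey k = - (ey k' * ?T)"
    proof cases
      case 1
      have "?T * ey k = - (ey 1 * ?T)" using exchange_commute[OF d exchange_et] 1 by simp
      then show ?thesis using n by (intro exI[of _ 1]) simp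
    next
      case 2
      have t: "et * ey 0 = ey 1 * et - eu" and t1: "et * ey 1 = eu + ey 0 * et" by (fact et_ey)+
      have dd: "ed 1 * ey 0 = eu - ey 1 * ed 1" "ed 1 * ey 1 = eu - ey 0 * ed 1" using d by (auto simp: exchange_def)
      have u: "eu * et = et" "et * eu = et" "eu * ed 1 = ed 1" "ed 1 * eu = ed 1" using n by (auto simp: eu_mult)
      have "et * (ey 1 * w) = eu * w + ey 0 * (et * w)" "ed 1 * (ey 1 * w) = eu * w - ey 0 * (ed 1 * w)" for w
        using t1 dd by (simp_all add: distrib_right left_diff_distrib mult.assoc flip: mult.assoc[of et] mult.assoc[of "ed 1"])
      then have "?T * ey k = - (ey 0 * ?T)" using 2 u by (simp add: algebra_simps t dd)
      then show ?thesis using n by (intro exI[of _ 0]) simp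
    next
      case 3
      have "?T * ey k = ey k * ?T" using pair_commute(2)[of et "ey k" "ed 1"] et_ey(3)[of k] ed_ey(3)[of 1 k] 3 k n by simp
      then show ?thesis using k by blast
    qed
  qed
  then show ?thesis by simp
qed

sublocale E: type_D_relations n ey ed et eu
  by (rule type_D_relations.intro)
    ((rule two_le_n ey_ey ed_ed ed_braid ed_far ed_ey et_ey et_et et_ed1 et_braid et_far; assumption)
      | (rule eu_mult, simp))+

end

section \<open>The nilHecke algebra and its polynomial representation\<close>

lemma spinD_rels_closed: "spinD_rels n \<subseteq> carrier (free_algebra (spinD_gens n))"
  unfolding spinD_rels_def Let_def
  by (auto intro!: free_algebra_closed free_algebra_closed_minus simp: spinD_gens_def)

lemma spinD_relsI:
  "1 \<le> i \<Longrightarrow> i \<le> n \<Longrightarrow> 1 \<le> j \<Longrightarrow> j \<le> n \<Longrightarrow> i \<noteq> j \<Longrightarrow> letter (X i) * letter (X j) + letter (X j) * letter (X i) \<in> spinD_rels n"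
  "1 \<le> i \<Longrightarrow> i < n \<Longrightarrow> letter (Del i) * letter (Del i) \<in> spinD_rels n"
  "1 \<le> i \<Longrightarrow> i + 1 < n \<Longrightarrow> letter (Del i) * letter (Del (i + 1)) * letter (Del i) - letter (Del (i + 1)) * letter (Del i) * letter (Del (i + 1)) \<in> spinD_rels n"
  "1 \<le> i \<Longrightarrow> i < n \<Longrightarrow> 1 \<le> j \<Longrightarrow> j < n \<Longrightarrow> \<bar>int i - int j\<bar> > 1 \<Longrightarrow> letter (Del i) * letter (Del j) + letter (Del j) * letter (Del i) \<in> spinD_rels n"
  "1 \<le> i \<Longrightarrow> i < n \<Longrightarrow> letter (X i) * letter (Del i) + letter (Del i) * letter (X (i + 1)) - 1 \<in> spinD_rels n"
  "1 \<le> i \<Longrightarrow> i < n \<Longrightarrow> letter (Del i) * letter (X i) + letter (X (i + 1)) * letter (Del i) - 1 \<in> spinD_rels n"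
  "1 \<le> i \<Longrightarrow> i < n \<Longrightarrow> 1 \<le> j \<Longrightarrow> j \<le> n \<Longrightarrow> j \<noteq> i \<Longrightarrow> j \<noteq> i + 1 \<Longrightarrow> letter (Del i) * letter (X j) + letter (X j) * letter (Del i) \<in> spinD_rels n"
  "letter DelD * letter DelD \<in> spinD_rels n"
  "1 \<le> i \<Longrightarrow> i + 2 = n \<Longrightarrow> letter DelD * letter (Del i) * letter DelD - letter (Del i) * letter DelD * letter (Del i) \<in> spinD_rels n"
  "1 \<le> i \<Longrightarrow> i + 3 \<le> n \<Longrightarrow> letter DelD * letter (Del i) + letter (Del i) * letter DelD \<in> spinD_rels n"
  "1 \<le> i \<Longrightarrow> i + 1 = n \<Longrightarrow> letter DelD * letter (Del i) - letter (Del i) * letter DelD \<in> spinD_rels n"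
  "1 \<le> i \<Longrightarrow> i + 1 = n \<Longrightarrow> letter (X i) * letter DelD - letter DelD * letter (X n) - 1 \<in> spinD_rels n"
  "1 \<le> i \<Longrightarrow> i + 1 = n \<Longrightarrow> letter DelD * letter (X i) - letter (X n) * letter DelD - 1 \<in> spinD_rels n"
  "1 \<le> i \<Longrightarrow> i + 2 \<le> n \<Longrightarrow> letter DelD * letter (X i) + letter (X i) * letter DelD \<in> spinD_rels n"
proof -
  note defs = spinD_rels_def Let_def
  show "1 \<le> i \<Longrightarrow> i \<le> n \<Longrightarrow> 1 \<le> j \<Longrightarrow> j \<le> n \<Longrightarrow> i \<noteq> j \<Longrightarrow> letter (X i) * letter (X j) + letter (X j) * letter (X i) \<in> spinD_rels n"
    by (unfold defs, rule UnI1, rule UnI1, rule UnI1, rule UnI1, rule UnI1, rule UnI1, rule UnI1, rule UnI1, rule UnI1, rule UnI1, rule UnI1, rule UnI1, rule UnI1, rule CollectI, intro exI conjI, rule refl, assumption+)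
  show "1 \<le> i \<Longrightarrow> i < n \<Longrightarrow> letter (Del i) * letter (Del i) \<in> spinD_rels n"
    by (unfold defs, rule UnI1, rule UnI1, rule UnI1, rule UnI1, rule UnI1, rule UnI1, rule UnI1, rule UnI1, rule UnI1, rule UnI1, rule UnI1, rule UnI1, rule UnI2, rule CollectI, intro exI conjI, rule refl, assumption+)
  show "1 \<le> i \<Longrightarrow> i + 1 < n \<Longrightarrow> letter (Del i) * letter (Del (i + 1)) * letter (Del i) - letter (Del (i + 1)) * letter (Del i) * letter (Del (i + 1)) \<in> spinD_rels n"
    by (unfold defs, rule UnI1, rule UnI1, rule UnI1, rule UnI1, rule UnI1, rule UnI1, rule UnI1, rule UnI1, rule UnI1, rule UnI1, rule UnI1, rule UnI2, rule CollectI, intro exI conjI, rule refl, assumption+)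
  show "1 \<le> i \<Longrightarrow> i < n \<Longrightarrow> 1 \<le> j \<Longrightarrow> j < n \<Longrightarrow> \<bar>int i - int j\<bar> > 1 \<Longrightarrow> letter (Del i) * letter (Del j) + letter (Del j) * letter (Del i) \<in> spinD_rels n"
    by (unfold defs, rule UnI1, rule UnI1, rule UnI1, rule UnI1, rule UnI1, rule UnI1, rule UnI1, rule UnI1, rule UnI1, rule UnI1, rule UnI2, rule CollectI, intro exI conjI, rule refl, assumption+)
  show "1 \<le> i \<Longrightarrow> i < n \<Longrightarrow> letter (X i) * letter (Del i) + letter (Del i) * letter (X (i + 1)) - 1 \<in> spinD_rels n"
    by (unfold defs, rule UnI1, rule UnI1, rule UnI1, rule UnI1, rule UnI1, rule UnI1, rule UnI1, rule UnI1, rule UnI1, rule UnI2, rule CollectI, intro exI conjI, rule refl, assumption+)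
  show "1 \<le> i \<Longrightarrow> i < n \<Longrightarrow> letter (Del i) * letter (X i) + letter (X (i + 1)) * letter (Del i) - 1 \<in> spinD_rels n"
    by (unfold defs, rule UnI1, rule UnI1, rule UnI1, rule UnI1, rule UnI1, rule UnI1, rule UnI1, rule UnI1, rule UnI2, rule CollectI, intro exI conjI, rule refl, assumption+)
  show "1 \<le> i \<Longrightarrow> i < n \<Longrightarrow> 1 \<le> j \<Longrightarrow> j \<le> n \<Longrightarrow> j \<noteq> i \<Longrightarrow> j \<noteq> i + 1 \<Longrightarrow> letter (Del i) * letter (X j) + letter (X j) * letter (Del i) \<in> spinD_rels n"
    by (unfold defs, rule UnI1, rule UnI1, rule UnI1, rule UnI1, rule UnI1, rule UnI1, rule UnI1, rule UnI2, rule CollectI, intro exI conjI, rule refl, assumption+)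
  show "letter DelD * letter DelD \<in> spinD_rels n"
    by (unfold defs, rule UnI1, rule UnI1, rule UnI1, rule UnI1, rule UnI1, rule UnI1, rule UnI2, rule singletonI)
  show "1 \<le> i \<Longrightarrow> i + 2 = n \<Longrightarrow> letter DelD * letter (Del i) * letter DelD - letter (Del i) * letter DelD * letter (Del i) \<in> spinD_rels n"
    by (unfold defs, rule UnI1, rule UnI1, rule UnI1, rule UnI1, rule UnI1, rule UnI2, rule CollectI, intro exI conjI, rule refl, assumption+)
  show "1 \<le> i \<Longrightarrow> i + 3 \<le> n \<Longrightarrow> letter DelD * letter (Del i) + letter (Del i) * letter DelD \<in> spinD_rels n"
    by (unfold defs, rule UnI1, rule UnI1, rule UnI1, rule UnI1, rule UnI2, rule CollectI, intro exI conjI, rule refl, assumption+)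
  show "1 \<le> i \<Longrightarrow> i + 1 = n \<Longrightarrow> letter DelD * letter (Del i) - letter (Del i) * letter DelD \<in> spinD_rels n"
    by (unfold defs, rule UnI1, rule UnI1, rule UnI1, rule UnI2, rule CollectI, intro exI conjI, rule refl, assumption+)
  show "1 \<le> i \<Longrightarrow> i + 1 = n \<Longrightarrow> letter (X i) * letter DelD - letter DelD * letter (X n) - 1 \<in> spinD_rels n"
    by (unfold defs, rule UnI1, rule UnI1, rule UnI2, rule CollectI, intro exI conjI, rule refl, assumption+)
  show "1 \<le> i \<Longrightarrow> i + 1 = n \<Longrightarrow> letter DelD * letter (X i) - letter (X n) * letter DelD - 1 \<in> spinD_rels n"
    by (unfold defs, rule UnI1, rule UnI2, rule CollectI, intro exI conjI, rule refl, assumption+)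
  show "1 \<le> i \<Longrightarrow> i + 2 \<le> n \<Longrightarrow> letter DelD * letter (X i) + letter (X i) * letter DelD \<in> spinD_rels n"
    by (unfold defs, rule UnI2, rule CollectI, intro exI conjI, rule refl, assumption+)
qed

context odd_polynomials
begin

abbreviation NH :: "(nh_gen list \<Rightarrow>\<^sub>0 rat) set ring" where "NH \<equiv> spinD_nilHecke n"

sublocale nh: presentation "spinD_gens n" "spinD_rels n :: (nh_gen list \<Rightarrow>\<^sub>0 rat) set"
  rewrites "presented_algebra (spinD_gens n) (spinD_rels n) = NH"
  by (unfold_locales, rule spinD_rels_closed) (simp add: spinD_nilHecke_def)

sublocale NH: ring NH by (rule nh.ring_presented)

definition scalar_op :: "rat \<Rightarrow> (nat list \<Rightarrow>\<^sub>0 rat) set \<Rightarrow> (nat list \<Rightarrow>\<^sub>0 rat) set" where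
  "scalar_op c = (\<lambda>g\<in>carrier P. const c \<otimes>\<^bsub>P\<^esub> g)"

lemma scalar_op_E [simp]: "scalar_op c \<in> carrier E"
  unfolding scalar_op_def by (rule mult_E) simp

lemma E_linear_const: "\<phi> \<in> carrier E \<Longrightarrow> f \<in> carrier P \<Longrightarrow> \<phi> (const c \<otimes>\<^bsub>P\<^esub> f) = const c \<otimes>\<^bsub>P\<^esub> \<phi> f"
  using const_central[of f c] const_central[of "\<phi> f" c] const_Lam[of c] by (auto simp: right_End_mem)

lemma E_closed: "\<phi> \<in> carrier E \<Longrightarrow> f \<in> carrier P \<Longrightarrow> \<phi> f \<in> carrier P"
  by (auto simp: right_End_mem)

sublocale e: algebra_target E scalar_op "spinD_gens n" "gen_action n"
proof (rule algebra_target.intro)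
  show "ring E" by (rule ring_E)
  interpret E': ring E by (rule ring_E)
  show "scalar_op c \<in> carrier E" for c by simp
  show "scalar_op (c + c') = scalar_op c \<oplus>\<^bsub>E\<^esub> scalar_op c'" for c c'
    by (rule right_End_eqI[OF _ E'.a_closed]) (simp_all add: right_End_simps, simp add: scalar_op_def const_add P.l_distr)
  show "scalar_op (c * c') = scalar_op c \<otimes>\<^bsub>E\<^esub> scalar_op c'" for c c'
    by (rule right_End_eqI[OF _ E'.m_closed]) (simp_all add: right_End_simps compose_eq, simp add: scalar_op_def const_mult P.m_assoc)
  show "scalar_op 1 = \<one>\<^bsub>E\<^esub>"
    by (rule right_End_eqI[OF _ E'.one_closed]) (simp_all add: right_End_simps, simp add: scalar_op_def const_one)
  show "gen_action n a \<in> carrier E" if "a \<in> spinD_gens n" for a by (rule gen_action_E[OF that])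
  show "scalar_op c \<otimes>\<^bsub>E\<^esub> gen_action n a = gen_action n a \<otimes>\<^bsub>E\<^esub> scalar_op c" if "a \<in> spinD_gens n" for a c
    by (rule right_End_eqI[OF E'.m_closed E'.m_closed])
      (use gen_action_E[OF that] E_linear_const E_closed in
        \<open>simp_all add: right_End_simps compose_eq\<close>, simp add: scalar_op_def)
qed

lemma embed_action_index:
  "1 \<le> i \<Longrightarrow> i \<le> n \<Longrightarrow> embed E (gen_action n (X i)) = ey (n - i)"
  "1 \<le> i \<Longrightarrow> i < n \<Longrightarrow> embed E (gen_action n (Del i)) = ed (n - i)"
  by (simp_all add: ey_def ed_def)

lemma gens_simps [simp]: "X i \<in> spinD_gens n \<longleftrightarrow> 1 \<le> i \<and> i \<le> n" "Del i \<in> spinD_gens n \<longleftrightarrow> 1 \<le> i \<and> i < n"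
  "DelD \<in> spinD_gens n"
  using two_le_n by (auto simp: spinD_gens_def)

text \<open>
  The relations are sorted by their shape; in each case the corresponding identity between operators
  applies after reversing the indices.
\<close>

lemma free_eval_rel:
  assumes "r \<in> spinD_rels n" shows "e.ev r = 0"
proof -
  have Xe: "e.ev (letter (X i)) = ey (n - i)" if "1 \<le> i" "i \<le> n" for i
    using that by (simp add: e.free_eval_letter embed_action_index del: gen_action.simps)
  have De: "e.ev (letter (Del i)) = ed (n - i)" if "1 \<le> i" "i < n" for i
    using that by (simp add: e.free_eval_letter embed_action_index del: gen_action.simps)
  have Te: "e.ev (letter DelD) = et" by (simp add: e.free_eval_letter et_def del: gen_action.simps)
  have one: "e.ev 1 = eu" by (simp add: e.free_eval_one eu_def)
  note ev = e.free_eval_add e.free_eval_diff e.free_eval_mult Xe De Te one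
  have "(\<exists>i j. r = letter (X i) * letter (X j) + letter (X j) * letter (X i) \<and> 1 \<le> i \<and> i \<le> n \<and> 1 \<le> j \<and> j \<le> n \<and> i \<noteq> j)
    \<or> (\<exists>i. r = letter (Del i) * letter (Del i) \<and> 1 \<le> i \<and> i < n)
    \<or> (\<exists>i. r = letter (Del i) * letter (Del (i + 1)) * letter (Del i) - letter (Del (i + 1)) * letter (Del i) * letter (Del (i + 1)) \<and> 1 \<le> i \<and> i + 1 < n)
    \<or> (\<exists>i j. r = letter (Del i) * letter (Del j) + letter (Del j) * letter (Del i) \<and> 1 \<le> i \<and> i < n \<and> 1 \<le> j \<and> j < n \<and> \<bar>int i - int j\<bar> > 1)
    \<or> (\<exists>i. r = letter (X i) * letter (Del i) + letter (Del i) * letter (X (i + 1)) - 1 \<and> 1 \<le> i \<and> i < n)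
    \<or> (\<exists>i. r = letter (Del i) * letter (X i) + letter (X (i + 1)) * letter (Del i) - 1 \<and> 1 \<le> i \<and> i < n)
    \<or> (\<exists>i j. r = letter (Del i) * letter (X j) + letter (X j) * letter (Del i) \<and> 1 \<le> i \<and> i < n \<and> 1 \<le> j \<and> j \<le> n \<and> j \<noteq> i \<and> j \<noteq> i + 1)
    \<or> r = letter DelD * letter DelD
    \<or> (\<exists>i. r = letter DelD * letter (Del i) * letter DelD - letter (Del i) * letter DelD * letter (Del i) \<and> 1 \<le> i \<and> i + 2 = n)
    \<or> (\<exists>i. r = letter DelD * letter (Del i) + letter (Del i) * letter DelD \<and> 1 \<le> i \<and> i + 3 \<le> n)
    \<or> (\<exists>i. r = letter DelD * letter (Del i) - letter (Del i) * letter DelD \<and> 1 \<le> i \<and> i + 1 = n)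
    \<or> (\<exists>i. r = letter (X i) * letter DelD - letter DelD * letter (X n) - 1 \<and> 1 \<le> i \<and> i + 1 = n)
    \<or> (\<exists>i. r = letter DelD * letter (X i) - letter (X n) * letter DelD - 1 \<and> 1 \<le> i \<and> i + 1 = n)
    \<or> (\<exists>i. r = letter DelD * letter (X i) + letter (X i) * letter DelD \<and> 1 \<le> i \<and> i + 2 \<le> n)"
    using assms unfolding spinD_rels_def Let_def by (simp only: Un_iff mem_Collect_eq insert_iff empty_iff simp_thms disj_assoc)
  then show ?thesis
  proof (elim disjE exE conjE)
    fix i j assume "r = letter (X i) * letter (X j) + letter (X j) * letter (X i)" "1 \<le> i" "i \<le> n" "1 \<le> j" "j \<le> n" "i \<noteq> j"
    then show ?thesis using ey_ey[of "n - i" "n - j"] by (simp add: ev)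
  next
    fix i assume "r = letter (Del i) * letter (Del i)" "1 \<le> i" "i < n"
    then show ?thesis using ed_ed[of "n - i"] by (simp add: ev)
  next
    fix i assume "r = letter (Del i) * letter (Del (i + 1)) * letter (Del i) - letter (Del (i + 1)) * letter (Del i) * letter (Del (i + 1))" "1 \<le> i" "i + 1 < n"
    moreover from this have "n - i = Suc (n - (i + 1))" by simp
    ultimately show ?thesis using ed_braid[of "n - (i + 1)"] by (simp add: ev)
  next
    fix i j assume r: "r = letter (Del i) * letter (Del j) + letter (Del j) * letter (Del i)" "1 \<le> i" "i < n" "1 \<le> j" "j < n" "\<bar>int i - int j\<bar> > 1"
    then consider "i + 1 < j" | "j + 1 < i" by linarith
    then have "ed (n - i) * ed (n - j) = - (ed (n - j) * ed (n - i))"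
    proof cases
      case 1 then show ?thesis using ed_far[of "n - j" "n - i"] r by simp
    next
      case 2 then show ?thesis using ed_far[of "n - i" "n - j"] r by simp
    qed
    then show ?thesis using r by (simp add: ev)
  next
    fix i assume r: "r = letter (X i) * letter (Del i) + letter (Del i) * letter (X (i + 1)) - 1" "1 \<le> i" "i < n"
    have "n - (i + 1) = n - i - 1" by simp
    then show ?thesis using ed_ey(2)[of "n - i"] r by (simp add: ev)
  next
    fix i assume r: "r = letter (Del i) * letter (X i) + letter (X (i + 1)) * letter (Del i) - 1" "1 \<le> i" "i < n"
    have "n - (i + 1) = n - i - 1" by simp
    then show ?thesis using ed_ey(1)[of "n - i"] r by (simp add: ev)
  next
    fix i j assume r: "r = letter (Del i) * letter (X j) + letter (X j) * letter (Del i)" "1 \<le> i" "i < n" "1 \<le> j" "j \<le> n" "j \<noteq> i" "j \<noteq> i + 1"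
    then show ?thesis using ed_ey(3)[of "n - i" "n - j"] by (simp add: ev)
  next
    assume "r = letter DelD * letter DelD"
    then show ?thesis using et_et by (simp add: ev)
  next
    fix i assume r: "r = letter DelD * letter (Del i) * letter DelD - letter (Del i) * letter DelD * letter (Del i)" "1 \<le> i" "i + 2 = n"
    then have "n - i = 2" "2 < n" by auto
    then show ?thesis using et_braid r by (simp add: ev)
  next
    fix i assume r: "r = letter DelD * letter (Del i) + letter (Del i) * letter DelD" "1 \<le> i" "i + 3 \<le> n"
    then show ?thesis using et_far[of "n - i"] by (simp add: ev)
  next
    fix i assume r: "r = letter DelD * letter (Del i) - letter (Del i) * letter DelD" "1 \<le> i" "i + 1 = n"
    then have "n - i = 1" by auto
    then show ?thesis using et_ed1 r by (simp add: ev)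
  next
    fix i assume r: "r = letter (X i) * letter DelD - letter DelD * letter (X n) - 1" "1 \<le> i" "i + 1 = n"
    then have "n - i = 1" by auto
    then show ?thesis using et_ey(2) r by (simp add: ev)
  next
    fix i assume r: "r = letter DelD * letter (X i) - letter (X n) * letter DelD - 1" "1 \<le> i" "i + 1 = n"
    then have "n - i = 1" by auto
    then show ?thesis using et_ey(1) r by (simp add: ev)
  next
    fix i assume r: "r = letter DelD * letter (X i) + letter (X i) * letter DelD" "1 \<le> i" "i + 2 \<le> n"
    then show ?thesis using et_ey(3)[of "n - i"] by (simp add: ev)
  qed
qed

text \<open>
  The action of the nilHecke algebra on its polynomial representation.
\<close>

definition \<Phi> :: "(nh_gen list \<Rightarrow>\<^sub>0 rat) set \<Rightarrow> (nat list \<Rightarrow>\<^sub>0 rat) set \<Rightarrow> (nat list \<Rightarrow>\<^sub>0 rat) set" where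
  "\<Phi> = (SOME h. h \<in> ring_hom NH E \<and> (\<forall>a\<in>spinD_gens n. h (nilHecke_gen n a) = gen_action n a) \<and>
    (\<forall>c. h (nh.cls (Poly_Mapping.single [] c)) = scalar_op c))"

lemma Phi: "\<Phi> \<in> ring_hom NH E" "a \<in> spinD_gens n \<Longrightarrow> \<Phi> (nilHecke_gen n a) = gen_action n a"
  "\<Phi> (nh.cls (Poly_Mapping.single [] c)) = scalar_op c"
proof -
  have "\<exists>h. h \<in> ring_hom NH E \<and> (\<forall>a\<in>spinD_gens n. h (nilHecke_gen n a) = gen_action n a) \<and>
    (\<forall>c. h (nh.cls (Poly_Mapping.single [] c)) = scalar_op c)"
    using e.presented_universal[OF spinD_rels_closed free_eval_rel]
    unfolding spinD_nilHecke_def[symmetric] nilHecke_gen_def by blast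
  from someI_ex[OF this] show "\<Phi> \<in> ring_hom NH E" "a \<in> spinD_gens n \<Longrightarrow> \<Phi> (nilHecke_gen n a) = gen_action n a"
    "\<Phi> (nh.cls (Poly_Mapping.single [] c)) = scalar_op c"
    unfolding \<Phi>_def[symmetric] by blast+
qed

subsection \<open>The relations between the generators\<close>

abbreviation nh_const :: "rat \<Rightarrow> _" where "nh_const c \<equiv> nh.cls (Poly_Mapping.single [] c)"

definition "gu = embed NH \<one>\<^bsub>NH\<^esub>"
definition "gy k = embed NH (nilHecke_gen n (X (n - k)))"
definition "gd j = embed NH (nilHecke_gen n (Del (n - j)))"
definition "gt = embed NH (nilHecke_gen n DelD)"

abbreviation em :: "(nh_gen list \<Rightarrow>\<^sub>0 rat) \<Rightarrow> (nh_gen list \<Rightarrow>\<^sub>0 rat) set all_rings" where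
  "em p \<equiv> embed NH (nh.cls p)"

lemma gen_closed [simp]: "a \<in> spinD_gens n \<Longrightarrow> nilHecke_gen n a \<in> carrier NH"
  unfolding nilHecke_gen_def by simp

lemma em_simps:
  "p \<in> carrier nh.F \<Longrightarrow> q \<in> carrier nh.F \<Longrightarrow> em (p + q) = em p + em q"
  "p \<in> carrier nh.F \<Longrightarrow> q \<in> carrier nh.F \<Longrightarrow> em (p * q) = em p * em q"
  "p \<in> carrier nh.F \<Longrightarrow> em (- p) = - em p" "em 1 = gu"
  by (simp_all add: nh.presented_class_add nh.presented_class_mult nh.presented_class_uminus nh.presented_class_one
      gu_def embed_add[OF NH.ring_axioms] embed_mult[OF NH.ring_axioms] embed_uminus[OF NH.ring_axioms])

lemma em_minus: "p \<in> carrier nh.F \<Longrightarrow> q \<in> carrier nh.F \<Longrightarrow> em (p - q) = em p - em q"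
  using em_simps(1)[of p "- q"] em_simps(3)[of q] by simp

lemma em_rel: "r \<in> spinD_rels n \<Longrightarrow> em r = 0"
  using nh.presented_class_rel[of r] by (simp add: embed_zero[OF NH.ring_axioms])

lemma em_letter: "k < n \<Longrightarrow> em (letter (X (n - k))) = gy k" "em (letter (Del (n - j))) = gd j" "em (letter DelD) = gt"
  by (simp_all add: gy_def gd_def gt_def nilHecke_gen_def)

abbreviation "imH \<equiv> embed NH ` carrier NH"

lemma imH_closed [simp]:
  "a \<in> imH \<Longrightarrow> b \<in> imH \<Longrightarrow> a + b \<in> imH" "a \<in> imH \<Longrightarrow> b \<in> imH \<Longrightarrow> a * b \<in> imH"
  "a \<in> imH \<Longrightarrow> - a \<in> imH" "0 \<in> imH"
  using embed_zero[OF NH.ring_axioms, symmetric]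
  by (auto simp flip: embed_add[OF NH.ring_axioms] embed_mult[OF NH.ring_axioms] embed_uminus[OF NH.ring_axioms])

lemma h_gens [simp]: "gu \<in> imH" "k < n \<Longrightarrow> gy k \<in> imH" "1 \<le> j \<Longrightarrow> j < n \<Longrightarrow> gd j \<in> imH" "gt \<in> imH"
  unfolding gu_def gy_def gd_def gt_def by (intro imageI gen_closed NH.one_closed; simp)+

lemma gu_mult [simp]: "a \<in> imH \<Longrightarrow> gu * a = a" "a \<in> imH \<Longrightarrow> a * gu = a"
  by (auto simp: gu_def simp flip: embed_mult[OF NH.ring_axioms])

sublocale NR: type_D_relations n gy gd gt gu
proof (rule type_D_relations.intro)
  note ems = em_simps em_minus em_letter
  have X [simp]: "letter (X (n - k)) \<in> carrier nh.F" if "k < n" for k using that by simp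
  have D [simp]: "letter (Del (n - j)) \<in> carrier nh.F" if "1 \<le> j" "j < n" for j using that by simp
  have T [simp]: "letter DelD \<in> carrier nh.F" by simp
  show "2 \<le> n" by (rule two_le_n)
  show "gu * gu = gu" "gu * gt = gt" "gt * gu = gt" by simp_all
  show "gu * gy k = gy k" "gy k * gu = gy k" if "k < n" for k using that by simp_all
  show "gu * gd j = gd j" "gd j * gu = gd j" if "1 \<le> j" "j < n" for j using that by simp_all
  show "gy i * gy j = - (gy j * gy i)" if "i < n" "j < n" "i \<noteq> j" for i j
  proof -
    let ?r = "letter (X (n - i)) * letter (X (n - j)) + letter (X (n - j)) * letter (X (n - i)) :: nh_gen list \<Rightarrow>\<^sub>0 rat"
    have "n - i \<noteq> n - j" "1 \<le> n - i" "1 \<le> n - j" using that by auto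
    then have "?r \<in> spinD_rels n" by (intro spinD_relsI) simp_all
    from em_rel[OF this] show ?thesis using that by (simp add: ems eq_neg_iff_add_eq_0)
  qed
  show "gd j * gd j = 0" if "1 \<le> j" "j < n" for j
  proof -
    let ?r = "letter (Del (n - j)) * letter (Del (n - j)) :: nh_gen list \<Rightarrow>\<^sub>0 rat"
    have "1 \<le> n - j" "n - j < n" using that by auto
    then have "?r \<in> spinD_rels n" by (intro spinD_relsI) simp_all
    from em_rel[OF this] show ?thesis using that by (simp add: ems)
  qed
  show "gd j * gd (Suc j) * gd j = gd (Suc j) * gd j * gd (Suc j)" if "1 \<le> j" "Suc j < n" for j
  proof -
    let ?i = "n - Suc j"
    let ?r = "letter (Del ?i) * letter (Del (?i + 1)) * letter (Del ?i) - letter (Del (?i + 1)) * letter (Del ?i) * letter (Del (?i + 1)) :: nh_gen list \<Rightarrow>\<^sub>0 rat"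
    have i: "1 \<le> ?i" "?i + 1 < n" "?i + 1 = n - j" using that by auto
    then have "?r \<in> spinD_rels n" by (intro spinD_relsI) simp_all
    from em_rel[OF this] show ?thesis using that D[of "Suc j"] D[of j] unfolding i(3) by (simp add: ems)
  qed
  show "gd i * gd j = - (gd j * gd i)" if "1 \<le> i" "Suc i < j" "j < n" for i j
  proof -
    let ?r = "letter (Del (n - i)) * letter (Del (n - j)) + letter (Del (n - j)) * letter (Del (n - i)) :: nh_gen list \<Rightarrow>\<^sub>0 rat"
    have "1 \<le> n - i" "n - i < n" "1 \<le> n - j" "n - j < n" "\<bar>int (n - i) - int (n - j)\<bar> > 1" using that by auto
    then have "?r \<in> spinD_rels n" by (intro spinD_relsI) simp_all
    from em_rel[OF this] show ?thesis using that by (simp add: ems eq_neg_iff_add_eq_0)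
  qed
  show "gd j * gy j = gu - gy (j - 1) * gd j" if j: "1 \<le> j" "j < n" for j
  proof -
    let ?i = "n - j"
    let ?r = "letter (Del ?i) * letter (X ?i) + letter (X (?i + 1)) * letter (Del ?i) - 1 :: nh_gen list \<Rightarrow>\<^sub>0 rat"
    have i: "1 \<le> ?i" "?i < n" "?i + 1 = n - (j - 1)" "j - 1 < n" using j by auto
    then have "?r \<in> spinD_rels n" by (intro spinD_relsI) simp_all
    from em_rel[OF this] show ?thesis using j i(4) X[of "j - 1"] em_letter(1)[of "j - 1"] unfolding i(3) by (simp add: ems eq_diff_eq)
  qed
  show "gd j * gy (j - 1) = gu - gy j * gd j" if j: "1 \<le> j" "j < n" for j
  proof -
    let ?i = "n - j"
    let ?r = "letter (X ?i) * letter (Del ?i) + letter (Del ?i) * letter (X (?i + 1)) - 1 :: nh_gen list \<Rightarrow>\<^sub>0 rat"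
    have i: "1 \<le> ?i" "?i < n" "?i + 1 = n - (j - 1)" "j - 1 < n" using j by auto
    then have "?r \<in> spinD_rels n" by (intro spinD_relsI) simp_all
    from em_rel[OF this] show ?thesis using j i(4) X[of "j - 1"] em_letter(1)[of "j - 1"] unfolding i(3) by (simp add: ems eq_diff_eq add.commute)
  qed
  show "gd j * gy k = - (gy k * gd j)" if j: "1 \<le> j" "j < n" and k: "k < n" "k \<noteq> j" "k \<noteq> j - 1" for j k
  proof -
    let ?r = "letter (Del (n - j)) * letter (X (n - k)) + letter (X (n - k)) * letter (Del (n - j)) :: nh_gen list \<Rightarrow>\<^sub>0 rat"
    have "1 \<le> n - j" "n - j < n" "1 \<le> n - k" "n - k \<le> n" "n - k \<noteq> n - j" "n - k \<noteq> n - j + 1" using j k by auto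
    then have "?r \<in> spinD_rels n" by (intro spinD_relsI) simp_all
    from em_rel[OF this] show ?thesis using j k by (simp add: ems eq_neg_iff_add_eq_0)
  qed
  show "gt * gt = 0"
  proof -
    have "letter DelD * letter DelD \<in> (spinD_rels n :: (nh_gen list \<Rightarrow>\<^sub>0 rat) set)" by (rule spinD_relsI)
    from em_rel[OF this] show ?thesis by (simp add: ems)
  qed
  show "gt * gd 1 = gd 1 * gt"
  proof -
    have "1 \<le> n - 1" "n - 1 + 1 = n" using two_le_n by auto
    then have "letter DelD * letter (Del (n - 1)) - letter (Del (n - 1)) * letter DelD \<in> (spinD_rels n :: (nh_gen list \<Rightarrow>\<^sub>0 rat) set)"
      by (intro spinD_relsI) simp_all
    from em_rel[OF this] show ?thesis using two_le_n D[of 1] by (simp add: ems)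
  qed
  show "gt * gd 2 * gt = gd 2 * gt * gd 2" if "2 < n"
  proof -
    have "1 \<le> n - 2" "n - 2 + 2 = n" using that by auto
    then have "letter DelD * letter (Del (n - 2)) * letter DelD - letter (Del (n - 2)) * letter DelD * letter (Del (n - 2)) \<in> (spinD_rels n :: (nh_gen list \<Rightarrow>\<^sub>0 rat) set)"
      by (intro spinD_relsI) simp_all
    from em_rel[OF this] show ?thesis using that D[of 2] by (simp add: ems)
  qed
  show "gt * gd j = - (gd j * gt)" if "3 \<le> j" "j < n" for j
  proof -
    have "1 \<le> n - j" "n - j + 3 \<le> n" using that by auto
    then have "letter DelD * letter (Del (n - j)) + letter (Del (n - j)) * letter DelD \<in> (spinD_rels n :: (nh_gen list \<Rightarrow>\<^sub>0 rat) set)"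
      by (intro spinD_relsI) simp_all
    from em_rel[OF this] show ?thesis using that by (simp add: ems eq_neg_iff_add_eq_0)
  qed
  have n1: "1 \<le> n - 1" "n - 1 + 1 = n" "1 < n" "0 < n" using two_le_n by auto
  have X0: "letter (X n) \<in> carrier nh.F" "em (letter (X n)) = gy 0" using X[of 0] em_letter(1)[of 0] n1 by auto
  show "gt * gy 1 = gu + gy 0 * gt"
  proof -
    have "letter DelD * letter (X (n - 1)) - letter (X n) * letter DelD - 1 \<in> (spinD_rels n :: (nh_gen list \<Rightarrow>\<^sub>0 rat) set)"
      using n1 by (intro spinD_relsI) simp_all
    from em_rel[OF this] show ?thesis using n1 X[of 1] X0 by (simp add: ems diff_eq_eq)
  qed
  show "gt * gy 0 = gy 1 * gt - gu"
  proof -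
    have "letter (X (n - 1)) * letter DelD - letter DelD * letter (X n) - 1 \<in> (spinD_rels n :: (nh_gen list \<Rightarrow>\<^sub>0 rat) set)"
      using n1 by (intro spinD_relsI) simp_all
    from em_rel[OF this] show ?thesis using n1 X[of 1] X0 by (simp add: ems algebra_simps)
  qed
  show "gt * gy k = - (gy k * gt)" if "2 \<le> k" "k < n" for k
  proof -
    have "1 \<le> n - k" "n - k + 2 \<le> n" using that by auto
    then have "letter DelD * letter (X (n - k)) + letter (X (n - k)) * letter DelD \<in> (spinD_rels n :: (nh_gen list \<Rightarrow>\<^sub>0 rat) set)"
      by (intro spinD_relsI) simp_all
    from em_rel[OF this] show ?thesis using that by (simp add: ems eq_neg_iff_add_eq_0)
  qed
qed

end

section \<open>Polynomials inside the nilHecke algebra\<close>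

context odd_polynomials
begin

lemma nh_const_commute: "x \<in> carrier NH \<Longrightarrow> nh_const c \<otimes>\<^bsub>NH\<^esub> x = x \<otimes>\<^bsub>NH\<^esub> nh_const c"
proof -
  assume "x \<in> carrier NH"
  then obtain p where "p \<in> carrier nh.F" "x = nh.cls p" using nh.presented_carrierE by blast
  then show ?thesis by (simp add: const_commute flip: nh.presented_class_mult)
qed

sublocale j: algebra_target NH nh_const "{1..n}" "\<lambda>i. nilHecke_gen n (X i)"
proof (rule algebra_target.intro)
  show "ring NH" by (rule NH.ring_axioms)
  show "nh_const (c + c') = nh_const c \<oplus>\<^bsub>NH\<^esub> nh_const c'" for c c'
    by (simp add: single_add nh.presented_class_add)
  show "nh_const (c * c') = nh_const c \<otimes>\<^bsub>NH\<^esub> nh_const c'" for c c'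
    using nh.presented_class_mult[of "Poly_Mapping.single [] c" "Poly_Mapping.single [] c'"]
    by (simp add: mult_single plus_list_def)
  show "nh_const 1 = \<one>\<^bsub>NH\<^esub>" by (simp add: single_Nil_one nh.presented_class_one)
qed (simp_all add: nh_const_commute)

lemma free_eval_odd_pol_rel:
  assumes "r \<in> odd_pol_rels n" shows "j.ev r = 0"
proof -
  obtain i k where ik: "r = letter i * letter k + letter k * letter i" "i \<in> {1..n}" "k \<in> {1..n}" "i \<noteq> k"
    using assms by (auto simp: odd_pol_rels_def)
  have g: "embed NH (nilHecke_gen n (X a)) = gy (n - a)" if "a \<in> {1..n}" for a
    using that by (simp add: gy_def)
  have "gy (n - i) * gy (n - k) = - (gy (n - k) * gy (n - i))" using ik by (intro NR.y_y) auto
  then show ?thesis using ik g by (simp add: j.free_eval_add j.free_eval_mult j.free_eval_letter)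
qed

text \<open>
  The inclusion of the polynomials as the subalgebra generated by the variables; \<open>eJ\<close> is its composition
  with the embedding into the product of all rings.
\<close>

definition J :: "(nat list \<Rightarrow>\<^sub>0 rat) set \<Rightarrow> (nh_gen list \<Rightarrow>\<^sub>0 rat) set" where
  "J = (SOME h. h \<in> ring_hom P NH \<and> (\<forall>i\<in>{1..n}. h (var i) = nilHecke_gen n (X i)) \<and>
    (\<forall>c. h (const c) = nh_const c))"

lemma J: "J \<in> ring_hom P NH" "i \<in> {1..n} \<Longrightarrow> J (var i) = nilHecke_gen n (X i)" "J (const c) = nh_const c"
proof -
  have "\<exists>h. h \<in> ring_hom P NH \<and> (\<forall>i\<in>{1..n}. h (var i) = nilHecke_gen n (X i)) \<and> (\<forall>c. h (const c) = nh_const c)"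
    using j.presented_universal[OF odd_pol_rels_closed free_eval_odd_pol_rel]
    unfolding odd_pol_def[symmetric] pol_var_def[symmetric] pol_const_def[symmetric] by blast
  from someI_ex[OF this] show "J \<in> ring_hom P NH" "i \<in> {1..n} \<Longrightarrow> J (var i) = nilHecke_gen n (X i)" "J (const c) = nh_const c"
    unfolding J_def[symmetric] by blast+
qed

definition "eJ f = embed NH (J f)"

lemma J_closed [simp]: "f \<in> carrier P \<Longrightarrow> J f \<in> carrier NH"
  using ring_hom_closed[OF J(1)] .

lemma eJ_imH [simp]: "f \<in> carrier P \<Longrightarrow> eJ f \<in> imH"
  by (simp add: eJ_def)

lemma eJ_add: "f \<in> carrier P \<Longrightarrow> g \<in> carrier P \<Longrightarrow> eJ (f \<oplus>\<^bsub>P\<^esub> g) = eJ f + eJ g"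
  and eJ_mult: "f \<in> carrier P \<Longrightarrow> g \<in> carrier P \<Longrightarrow> eJ (f \<otimes>\<^bsub>P\<^esub> g) = eJ f * eJ g"
  and eJ_one: "eJ \<one>\<^bsub>P\<^esub> = gu"
  using ring_hom_add[OF J(1)] ring_hom_mult[OF J(1)] ring_hom_one[OF J(1)]
  by (simp_all add: eJ_def gu_def embed_add[OF NH.ring_axioms] embed_mult[OF NH.ring_axioms])

lemma eJ_zero: "eJ \<zero>\<^bsub>P\<^esub> = 0"
  using eJ_add[of "\<zero>\<^bsub>P\<^esub>" "\<zero>\<^bsub>P\<^esub>"] by simp

lemma eJ_uminus: "f \<in> carrier P \<Longrightarrow> eJ (\<ominus>\<^bsub>P\<^esub> f) = - eJ f"
  using eJ_add[of "\<ominus>\<^bsub>P\<^esub> f" f] by (simp add: P.l_neg eJ_zero eq_neg_iff_add_eq_0)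

lemma eJ_var: "k < n \<Longrightarrow> eJ (yv k) = gy k"
  by (simp add: eJ_def J gy_def)

lemma eJ_const_commute: "a \<in> imH \<Longrightarrow> eJ (const c) * a = a * eJ (const c)"
  using nh_const_commute by (auto simp: eJ_def J simp flip: embed_mult[OF NH.ring_axioms])

text \<open>
  The commutation rule \<open>a * f = D f + s f * a\<close> between a Demazure generator and polynomials. Both sides are
  compatible with products by the twisted Leibniz rule, so variables suffice.
\<close>

lemma derivation_exchange:
  assumes s: "is_endo img s" and D: "is_derivation s val D" and a: "a \<in> imH"
    and val: "\<And>i. i \<in> {1..n} \<Longrightarrow> val i \<in> carrier P" and img: "\<And>i. i \<in> {1..n} \<Longrightarrow> img i \<in> carrier P"
    and var: "\<And>i. i \<in> {1..n} \<Longrightarrow> a * eJ (var i) = eJ (val i) + eJ (img i) * a"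
    and f: "f \<in> carrier P"
  shows "a * eJ f = eJ (D f) + eJ (s f) * a"
  using f
proof (induction f rule: pol_induct)
  case (const c)
  then show ?case using eJ_const_commute[OF a, of c] derivation_const[OF D] s by (simp add: eJ_zero is_endo_def)
next
  case (var i g)
  have sg: "s g \<in> carrier P" "D g \<in> carrier P" using endoD(1)[OF s] derivationD(2)[OF D] var by auto
  have "s (pol_var n i \<otimes>\<^bsub>P\<^esub> g) = img i \<otimes>\<^bsub>P\<^esub> s g" 
    using ring_hom_mult[of s P P "pol_var n i" g] s var by (simp add: is_endo_def)
  moreover have "D (pol_var n i \<otimes>\<^bsub>P\<^esub> g) = val i \<otimes>\<^bsub>P\<^esub> g \<oplus>\<^bsub>P\<^esub> img i \<otimes>\<^bsub>P\<^esub> D g"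
    using derivationD(5,6)[OF D] endoD(2)[OF s] var by simp
  moreover have "a * eJ (pol_var n i \<otimes>\<^bsub>P\<^esub> g) = (eJ (val i) + eJ (img i) * a) * eJ g"
    using assms(6)[of i] var by (simp add: eJ_mult flip: mult.assoc)
  moreover have "\<dots> = eJ (val i) * eJ g + eJ (img i) * (eJ (D g) + eJ (s g) * a)"
    using var by (simp add: distrib_right mult.assoc)
  ultimately show ?case using var sg assms(4,5)[of i]
    by (simp add: eJ_add eJ_mult distrib_left mult.assoc add.assoc)
next
  case (add g h)
  then show ?case using derivationD(2,3)[OF D] endoD(1)[OF s] ring_hom_add[of s P P g h] s
    by (simp add: is_endo_def eJ_add distrib_left distrib_right add_ac)
qed

lemma gd_eJ:
  assumes j: "1 \<le> j" "j < n" and f: "f \<in> carrier P"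
  shows "gd j * eJ f = eJ (odd_demazure n (n - j) f) + eJ (odd_refl n (n - j) f) * gd j"
proof (rule derivation_exchange[OF odd_refl_demazure[of "n - j"]])
  fix i assume i: "i \<in> {1..n}"
  define k where "k = n - i"
  have k: "i = n - k" "k < n" using i by (auto simp: k_def)
  have v: "var (n - j + 1) \<in> carrier P" by (rule var_closed) (use j in auto)
  then show "dem_val (n - j) i \<in> carrier P" "refl_img (n - j) i \<in> carrier P"
    using i j by (auto simp: dem_val_def refl_img_def simp del: Nat.add_diff_assoc2 Nat.diff_add_assoc2)
  have "eJ (pol_var n (n - j + 1)) = gy (j - 1)" using eJ_var[of "j - 1"] j by (auto simp: Suc_diff_le)
  note e = this v
  consider "k = j" | "k = j - 1" | "k \<noteq> j" "k \<noteq> j - 1" by blast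
  then show "gd j * eJ (var i) = eJ (dem_val (n - j) i) + eJ (refl_img (n - j) i) * gd j"
  proof cases
    case 1
    then have "dem_val (n - j) i = \<one>\<^bsub>P\<^esub>" "refl_img (n - j) i = \<ominus>\<^bsub>P\<^esub> pol_var n (n - j + 1)"
      using k by (auto simp: dem_val_def refl_img_def)
    then show ?thesis using 1 k e NR.d_y[OF j] by (simp add: eJ_one eJ_uminus eJ_var del: One_nat_def)
  next
    case 2
    then have i': "i = n - j + 1" using k j by auto
    then have "dem_val (n - j) i = \<one>\<^bsub>P\<^esub>" "refl_img (n - j) i = \<ominus>\<^bsub>P\<^esub> yv j"
      by (auto simp: dem_val_def refl_img_def)
    then show ?thesis using 2 i' j e NR.d_y_pred[OF j] by (simp add: eJ_one eJ_uminus eJ_var)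
  next
    case 3
    then have "i \<noteq> n - j" "i \<noteq> n - j + 1" using k j by auto
    then have "dem_val (n - j) i = \<zero>\<^bsub>P\<^esub>" "refl_img (n - j) i = \<ominus>\<^bsub>P\<^esub> yv k"
      using k by (auto simp: dem_val_def refl_img_def)
    then show ?thesis using k NR.d_y_far[OF j, of k] 3 by (simp add: eJ_zero eJ_uminus eJ_var)
  qed
qed (use j f in auto)

lemma gt_eJ:
  assumes f: "f \<in> carrier P"
  shows "gt * eJ f = eJ (odd_demazure_D n f) + eJ (odd_refl_D n f) * gt"
proof (rule derivation_exchange[OF odd_refl_demazure_D])
  have n: "1 < n" "0 < n" using two_le_n by auto
  fix i assume i: "i \<in> {1..n}"
  define k where "k = n - i"
  have k: "i = n - k" "k < n" using i by (auto simp: k_def)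
  show "dem_val_D i \<in> carrier P" "refl_img_D i \<in> carrier P"
    using i n by (auto simp: dem_val_D_def refl_img_D_def)
  have e: "eJ (var n) = gy 0" "eJ (var (n - 1)) = gy 1" using eJ_var[of 0] eJ_var[of 1] n by auto
  have nn: "n - 1 \<noteq> n" using n by auto
  consider "k = 0" | "k = 1" | "2 \<le> k" by linarith
  then show "gt * eJ (var i) = eJ (dem_val_D i) + eJ (refl_img_D i) * gt"
  proof cases
    case 1
    then have "dem_val_D i = \<ominus>\<^bsub>P\<^esub> \<one>\<^bsub>P\<^esub>" "refl_img_D i = var (n - 1)"
      using k by (auto simp: dem_val_D_def refl_img_D_def)
    then show ?thesis using 1 k e NR.t_y0 by (simp add: eJ_one eJ_uminus)
  next
    case 2
    then have "dem_val_D i = \<one>\<^bsub>P\<^esub>" "refl_img_D i = var n"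
      using k nn by (auto simp: dem_val_D_def refl_img_D_def)
    then show ?thesis using 2 k e NR.t_y1 by (simp add: eJ_one)
  next
    case 3
    then have "i \<noteq> n" "i \<noteq> n - 1" using k by auto
    then have "dem_val_D i = \<zero>\<^bsub>P\<^esub>" "refl_img_D i = \<ominus>\<^bsub>P\<^esub> yv k"
      using k by (auto simp: dem_val_D_def refl_img_D_def)
    then show ?thesis using k NR.t_y_far[of k] 3 by (simp add: eJ_zero eJ_uminus eJ_var)
  qed
qed (use f in auto)

lemma eJ_gd:
  assumes j: "1 \<le> j" "j < n" and f: "f \<in> carrier P"
  shows "\<exists>p\<in>carrier P. \<exists>q\<in>carrier P. eJ f * gd j = gd j * eJ p + eJ q"
  using f
proof (induction f rule: pol_induct)
  case (const c)
  have "eJ (const c) * gd j = gd j * eJ (const c) + eJ \<zero>\<^bsub>P\<^esub>" using eJ_const_commute[of "gd j" c] j by (simp add: eJ_zero)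
  then show ?case using const_closed P.zero_closed by blast
next
  case (var i g)
  define k where "k = n - i"
  have k: "i = n - k" "k < n" using var by (auto simp: k_def)
  obtain p q where pq: "p \<in> carrier P" "q \<in> carrier P" "eJ g * gd j = gd j * eJ p + eJ q" using var by blast
  have "\<exists>p'\<in>carrier P. \<exists>q'\<in>carrier P. gy k * gd j = gd j * eJ p' + eJ q'"
  proof -
    consider "k = j" | "k = j - 1" | "k \<noteq> j" "k \<noteq> j - 1" by blast
    then show ?thesis
    proof cases
      case 1
      have v: "yv (j - 1) \<in> carrier P" by (rule yv_closed) (use j in auto)
      have "gy k * gd j = gd j * eJ (\<ominus>\<^bsub>P\<^esub> yv (j - 1)) + eJ \<one>\<^bsub>P\<^esub>"
        unfolding eJ_uminus[OF v] using 1 j eJ_var[of "j - 1"] NR.d_y_pred[OF j] by (simp add: eJ_one)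
      then show ?thesis using v P.a_inv_closed P.one_closed by blast
    next
      case 2
      have "gy k * gd j = gd j * eJ (\<ominus>\<^bsub>P\<^esub> yv j) + eJ \<one>\<^bsub>P\<^esub>"
        using 2 j eJ_var[of j] NR.d_y[OF j] by (simp add: eJ_one eJ_uminus)
      then show ?thesis using j P.a_inv_closed P.one_closed yv_closed by metis
    next
      case 3
      have "gy k * gd j = gd j * eJ (\<ominus>\<^bsub>P\<^esub> yv k) + eJ \<zero>\<^bsub>P\<^esub>"
        using 3 k j NR.d_y_far[OF j, of k] by (simp add: eJ_zero eJ_uminus eJ_var)
      then show ?thesis using k P.a_inv_closed P.zero_closed yv_closed by metis
    qed
  qed
  then obtain p' q' where pq': "p' \<in> carrier P" "q' \<in> carrier P" "gy k * gd j = gd j * eJ p' + eJ q'" by blast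
  have "eJ (pol_var n i \<otimes>\<^bsub>P\<^esub> g) * gd j = gy k * (gd j * eJ p + eJ q)"
    using var k pq by (simp add: eJ_mult eJ_var mult.assoc)
  also have "\<dots> = gy k * gd j * eJ p + gy k * eJ q" by (simp add: distrib_left mult.assoc)
  also have "\<dots> = gd j * eJ (p' \<otimes>\<^bsub>P\<^esub> p) + eJ (q' \<otimes>\<^bsub>P\<^esub> p \<oplus>\<^bsub>P\<^esub> yv k \<otimes>\<^bsub>P\<^esub> q)"
    unfolding pq'(3) using pq pq' k by (simp add: eJ_mult eJ_add eJ_var distrib_right mult.assoc add.assoc)
  finally show ?case using pq pq' k yv_closed by blast
next
  case (add g h)
  then obtain p q p' q' where pq: "p \<in> carrier P" "q \<in> carrier P" "eJ g * gd j = gd j * eJ p + eJ q"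
    "p' \<in> carrier P" "q' \<in> carrier P" "eJ h * gd j = gd j * eJ p' + eJ q'" by blast
  then have "eJ (g \<oplus>\<^bsub>P\<^esub> h) * gd j = gd j * eJ (p \<oplus>\<^bsub>P\<^esub> p') + eJ (q \<oplus>\<^bsub>P\<^esub> q')"
    using add by (simp add: eJ_add distrib_left distrib_right add_ac)
  then show ?case using pq P.a_closed by blast
qed

abbreviation "HP \<equiv> eJ ` carrier P"

sublocale N: type_D_nilHecke n gy gd gt gu HP "eJ (const (1/2))"
proof (intro type_D_nilHecke.intro type_D_nilHecke_axioms.intro)
  show "type_D_relations n gy gd gt gu" by (rule NR.type_D_relations_axioms)
  show "eJ (const (1/2)) \<in> HP" by simp
  have "const (1/2) \<oplus>\<^bsub>P\<^esub> const (1/2) = \<one>\<^bsub>P\<^esub>" by (simp flip: const_add const_one)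
  then show "eJ (const (1/2)) + eJ (const (1/2)) = gu" by (simp add: eJ_one flip: eJ_add)
  show "gu \<in> HP" by (simp flip: eJ_one)
  show "gy k \<in> HP" if "k < n" for k using eJ_var[OF that] that by (metis imageI yv_closed)
  show "g + h \<in> HP" "g * h \<in> HP" if "g \<in> HP" "h \<in> HP" for g h
    using that by (auto simp flip: eJ_add eJ_mult)
  show "- g \<in> HP" if "g \<in> HP" for g using that by (auto simp flip: eJ_uminus)
  show "gu * g = g" "g * gu = g" if "g \<in> HP" for g using that eJ_imH by auto
  show "\<exists>g'\<in>HP. \<exists>g''\<in>HP. g * gd j = gd j * g' + g''" if "g \<in> HP" "1 \<le> j" "j < n" for g j
    using that eJ_gd by blast
qed

subsection \<open>Operators attached to algebra elements\<close>

text \<open>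
  The homomorphism \<open>\<Phi>\<close> between the products of all rings, so that words are mapped to words. It involves
  the components at the two relevant rings only.
\<close>

definition "tau h = embed E (\<Phi> (component h NH))"

lemma component_NH [simp]: "component h NH \<in> carrier NH"
  by (rule component_closed[OF NH.ring_axioms])

lemma Phi_closed [simp]: "x \<in> carrier NH \<Longrightarrow> \<Phi> x \<in> carrier E"
  using ring_hom_closed[OF Phi(1)] .

lemma tau_add: "tau (a + b) = tau a + tau b"
  using ring_hom_add[OF Phi(1)] by (simp add: tau_def plus_all_rings.rep_eq NH.ring_axioms embed_add[OF ring_E])

lemma tau_mult: "tau (a * b) = tau a * tau b"
  using ring_hom_mult[OF Phi(1)] by (simp add: tau_def times_all_rings.rep_eq NH.ring_axioms embed_mult[OF ring_E])

lemma tau_one: "tau 1 = eu"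
  using ring_hom_one[OF Phi(1)] by (simp add: tau_def one_all_rings.rep_eq NH.ring_axioms eu_def)

lemma tau_zero [simp]: "tau 0 = 0"
  using tau_add[of 0 0] by simp

lemma tau_uminus: "tau (- a) = - tau a"
  using tau_add[of "- a" a] by (simp add: eq_neg_iff_add_eq_0)

lemma tau_sum: "tau (\<Sum>i\<in>A. f i) = (\<Sum>i\<in>A. tau (f i))"
  by (induction A rule: infinite_finite_induct) (auto simp: tau_add)

lemma tau_embed: "x \<in> carrier NH \<Longrightarrow> tau (embed NH x) = embed E (\<Phi> x)"
  by (simp add: tau_def component_embed NH.ring_axioms)

lemma tau_gens: "tau gu = eu" "k < n \<Longrightarrow> tau (gy k) = ey k" "1 \<le> j \<Longrightarrow> j < n \<Longrightarrow> tau (gd j) = ed j" "tau gt = et"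
proof -
  have "Del (n - j) \<in> spinD_gens n" if "1 \<le> j" "j < n" for j using that by auto
  then show "tau gu = eu" "k < n \<Longrightarrow> tau (gy k) = ey k" "1 \<le> j \<Longrightarrow> j < n \<Longrightarrow> tau (gd j) = ed j" "tau gt = et"
    using ring_hom_one[OF Phi(1)]
    by (simp_all add: gu_def gy_def gd_def gt_def eu_def ey_def ed_def et_def tau_embed Phi(2) del: gen_action.simps)
qed

lemma tau_cox: "r < n \<Longrightarrow> tau (NR.coset_word r) = E.coset_word r"
  by (induction r rule: NR.coset_word.induct) (auto simp: tau_mult tau_gens)

lemma tau_long: "r < n \<Longrightarrow> tau (NR.longest_word r) = E.longest_word r"
  by (induction r) (auto simp: tau_mult tau_gens tau_cox simp del: E.coset_word.simps NR.coset_word.simps)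

lemma act_tau_eJ: "f \<in> carrier P \<Longrightarrow> g \<in> carrier P \<Longrightarrow> act (tau (eJ f)) g = f \<otimes>\<^bsub>P\<^esub> g"
proof (induction f arbitrary: g rule: pol_induct)
  case (const c)
  then have "act (tau (eJ (const c))) g = scalar_op c g"
    by (simp add: eJ_def J tau_embed Phi(3) embed_act)
  then show ?case using const by (simp add: scalar_op_def)
next
  case (var i f)
  define k where "k = n - i"
  have k: "i = n - k" "k < n" using var by (auto simp: k_def)
  then show ?case using var by (simp add: eJ_mult tau_mult mult_act eJ_var tau_gens P.m_assoc)
next
  case (add f f')
  then show ?case by (simp add: eJ_add tau_add add_act P.l_distr)
qed

text \<open>
  For an element of the polynomial subalgebra, the value at \<open>1\<close> of its action is the corresponding polynomial.
\<close>

definition "as_poly h = act (tau h) \<one>\<^bsub>P\<^esub>"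

lemma as_poly_closed [simp]: "as_poly h \<in> carrier P"
  by (simp add: as_poly_def)

lemma as_poly_eJ: "f \<in> carrier P \<Longrightarrow> as_poly (eJ f) = f"
  by (simp add: as_poly_def act_tau_eJ)

lemma act_tau_HP: "h \<in> HP \<Longrightarrow> g \<in> carrier P \<Longrightarrow> act (tau h) g = as_poly h \<otimes>\<^bsub>P\<^esub> g"
  using act_tau_eJ as_poly_eJ by auto

lemma eJ_as_poly: "h \<in> HP \<Longrightarrow> eJ (as_poly h) = h"
  using as_poly_eJ by auto

lemma as_poly_mult: "h \<in> HP \<Longrightarrow> as_poly (h * h') = as_poly h \<otimes>\<^bsub>P\<^esub> as_poly h'"
  using act_tau_HP[of h "as_poly h'"] by (simp add: as_poly_def tau_mult mult_act)

lemma as_poly_one: "as_poly 1 = \<one>\<^bsub>P\<^esub>" "as_poly gu = \<one>\<^bsub>P\<^esub>"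
  by (simp_all add: as_poly_def tau_one tau_gens)

lemma as_poly_gy: "k < n \<Longrightarrow> as_poly (gy k) = yv k"
  using as_poly_eJ[of "yv k"] by (simp add: eJ_var)

end

section \<open>A homogeneous basis over the symmetric polynomials\<close>

context odd_polynomials
begin

abbreviation gr :: "int \<Rightarrow> (nat list \<Rightarrow>\<^sub>0 rat) set set" where "gr \<equiv> pol_degree n"

text \<open>
  No element of the ideal of relations has a constant term.
\<close>

lemma one_neq_zero: "\<one>\<^bsub>P\<^esub> \<noteq> \<zero>\<^bsub>P\<^esub>"
proof
  assume "\<one>\<^bsub>P\<^esub> = \<zero>\<^bsub>P\<^esub>"
  then have "1 \<in> Idl\<^bsub>pol.F\<^esub> (odd_pol_rels n :: (nat list \<Rightarrow>\<^sub>0 rat) set)"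
    using pol.presented_class_eq_zero_iff[of 1] by (simp add: pol.presented_class_one)
  moreover have "Idl\<^bsub>pol.F\<^esub> (odd_pol_rels n) \<subseteq> {p \<in> carrier pol.F. [] \<notin> Poly_Mapping.keys p}"
  proof (rule pol.presented_ideal_subset)
    show "odd_pol_rels n \<subseteq> {p \<in> carrier pol.F. [] \<notin> Poly_Mapping.keys p}"
    proof
      fix r :: "nat list \<Rightarrow>\<^sub>0 rat" assume r: "r \<in> odd_pol_rels n"
      then obtain i j where "r = letter i * letter j + letter j * letter i" by (auto simp: odd_pol_rels_def)
      then have "Poly_Mapping.keys r \<subseteq> {[i, j], [j, i]}"
        using Poly_Mapping.keys_add[of "letter i * letter j" "letter j * letter i"] by (auto simp: keys_letter_mult)
      then show "r \<in> {p \<in> carrier pol.F. [] \<notin> Poly_Mapping.keys p}" using r odd_pol_rels_closed by auto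
    qed
  next
    fix p q :: "nat list \<Rightarrow>\<^sub>0 rat"
    assume p: "p \<in> {p \<in> carrier pol.F. [] \<notin> Poly_Mapping.keys p}"
    show "p + q \<in> {p \<in> carrier pol.F. [] \<notin> Poly_Mapping.keys p}"
      if "q \<in> {p \<in> carrier pol.F. [] \<notin> Poly_Mapping.keys p}"
      using p that Poly_Mapping.keys_add[of p q] by auto
    show "q * p \<in> {p \<in> carrier pol.F. [] \<notin> Poly_Mapping.keys p}" if "q \<in> carrier pol.F"
      using p that keys_mult[of q p] by (auto simp: plus_list_def)
    show "p * q \<in> {p \<in> carrier pol.F. [] \<notin> Poly_Mapping.keys p}" if "q \<in> carrier pol.F"
      using p that keys_mult[of p q] by (auto simp: plus_list_def)
  qed (auto simp: keys_uminus)
  ultimately show False using keys_one[where 'a = "nat list" and 'b = rat] by (auto simp: zero_list_def)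
qed

lemma const_gr: "const c \<in> gr 0"
  unfolding pol_const_def by (rule pol.const_gr)

lemma one_gr: "\<one>\<^bsub>P\<^esub> \<in> gr 0"
  using const_gr[of 1] by (simp add: const_one)

lemma var_gr: "i \<in> {1..n} \<Longrightarrow> var i \<in> gr 2"
  unfolding pol_var_def using pol.letter_gr[of i] by simp

lemma gr_uminus: "f \<in> gr d \<Longrightarrow> \<ominus>\<^bsub>P\<^esub> f \<in> gr d"
proof -
  assume f: "f \<in> gr d"
  have fP: "f \<in> carrier P" using f pol.gr_carrier by blast
  have "const (-1) \<otimes>\<^bsub>P\<^esub> f \<oplus>\<^bsub>P\<^esub> f = (const (-1) \<oplus>\<^bsub>P\<^esub> const 1) \<otimes>\<^bsub>P\<^esub> f"
    using fP by (simp add: P.l_distr const_one)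
  also have "\<dots> = \<zero>\<^bsub>P\<^esub>" using fP by (simp add: const_zero flip: const_add)
  finally have "\<ominus>\<^bsub>P\<^esub> f = const (-1) \<otimes>\<^bsub>P\<^esub> f" using fP by (simp add: P.minus_equality)
  then show ?thesis using pol.gr_mult[OF const_gr f] by simp
qed

lemma word_weight_two: "word_weight (\<lambda>_. 2) w = 2 * int (length w)"
  by (induction w) auto

lemma gr_negative: "f \<in> gr d \<Longrightarrow> d < 0 \<Longrightarrow> f = \<zero>\<^bsub>P\<^esub>"
proof -
  assume "f \<in> gr d" and d: "d < 0"
  then obtain p where p: "p \<in> carrier pol.F" "f = pol.cls p" "\<forall>w\<in>Poly_Mapping.keys p. word_weight (\<lambda>_. 2) w = d"
    unfolding pol_degree_def presented_degree_def by blast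
  have "Poly_Mapping.keys p = {}" using p(3) d by (force simp: word_weight_two)
  then have "p = 0" by simp
  then show ?thesis using p by (simp add: pol.presented_class_zero)
qed

lemma gr_zero_const: "f \<in> gr 0 \<Longrightarrow> \<exists>c. f = const c"
proof -
  assume "f \<in> gr 0"
  then obtain p where p: "p \<in> carrier pol.F" "f = pol.cls p" "\<forall>w\<in>Poly_Mapping.keys p. word_weight (\<lambda>_. 2) w = 0"
    unfolding pol_degree_def presented_degree_def by blast
  have "p = Poly_Mapping.single [] (Poly_Mapping.lookup p [])"
  proof (rule poly_mapping_eqI)
    fix w
    have "w = []" if "w \<in> Poly_Mapping.keys p" using p(3) that word_weight_two[of w] by simp
    then show "Poly_Mapping.lookup p w = Poly_Mapping.lookup (Poly_Mapping.single [] (Poly_Mapping.lookup p [])) w"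
      by (cases "w = []") (auto simp: lookup_single when_def in_keys_iff)
  qed
  then show ?thesis using p unfolding pol_const_def by metis
qed

lemma derivation_gr:
  assumes s: "is_endo img s" and D: "is_derivation s val D"
    and val: "\<And>i. i \<in> {1..n} \<Longrightarrow> val i \<in> gr 0" and img: "\<And>i. i \<in> {1..n} \<Longrightarrow> img i \<in> gr 2"
    and f: "f \<in> gr d"
  shows "D f \<in> gr (d - 2)"
proof -
  have "\<forall>d. D (pol.comp d f) \<in> gr (d - 2)" if "f \<in> carrier P" for f
    using that
  proof (induction f rule: pol_induct)
    case (const c)
    have "D \<zero>\<^bsub>P\<^esub> = \<zero>\<^bsub>P\<^esub>" using derivation_const[OF D, of 0] by (simp add: const_zero)
    then show ?case using pol.comp_gr[OF const_gr] derivation_const[OF D] pol.zero_gr by simp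
  next
    case (var i g)
    show ?case
    proof
      fix d
      have c: "pol.comp d (pol_var n i \<otimes>\<^bsub>P\<^esub> g) = pol_var n i \<otimes>\<^bsub>P\<^esub> pol.comp (d - 2) g"
        using pol.comp_mult[OF var_gr, of i g "d - 2"] var by simp
      have "val i \<otimes>\<^bsub>P\<^esub> pol.comp (d - 2) g \<in> gr (0 + (d - 2))"
        using var val pol.comp_in_gr by (intro pol.gr_mult) auto
      moreover have "D (pol.comp (d - 2) g) \<in> gr (d - 2 - 2)" using var.IH by blast
      then have "img i \<otimes>\<^bsub>P\<^esub> D (pol.comp (d - 2) g) \<in> gr (2 + (d - 2 - 2))"
        by (rule pol.gr_mult[OF img[OF var.hyps(1)]])
      ultimately show "D (pol.comp d (pol_var n i \<otimes>\<^bsub>P\<^esub> g)) \<in> gr (d - 2)"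
        unfolding c using var derivationD(5,6)[OF D] endoD(2)[OF s] pol.gr_add by simp
    qed
  next
    case (add g h)
    then show ?case using pol.comp_add derivationD(3)[OF D] pol.gr_add by simp
  qed
  then have "D (pol.comp d f) \<in> gr (d - 2)" using pol.gr_carrier[OF f] by blast
  then show ?thesis using pol.comp_gr[OF f, of d] by simp
qed

lemma act_ed_gr: "1 \<le> j \<Longrightarrow> j < n \<Longrightarrow> f \<in> gr d \<Longrightarrow> act (ed j) f \<in> gr (d - 2)"
proof -
  assume j: "1 \<le> j" "j < n" and f: "f \<in> gr d"
  have "odd_demazure n (n - j) f \<in> gr (d - 2)"
  proof (rule derivation_gr[OF odd_refl_demazure _ _ f])
    fix i assume i: "i \<in> {1..n}"
    show "dem_val (n - j) i \<in> gr 0" using one_gr pol.zero_gr by (simp add: dem_val_def)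
    show "refl_img (n - j) i \<in> gr 2" unfolding refl_img_def
      using i j by (simp only: split: if_split) (intro conjI impI gr_uminus var_gr; simp; linarith)
  qed (use j in auto)
  then show ?thesis using j by (simp add: act_ed)
qed

lemma act_et_gr: "f \<in> gr d \<Longrightarrow> act et f \<in> gr (d - 2)"
proof -
  assume f: "f \<in> gr d"
  have "odd_demazure_D n f \<in> gr (d - 2)"
  proof (rule derivation_gr[OF odd_refl_demazure_D _ _ f])
    fix i assume i: "i \<in> {1..n}"
    show "dem_val_D i \<in> gr 0" using one_gr pol.zero_gr gr_uminus by (simp add: dem_val_D_def)
    show "refl_img_D i \<in> gr 2" unfolding refl_img_D_def
      using i two_le_n gr_uminus var_gr by auto
  qed
  then show ?thesis by (simp add: act_et)
qed

lemma act_cox_gr: "1 \<le> r \<Longrightarrow> r < n \<Longrightarrow> f \<in> gr d \<Longrightarrow> act (E.coset_word r) f \<in> gr (d - 4 * int r)"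
proof (induction r arbitrary: f d rule: nat_induct_at_least)
  case base
  have c: "E.coset_word 1 = ed 1 * et" by (simp add: One_nat_def)
  show ?case using act_ed_gr[OF _ _ act_et_gr[OF base(2)], of 1] base pol.gr_carrier[OF base(2)]
    unfolding c by (simp add: mult_act)
next
  case (Suc r)
  have c: "E.coset_word (Suc r) = ed (Suc r) * E.coset_word r * ed (Suc r)" using Suc.hyps by (rule E.cox_step)
  have "act (ed (Suc r)) f \<in> gr (d - 2)" using Suc.prems by (intro act_ed_gr) auto
  then have "act (E.coset_word r) (act (ed (Suc r)) f) \<in> gr (d - 2 - 4 * int r)" using Suc by auto
  then have "act (ed (Suc r)) (act (E.coset_word r) (act (ed (Suc r)) f)) \<in> gr (d - 2 - 4 * int r - 2)"
    using Suc.prems by (intro act_ed_gr) auto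
  then show ?case using pol.gr_carrier[OF Suc.prems(2)] unfolding c by (simp add: mult_act algebra_simps)
qed

subsection \<open>Symmetric polynomials of lower rank\<close>

text \<open>
  The symmetric polynomials with respect to the operators of rank \<open>r + 1\<close>. They form a decreasing chain of
  subrings from all polynomials, for \<open>r = 0\<close>, to \<open>Lam\<close>. The basis is built along this chain.
\<close>

definition rank_sym :: "nat \<Rightarrow> (nat list \<Rightarrow>\<^sub>0 rat) set set" where
  "rank_sym r = {f \<in> carrier P. (\<forall>j. 1 \<le> j \<and> j \<le> r \<longrightarrow> act (ed j) f = \<zero>\<^bsub>P\<^esub>) \<and> (1 \<le> r \<longrightarrow> act et f = \<zero>\<^bsub>P\<^esub>)}"

lemma rank_sym_carrier: "f \<in> rank_sym r \<Longrightarrow> f \<in> carrier P"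
  by (simp add: rank_sym_def)

lemma rank_sym_top: "rank_sym (n - 1) = Lam"
proof -
  have "(\<forall>j. 1 \<le> j \<and> j \<le> n - 1 \<longrightarrow> act (ed j) f = \<zero>\<^bsub>P\<^esub>) \<longleftrightarrow> (\<forall>i. 1 \<le> i \<and> i < n \<longrightarrow> odd_demazure n i f = \<zero>\<^bsub>P\<^esub>)" for f
  proof (intro iffI allI impI; (elim conjE)?)
    fix i assume all: "\<forall>j. 1 \<le> j \<and> j \<le> n - 1 \<longrightarrow> act (ed j) f = \<zero>\<^bsub>P\<^esub>" and i: "1 \<le> i" "i < n"
    have j: "1 \<le> n - i" "n - i \<le> n - 1" "n - i < n" "n - (n - i) = i" using i by auto
    have "act (ed (n - i)) f = \<zero>\<^bsub>P\<^esub>" using all j by blast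
    then show "odd_demazure n i f = \<zero>\<^bsub>P\<^esub>" using act_ed[OF j(1,3), of f] j(4) by simp
  next
    fix j assume "\<forall>i. 1 \<le> i \<and> i < n \<longrightarrow> odd_demazure n i f = \<zero>\<^bsub>P\<^esub>" "1 \<le> j" "j \<le> n - 1"
    then show "act (ed j) f = \<zero>\<^bsub>P\<^esub>" using act_ed[of j f] by simp
  qed
  then show ?thesis using two_le_n by (auto simp only: rank_sym_def Lam_iff act_et mem_Collect_eq set_eq_iff)
qed

lemma act_ed_rank_sym:
  "1 \<le> j \<Longrightarrow> j \<le> r \<Longrightarrow> r < n \<Longrightarrow> f \<in> carrier P \<Longrightarrow> l \<in> rank_sym r \<Longrightarrow> act (ed j) (f \<otimes>\<^bsub>P\<^esub> l) = act (ed j) f \<otimes>\<^bsub>P\<^esub> l"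
proof -
  assume j: "1 \<le> j" "j \<le> r" "r < n" and f: "f \<in> carrier P" and l: "l \<in> rank_sym r"
  have i: "1 \<le> n - j" "n - j < n" "j < n" using j by auto
  have "odd_demazure n (n - j) l = \<zero>\<^bsub>P\<^esub>" using l j act_ed[OF j(1) i(3), of l] by (simp add: rank_sym_def)
  from derivation_right_linear[OF odd_refl_demazure[OF i(1,2)] this f rank_sym_carrier[OF l]]
  show ?thesis using act_ed[OF j(1) i(3)] by simp
qed

lemma act_et_rank_sym:
  "1 \<le> r \<Longrightarrow> f \<in> carrier P \<Longrightarrow> l \<in> rank_sym r \<Longrightarrow> act et (f \<otimes>\<^bsub>P\<^esub> l) = act et f \<otimes>\<^bsub>P\<^esub> l"
  using derivation_right_linear[OF odd_refl_demazure_D, of l f] act_et by (simp add: rank_sym_def)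

lemma rank_sym_add: "f \<in> rank_sym r \<Longrightarrow> g \<in> rank_sym r \<Longrightarrow> f \<oplus>\<^bsub>P\<^esub> g \<in> rank_sym r"
  by (simp add: rank_sym_def act_plus)

lemma rank_sym_zero: "\<zero>\<^bsub>P\<^esub> \<in> rank_sym r"
  by (simp add: rank_sym_def)

lemma rank_sym_mult: "r < n \<Longrightarrow> f \<in> rank_sym r \<Longrightarrow> g \<in> rank_sym r \<Longrightarrow> f \<otimes>\<^bsub>P\<^esub> g \<in> rank_sym r"
  using act_ed_rank_sym[of _ r f g] act_et_rank_sym[of r f g] rank_sym_carrier[of f r] rank_sym_carrier[of g r]
  by (simp add: rank_sym_def)

lemma rank_sym_one: "r < n \<Longrightarrow> \<one>\<^bsub>P\<^esub> \<in> rank_sym r"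
  using annihilates_one(1,2) by (simp add: rank_sym_def annihilates_one_def)

lemma rank_sym_finsum: "(\<And>i. i \<in> A \<Longrightarrow> f i \<in> rank_sym r) \<Longrightarrow> finsum P f A \<in> rank_sym r"
proof (induction A rule: infinite_finite_induct)
  case (insert a A)
  then show ?case using rank_sym_carrier[of _ r] by (subst P.finsum_insert) (auto intro: rank_sym_add)
qed (auto simp: rank_sym_zero P.add.finprod_infinite)

lemma rank_sym_mono: "r \<le> r' \<Longrightarrow> rank_sym r' \<subseteq> rank_sym r"
  by (auto simp: rank_sym_def)

lemma act_long_rank_sym: "r < n \<Longrightarrow> f \<in> carrier P \<Longrightarrow> act (E.longest_word r) f \<in> rank_sym r"
  using E.d_long[of _ r] E.t_long[of r] by (simp add: rank_sym_def flip: mult_act)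

lemma act_cox_right: "k \<le> r \<Longrightarrow> r < n \<Longrightarrow> f \<in> carrier P \<Longrightarrow> l \<in> rank_sym r \<Longrightarrow>
    act (E.coset_word k) (f \<otimes>\<^bsub>P\<^esub> l) = act (E.coset_word k) f \<otimes>\<^bsub>P\<^esub> l"
proof (induction k arbitrary: f rule: E.coset_word.induct)
  case 1 then show ?case using rank_sym_carrier by simp
next
  case 2
  then show ?case using act_ed_rank_sym[of "Suc 0" r "act et f" l] act_et_rank_sym[of r f l] rank_sym_carrier[of l r]
    by (simp add: mult_act One_nat_def)
next
  case (3 k)
  let ?d = "ed (Suc (Suc k))"
  have P: "act ?d f \<in> carrier P" "act (E.coset_word (Suc k)) (act ?d f) \<in> carrier P" "l \<in> carrier P"
    using 3 rank_sym_carrier[of l r] by auto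
  then show ?case using 3 act_ed_rank_sym[of "Suc (Suc k)" r f l]
      act_ed_rank_sym[of "Suc (Suc k)" r "act (E.coset_word (Suc k)) (act ?d f)" l] by (simp add: mult_act)
qed

lemma act_finsum:
  "finite A \<Longrightarrow> (\<And>i. i \<in> A \<Longrightarrow> f i \<in> carrier P) \<Longrightarrow> act a (finsum P f A) = finsum P (\<lambda>i. act a (f i)) A"
  by (induction A rule: finite_induct) (auto simp: act_plus Pi_iff)

lemma sum_act: "finite A \<Longrightarrow> f \<in> carrier P \<Longrightarrow> act (\<Sum>i\<in>A. a i) f = finsum P (\<lambda>i. act (a i) f) A"
  by (induction A rule: finite_induct) (auto simp: add_act Pi_iff)

lemma act_cox_finsum:
  "finite A \<Longrightarrow> r < n \<Longrightarrow> (\<And>i. i \<in> A \<Longrightarrow> f i \<in> carrier P) \<Longrightarrow> (\<And>i. i \<in> A \<Longrightarrow> l i \<in> rank_sym r) \<Longrightarrow>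
    act (E.coset_word r) (finsum P (\<lambda>i. f i \<otimes>\<^bsub>P\<^esub> l i) A) = finsum P (\<lambda>i. act (E.coset_word r) (f i) \<otimes>\<^bsub>P\<^esub> l i) A"
proof (induction A rule: finite_induct)
  case (insert a A)
  have "l i \<in> carrier P" if "i = a \<or> i \<in> A" for i using insert.prems(3) that rank_sym_carrier by blast
  then show ?case using insert by (simp add: Pi_iff act_plus act_cox_right[of r r])
qed simp

abbreviation "layer_poly r j \<equiv> as_poly (N.layer r j)"

lemma power_HP: "k < n \<Longrightarrow> b \<noteq> 0 \<Longrightarrow> gy k ^ b \<in> HP"
proof (induction b)
  case (Suc b)
  then show ?case using N.H_y N.H_mult[of "gy k" "gy k ^ b"] by (cases b) auto
qed simp

lemma as_poly_power_Suc: "k < n \<Longrightarrow> as_poly (gy k ^ Suc b) = yv k \<otimes>\<^bsub>P\<^esub> as_poly (gy k ^ b)"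
  using as_poly_mult[OF N.H_y] by (simp add: as_poly_gy)

lemma as_poly_power_add: "k < n \<Longrightarrow> as_poly (gy k ^ (a + b)) = as_poly (gy k ^ a) \<otimes>\<^bsub>P\<^esub> as_poly (gy k ^ b)"
  by (cases "a = 0") (auto simp: as_poly_one power_add as_poly_mult power_HP)

lemma as_poly_power_gr: "k < n \<Longrightarrow> as_poly (gy k ^ b) \<in> gr (2 * int b)"
proof (induction b)
  case 0 then show ?case by (simp add: as_poly_one one_gr)
next
  case (Suc b)
  have "var (n - k) \<in> gr 2" by (rule var_gr) (use Suc in auto)
  from pol.gr_mult[OF this Suc.IH[OF Suc.prems]] show ?case
    unfolding as_poly_power_Suc[OF Suc.prems] by (simp add: algebra_simps)
qed

lemma as_poly_omega_Suc: "r < n \<Longrightarrow> as_poly (N.omega (Suc r)) = yv r \<otimes>\<^bsub>P\<^esub> as_poly (N.omega r)"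
  using as_poly_mult[OF N.H_y] by (simp add: as_poly_gy)

lemma as_poly_omega_gr: "r \<le> n \<Longrightarrow> as_poly (N.omega r) \<in> gr (2 * int r)"
proof (induction r)
  case 0 then show ?case by (simp add: as_poly_one one_gr)
next
  case (Suc r)
  have "var (n - r) \<in> gr 2" by (rule var_gr) (use Suc in auto)
  from pol.gr_mult[OF this Suc.IH] show ?case
    using as_poly_omega_Suc[of r] Suc.prems by (simp add: algebra_simps)
qed

lemma tau_eq_upto_sign: "a \<approx> b \<Longrightarrow> tau a \<approx> tau b"
  by (auto simp: eq_upto_sign_def tau_uminus)

text \<open>
  Operators that supercommute with the multiplication by a polynomial and kill \<open>1\<close> also kill the polynomial.
\<close>

lemma rank_sym_as_polyI:
  assumes "h \<in> HP" "r < n" "\<And>j. 1 \<le> j \<Longrightarrow> j \<le> r \<Longrightarrow> h * gd j \<approx> gd j * h" "1 \<le> r \<Longrightarrow> h * gt \<approx> gt * h"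
  shows "as_poly h \<in> rank_sym r"
proof -
  have *: "act (tau a) (as_poly h) = \<zero>\<^bsub>P\<^esub>" if "h * a \<approx> a * h" "annihilates_one (tau a)" for a
  proof -
    have "tau a * tau h \<approx> tau h * tau a"
      using tau_eq_upto_sign[OF that(1)] eq_upto_sign_sym by (simp add: tau_mult)
    moreover have "act (tau h * tau a) \<one>\<^bsub>P\<^esub> = \<zero>\<^bsub>P\<^esub>" "act (- (tau h * tau a)) \<one>\<^bsub>P\<^esub> = \<zero>\<^bsub>P\<^esub>"
      using that(2) by (simp_all add: mult_act uminus_act annihilates_one_def)
    ultimately have "act (tau a * tau h) \<one>\<^bsub>P\<^esub> = \<zero>\<^bsub>P\<^esub>" by (auto simp only: eq_upto_sign_def)
    then show ?thesis by (simp add: as_poly_def mult_act)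
  qed
  have "act (ed j) (as_poly h) = \<zero>\<^bsub>P\<^esub>" if "1 \<le> j" "j \<le> r" for j
    using *[of "gd j"] assms(2,3) that by (simp add: tau_gens)
  moreover have "1 \<le> r \<Longrightarrow> act et (as_poly h) = \<zero>\<^bsub>P\<^esub>" using *[of gt] assms(4) by (simp add: tau_gens)
  ultimately show ?thesis unfolding rank_sym_def by simp
qed

lemma omega_rank_sym: "r < n \<Longrightarrow> as_poly (N.omega (Suc r)) \<in> rank_sym r"
  by (rule rank_sym_as_polyI) (use N.omega_H[of "Suc r"] N.d_omega N.t_omega in \<open>auto simp del: N.omega.simps\<close>)

lemma power_rank_sym: "r < k \<Longrightarrow> k < n \<Longrightarrow> as_poly (gy k ^ b) \<in> rank_sym r"
proof (induction b)
  case 0 then show ?case by (simp add: as_poly_one rank_sym_one)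
next
  case (Suc b)
  have "as_poly (gy k) \<in> rank_sym r"
    by (rule rank_sym_as_polyI) (use Suc.prems N.H_y N.y_d_far N.y_t_far in auto)
  then show ?case using Suc as_poly_power_Suc[of k b] rank_sym_mult[of r] by (simp add: as_poly_gy)
qed

lemma layer_rank_sym: "1 \<le> r \<Longrightarrow> r < n \<Longrightarrow> layer_poly r j \<in> rank_sym (r - 1)"
  using omega_rank_sym[of "r - 1"] power_rank_sym[of "r - 1" r] by (cases r) auto

definition layer_degree :: "nat \<Rightarrow> nat \<Rightarrow> nat" where
  "layer_degree r j = (if j \<le> 2 * r then 2 * j else 2 * r)"

lemma layer_gr: "r < n \<Longrightarrow> layer_poly r j \<in> gr (int (layer_degree r j))"
  using as_poly_power_gr[of r j] as_poly_omega_gr[of r] by (simp add: layer_degree_def)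

lemma layer_HP: "r < n \<Longrightarrow> j \<noteq> 0 \<Longrightarrow> N.layer r j \<in> HP"
  using power_HP[of r j] N.omega_H[of r] by simp

lemma act_layer: "r < n \<Longrightarrow> f \<in> carrier P \<Longrightarrow> act (tau (N.layer r j)) f = layer_poly r j \<otimes>\<^bsub>P\<^esub> f"
proof (cases "j = 0")
  case True
  assume "r < n" "f \<in> carrier P"
  then show ?thesis using True by (simp add: as_poly_one tau_one)
next
  case False
  assume r: "r < n" and f: "f \<in> carrier P"
  show ?thesis by (rule act_tau_HP[OF layer_HP[OF r False] f])
qed

text \<open>
  The expression of the longest word by the one of the next rank, read as an identity of operators.
\<close>

lemma long_expansion:
  assumes r: "1 \<le> r" "r < n" and g: "g \<in> carrier P"
  shows "\<exists>l. (\<forall>j. l j \<in> rank_sym r \<and> (\<exists>h\<in>carrier P. l j = act (E.longest_word r) h)) \<and>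
    act (E.longest_word (r - 1)) g = finsum P (\<lambda>j. layer_poly r j \<otimes>\<^bsub>P\<^esub> l j) {..2 * r + 1}"
proof -
  obtain h where h: "\<And>j. h j \<in> HP"
    and lr: "NR.longest_word (r - 1) = (\<Sum>j\<le>2 * (r - 1) + 3. N.layer r j * NR.longest_word r * h j)"
    using N.long_layers[of "r - 1"] r by auto
  have i: "2 * (r - 1) + 3 = 2 * r + 1" using r by simp
  let ?l = "\<lambda>j. act (E.longest_word r) (act (tau (h j)) g)"
  have "act (E.longest_word (r - 1)) g = act (tau (NR.longest_word (r - 1))) g" using r by (simp add: tau_long)
  also have "\<dots> = finsum P (\<lambda>j. act (tau (N.layer r j * NR.longest_word r * h j)) g) {..2 * r + 1}"
    unfolding lr i tau_sum using g by (simp add: sum_act)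
  also have "\<dots> = finsum P (\<lambda>j. layer_poly r j \<otimes>\<^bsub>P\<^esub> ?l j) {..2 * r + 1}"
    using g r by (intro P.finsum_cong') (auto simp: tau_mult mult_act act_layer tau_long simp del: N.layer.simps)
  finally have "act (E.longest_word (r - 1)) g = finsum P (\<lambda>j. layer_poly r j \<otimes>\<^bsub>P\<^esub> ?l j) {..2 * r + 1}" .
  moreover have "?l j \<in> rank_sym r \<and> (\<exists>h\<in>carrier P. ?l j = act (E.longest_word r) h)" for j
    using g act_long_rank_sym[OF r(2)] by auto
  ultimately show ?thesis by (intro exI[of _ ?l]) blast
qed

lemma comp_zero_layer:
  assumes "1 \<le> r" "r < n" "f \<in> carrier P"
  shows "pol.comp 0 (layer_poly r j \<otimes>\<^bsub>P\<^esub> f) = (if j = 0 then pol.comp 0 f else \<zero>\<^bsub>P\<^esub>)"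
proof (cases "j = 0")
  case True then show ?thesis using assms by (simp add: as_poly_one)
next
  case False
  have "layer_degree r j > 0" using False assms by (simp add: layer_degree_def)
  then have "pol.comp (- int (layer_degree r j)) f = \<zero>\<^bsub>P\<^esub>"
    using pol.comp_in_gr[OF assms(3)] gr_negative by force
  then show ?thesis using pol.comp_mult[OF layer_gr[OF assms(2)] assms(3), of "- int (layer_degree r j)" j] False
    by (simp del: N.layer.simps)
qed

lemma comp_finsum:
  "finite A \<Longrightarrow> (\<And>i. i \<in> A \<Longrightarrow> f i \<in> carrier P) \<Longrightarrow> pol.comp d (finsum P f A) = finsum P (\<lambda>i. pol.comp d (f i)) A"
proof (induction A rule: finite_induct)
  case empty
  then show ?case using pol.comp_gr[OF pol.zero_gr] by simp
qed (auto simp: pol.comp_add Pi_iff)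

lemma finsum_single:
  assumes "finite A" "i \<in> A" "f i \<in> carrier P" "\<And>j. j \<in> A \<Longrightarrow> j \<noteq> i \<Longrightarrow> f j = \<zero>\<^bsub>P\<^esub>"
  shows "finsum P f A = f i"
proof -
  have "finsum P f A = finsum P (\<lambda>j. if i = j then f j else \<zero>\<^bsub>P\<^esub>) A"
    using assms by (intro P.finsum_cong') auto
  also have "\<dots> = finsum P (\<lambda>j. if i = j then (if j = i then f j else \<zero>\<^bsub>P\<^esub>) else \<zero>\<^bsub>P\<^esub>) A"
    by (intro P.finsum_cong') (use assms in auto)
  also have "\<dots> = f i" using P.finsum_singleton[OF assms(2,1), of "\<lambda>j. if j = i then f j else \<zero>\<^bsub>P\<^esub>"] assms(3) by simp
  finally show ?thesis .
qed

text \<open>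
  By induction on the rank: if all values of the longest word of the next rank had zero constant term, the
  expansion of the previous longest word would have zero constant term too, since the first
  layer \<open>1\<close> is the only one of degree zero.
\<close>

lemma long_nonzero: "r < n \<Longrightarrow> \<exists>g\<in>carrier P. pol.comp 0 (act (E.longest_word r) g) \<noteq> \<zero>\<^bsub>P\<^esub>"
proof (induction r)
  case 0
  show ?case using one_neq_zero pol.comp_gr[OF one_gr, of 0] by (intro bexI[of _ "\<one>\<^bsub>P\<^esub>"]) auto
next
  case (Suc r)
  then obtain g where g: "g \<in> carrier P" "pol.comp 0 (act (E.longest_word r) g) \<noteq> \<zero>\<^bsub>P\<^esub>" by auto
  have "1 \<le> Suc r" by simp
  then obtain l where "(\<forall>j. l j \<in> rank_sym (Suc r) \<and> (\<exists>h\<in>carrier P. l j = act (E.longest_word (Suc r)) h)) \<and>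
    act (E.longest_word (Suc r - 1)) g = finsum P (\<lambda>j. layer_poly (Suc r) j \<otimes>\<^bsub>P\<^esub> l j) {..2 * Suc r + 1}"
    using long_expansion[OF _ Suc.prems g(1)] by blast
  then have l: "\<And>j. l j \<in> rank_sym (Suc r)" "\<And>j. \<exists>h\<in>carrier P. l j = act (E.longest_word (Suc r)) h"
    and e: "act (E.longest_word (Suc r - 1)) g = finsum P (\<lambda>j. layer_poly (Suc r) j \<otimes>\<^bsub>P\<^esub> l j) {..2 * Suc r + 1}"
    by (simp_all del: N.layer.simps E.longest_word.simps)
  have lc: "l j \<in> carrier P" for j using l(1) rank_sym_carrier by blast
  have c0: "pol.comp 0 (layer_poly (Suc r) j \<otimes>\<^bsub>P\<^esub> l j) = (if j = 0 then pol.comp 0 (l j) else \<zero>\<^bsub>P\<^esub>)" for j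
    using comp_zero_layer[of "Suc r" "l j" j] lc Suc.prems by simp
  have "pol.comp 0 (act (E.longest_word r) g) = finsum P (\<lambda>j. pol.comp 0 (layer_poly (Suc r) j \<otimes>\<^bsub>P\<^esub> l j)) {..2 * Suc r + 1}"
    unfolding e[unfolded diff_Suc_1] by (rule comp_finsum) (use lc in \<open>simp_all del: N.layer.simps\<close>)
  also have "\<dots> = pol.comp 0 (layer_poly (Suc r) 0 \<otimes>\<^bsub>P\<^esub> l 0)"
    by (rule finsum_single) (use lc c0 in \<open>simp_all del: N.layer.simps\<close>)
  also have "\<dots> = pol.comp 0 (l 0)" unfolding c0 by simp
  finally show ?case using g(2) l(2)[of 0] by metis
qed

lemma act_cox_low: "1 \<le> r \<Longrightarrow> r < n \<Longrightarrow> f \<in> gr d \<Longrightarrow> d < 4 * int r \<Longrightarrow> act (E.coset_word r) f = \<zero>\<^bsub>P\<^esub>"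
  by (rule gr_negative[OF act_cox_gr]) auto

text \<open>
  For reasons of degree the value is a constant, and the coset word kills the other layers. If it killed
  this power as well, it would kill the image of the previous longest word by \<open>long_expansion\<close>, and
  the product of the two, which is the longest word, would vanish.
\<close>

lemma cox_top_const:
  assumes r: "1 \<le> r" "r < n"
  obtains c where "c \<noteq> 0" "act (E.coset_word r) (as_poly (gy r ^ (2 * r))) = const c"
proof -
  let ?y = "as_poly (gy r ^ (2 * r))"
  have "act (E.coset_word r) ?y \<in> gr (2 * int (2 * r) - 4 * int r)" by (rule act_cox_gr[OF r as_poly_power_gr[OF r(2)]])
  then obtain c where c: "act (E.coset_word r) ?y = const c" using gr_zero_const by auto
  have "c \<noteq> 0"
  proof
    assume "c = 0"
    then have y0: "act (E.coset_word r) ?y = \<zero>\<^bsub>P\<^esub>" using c const_zero by simp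
    have low: "act (E.coset_word r) (layer_poly r j) = \<zero>\<^bsub>P\<^esub>" if j: "j \<le> 2 * r + 1" for j
    proof -
      consider "j < 2 * r" | "j = 2 * r" | "j = 2 * r + 1" using j by linarith
      then show ?thesis
      proof cases
        case 1 then show ?thesis using as_poly_power_gr[of r j] r by (intro act_cox_low[where d = "2 * int j"]) auto
      next
        case 2 then show ?thesis using y0 by simp
      next
        case 3 then show ?thesis using as_poly_omega_gr[of r] r by (intro act_cox_low[where d = "2 * int r"]) auto
      qed
    qed
    obtain g where g: "g \<in> carrier P" "pol.comp 0 (act (E.longest_word r) g) \<noteq> \<zero>\<^bsub>P\<^esub>" using long_nonzero[OF r(2)] by blast
    obtain l where "(\<forall>j. l j \<in> rank_sym r \<and> (\<exists>h\<in>carrier P. l j = act (E.longest_word r) h)) \<and>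
      act (E.longest_word (r - 1)) g = finsum P (\<lambda>j. layer_poly r j \<otimes>\<^bsub>P\<^esub> l j) {..2 * r + 1}"
      using long_expansion[OF r g(1)] by blast
    then have l: "\<And>j. l j \<in> rank_sym r"
      and e: "act (E.longest_word (r - 1)) g = finsum P (\<lambda>j. layer_poly r j \<otimes>\<^bsub>P\<^esub> l j) {..2 * r + 1}"
      by (simp_all del: N.layer.simps)
    have lc: "l j \<in> carrier P" for j using l rank_sym_carrier by blast
    have "E.longest_word r = E.coset_word r * E.longest_word (r - 1)" using E.long_cox_commute[of "r - 1" r] r by (cases r) auto
    then have "act (E.longest_word r) g = act (E.coset_word r) (act (E.longest_word (r - 1)) g)" using g by (simp add: mult_act)
    also have "\<dots> = finsum P (\<lambda>j. act (E.coset_word r) (layer_poly r j) \<otimes>\<^bsub>P\<^esub> l j) {..2 * r + 1}"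
      unfolding e by (rule act_cox_finsum) (use l r in simp_all)
    also have "\<dots> = finsum P (\<lambda>j. \<zero>\<^bsub>P\<^esub>) {..2 * r + 1}"
      using low lc by (intro P.finsum_cong') (auto simp del: N.layer.simps)
    finally have "act (E.longest_word r) g = \<zero>\<^bsub>P\<^esub>" by simp
    then show False using g pol.comp_gr[OF pol.zero_gr, of 0] by simp
  qed
  then show thesis using c that by blast
qed

text \<open>
  The operators \<open>d s, \<dots>, d 1\<close> remove the variables of \<open>omega s\<close> one after the other and do not
  affect \<open>l\<close>.
\<close>

lemma omega_cancel:
  "s \<le> r \<Longrightarrow> r < n \<Longrightarrow> l \<in> rank_sym r \<Longrightarrow> as_poly (N.omega s) \<otimes>\<^bsub>P\<^esub> l = \<zero>\<^bsub>P\<^esub> \<Longrightarrow> l = \<zero>\<^bsub>P\<^esub>"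
proof (induction s)
  case 0
  then show ?case using rank_sym_carrier[of l r] by (simp add: as_poly_one)
next
  case (Suc s)
  let ?w = "as_poly (N.omega s)" and ?d = "ed (Suc s)"
  have lc: "l \<in> carrier P" using Suc.prems rank_sym_carrier by blast
  have o: "N.omega m * gd (Suc s) \<approx> gd (Suc s) * N.omega m" if "m \<le> s" for m using that
  proof (induction m)
    case 0 then show ?case using Suc.prems by simp
  next
    case (Suc m)
    then show ?case using supercommute_mult'[of "gy m" "gd (Suc s)" "N.omega m"] N.y_d_far[of "Suc s" m] \<open>Suc s \<le> r\<close> \<open>r < n\<close> by simp
  qed
  have "act ?d ?w = \<zero>\<^bsub>P\<^esub>"
  proof -
    have "tau (gd (Suc s)) * tau (N.omega s) \<approx> tau (N.omega s) * tau (gd (Suc s))"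
      using tau_eq_upto_sign[OF o[of s]] eq_upto_sign_sym by (simp add: tau_mult)
    moreover have "act (tau (N.omega s) * tau (gd (Suc s))) \<one>\<^bsub>P\<^esub> = \<zero>\<^bsub>P\<^esub>"
      "act (- (tau (N.omega s) * tau (gd (Suc s)))) \<one>\<^bsub>P\<^esub> = \<zero>\<^bsub>P\<^esub>"
      using annihilates_one(1)[of "Suc s"] Suc.prems by (simp_all add: mult_act uminus_act annihilates_one_def tau_gens)
    ultimately have "act (tau (gd (Suc s)) * tau (N.omega s)) \<one>\<^bsub>P\<^esub> = \<zero>\<^bsub>P\<^esub>" by (auto simp only: eq_upto_sign_def)
    then show ?thesis using Suc.prems by (simp add: as_poly_def mult_act tau_gens)
  qed
  then have wl: "act ?d (?w \<otimes>\<^bsub>P\<^esub> l) = \<zero>\<^bsub>P\<^esub>" using act_ed_rank_sym[of "Suc s" r ?w l] Suc.prems lc by simp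
  have "\<zero>\<^bsub>P\<^esub> = act ?d (as_poly (N.omega (Suc s)) \<otimes>\<^bsub>P\<^esub> l)" using Suc.prems by simp
  also have "\<dots> = act ?d (yv s \<otimes>\<^bsub>P\<^esub> (?w \<otimes>\<^bsub>P\<^esub> l))"
    using Suc.prems lc as_poly_omega_Suc[of s] by (simp add: P.m_assoc del: N.omega.simps)
  also have "\<dots> = act (?d * ey s) (?w \<otimes>\<^bsub>P\<^esub> l)" using Suc.prems lc by (simp add: mult_act)
  also have "?d * ey s = eu - ey (Suc s) * ?d" using ed_ey(2)[of "Suc s"] Suc.prems by simp
  also have "act (eu - ey (Suc s) * ?d) (?w \<otimes>\<^bsub>P\<^esub> l) = ?w \<otimes>\<^bsub>P\<^esub> l"
    using wl Suc.prems lc by (simp add: minus_act mult_act a_minus_def)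
  finally show ?case using Suc by simp
qed

lemma mult_finsum_assoc:
  "finite A \<Longrightarrow> b \<in> carrier P \<Longrightarrow> (\<And>i. i \<in> A \<Longrightarrow> f i \<in> carrier P) \<Longrightarrow> (\<And>i. i \<in> A \<Longrightarrow> g i \<in> carrier P) \<Longrightarrow>
    b \<otimes>\<^bsub>P\<^esub> finsum P (\<lambda>i. f i \<otimes>\<^bsub>P\<^esub> g i) A = finsum P (\<lambda>i. b \<otimes>\<^bsub>P\<^esub> f i \<otimes>\<^bsub>P\<^esub> g i) A"
  by (induction A rule: finite_induct) (simp_all add: Pi_iff P.r_distr P.m_assoc)

text \<open>
  Multiply the relation by the \<open>i\<close>-th power of \<open>y r\<close> and apply the coset word. For \<open>i = 0\<close> only the
  top power survives; increasing \<open>i\<close> isolates the coefficients of the lower powers one by one.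
  What is left is the coefficient of \<open>omega r\<close>.
\<close>

lemma layers_independent:
  assumes r: "1 \<le> r" "r < n" and l: "\<And>j. j \<le> 2 * r + 1 \<Longrightarrow> l j \<in> rank_sym r"
    and z: "finsum P (\<lambda>j. layer_poly r j \<otimes>\<^bsub>P\<^esub> l j) {..2 * r + 1} = \<zero>\<^bsub>P\<^esub>"
    and j: "j \<le> 2 * r + 1"
  shows "l j = \<zero>\<^bsub>P\<^esub>"
proof -
  let ?C = "act (E.coset_word r)" and ?y = "\<lambda>b. as_poly (gy r ^ b)"
  obtain c where c: "c \<noteq> 0" "?C (?y (2 * r)) = const c" using cox_top_const[OF r] by blast
  have lc: "l j \<in> carrier P" if "j \<le> 2 * r + 1" for j using l[OF that] rank_sym_carrier by blast
  have powers: "l (2 * r - i) = \<zero>\<^bsub>P\<^esub>" if "i \<le> 2 * r" for i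
    using that
  proof (induction i rule: less_induct)
    case (less i)
    have vanish: "?C (?y i \<otimes>\<^bsub>P\<^esub> layer_poly r j) \<otimes>\<^bsub>P\<^esub> l j = \<zero>\<^bsub>P\<^esub>" if j: "j \<le> 2 * r + 1" "j \<noteq> 2 * r - i" for j
    proof -
      consider "j \<le> 2 * r" "i + j < 2 * r" | "j \<le> 2 * r" "i + j > 2 * r" | "j = 2 * r + 1" "i = 0" | "j = 2 * r + 1" "i \<noteq> 0"
        using j less.prems by linarith
      then show ?thesis
      proof cases
        case 1
        have "?C (?y (i + j)) = \<zero>\<^bsub>P\<^esub>" using as_poly_power_gr[of r "i + j"] r 1
          by (intro act_cox_low[where d = "2 * int (i + j)"]) auto
        then show ?thesis using 1 r lc[of j] by (simp add: as_poly_power_add)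
      next
        case 2
        then have "l (2 * r - (2 * r - j)) = \<zero>\<^bsub>P\<^esub>" by (intro less.IH) auto
        then show ?thesis using 2 by simp
      next
        case 3
        have "?C (as_poly (N.omega r)) = \<zero>\<^bsub>P\<^esub>" using as_poly_omega_gr[of r] r
          by (intro act_cox_low[where d = "2 * int r"]) auto
        then show ?thesis using 3 lc[of j] by (simp add: as_poly_one)
      next
        case 4
        \<comment> \<open>One factor turns \<open>omega r\<close> into \<open>omega (r + 1)\<close>, which is symmetric and leaves a power of low degree.\<close>
        then obtain i' where i': "i = i' + 1" by (cases i) auto
        have "?y i \<otimes>\<^bsub>P\<^esub> as_poly (N.omega r) = ?y i' \<otimes>\<^bsub>P\<^esub> as_poly (N.omega (Suc r))"
          unfolding i' as_poly_power_add[OF r(2)] as_poly_omega_Suc[OF r(2)] using r by (simp add: P.m_assoc as_poly_gy)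
        moreover have "?C (?y i' \<otimes>\<^bsub>P\<^esub> as_poly (N.omega (Suc r))) = ?C (?y i') \<otimes>\<^bsub>P\<^esub> as_poly (N.omega (Suc r))"
          using r omega_rank_sym by (intro act_cox_right[of r r]) auto
        moreover have "?C (?y i') = \<zero>\<^bsub>P\<^esub>" using as_poly_power_gr[of r i'] r less.prems i'
          by (intro act_cox_low[where d = "2 * int i'"]) auto
        ultimately show ?thesis using 4 lc[of j] by (simp del: N.omega.simps)
      qed
    qed
    have "\<zero>\<^bsub>P\<^esub> = ?C (?y i \<otimes>\<^bsub>P\<^esub> finsum P (\<lambda>j. layer_poly r j \<otimes>\<^bsub>P\<^esub> l j) {..2 * r + 1})" using z by simp
    also have "?y i \<otimes>\<^bsub>P\<^esub> finsum P (\<lambda>j. layer_poly r j \<otimes>\<^bsub>P\<^esub> l j) {..2 * r + 1} =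
        finsum P (\<lambda>j. ?y i \<otimes>\<^bsub>P\<^esub> layer_poly r j \<otimes>\<^bsub>P\<^esub> l j) {..2 * r + 1}"
      by (rule mult_finsum_assoc) (use lc in simp_all)
    also have "?C \<dots> = finsum P (\<lambda>j. ?C (?y i \<otimes>\<^bsub>P\<^esub> layer_poly r j) \<otimes>\<^bsub>P\<^esub> l j) {..2 * r + 1}"
      by (rule act_cox_finsum) (use l r in simp_all)
    also have "\<dots> = ?C (?y i \<otimes>\<^bsub>P\<^esub> layer_poly r (2 * r - i)) \<otimes>\<^bsub>P\<^esub> l (2 * r - i)"
      by (rule finsum_single) (use vanish lc[of "2 * r - i"] in \<open>auto simp del: N.layer.simps\<close>)
    also have "?y i \<otimes>\<^bsub>P\<^esub> layer_poly r (2 * r - i) = ?y (2 * r)"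
      using r less.prems as_poly_power_add[of r i "2 * r - i"] by simp
    finally have cl: "const c \<otimes>\<^bsub>P\<^esub> l (2 * r - i) = \<zero>\<^bsub>P\<^esub>" using c by simp
    have "l (2 * r - i) = const (inverse c * c) \<otimes>\<^bsub>P\<^esub> l (2 * r - i)" using c lc[of "2 * r - i"] by (simp add: const_one)
    also have "\<dots> = const (inverse c) \<otimes>\<^bsub>P\<^esub> (const c \<otimes>\<^bsub>P\<^esub> l (2 * r - i))" using lc[of "2 * r - i"] by (simp add: const_mult P.m_assoc)
    finally show ?case using cl by simp
  qed
  show ?thesis
  proof (cases "j \<le> 2 * r")
    case True then show ?thesis using powers[of "2 * r - j"] by simp
  next
    case False
    then have j': "j = 2 * r + 1" using j by simp
    have "finsum P (\<lambda>j. layer_poly r j \<otimes>\<^bsub>P\<^esub> l j) {..2 * r + 1} = layer_poly r (2 * r + 1) \<otimes>\<^bsub>P\<^esub> l (2 * r + 1)"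
    proof (rule finsum_single)
      fix i assume "i \<in> {..2 * r + 1}" "i \<noteq> 2 * r + 1"
      then show "layer_poly r i \<otimes>\<^bsub>P\<^esub> l i = \<zero>\<^bsub>P\<^esub>" using powers[of "2 * r - i"] by simp
    qed (use lc in \<open>auto simp del: N.layer.simps\<close>)
    then have "as_poly (N.omega r) \<otimes>\<^bsub>P\<^esub> l (2 * r + 1) = \<zero>\<^bsub>P\<^esub>" using z by simp
    then show ?thesis using omega_cancel[of r r "l j"] l[OF j] r j' by simp
  qed
qed

abbreviation "basis_poly k \<equiv> as_poly (N.basis k)"

lemma basis_HP: "k \<in> N.multi_indices r \<Longrightarrow> r < n \<Longrightarrow> N.basis k \<in> HP"
proof (induction r arbitrary: k)
  case 0 then show ?case using N.H_u by simp
next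
  case (Suc r)
  then obtain j l where k: "k = j # l" "l \<in> N.multi_indices r" by auto
  have lb: "N.basis l \<in> HP" using Suc k by simp
  have "length l = r" using N.multi_indices_length[OF k(2)] .
  then show ?case using k lb N.H_mult[OF lb layer_HP[of "Suc r" j]] Suc.prems
    by (cases "j = 0") (auto simp del: N.layer.simps, simp_all)
qed

lemma basis_poly_Cons: "k \<in> N.multi_indices r \<Longrightarrow> r < n \<Longrightarrow> basis_poly (j # k) = basis_poly k \<otimes>\<^bsub>P\<^esub> layer_poly (Suc r) j"
  using as_poly_mult[OF basis_HP] N.multi_indices_length[of k r] by (simp del: N.layer.simps)

fun basis_degree :: "nat list \<Rightarrow> nat" where
  "basis_degree [] = 0"
| "basis_degree (j # k) = basis_degree k + layer_degree (Suc (length k)) j"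

lemma basis_poly_gr: "k \<in> N.multi_indices r \<Longrightarrow> r < n \<Longrightarrow> basis_poly k \<in> gr (int (basis_degree k))"
proof (induction r arbitrary: k)
  case 0 then show ?case by (simp add: as_poly_one one_gr)
next
  case (Suc r)
  then obtain j l where k: "k = j # l" "l \<in> N.multi_indices r" by auto
  show ?case using pol.gr_mult[OF Suc.IH[OF k(2)] layer_gr[of "Suc r" j]] Suc.prems k basis_poly_Cons[OF k(2), of j]
      N.multi_indices_length[OF k(2)] by (simp del: N.layer.simps N.basis.simps)
qed

text \<open>
  Grouping the sum by the first entry of the index gives a relation of the previous rank, whose coefficients
  are sums over one layer.
\<close>

lemma basis_independent:
  "r < n \<Longrightarrow> (\<And>k. k \<in> N.multi_indices r \<Longrightarrow> l k \<in> rank_sym r) \<Longrightarrow>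
    finsum P (\<lambda>k. basis_poly k \<otimes>\<^bsub>P\<^esub> l k) (N.multi_indices r) = \<zero>\<^bsub>P\<^esub> \<Longrightarrow>
    k \<in> N.multi_indices r \<Longrightarrow> l k = \<zero>\<^bsub>P\<^esub>"
proof (induction r arbitrary: l k)
  case 0
  then show ?case using rank_sym_carrier[of "l []" 0] by (simp add: as_poly_one)
next
  case (Suc r)
  note e = embed_finsum[OF P.ring_axioms] embed_mult[OF P.ring_axioms]
  have i: "2 * r + 3 = 2 * Suc r + 1" by simp
  have lL: "l (j # k) \<in> rank_sym (Suc r)" if "k \<in> N.multi_indices r" "j \<le> 2 * Suc r + 1" for j k
  proof (rule Suc.prems(2))
    show "j # k \<in> N.multi_indices (Suc r)" using that by (auto intro!: image_eqI[of _ _ "(j, k)"])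
  qed
  then have lc: "l (j # k) \<in> carrier P" if "k \<in> N.multi_indices r" "j \<le> 2 * Suc r + 1" for j k
    using that rank_sym_carrier by blast
  let ?m = "\<lambda>k. finsum P (\<lambda>j. layer_poly (Suc r) j \<otimes>\<^bsub>P\<^esub> l (j # k)) {..2 * Suc r + 1}"
  have mL: "?m k \<in> rank_sym r" if "k \<in> N.multi_indices r" for k
  proof (rule rank_sym_finsum)
    fix j assume "j \<in> {..2 * Suc r + 1}"
    then have "l (j # k) \<in> rank_sym r" using lL[OF that, of j] rank_sym_mono[of r "Suc r"] by auto
    moreover have "layer_poly (Suc r) j \<in> rank_sym r" using layer_rank_sym[of "Suc r" j] Suc.prems by simp
    ultimately show "layer_poly (Suc r) j \<otimes>\<^bsub>P\<^esub> l (j # k) \<in> rank_sym r" using rank_sym_mult Suc.prems by simp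
  qed
  have mP: "?m k \<in> carrier P" if "k \<in> N.multi_indices r" for k using mL[OF that] rank_sym_carrier by blast
  have "0 = embed P (finsum P (\<lambda>k. basis_poly k \<otimes>\<^bsub>P\<^esub> l k) (N.multi_indices (Suc r)))"
    unfolding Suc.prems(3) by (simp add: embed_zero[OF P.ring_axioms])
  also have "\<dots> = (\<Sum>k\<in>N.multi_indices (Suc r). embed P (basis_poly k \<otimes>\<^bsub>P\<^esub> l k))"
    by (rule e(1)) (use rank_sym_carrier[OF Suc.prems(2)] in \<open>auto simp del: N.basis.simps N.multi_indices.simps\<close>)
  also have "\<dots> = (\<Sum>k\<in>N.multi_indices r. \<Sum>j\<le>2 * Suc r + 1. embed P (basis_poly (j # k) \<otimes>\<^bsub>P\<^esub> l (j # k)))"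
    unfolding N.sum_multi_indices_Suc i ..
  also have "\<dots> = (\<Sum>k\<in>N.multi_indices r. embed P (basis_poly k \<otimes>\<^bsub>P\<^esub> ?m k))"
  proof (rule sum.cong[OF refl])
    fix k assume k: "k \<in> N.multi_indices r"
    have "basis_poly k \<otimes>\<^bsub>P\<^esub> ?m k = finsum P (\<lambda>j. basis_poly (j # k) \<otimes>\<^bsub>P\<^esub> l (j # k)) {..2 * Suc r + 1}"
      unfolding basis_poly_Cons[OF k Suc_lessD[OF Suc.prems(1)]]
      by (rule mult_finsum_assoc) (use lc[OF k] in simp_all)
    then show "(\<Sum>j\<le>2 * Suc r + 1. embed P (basis_poly (j # k) \<otimes>\<^bsub>P\<^esub> l (j # k))) = embed P (basis_poly k \<otimes>\<^bsub>P\<^esub> ?m k)"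
      using lc[OF k] by (subst \<open>basis_poly k \<otimes>\<^bsub>P\<^esub> ?m k = _\<close>, subst e(1)) (auto simp del: N.basis.simps)
  qed
  also have "\<dots> = embed P (finsum P (\<lambda>k. basis_poly k \<otimes>\<^bsub>P\<^esub> ?m k) (N.multi_indices r))"
    by (rule e(1)[symmetric]) (use mP in \<open>auto simp del: N.layer.simps\<close>)
  finally have "finsum P (\<lambda>k. basis_poly k \<otimes>\<^bsub>P\<^esub> ?m k) (N.multi_indices r) = \<zero>\<^bsub>P\<^esub>"
    using embed_inject[OF P.ring_axioms, of _ "\<zero>\<^bsub>P\<^esub>"] mP
    by (simp add: embed_zero[OF P.ring_axioms] Pi_iff del: N.layer.simps)
  then have m0: "?m k = \<zero>\<^bsub>P\<^esub>" if "k \<in> N.multi_indices r" for k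
    using Suc.IH[of ?m k] mL that Suc.prems(1) by simp
  from Suc.prems(4) obtain j k' where k: "k = j # k'" "k' \<in> N.multi_indices r" "j \<le> 2 * Suc r + 1" by auto
  show ?case unfolding k(1)
    by (rule layers_independent[of "Suc r" "\<lambda>j. l (j # k')"]) (use Suc.prems k lL m0 in auto)
qed

abbreviation "basis_indices \<equiv> N.multi_indices (n - 1)"

definition is_dual_basis :: "(nat list \<Rightarrow> (nh_gen list \<Rightarrow>\<^sub>0 rat) set) \<Rightarrow> bool" where
  "is_dual_basis h \<longleftrightarrow> (\<forall>k. h k \<in> carrier NH) \<and> (\<forall>k. \<forall>f\<in>carrier P. \<Phi> (h k) f \<in> Lam) \<and>
    (\<forall>f\<in>carrier P. f = finsum P (\<lambda>k. basis_poly k \<otimes>\<^bsub>P\<^esub> \<Phi> (h k) f) basis_indices) \<and>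
    (\<forall>k\<in>basis_indices. \<forall>l\<in>basis_indices. \<Phi> (h k) (basis_poly l) = (if k = l then \<one>\<^bsub>P\<^esub> else \<zero>\<^bsub>P\<^esub>))"

text \<open>
  The elements \<open>E * c k\<close> of the resolution of the unit. Their values are symmetric, since every Demazure
  operator kills \<open>E\<close> on the left. Expanding a basis element and comparing coefficients gives the duality.
\<close>

theorem dual_basis: "\<exists>h. is_dual_basis h"
proof -
  let ?K = basis_indices
  have r: "n - 1 < n" using two_le_n by simp
  obtain c where c: "\<And>k. c k \<in> HP" "gu = (\<Sum>k\<in>?K. N.basis k * NR.longest_word (n - 1) * c k)"
    using N.unit_resolution[OF r] by blast
  define h where "h k = component (NR.longest_word (n - 1) * c k) NH" for k
  define \<phi> where "\<phi> k = \<Phi> (h k)" for k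
  have \<phi>_act: "\<phi> k f = act (E.longest_word (n - 1)) (act (tau (c k)) f)" if "f \<in> carrier P" for k f
  proof -
    have "\<phi> k f = act (tau (NR.longest_word (n - 1) * c k)) f" by (simp add: \<phi>_def h_def tau_def embed_act)
    then show ?thesis using that r by (simp add: tau_mult mult_act tau_long)
  qed
  have L: "\<phi> k f \<in> Lam" if "f \<in> carrier P" for k f
    using act_long_rank_sym[OF r, of "act (tau (c k)) f"] that \<phi>_act by (simp add: rank_sym_top)
  have LP: "\<phi> k f \<in> carrier P" if "f \<in> carrier P" for k f using L[OF that] Lam_subset by blast
  have exp: "f = finsum P (\<lambda>k. basis_poly k \<otimes>\<^bsub>P\<^esub> \<phi> k f) ?K" if f: "f \<in> carrier P" for f
  proof -
    have "f = act (tau gu) f" using f by (simp add: tau_gens)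
    also have "\<dots> = act (tau (\<Sum>k\<in>?K. N.basis k * NR.longest_word (n - 1) * c k)) f"
      by (rule arg_cong[OF c(2), of "\<lambda>x. act (tau x) f"])
    also have "\<dots> = finsum P (\<lambda>k. act (tau (N.basis k * NR.longest_word (n - 1) * c k)) f) ?K"
      unfolding tau_sum using f by (simp add: sum_act)
    also have "\<dots> = finsum P (\<lambda>k. basis_poly k \<otimes>\<^bsub>P\<^esub> \<phi> k f) ?K"
      using f r basis_HP[OF _ r] LP by (intro P.finsum_cong') (auto simp: tau_mult mult_act act_tau_HP tau_long \<phi>_act)
    finally show ?thesis .
  qed
  have dual: "\<phi> k (basis_poly l) = (if k = l then \<one>\<^bsub>P\<^esub> else \<zero>\<^bsub>P\<^esub>)" if kl: "k \<in> ?K" "l \<in> ?K" for k l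
  proof -
    let ?d = "\<lambda>k. if k = l then \<one>\<^bsub>P\<^esub> else \<zero>\<^bsub>P\<^esub>"
    let ?v = "\<lambda>k. \<phi> k (basis_poly l) \<oplus>\<^bsub>P\<^esub> \<ominus>\<^bsub>P\<^esub> ?d k"
    have "finsum P (\<lambda>k. basis_poly k \<otimes>\<^bsub>P\<^esub> \<ominus>\<^bsub>P\<^esub> ?d k) ?K = \<ominus>\<^bsub>P\<^esub> basis_poly l"
      by (subst finsum_single[of _ l]) (use kl in \<open>auto simp: P.r_minus\<close>)
    then have "finsum P (\<lambda>k. basis_poly k \<otimes>\<^bsub>P\<^esub> \<phi> k (basis_poly l)) ?K \<oplus>\<^bsub>P\<^esub> finsum P (\<lambda>k. basis_poly k \<otimes>\<^bsub>P\<^esub> \<ominus>\<^bsub>P\<^esub> ?d k) ?K = \<zero>\<^bsub>P\<^esub>"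
      using exp[of "basis_poly l"] by (simp add: P.r_neg)
    moreover have "finsum P (\<lambda>k. basis_poly k \<otimes>\<^bsub>P\<^esub> ?v k) ?K =
        finsum P (\<lambda>k. basis_poly k \<otimes>\<^bsub>P\<^esub> \<phi> k (basis_poly l)) ?K \<oplus>\<^bsub>P\<^esub> finsum P (\<lambda>k. basis_poly k \<otimes>\<^bsub>P\<^esub> \<ominus>\<^bsub>P\<^esub> ?d k) ?K"
      using LP by (subst P.finsum_addf[symmetric]) (auto simp: P.r_distr intro!: P.finsum_cong')
    ultimately have z: "finsum P (\<lambda>k. basis_poly k \<otimes>\<^bsub>P\<^esub> ?v k) ?K = \<zero>\<^bsub>P\<^esub>" by simp
    have vL: "?v k \<in> rank_sym (n - 1)" for k
    proof -
      have "\<ominus>\<^bsub>P\<^esub> ?d k \<in> rank_sym (n - 1)"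
        using rank_sym_one[OF r] by (simp add: rank_sym_def act_uminus)
      moreover have "\<phi> k (basis_poly l) \<in> rank_sym (n - 1)" unfolding rank_sym_top by (rule L) simp
      ultimately show ?thesis by (intro rank_sym_add)
    qed
    have "?v k = \<zero>\<^bsub>P\<^esub>" using basis_independent[OF r vL z kl(1)] .
    from P.minus_equality[OF this] show ?thesis using LP[of "basis_poly l" k] by simp
  qed
  have "is_dual_basis h" unfolding is_dual_basis_def \<phi>_def[symmetric]
  proof (intro conjI allI ballI)
    show "h k \<in> carrier NH" for k unfolding h_def by (rule component_NH)
  qed (rule L exp dual; assumption)+
  then show ?thesis by (intro exI[of is_dual_basis h])
qed

lemma dual_basisD:
  assumes "is_dual_basis h"
  shows "h k \<in> carrier NH" "f \<in> carrier P \<Longrightarrow> \<Phi> (h k) f \<in> Lam"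
    "f \<in> carrier P \<Longrightarrow> f = finsum P (\<lambda>k. basis_poly k \<otimes>\<^bsub>P\<^esub> \<Phi> (h k) f) basis_indices"
    "k \<in> basis_indices \<Longrightarrow> l \<in> basis_indices \<Longrightarrow> \<Phi> (h k) (basis_poly l) = (if k = l then \<one>\<^bsub>P\<^esub> else \<zero>\<^bsub>P\<^esub>)"
proof -
  note h = assms[unfolded is_dual_basis_def]
  note h1 = conjunct1[OF h] and h2 = conjunct1[OF conjunct2[OF h]]
    and h3 = conjunct1[OF conjunct2[OF conjunct2[OF h]]] and h4 = conjunct2[OF conjunct2[OF conjunct2[OF h]]]
  show "h k \<in> carrier NH" by (rule spec[OF h1])
  show "f \<in> carrier P \<Longrightarrow> \<Phi> (h k) f \<in> Lam" by (rule bspec[OF spec[OF h2]])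
  show "f \<in> carrier P \<Longrightarrow> f = finsum P (\<lambda>k. basis_poly k \<otimes>\<^bsub>P\<^esub> \<Phi> (h k) f) basis_indices"
    by (rule bspec[OF h3])
  show "k \<in> basis_indices \<Longrightarrow> l \<in> basis_indices \<Longrightarrow> \<Phi> (h k) (basis_poly l) = (if k = l then \<one>\<^bsub>P\<^esub> else \<zero>\<^bsub>P\<^esub>)"
    by (rule bspec[OF bspec[OF h4]])
qed

text \<open>
  A right linear endomorphism is determined by its values on the basis, and the coordinates with respect to
  the basis are given by elements of the algebra.
\<close>

theorem Phi_surj: "x \<in> carrier E \<Longrightarrow> \<exists>y\<in>carrier NH. \<Phi> y = x"
proof -
  assume x: "x \<in> carrier E"
  obtain h where h: "is_dual_basis h" using dual_basis by blast
  note hc = dual_basisD(1)[OF h] and hL = dual_basisD(2)[OF h]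
  let ?y = "component (\<Sum>k\<in>basis_indices. eJ (x (basis_poly k)) * embed NH (h k)) NH"
  have xc: "x (basis_poly k) \<in> carrier P" for k using E_closed[OF x] by simp
  have LP: "\<Phi> (h k) f \<in> carrier P" if "f \<in> carrier P" for k f using hL[OF that] Lam_subset by blast
  have "\<Phi> ?y = x"
  proof (rule right_End_eqI[OF Phi_closed[OF component_NH] x])
    fix f assume f: "f \<in> carrier P"
    have "\<Phi> ?y f = act (tau (\<Sum>k\<in>basis_indices. eJ (x (basis_poly k)) * embed NH (h k))) f"
      by (simp add: tau_def embed_act)
    also have "\<dots> = finsum P (\<lambda>k. act (tau (eJ (x (basis_poly k)) * embed NH (h k))) f) basis_indices"
      unfolding tau_sum using f by (simp add: sum_act)
    also have "\<dots> = finsum P (\<lambda>k. act (embed E x) (basis_poly k \<otimes>\<^bsub>P\<^esub> \<Phi> (h k) f)) basis_indices"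
    proof (rule P.finsum_cong'[OF refl])
      fix k
      have "act (tau (eJ (x (basis_poly k)) * embed NH (h k))) f = x (basis_poly k) \<otimes>\<^bsub>P\<^esub> \<Phi> (h k) f"
        using f xc LP hc by (simp add: tau_mult mult_act act_tau_eJ tau_embed embed_act)
      also have "\<dots> = x (basis_poly k \<otimes>\<^bsub>P\<^esub> \<Phi> (h k) f)" using x hL[OF f] by (simp add: right_End_mem)
      finally show "act (tau (eJ (x (basis_poly k)) * embed NH (h k))) f = act (embed E x) (basis_poly k \<otimes>\<^bsub>P\<^esub> \<Phi> (h k) f)"
        using x by (simp add: embed_act)
    qed (use LP[OF f] in auto)
    also have "\<dots> = act (embed E x) (finsum P (\<lambda>k. basis_poly k \<otimes>\<^bsub>P\<^esub> \<Phi> (h k) f) basis_indices)"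
      by (rule act_finsum[symmetric]) (use LP[OF f] in auto)
    also have "finsum P (\<lambda>k. basis_poly k \<otimes>\<^bsub>P\<^esub> \<Phi> (h k) f) basis_indices = f"
      by (rule dual_basisD(3)[OF h f, symmetric])
    finally show "\<Phi> ?y f = x f" using x by (simp add: embed_act)
  qed
  then show ?thesis using component_NH by blast
qed

end

section \<open>Matrices of right linear endomorphisms\<close>

text \<open>
  A ring \<open>R\<close> that is free as a right module over the subring \<open>S\<close>, with a homogeneous basis \<open>b\<close> and coordinate
  functions \<open>co\<close>.
\<close>

locale dual_bases = ring R for R :: "'a ring" (structure) +
  fixes S :: "'a set" and N :: nat and b :: "nat \<Rightarrow> 'a" and co :: "nat \<Rightarrow> 'a \<Rightarrow> 'a"
    and gr :: "int \<Rightarrow> 'a set" and deg :: "nat \<Rightarrow> int"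
  assumes S_subset: "S \<subseteq> carrier R" and S_zero [simp]: "\<zero> \<in> S"
    and S_add [simp]: "a \<in> S \<Longrightarrow> a' \<in> S \<Longrightarrow> a \<oplus> a' \<in> S"
    and S_mult [simp]: "a \<in> S \<Longrightarrow> a' \<in> S \<Longrightarrow> a \<otimes> a' \<in> S"
    and b_closed [simp]: "i < N \<Longrightarrow> b i \<in> carrier R"
    and co_S [simp]: "i < N \<Longrightarrow> f \<in> carrier R \<Longrightarrow> co i f \<in> S"
    and co_add: "i < N \<Longrightarrow> f \<in> carrier R \<Longrightarrow> g \<in> carrier R \<Longrightarrow> co i (f \<oplus> g) = co i f \<oplus> co i g"
    and co_mult: "i < N \<Longrightarrow> f \<in> carrier R \<Longrightarrow> a \<in> S \<Longrightarrow> co i (f \<otimes> a) = co i f \<otimes> a"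
    and co_b: "i < N \<Longrightarrow> j < N \<Longrightarrow> co i (b j) = (if i = j then \<one> else \<zero>)"
    and expand: "f \<in> carrier R \<Longrightarrow> f = (\<Oplus>i\<in>{..<N}. b i \<otimes> co i f)"
    and gr_subset: "gr d \<subseteq> carrier R"
    and gr_zero: "\<zero> \<in> gr d"
    and gr_add: "f \<in> gr d \<Longrightarrow> g \<in> gr d \<Longrightarrow> f \<oplus> g \<in> gr d"
    and gr_mult: "f \<in> gr d \<Longrightarrow> g \<in> gr d' \<Longrightarrow> f \<otimes> g \<in> gr (d + d')"
    and b_gr: "i < N \<Longrightarrow> b i \<in> gr (deg i)"
    and co_gr: "i < N \<Longrightarrow> f \<in> gr d \<Longrightarrow> co i f \<in> gr (d - deg i)"
begin

abbreviation "T \<equiv> R\<lparr>carrier := S\<rparr>"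
abbreviation "End \<equiv> right_End R S"

lemma S_carrier [simp]: "a \<in> S \<Longrightarrow> a \<in> carrier R"
  using S_subset by blast

lemma co_closed [simp]: "i < N \<Longrightarrow> f \<in> carrier R \<Longrightarrow> co i f \<in> carrier R"
  by simp

lemma End_closed: "\<phi> \<in> carrier End \<Longrightarrow> f \<in> carrier R \<Longrightarrow> \<phi> f \<in> carrier R"
  and End_add: "\<phi> \<in> carrier End \<Longrightarrow> f \<in> carrier R \<Longrightarrow> g \<in> carrier R \<Longrightarrow> \<phi> (f \<oplus> g) = \<phi> f \<oplus> \<phi> g"
  and End_mult: "\<phi> \<in> carrier End \<Longrightarrow> f \<in> carrier R \<Longrightarrow> a \<in> S \<Longrightarrow> \<phi> (f \<otimes> a) = \<phi> f \<otimes> a"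
  by (auto simp: right_End_mem)

lemma abelian_monoid_T: "abelian_monoid T"
  by (rule abelian_monoidI) (auto simp: a_ac)

lemma finsum_S: "finite A \<Longrightarrow> (\<And>i. i \<in> A \<Longrightarrow> f i \<in> S) \<Longrightarrow> finsum T f A = finsum R f A \<and> finsum R f A \<in> S"
proof (induction A rule: finite_induct)
  case empty
  then show ?case using abelian_monoid.finsum_empty[OF abelian_monoid_T] by simp
next
  case (insert a A)
  then show ?case using abelian_monoid.finsum_insert[OF abelian_monoid_T, of A a f] by (simp add: Pi_iff)
qed

lemma additive_finsum:
  assumes "finite A" "\<And>i. i \<in> A \<Longrightarrow> f i \<in> carrier R"
    and "\<And>x. x \<in> carrier R \<Longrightarrow> h x \<in> carrier R"
    and add: "\<And>x y. x \<in> carrier R \<Longrightarrow> y \<in> carrier R \<Longrightarrow> h (x \<oplus> y) = h x \<oplus> h y"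
  shows "h (finsum R f A) = finsum R (\<lambda>i. h (f i)) A"
  using assms(1,2)
proof (induction A rule: finite_induct)
  case empty
  have "h \<zero> = \<zero>" using add[of \<zero> \<zero>] assms(3)[of \<zero>] add.l_cancel_one'[of "h \<zero>" "h \<zero>"] by simp
  then show ?case by simp
qed (use assms(3) add in \<open>simp_all add: Pi_iff\<close>)

lemma co_finsum: "finite A \<Longrightarrow> i < N \<Longrightarrow> (\<And>k. k \<in> A \<Longrightarrow> f k \<in> carrier R) \<Longrightarrow> co i (finsum R f A) = finsum R (\<lambda>k. co i (f k)) A"
  by (rule additive_finsum) (simp_all add: co_add)

lemma End_expand:
  assumes "\<phi> \<in> carrier End" "f \<in> carrier R"
  shows "\<phi> f = (\<Oplus>k\<in>{..<N}. \<phi> (b k) \<otimes> co k f)"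
proof -
  have "\<phi> f = \<phi> (\<Oplus>k\<in>{..<N}. b k \<otimes> co k f)" using expand[OF assms(2)] by simp
  also have "\<dots> = (\<Oplus>k\<in>{..<N}. \<phi> (b k \<otimes> co k f))"
    by (rule additive_finsum) (use assms in \<open>simp_all add: End_closed End_add\<close>)
  also have "\<dots> = (\<Oplus>k\<in>{..<N}. \<phi> (b k) \<otimes> co k f)"
    by (rule finsum_cong') (use assms in \<open>auto simp: End_closed End_mult\<close>)
  finally show ?thesis .
qed

lemma finsum_delta:
  assumes "j < N" "\<And>i. i < N \<Longrightarrow> x i \<in> carrier R"
  shows "(\<Oplus>i\<in>{..<N}. x i \<otimes> (if i = j then \<one> else \<zero>)) = x j"
    and "(\<Oplus>i\<in>{..<N}. (if j = i then \<one> else \<zero>) \<otimes> x i) = x j"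
proof -
  have s: "(\<Oplus>i\<in>{..<N}. if j = i then (if i < N then x i else \<zero>) else \<zero>) = x j"
    using finsum_singleton[of j "{..<N}" "\<lambda>i. if i < N then x i else \<zero>"] assms by (simp add: Pi_iff)
  show "(\<Oplus>i\<in>{..<N}. x i \<otimes> (if i = j then \<one> else \<zero>)) = x j"
    by (rule trans[OF finsum_cong' s]) (use assms in auto)
  show "(\<Oplus>i\<in>{..<N}. (if j = i then \<one> else \<zero>) \<otimes> x i) = x j"
    by (rule trans[OF finsum_cong' s]) (use assms in auto)
qed

definition to_matrix :: "('a \<Rightarrow> 'a) \<Rightarrow> nat \<Rightarrow> nat \<Rightarrow> 'a" where
  "to_matrix \<phi> = (\<lambda>i\<in>{..<N}. \<lambda>j\<in>{..<N}. co i (\<phi> (b j)))"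

definition from_matrix :: "(nat \<Rightarrow> nat \<Rightarrow> 'a) \<Rightarrow> 'a \<Rightarrow> 'a" where
  "from_matrix A = (\<lambda>f\<in>carrier R. \<Oplus>j\<in>{..<N}. (\<Oplus>i\<in>{..<N}. b i \<otimes> A i j) \<otimes> co j f)"

lemma matrix_mem: "A \<in> carrier (matrix_ring N T) \<longleftrightarrow> A \<in> {..<N} \<rightarrow>\<^sub>E ({..<N} \<rightarrow>\<^sub>E S)"
  by (simp add: matrix_ring_def)

lemma matrix_eqI:
  assumes "A \<in> carrier (matrix_ring N T)" "B \<in> carrier (matrix_ring N T)"
    and "\<And>i j. i < N \<Longrightarrow> j < N \<Longrightarrow> A i j = B i j"
  shows "A = B"
proof (rule extensionalityI[of _ "{..<N}"])
  fix i assume i: "i \<in> {..<N}"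
  show "A i = B i"
    by (rule extensionalityI[of _ "{..<N}"]) (use assms i in \<open>auto simp: matrix_mem PiE_iff\<close>)
qed (use assms in \<open>auto simp: matrix_mem PiE_iff\<close>)

lemma to_matrix_closed: "\<phi> \<in> carrier End \<Longrightarrow> to_matrix \<phi> \<in> carrier (matrix_ring N T)"
  unfolding matrix_mem to_matrix_def by (auto simp: End_closed)

lemma column_closed:
  "A \<in> carrier (matrix_ring N T) \<Longrightarrow> j < N \<Longrightarrow> (\<Oplus>i\<in>{..<N}. b i \<otimes> A i j) \<in> carrier R"
  unfolding matrix_mem by (intro finsum_closed) (auto intro!: m_closed S_carrier simp: PiE_iff)

lemma from_matrix_End:
  assumes A: "A \<in> carrier (matrix_ring N T)" shows "from_matrix A \<in> carrier End"
  unfolding right_End_mem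
proof (intro conjI ballI)
  let ?c = "\<lambda>j. \<Oplus>i\<in>{..<N}. b i \<otimes> A i j"
  note c = column_closed[OF A]
  show "from_matrix A \<in> carrier R \<rightarrow>\<^sub>E carrier R" unfolding from_matrix_def
    using c by (auto intro!: finsum_closed)
  fix f assume f: "f \<in> carrier R"
  show "from_matrix A (f \<oplus> g) = from_matrix A f \<oplus> from_matrix A g" if g: "g \<in> carrier R" for g
  proof -
    have "(\<Oplus>j\<in>{..<N}. ?c j \<otimes> co j (f \<oplus> g)) = (\<Oplus>j\<in>{..<N}. ?c j \<otimes> co j f \<oplus> ?c j \<otimes> co j g)"
      by (rule finsum_cong') (use f g c in \<open>auto simp: co_add r_distr\<close>)
    also have "\<dots> = (\<Oplus>j\<in>{..<N}. ?c j \<otimes> co j f) \<oplus> (\<Oplus>j\<in>{..<N}. ?c j \<otimes> co j g)"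
      by (rule finsum_addf) (use f g c in auto)
    finally show ?thesis using f g by (simp add: from_matrix_def)
  qed
  show "from_matrix A (f \<otimes> a) = from_matrix A f \<otimes> a" if a: "a \<in> S" for a
  proof -
    have "(\<Oplus>j\<in>{..<N}. ?c j \<otimes> co j f) \<otimes> a = (\<Oplus>j\<in>{..<N}. ?c j \<otimes> co j f \<otimes> a)"
      by (rule finsum_ldistr) (use f a c in auto)
    also have "\<dots> = (\<Oplus>j\<in>{..<N}. ?c j \<otimes> co j (f \<otimes> a))"
      by (rule finsum_cong') (use f a c in \<open>auto simp: co_mult m_assoc\<close>)
    finally show ?thesis using f a by (simp add: from_matrix_def)
  qed
qed

lemma from_matrix_b:
  assumes A: "A \<in> carrier (matrix_ring N T)" and l: "l < N"
  shows "from_matrix A (b l) = (\<Oplus>i\<in>{..<N}. b i \<otimes> A i l)"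
proof -
  let ?c = "\<lambda>j. \<Oplus>i\<in>{..<N}. b i \<otimes> A i j"
  have "from_matrix A (b l) = (\<Oplus>j\<in>{..<N}. ?c j \<otimes> (if j = l then \<one> else \<zero>))"
    using l unfolding from_matrix_def
    by simp (rule finsum_cong', use column_closed[OF A] l in \<open>auto simp: co_b\<close>)
  then show ?thesis using finsum_delta(1)[OF l, of ?c] column_closed[OF A] by simp
qed

lemma to_from_matrix:
  assumes A: "A \<in> carrier (matrix_ring N T)"
  shows "to_matrix (from_matrix A) = A"
proof (rule matrix_eqI[OF to_matrix_closed[OF from_matrix_End[OF A]] A])
  fix i j assume ij: "i < N" "j < N"
  have AS: "A k j \<in> S" if "k < N" for k using A ij that by (auto simp: matrix_mem PiE_iff)
  have "co i (from_matrix A (b j)) = (\<Oplus>k\<in>{..<N}. co i (b k \<otimes> A k j))"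
    unfolding from_matrix_b[OF A ij(2)] by (rule co_finsum) (use ij AS in auto)
  also have "\<dots> = (\<Oplus>k\<in>{..<N}. (if i = k then \<one> else \<zero>) \<otimes> A k j)"
    by (rule finsum_cong') (use ij AS in \<open>auto simp: co_mult co_b\<close>)
  also have "\<dots> = A i j" using finsum_delta(2)[OF ij(1), of "\<lambda>k. A k j"] AS by simp
  finally show "to_matrix (from_matrix A) i j = A i j" using ij by (simp add: to_matrix_def)
qed

lemma to_matrix_inj: "inj_on to_matrix (carrier End)"
proof (rule inj_onI)
  fix \<phi> \<psi> assume *: "\<phi> \<in> carrier End" "\<psi> \<in> carrier End" "to_matrix \<phi> = to_matrix \<psi>"
  have "\<phi> (b j) = \<psi> (b j)" if j: "j < N" for j
  proof -
    have "co i (\<phi> (b j)) = co i (\<psi> (b j))" if "i < N" for i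
      using fun_cong[OF fun_cong[OF *(3)], of i j] that j by (simp add: to_matrix_def)
    then have "(\<Oplus>i\<in>{..<N}. b i \<otimes> co i (\<phi> (b j))) = (\<Oplus>i\<in>{..<N}. b i \<otimes> co i (\<psi> (b j)))"
      by (intro finsum_cong') (use * j in \<open>auto simp: End_closed\<close>)
    then show ?thesis using expand[of "\<phi> (b j)"] expand[of "\<psi> (b j)"] * j by (simp add: End_closed)
  qed
  then have "\<phi> f = \<psi> f" if "f \<in> carrier R" for f
    unfolding End_expand[OF *(1) that] End_expand[OF *(2) that]
    by (intro finsum_cong') (use * that in \<open>auto simp: End_closed\<close>)
  then show "\<phi> = \<psi>" using right_End_eqI * by blast
qed

lemma to_matrix_hom: "to_matrix \<in> ring_hom End (matrix_ring N T)"
proof (rule ring_hom_memI)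
  have E: "ring End" by (rule ring_right_End[OF ring_axioms S_subset])
  interpret M: ring End by (rule E)
  show "to_matrix \<phi> \<in> carrier (matrix_ring N T)" if "\<phi> \<in> carrier End" for \<phi> using to_matrix_closed[OF that] .
  fix \<phi> \<psi> assume *: "\<phi> \<in> carrier End" "\<psi> \<in> carrier End"
  have "co i (\<phi> (\<psi> (b j))) = finsum T (\<lambda>k. co i (\<phi> (b k)) \<otimes> co k (\<psi> (b j))) {..<N}" if ij: "i < N" "j < N" for i j
  proof -
    have "co i (\<phi> (\<psi> (b j))) = co i (\<Oplus>k\<in>{..<N}. \<phi> (b k) \<otimes> co k (\<psi> (b j)))"
      using End_expand[OF *(1), of "\<psi> (b j)"] * ij by (simp add: End_closed)
    also have "\<dots> = (\<Oplus>k\<in>{..<N}. co i (\<phi> (b k) \<otimes> co k (\<psi> (b j))))"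
      by (rule co_finsum) (use * ij in \<open>auto simp: End_closed\<close>)
    also have "\<dots> = (\<Oplus>k\<in>{..<N}. co i (\<phi> (b k)) \<otimes> co k (\<psi> (b j)))"
      by (rule finsum_cong') (use * ij in \<open>auto simp: End_closed co_mult\<close>)
    also have "\<dots> = finsum T (\<lambda>k. co i (\<phi> (b k)) \<otimes> co k (\<psi> (b j))) {..<N}"
      using finsum_S[of "{..<N}" "\<lambda>k. co i (\<phi> (b k)) \<otimes> co k (\<psi> (b j))"] * ij by (simp add: End_closed)
    finally show ?thesis .
  qed
  then have e: "to_matrix \<phi> \<otimes>\<^bsub>matrix_ring N T\<^esub> to_matrix \<psi> = (\<lambda>i\<in>{..<N}. \<lambda>j\<in>{..<N}. co i (\<phi> (\<psi> (b j))))"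
  proof -
    have "finsum T (\<lambda>k. to_matrix \<phi> i k \<otimes> to_matrix \<psi> k j) {..<N} = finsum T (\<lambda>k. co i (\<phi> (b k)) \<otimes> co k (\<psi> (b j))) {..<N}"
      if "i < N" "j < N" for i j
      by (rule abelian_monoid.finsum_cong'[OF abelian_monoid_T refl])
        (use that * in \<open>auto simp: to_matrix_def End_closed\<close>)
    then show ?thesis using \<open>\<And>i j. i < N \<Longrightarrow> j < N \<Longrightarrow> co i (\<phi> (\<psi> (b j))) = _ i j\<close>
      by (auto simp: matrix_ring_def intro!: restrict_ext)
  qed
  show "to_matrix (\<phi> \<otimes>\<^bsub>End\<^esub> \<psi>) = to_matrix \<phi> \<otimes>\<^bsub>matrix_ring N T\<^esub> to_matrix \<psi>"
    unfolding e unfolding to_matrix_def by (auto simp: right_End_simps compose_eq intro!: restrict_ext)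
  show "to_matrix (\<phi> \<oplus>\<^bsub>End\<^esub> \<psi>) = to_matrix \<phi> \<oplus>\<^bsub>matrix_ring N T\<^esub> to_matrix \<psi>"
    using * by (auto simp: to_matrix_def matrix_ring_def right_End_simps co_add End_closed intro!: restrict_ext)
next
  show "to_matrix \<one>\<^bsub>End\<^esub> = \<one>\<^bsub>matrix_ring N T\<^esub>"
    by (auto simp: to_matrix_def matrix_ring_def right_End_simps co_b intro!: restrict_ext)
qed

lemma finsum_gr: "finite A \<Longrightarrow> (\<And>i. i \<in> A \<Longrightarrow> f i \<in> gr d) \<Longrightarrow> finsum R f A \<in> gr d"
proof (induction A rule: finite_induct)
  case empty
  show ?case using gr_zero by simp
next
  case (insert a A)
  then have "f i \<in> carrier R" if "i \<in> insert a A" for i using gr_subset that by blast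
  then show ?case using insert by (simp add: Pi_iff gr_add)
qed

theorem to_matrix_graded_iso:
  "to_matrix \<in> graded_iso End (right_End_degree R S gr) (matrix_ring N T) (matrix_degree N deg T gr)"
proof -
  have surj: "to_matrix ` carrier End = carrier (matrix_ring N T)"
  proof (intro subset_antisym subsetI)
    fix A assume A: "A \<in> carrier (matrix_ring N T)"
    show "A \<in> to_matrix ` carrier End"
      by (rule image_eqI[of _ _ "from_matrix A"]) (use to_from_matrix[OF A] from_matrix_End[OF A] in simp_all)
  qed (use to_matrix_closed in blast)
  have iso: "to_matrix \<in> ring_iso End (matrix_ring N T)"
    using to_matrix_hom to_matrix_inj surj by (simp add: ring_iso_def bij_betw_def)
  have "to_matrix ` right_End_degree R S gr d = matrix_degree N deg T gr d" for d
  proof (intro subset_antisym subsetI)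
    fix A assume "A \<in> to_matrix ` right_End_degree R S gr d"
    then obtain \<phi> where \<phi>: "\<phi> \<in> carrier End" "\<And>k. \<phi> ` gr k \<subseteq> gr (k + d)" "A = to_matrix \<phi>"
      by (auto simp: right_End_degree_def)
    have "A i j \<in> S \<inter> gr (deg j + d - deg i)" if ij: "i < N" "j < N" for i j
    proof -
      have "\<phi> (b j) \<in> gr (deg j + d)" using \<phi>(2)[of "deg j"] b_gr[OF ij(2)] by blast
      then show ?thesis using ij \<phi> co_gr[OF ij(1)] by (simp add: to_matrix_def End_closed)
    qed
    then show "A \<in> matrix_degree N deg T gr d" using \<phi> to_matrix_closed by (simp add: matrix_degree_def)
  next
    fix A assume A: "A \<in> matrix_degree N deg T gr d"
    then have Ac: "A \<in> carrier (matrix_ring N T)" and Ag: "\<And>i j. i < N \<Longrightarrow> j < N \<Longrightarrow> A i j \<in> gr (deg j + d - deg i)"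
      by (auto simp: matrix_degree_def)
    have "from_matrix A f \<in> gr (k + d)" if f: "f \<in> gr k" for f k
    proof -
      have "(\<Oplus>i\<in>{..<N}. b i \<otimes> A i j) \<otimes> co j f \<in> gr (k + d)" if j: "j < N" for j
      proof -
        have "b i \<otimes> A i j \<in> gr (deg j + d)" if "i < N" for i
          using gr_mult[OF b_gr[OF that] Ag[OF that j]] by simp
        then have "(\<Oplus>i\<in>{..<N}. b i \<otimes> A i j) \<in> gr (deg j + d)" by (intro finsum_gr) auto
        from gr_mult[OF this co_gr[OF j f]] show ?thesis by (simp add: algebra_simps)
      qed
      then have "(\<Oplus>j\<in>{..<N}. (\<Oplus>i\<in>{..<N}. b i \<otimes> A i j) \<otimes> co j f) \<in> gr (k + d)" by (intro finsum_gr) auto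
      then show ?thesis using f gr_subset by (auto simp: from_matrix_def)
    qed
    then have "from_matrix A \<in> right_End_degree R S gr d"
      using from_matrix_End[OF Ac] by (auto simp: right_End_degree_def)
    then show "A \<in> to_matrix ` right_End_degree R S gr d" using to_from_matrix[OF Ac] by (metis image_eqI)
  qed
  then show ?thesis using iso by (simp add: graded_iso_def)
qed

end

section \<open>Quantum integers and the degrees of the basis\<close>

lemma q_pow_add: "q_pow (a + b) = q_pow a * q_pow b"
  by (simp add: fls_X_intpow_times_fls_X_intpow)

lemma q_denominator_nonzero: "q_pow 1 - q_pow (- 1) \<noteq> 0"
proof
  assume "q_pow 1 - q_pow (- 1) = 0"
  then have "fls_nth (q_pow 1 - q_pow (- 1)) 1 = fls_nth 0 1" by (simp only:)
  then show False by simp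
qed

lemma q_int_mult: "q_int m * (q_pow 1 - q_pow (- 1)) = q_pow (int m) - q_pow (- int m)"
  using q_denominator_nonzero by (simp add: q_int_def)

lemma q_geometric: "(q_pow 1 - q_pow (- 1)) * (\<Sum>j\<le>m. q_pow (2 * int j)) = q_pow (2 * int m + 1) - q_pow (- 1)"
proof (induction m)
  case (Suc m)
  have "(q_pow 1 - q_pow (- 1)) * (\<Sum>j\<le>Suc m. q_pow (2 * int j)) =
      q_pow (2 * int m + 1) - q_pow (- 1) + (q_pow 1 - q_pow (- 1)) * q_pow (2 * int (Suc m))"
    using Suc by (simp add: distrib_left)
  also have "(q_pow 1 - q_pow (- 1)) * q_pow (2 * int (Suc m)) = q_pow (2 * int (Suc m) + 1) - q_pow (2 * int m + 1)"
    unfolding left_diff_distrib q_pow_add[symmetric] by (simp add: algebra_simps)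
  finally show ?case by simp
qed simp

text \<open>
  The left factor \<open>q_int m\<close> and the right factor \<open>q_int (m + 1)\<close> telescope in the product over all layers.
  Both sides are compared after multiplication with the square of the common denominator.
\<close>

lemma q_layer_identity:
  "q_int m * ((\<Sum>j\<le>2 * m. q_pow (2 * int j)) + q_pow (2 * int m)) = q_pow (2 * int m) * q_int (m + 1) * q_int (2 * m)"
proof -
  let ?D = "q_pow 1 - q_pow (- 1)" and ?L = "(\<Sum>j\<le>2 * m. q_pow (2 * int j)) + q_pow (2 * int m)"
  have L: "?D * ?L = q_pow (4 * int m + 1) - q_pow (- 1) + (q_pow (2 * int m + 1) - q_pow (2 * int m - 1))"
    unfolding distrib_left q_geometric unfolding left_diff_distrib q_pow_add[symmetric] by (simp add: algebra_simps)
  have "(q_int m * ?L) * (?D * ?D) = (q_int m * ?D) * (?D * ?L)" by (simp only: ac_simps)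
  also have "\<dots> = (q_pow (int m) - q_pow (- int m)) * (q_pow (4 * int m + 1) - q_pow (- 1) + (q_pow (2 * int m + 1) - q_pow (2 * int m - 1)))"
    unfolding q_int_mult L ..
  also have "\<dots> = q_pow (2 * int m) * ((q_pow (int (m + 1)) - q_pow (- int (m + 1))) * (q_pow (int (2 * m)) - q_pow (- int (2 * m))))"
    unfolding left_diff_distrib right_diff_distrib distrib_left q_pow_add[symmetric]
    by (simp add: algebra_simps)
  also have "\<dots> = (q_pow (2 * int m) * q_int (m + 1) * q_int (2 * m)) * (?D * ?D)"
    unfolding q_int_mult[symmetric] by (simp only: ac_simps)
  finally show ?thesis using q_denominator_nonzero by simp
qed

context odd_polynomials
begin

lemma card_multi_indices: "card (N.multi_indices r) = 2 ^ r * fact (r + 1)"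
proof (induction r)
  case (Suc r)
  have "inj_on (\<lambda>(j, k). j # k) ({..2 * r + 3} \<times> N.multi_indices r)" by (auto simp: inj_on_def)
  then show ?case using Suc by (simp add: card_image card_cartesian_product algebra_simps)
qed simp

text \<open>
  The sum over the basis is the product over the layers of the sums over a layer.
\<close>

lemma basis_degree_sum:
  "(\<Sum>k\<in>N.multi_indices r. q_pow (int (basis_degree k))) = q_pow (int (r * (r + 1))) * q_int (r + 1) * q_even_dfact r"
proof (induction r)
  case 0
  have "q_int 1 = 1" using q_denominator_nonzero by (simp add: q_int_def)
  then show ?case by (simp add: q_even_dfact_def)
next
  case (Suc r)
  let ?m = "r + 1"
  have "(\<Sum>j\<le>2 * r + 3. q_pow (int (layer_degree ?m j))) = (\<Sum>j\<le>2 * ?m. q_pow (int (layer_degree ?m j))) + q_pow (int (layer_degree ?m (2 * ?m + 1)))"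
  proof -
    have "2 * r + 3 = Suc (2 * ?m)" "2 * ?m + 1 = Suc (2 * ?m)" by simp_all
    then show ?thesis by (simp only: sum.atMost_Suc)
  qed
  also have "\<dots> = (\<Sum>j\<le>2 * ?m. q_pow (2 * int j)) + q_pow (2 * int ?m)"
  proof -
    have "int (layer_degree ?m (2 * ?m + 1)) = 2 * int ?m" by (simp add: layer_degree_def)
    moreover have "(\<Sum>j\<le>2 * ?m. q_pow (int (layer_degree ?m j))) = (\<Sum>j\<le>2 * ?m. q_pow (2 * int j))"
      by (intro sum.cong) (auto simp: layer_degree_def)
    ultimately show ?thesis by (simp only:)
  qed
  finally have L: "(\<Sum>j\<le>2 * r + 3. q_pow (int (layer_degree ?m j))) = (\<Sum>j\<le>2 * ?m. q_pow (2 * int j)) + q_pow (2 * int ?m)" .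
  have "(\<Sum>k\<in>N.multi_indices (Suc r). q_pow (int (basis_degree k))) =
      (\<Sum>k\<in>N.multi_indices r. \<Sum>j\<le>2 * r + 3. q_pow (int (basis_degree k)) * q_pow (int (layer_degree ?m j)))"
    unfolding N.sum_multi_indices_Suc
  proof (intro sum.cong refl)
    fix k j assume "k \<in> N.multi_indices r"
    then have "int (basis_degree (j # k)) = int (basis_degree k) + int (layer_degree ?m j)"
      by (simp add: N.multi_indices_length One_nat_def)
    then show "q_pow (int (basis_degree (j # k))) = q_pow (int (basis_degree k)) * q_pow (int (layer_degree ?m j))"
      by (simp only: q_pow_add)
  qed
  also have "\<dots> = (\<Sum>k\<in>N.multi_indices r. q_pow (int (basis_degree k))) * (\<Sum>j\<le>2 * r + 3. q_pow (int (layer_degree ?m j)))"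
    by (simp only: sum_product)
  also have "\<dots> = q_pow (int (r * (r + 1))) * q_even_dfact r * (q_int ?m * ((\<Sum>j\<le>2 * ?m. q_pow (2 * int j)) + q_pow (2 * int ?m)))"
    unfolding L Suc by (simp only: ac_simps)
  also have "\<dots> = (q_pow (int (r * (r + 1))) * q_pow (2 * int ?m)) * q_int (?m + 1) * (q_even_dfact r * q_int (2 * ?m))"
    unfolding q_layer_identity by (simp only: ac_simps)
  also have "q_even_dfact r * q_int (2 * ?m) = q_even_dfact ?m" by (simp add: q_even_dfact_def One_nat_def)
  also have "q_pow (int (r * (r + 1))) * q_pow (2 * int ?m) = q_pow (int (Suc r * (Suc r + 1)))"
    unfolding q_pow_add[symmetric] by (simp add: algebra_simps)
  finally show ?case by (simp only: Suc_eq_plus1)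
qed

section \<open>The isomorphisms\<close>

lemma Phi_gen_mult: "a \<in> spinD_gens n \<Longrightarrow> x \<in> carrier NH \<Longrightarrow> f \<in> carrier P \<Longrightarrow>
    \<Phi> (nilHecke_gen n a \<otimes>\<^bsub>NH\<^esub> x) f = gen_action n a (\<Phi> x f)"
  using ring_hom_mult[OF Phi(1), of "nilHecke_gen n a" x] Phi(2) by (simp add: right_End_simps compose_eq)

lemma Phi_add: "x \<in> carrier NH \<Longrightarrow> x' \<in> carrier NH \<Longrightarrow> f \<in> carrier P \<Longrightarrow> \<Phi> (x \<oplus>\<^bsub>NH\<^esub> x') f = \<Phi> x f \<oplus>\<^bsub>P\<^esub> \<Phi> x' f"
  using ring_hom_add[OF Phi(1), of x x'] by (simp add: right_End_simps)

text \<open>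
  The second term of the commutation rule with a polynomial ends in a Demazure generator, which kills the longest word.
\<close>

lemma gen_long:
  assumes "a \<in> spinD_gens n" "f \<in> carrier P"
  shows "embed NH (nilHecke_gen n a) * eJ f * NR.longest_word (n - 1) = eJ (gen_action n a f) * NR.longest_word (n - 1)"
proof -
  have r: "n - 1 < n" "1 \<le> n - 1" using two_le_n by auto
  show ?thesis
  proof (cases a)
    case (X i)
    then have "embed NH (nilHecke_gen n a) = eJ (var i)" using assms by (simp add: eJ_def J)
    then show ?thesis using X assms by (simp add: eJ_mult)
  next
    case (Del i)
    have i: "1 \<le> n - i" "n - i < n" "n - (n - i) = i" "n - i \<le> n - 1" "1 \<le> i" "i < n" using Del assms by auto
    have "embed NH (nilHecke_gen n a) = gd (n - i)" using Del i by (simp add: gd_def)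
    then have "embed NH (nilHecke_gen n a) * eJ f * NR.longest_word (n - 1) =
        eJ (odd_demazure n i f) * NR.longest_word (n - 1) + eJ (odd_refl n i f) * (gd (n - i) * NR.longest_word (n - 1))"
      using gd_eJ[OF i(1,2) assms(2)] i(3) by (simp add: distrib_right mult.assoc)
    also have "gd (n - i) * NR.longest_word (n - 1) = 0" by (rule NR.d_long) (use i r in auto)
    finally show ?thesis using Del by simp
  next
    case DelD
    then have "embed NH (nilHecke_gen n a) = gt" by (simp add: gt_def)
    then have "embed NH (nilHecke_gen n a) * eJ f * NR.longest_word (n - 1) =
        eJ (odd_demazure_D n f) * NR.longest_word (n - 1) + eJ (odd_refl_D n f) * (gt * NR.longest_word (n - 1))"
      using gt_eJ[OF assms(2)] by (simp add: distrib_right mult.assoc)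
    also have "gt * NR.longest_word (n - 1) = 0" by (rule NR.t_long) (use r in auto)
    finally show ?thesis using DelD by simp
  qed
qed

lemma Phi_long:
  assumes "x \<in> carrier NH" "f \<in> carrier P"
  shows "embed NH x * eJ f * NR.longest_word (n - 1) = eJ (\<Phi> x f) * NR.longest_word (n - 1)"
  using assms
proof (induction x rule: nh.presented_induct)
  case (const c)
  have "embed NH (nh_const c) = eJ (const c)" by (simp add: eJ_def J)
  moreover have "\<Phi> (nh_const c) f = const c \<otimes>\<^bsub>P\<^esub> f" using const by (simp add: Phi(3) scalar_op_def)
  ultimately show ?case using const by (simp add: eJ_mult)
next
  case (letter a x)
  have c: "\<Phi> x f \<in> carrier P" using letter E_closed Phi_closed by blast
  have "embed NH (nilHecke_gen n a \<otimes>\<^bsub>NH\<^esub> x) * eJ f * NR.longest_word (n - 1) =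
      embed NH (nilHecke_gen n a) * (embed NH x * eJ f * NR.longest_word (n - 1))"
    using letter by (simp add: embed_mult[OF NH.ring_axioms] mult.assoc)
  also have "\<dots> = embed NH (nilHecke_gen n a) * eJ (\<Phi> x f) * NR.longest_word (n - 1)"
    using letter by (simp add: mult.assoc)
  also have "\<dots> = eJ (gen_action n a (\<Phi> x f)) * NR.longest_word (n - 1)" by (rule gen_long[OF letter(1) c])
  finally show ?case using Phi_gen_mult[OF letter(1,2) \<open>f \<in> carrier P\<close>] by (simp add: nilHecke_gen_def)
next
  case (add x y)
  then show ?case using E_closed[OF Phi_closed] by (simp add: embed_add[OF NH.ring_axioms] Phi_add eJ_add distrib_right)
qed

text \<open>
  The resolution of the unit and \<open>Phi_long\<close> recover an element of the algebra from its action on the basis.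
\<close>

lemma Phi_inj: "inj_on \<Phi> (carrier NH)"
proof (rule inj_onI)
  fix x y assume xy: "x \<in> carrier NH" "y \<in> carrier NH" "\<Phi> x = \<Phi> y"
  have r: "n - 1 < n" using two_le_n by simp
  let ?K = "N.multi_indices (n - 1)"
  obtain c where c: "\<And>k. c k \<in> HP" "gu = (\<Sum>k\<in>?K. N.basis k * NR.longest_word (n - 1) * c k)"
    using N.unit_resolution[OF r] by blast
  have e: "embed NH z = (\<Sum>k\<in>?K. eJ (\<Phi> z (basis_poly k)) * NR.longest_word (n - 1) * c k)" if z: "z \<in> carrier NH" for z
  proof -
    have "embed NH z = embed NH z * gu" using z by simp
    also have "\<dots> = embed NH z * (\<Sum>k\<in>?K. N.basis k * NR.longest_word (n - 1) * c k)"
      by (rule arg_cong[OF c(2)])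
    also have "\<dots> = (\<Sum>k\<in>?K. embed NH z * eJ (basis_poly k) * NR.longest_word (n - 1) * c k)"
      unfolding sum_distrib_left
      by (intro sum.cong refl) (use eJ_as_poly[OF basis_HP[OF _ r]] in \<open>simp add: mult.assoc\<close>)
    also have "\<dots> = (\<Sum>k\<in>?K. eJ (\<Phi> z (basis_poly k)) * NR.longest_word (n - 1) * c k)"
      by (simp only: Phi_long[OF z as_poly_closed])
    finally show ?thesis .
  qed
  have "embed NH x = embed NH y" unfolding e[OF xy(1)] e[OF xy(2)] xy(3) ..
  then show "x = y" using embed_inject[OF NH.ring_axioms xy(1,2)] by simp
qed

lemma gen_action_gr: "a \<in> spinD_gens n \<Longrightarrow> f \<in> gr k \<Longrightarrow> gen_action n a f \<in> gr (k + nh_weight a)"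
proof (cases a)
  case (X i)
  assume "a \<in> spinD_gens n" "f \<in> gr k"
  then show ?thesis using X pol.gr_mult[OF var_gr[of i], of f k] pol.gr_carrier[of f k] by (simp add: add.commute)
next
  case (Del i)
  assume a: "a \<in> spinD_gens n" and f: "f \<in> gr k"
  have i: "1 \<le> n - i" "n - i < n" "n - (n - i) = i" using Del a by auto
  show ?thesis using act_ed_gr[OF i(1,2) f] act_ed[OF i(1,2), of f] i(3) Del by simp
next
  case DelD
  assume "f \<in> gr k"
  then show ?thesis using act_et_gr DelD by (simp add: act_et)
qed

text \<open>
  The action commutes with taking homogeneous components. Together with bijectivity this shows that an
  operator of degree \<open>d\<close> comes from an element of degree \<open>d\<close>: take the component of degree \<open>d\<close>
  of any preimage.
\<close>

lemma Phi_component: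
  assumes "p \<in> carrier nh.F"
  shows "f \<in> gr k \<Longrightarrow> pol.comp (k + d) (\<Phi> (nh.cls p) f) = \<Phi> (nh.cls (free_component nh_weight d p)) f"
  using assms
proof (induction p arbitrary: d rule: free_algebra_induct)
  case (const c)
  have f: "f \<in> carrier P" using const pol.gr_carrier by blast
  have "const c \<otimes>\<^bsub>P\<^esub> f \<in> gr k" using pol.gr_mult[OF const_gr const(1), of c] by simp
  moreover have "\<Phi> (nh.cls 0) f = \<zero>\<^bsub>P\<^esub>"
    using Phi(3)[of 0] f by (simp add: scalar_op_def const_zero)
  ultimately show ?case
    using pol.comp_gr[of "const c \<otimes>\<^bsub>P\<^esub> f" k "k + d"] f
    by (simp add: Phi(3) scalar_op_def free_component_single)
next
  case (letter a q)
  have f: "f \<in> carrier P" using letter pol.gr_carrier by blast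
  have fc: "free_component nh_weight (d - nh_weight a) q \<in> carrier nh.F"
    using letter(2) by (auto simp: carrier_free_algebra keys_free_component)
  have g: "gen_action n a \<in> carrier E" by (rule gen_action_E[OF letter(1)])
  have "pol.comp ((k + (d - nh_weight a)) + nh_weight a) (gen_action n a (\<Phi> (nh.cls q) f)) =
      gen_action n a (pol.comp (k + (d - nh_weight a)) (\<Phi> (nh.cls q) f))"
    by (rule pol.comp_shift[of "gen_action n a"])
      (use g gen_action_gr[OF letter(1)] E_closed[OF Phi_closed[OF nh.presented_class_closed[OF letter(2)]] f] in
        \<open>auto simp: right_End_mem PiE_iff\<close>)
  then show ?case
    using letter f fc Phi_gen_mult[OF letter(1) _ f]
    by (simp add: free_component_letter_mult nh.presented_class_mult nilHecke_gen_def)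
next
  case (add q r)
  have f: "f \<in> carrier P" using add pol.gr_carrier by blast
  have fc: "free_component nh_weight d p \<in> carrier nh.F" if "p \<in> carrier nh.F" for p
    using that by (auto simp: carrier_free_algebra keys_free_component)
  show ?case using add f fc E_closed[OF Phi_closed _]
    by (simp add: free_component_add nh.presented_class_add Phi_add pol.comp_add)
qed

theorem Phi_graded_iso:
  "\<Phi> \<in> graded_iso NH (nilHecke_degree n) E (right_End_degree P Lam gr)"
proof -
  have iso: "\<Phi> \<in> ring_iso NH E"
    using Phi(1) Phi_inj Phi_surj Phi_closed unfolding ring_iso_def bij_betw_def by blast
  have "\<Phi> ` nilHecke_degree n d = right_End_degree P Lam gr d" for d
  proof (intro subset_antisym subsetI)
    fix x assume "x \<in> \<Phi> ` nilHecke_degree n d"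
    then obtain p where p: "p \<in> carrier nh.F" "\<forall>w\<in>Poly_Mapping.keys p. word_weight nh_weight w = d" "x = \<Phi> (nh.cls p)"
      unfolding nilHecke_degree_def presented_degree_def by blast
    have "x f \<in> gr (k + d)" if f: "f \<in> gr k" for f k
    proof -
      have "x f = pol.comp (k + d) (x f)"
        using Phi_component[OF p(1) f, of d] free_component_homogeneous[OF p(2), of d] p(3) by simp
      moreover have "x f \<in> carrier P" using p E_closed[OF Phi_closed] f pol.gr_carrier by simp
      ultimately show ?thesis using pol.comp_in_gr by metis
    qed
    then show "x \<in> right_End_degree P Lam gr d" using p by (auto simp: right_End_degree_def)
  next
    fix x assume "x \<in> right_End_degree P Lam gr d"
    then have x: "x \<in> carrier E" "\<And>k f. f \<in> gr k \<Longrightarrow> x f \<in> gr (k + d)" by (auto simp: right_End_degree_def)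
    obtain h where "h \<in> carrier NH" "\<Phi> h = x" using Phi_surj[OF x(1)] by blast
    then obtain p where p: "p \<in> carrier nh.F" "\<Phi> (nh.cls p) = x" using nh.presented_carrierE by metis
    let ?q = "free_component nh_weight d p"
    have q: "?q \<in> carrier nh.F" using p(1) by (auto simp: carrier_free_algebra keys_free_component)
    have xq: "\<Phi> (nh.cls ?q) \<in> carrier E" using q by simp
    have "x f = \<Phi> (nh.cls ?q) f" if "f \<in> carrier P" for f
      using that
    proof (induction f rule: pol.graded_induct)
      case (homogeneous k f)
      then show ?case using Phi_component[OF p(1) homogeneous, of d] p(2) pol.comp_gr[OF x(2)[OF homogeneous], of "k + d"] by simp
    next
      case (add f g)
      then show ?case using x(1) xq by (simp add: right_End_mem)
    qed
    then have "x = \<Phi> (nh.cls ?q)" by (rule right_End_eqI[OF x(1) xq])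
    moreover have "nh.cls ?q \<in> nilHecke_degree n d"
      unfolding nilHecke_degree_def presented_degree_def using q by (auto simp: keys_free_component)
    ultimately show "x \<in> \<Phi> ` nilHecke_degree n d" by blast
  qed
  then show ?thesis using iso by (simp add: graded_iso_def)
qed

text \<open>
  The Demazure operators are homogeneous, so their kernels are graded.
\<close>

lemma comp_Lam: "f \<in> Lam \<Longrightarrow> pol.comp d f \<in> Lam"
proof -
  assume f: "f \<in> Lam"
  then have fP: "f \<in> carrier P" using Lam_subset by blast
  have shift: "act a (pol.comp d f) = \<zero>\<^bsub>P\<^esub>" if "act a f = \<zero>\<^bsub>P\<^esub>" "\<And>k g. g \<in> gr k \<Longrightarrow> act a g \<in> gr (k + (-2))" for a
  proof -
    have "pol.comp (d + (-2)) (act a f) = act a (pol.comp d f)"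
      by (rule pol.comp_shift[of "act a"]) (use that(2) fP in \<open>auto simp: act_plus\<close>)
    then show ?thesis using that(1) pol.comp_gr[OF pol.zero_gr] by simp
  qed
  have "pol.comp d f \<in> rank_sym (n - 1)"
    using f fP act_ed_gr act_et_gr unfolding rank_sym_top[symmetric] rank_sym_def
    by (auto intro!: shift)
  then show ?thesis by (simp add: rank_sym_top)
qed

theorem End_matrix_iso:
  "\<exists>deg \<Psi>. (\<Sum>i<2 ^ (n - 1) * fact n. q_pow (deg i)) = q_pow (int (n * (n - 1))) * q_int n * q_even_dfact (n - 1) \<and>
    \<Psi> \<in> graded_iso E (right_End_degree P Lam gr) (matrix_ring (2 ^ (n - 1) * fact n) (P\<lparr>carrier := Lam\<rparr>))
      (matrix_degree (2 ^ (n - 1) * fact n) deg (P\<lparr>carrier := Lam\<rparr>) gr)"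
proof -
  let ?N = "2 ^ (n - 1) * fact n :: nat" and ?K = "N.multi_indices (n - 1)"
  have r: "n - 1 < n" and n: "n - 1 + 1 = n" using two_le_n by auto
  obtain h where h: "is_dual_basis h" using dual_basis by blast
  define \<phi> where "\<phi> k = \<Phi> (h k)" for k
  have \<phi>: "\<phi> k \<in> carrier E" "f \<in> carrier P \<Longrightarrow> \<phi> k f \<in> Lam" for k f
    unfolding \<phi>_def using dual_basisD(1,2)[OF h] Phi_closed by blast+
  have exp: "f = finsum P (\<lambda>k. basis_poly k \<otimes>\<^bsub>P\<^esub> \<phi> k f) ?K" if "f \<in> carrier P" for f
    unfolding \<phi>_def by (rule dual_basisD(3)[OF h that])
  have dual: "\<phi> k (basis_poly l) = (if k = l then \<one>\<^bsub>P\<^esub> else \<zero>\<^bsub>P\<^esub>)" if "k \<in> ?K" "l \<in> ?K" for k l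
    unfolding \<phi>_def by (rule dual_basisD(4)[OF h that])
  have "card ?K = ?N" using card_multi_indices[of "n - 1"] n by simp
  then obtain e where e: "bij_betw e {..<?N} ?K"
    using ex_bij_betw_nat_finite[OF N.finite_multi_indices, of "n - 1"] by (auto simp: atLeast0LessThan)
  have eK: "e i \<in> ?K" if "i < ?N" for i using e that by (auto simp: bij_betw_def)
  have e_inj: "e i = e j \<longleftrightarrow> i = j" if "i < ?N" "j < ?N" for i j
    using e that by (auto simp: bij_betw_def inj_on_def)
  let ?deg = "\<lambda>i. int (basis_degree (e i))"
  have \<phi>P: "\<phi> k f \<in> carrier P" if "f \<in> carrier P" for k f using \<phi>(2)[OF that] Lam_subset by blast
  have LamP: "l \<in> carrier P" if "l \<in> Lam" for l using that Lam_subset by blast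
  have Lam_closed: "f \<oplus>\<^bsub>P\<^esub> g \<in> Lam" "f \<otimes>\<^bsub>P\<^esub> g \<in> Lam" if "f \<in> Lam" "g \<in> Lam" for f g
    using that rank_sym_add[of f "n - 1" g] rank_sym_mult[OF r, of f g] by (simp_all add: rank_sym_top)
  have Lam_zero: "\<zero>\<^bsub>P\<^esub> \<in> Lam" using rank_sym_zero[of "n - 1"] by (simp add: rank_sym_top)
  have reindex: "finsum P (\<lambda>k. basis_poly k \<otimes>\<^bsub>P\<^esub> x k) ?K = finsum P (\<lambda>i. basis_poly (e i) \<otimes>\<^bsub>P\<^esub> x (e i)) {..<?N}"
    if "\<And>k. k \<in> ?K \<Longrightarrow> x k \<in> carrier P" for x
  proof -
    have im: "e ` {..<?N} = ?K" and inj: "inj_on e {..<?N}" using e by (auto simp: bij_betw_def)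
    show ?thesis using P.finsum_reindex[OF _ inj, of "\<lambda>k. basis_poly k \<otimes>\<^bsub>P\<^esub> x k"] that by (simp add: im Pi_iff)
  qed
  \<comment> \<open>The homogeneous component of the expansion of \<open>f\<close> is again an expansion, with coefficients in \<open>Lam\<close>;
      duality identifies these coefficients.\<close>
  have co_gr: "\<phi> k f \<in> gr (d - int (basis_degree k))" if k: "k \<in> ?K" and f: "f \<in> gr d" for k f d
  proof -
    let ?x = "\<lambda>k. pol.comp (d - int (basis_degree k)) (\<phi> k f)"
    have fP: "f \<in> carrier P" using f pol.gr_carrier by blast
    have xL: "?x l \<in> Lam" for l using comp_Lam \<phi>(2)[OF fP] by blast
    have xP: "?x l \<in> carrier P" for l using xL Lam_subset by blast
    have "f = pol.comp d f" using pol.comp_gr[OF f, of d] by simp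
    also have "\<dots> = pol.comp d (finsum P (\<lambda>k. basis_poly k \<otimes>\<^bsub>P\<^esub> \<phi> k f) ?K)" using exp[OF fP] by simp
    also have "\<dots> = finsum P (\<lambda>k. pol.comp d (basis_poly k \<otimes>\<^bsub>P\<^esub> \<phi> k f)) ?K"
      by (rule comp_finsum) (use \<phi>P[OF fP] in auto)
    also have "\<dots> = finsum P (\<lambda>k. basis_poly k \<otimes>\<^bsub>P\<^esub> ?x k) ?K"
    proof (rule P.finsum_cong')
      fix l assume l: "l \<in> ?K"
      show "pol.comp d (basis_poly l \<otimes>\<^bsub>P\<^esub> \<phi> l f) = basis_poly l \<otimes>\<^bsub>P\<^esub> ?x l"
        using pol.comp_mult[OF basis_poly_gr[OF l r] \<phi>P[OF fP, of l], of "d - int (basis_degree l)"] by simp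
    qed (use xP in auto)
    finally have fx: "f = finsum P (\<lambda>k. basis_poly k \<otimes>\<^bsub>P\<^esub> ?x k) ?K" .
    have "\<phi> k f = act (embed E (\<phi> k)) (finsum P (\<lambda>k. basis_poly k \<otimes>\<^bsub>P\<^esub> ?x k) ?K)"
      using fx \<phi>(1) by (simp add: embed_act)
    also have "\<dots> = finsum P (\<lambda>l. act (embed E (\<phi> k)) (basis_poly l \<otimes>\<^bsub>P\<^esub> ?x l)) ?K"
      by (rule act_finsum) (use xP in auto)
    also have "\<dots> = act (embed E (\<phi> k)) (basis_poly k \<otimes>\<^bsub>P\<^esub> ?x k)"
      by (rule finsum_single) (use k xP xL dual \<phi>(1) in \<open>auto simp: embed_act right_End_mem\<close>)
    also have "\<dots> = ?x k" using k xP xL dual[OF k k] \<phi>(1)[of k] by (simp add: embed_act right_End_mem)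
    finally show ?thesis using pol.comp_in_gr[OF \<phi>P[OF fP, of k]] by metis
  qed
  interpret B: dual_bases P Lam ?N "\<lambda>i. basis_poly (e i)" "\<lambda>i. \<phi> (e i)" gr ?deg
  proof (intro dual_bases.intro dual_bases_axioms.intro)
    show "ring P" by (rule P.ring_axioms)
    show "\<phi> (e i) (f \<oplus>\<^bsub>P\<^esub> g) = \<phi> (e i) f \<oplus>\<^bsub>P\<^esub> \<phi> (e i) g" if "f \<in> carrier P" "g \<in> carrier P" for i f g
      using \<phi>(1)[of "e i"] that by (simp add: right_End_mem)
    show "\<phi> (e i) (f \<otimes>\<^bsub>P\<^esub> a) = \<phi> (e i) f \<otimes>\<^bsub>P\<^esub> a" if "f \<in> carrier P" "a \<in> Lam" for i f a
      using \<phi>(1)[of "e i"] that by (simp add: right_End_mem)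
    show "\<phi> (e i) (basis_poly (e j)) = (if i = j then \<one>\<^bsub>P\<^esub> else \<zero>\<^bsub>P\<^esub>)" if "i < ?N" "j < ?N" for i j
      using dual[OF eK[OF that(1)] eK[OF that(2)]] e_inj[OF that] by simp
    show "f = finsum P (\<lambda>i. basis_poly (e i) \<otimes>\<^bsub>P\<^esub> \<phi> (e i) f) {..<?N}" if "f \<in> carrier P" for f
      using exp[OF that] reindex[of "\<lambda>k. \<phi> k f"] \<phi>P[OF that] by simp
    show "basis_poly (e i) \<in> gr (?deg i)" if "i < ?N" for i by (rule basis_poly_gr[OF eK[OF that] r])
    show "\<phi> (e i) f \<in> gr (d - ?deg i)" if "i < ?N" "f \<in> gr d" for i f d by (rule co_gr[OF eK[OF that(1)] that(2)])
  qed (use Lam_subset Lam_closed Lam_zero \<phi>(2) pol.gr_carrier pol.zero_gr pol.gr_add pol.gr_mult in auto)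
  have "(\<Sum>i<?N. q_pow (?deg i)) = (\<Sum>k\<in>?K. q_pow (int (basis_degree k)))"
    by (rule sum.reindex_bij_betw[OF e])
  also have "\<dots> = q_pow (int (n * (n - 1))) * q_int n * q_even_dfact (n - 1)"
    using basis_degree_sum[of "n - 1"] n by (simp add: mult.commute)
  finally have s: "(\<Sum>i<?N. q_pow (?deg i)) = q_pow (int (n * (n - 1))) * q_int n * q_even_dfact (n - 1)" .
  then show ?thesis using B.to_matrix_graded_iso by (intro exI[of _ ?deg] exI[of _ B.to_matrix]) simp
qed

end

theorem theorem5p10:
  fixes n :: nat
  assumes "n \<ge> 2"
  shows "(\<exists>\<Phi>. \<Phi> \<in> graded_iso (NHQ n) (nilHecke_degree n) (EndQ n) (EndQ_degree n) \<and>
             (\<forall>g\<in>spinD_gens n. \<Phi> (nilHecke_gen n g) = gen_action n g)) \<and>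
         (\<exists>deg \<Psi>.
             (\<Sum>i<2 ^ (n - 1) * fact n. q_pow (deg i)) =
               q_pow (int (n * (n - 1))) * q_int n * q_even_dfact (n - 1) \<and>
             \<Psi> \<in> graded_iso (EndQ n) (EndQ_degree n)
                   (matrix_ring (2 ^ (n - 1) * fact n) (LamQ n))
                   (matrix_degree (2 ^ (n - 1) * fact n) deg (LamQ n) (pol_degree n)))"
proof -
  interpret odd_polynomials n by unfold_locales (rule assms)
  have L: "LamQ n = P\<lparr>carrier := Lam\<rparr>" "carrier (LamQ n) = Lam" by (simp_all add: spinD_sym_ring_def)
  show ?thesis unfolding L(2) unfolding L(1)
    using Phi_graded_iso Phi(2) End_matrix_iso by blast
qed

end
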